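(* Let $\Omega\subset\mathbb{R}^n$ be open, $n\ge 2$, $N\ge 1$, and let $F\colon\mathbb{R}^{N\times n}\to\mathbb{R}$ satisfy the structural assumptions listed in the context (including the condition on $F''$ imposed when $\mu=0$), with exponents satisfying $2\le p\le q<\frac{p(n-1)}{n-3}$ if $n\ge 4$, and $2\le p\le q<\infty$ if $n\in\{2,3\}$. Let $u\in W^{1,p}_{\mathrm{loc}}(\Omega,\mathbb{R}^N)$ be a local minimizer of $\mathscr{F}$. Then: (i) if $p>n-2$ and $n\ge3$, then $u\in C^{0,1-\frac{n-2}{p}}_{\mathrm{loc}}(\Omega,\mathbb{R}^N)$; (ii) if, in addition to the assumptions above, $2\le p\le q\le\frac{np}{n-2}$ when $n\ge3$ and $2\le p\le q<\infty$ when $n=2$, then $\nabla u\in L^q_{\mathrm{loc}}(\Omega,\mathbb{R}^{N\times n})$; (iii) if $n=2$, then $u\in C^{0,\beta_0}_{\mathrm{loc}}(\Omega,\mathbb{R}^N)\cap W^{1,m}_{\mathrm{loc}}(\Omega,\mathbb{R}^N)$ and $F'(\nabla u)\in L^m_{\mathrm{loc}}(\Omega,\mathbb{R}^{N\times n})$ for all $\beta_0\in(0,1)$ and all $m\in[1,\infty)$.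
   Context: Notation. $\mathscr{F}(w;\Omega'):=\int_{\Omega'}F(\nabla w)\,dx$. A map $u\in W^{1,p}_{\mathrm{loc}}(\Omega,\mathbb{R}^N)$ is a local minimizer of $\mathscr{F}$ if for every open $\Omega'\Subset\Omega$ one has $\mathscr{F}(u;\Omega')<\infty$ and $\mathscr{F}(u;\Omega')\le\mathscr{F}(w;\Omega')$ for all $w\in u+W^{1,p}_0(\Omega',\mathbb{R}^N)$. For $\mu\ge0$, $\ell_\mu(z):=(\mu^2+|z|^2)^{1/2}$. Structural assumptions. There are constants $L>1$, $\mu\in[0,1]$ such that $F\in C^2(\mathbb{R}^{N\times n})$ and, for all $z,\xi\in\mathbb{R}^{N\times n}$, $$L^{-1}\ell_\mu(z)^p\le F(z)\le L\ell_\mu(z)^p+L\ell_\mu(z)^q,$$ $$L^{-1}\ell_\mu(z)^{p-2}|\xi|^2\le\langle F''(z)\xi,\xi\rangle,\qquad |F''(z)|\le L\big(1+|F'(z)|^{\frac{q-2}{q-1}}\big).$$ If $\mu=0$, it is moreover assumed that for some constant $L_0>1$, $|F''(z)|\le |z|^{p-2}\big(L_0+L_0|F'(z)|^{\frac{q-p}{q-1}}\big)$ for all $z\in\mathbb{R}^{N\times n}$. *)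

theory Defs
  imports "HOL-Analysis.Analysis"
begin

text \<open>
  Points of the domain have type real^'n, values of maps real^'N, and gradients, as N-by-n matrices,
  real^'n^'N; the library norm and inner product on real^'n^'N are the Euclidean (Frobenius) ones.
  Elements of Lebesgue and Sobolev spaces are functions on the whole space of which only the values
  almost everywhere in the domain matter.
\<close>

primrec C_k :: "nat \<Rightarrow> ('a::euclidean_space \<Rightarrow> 'b::real_normed_vector) \<Rightarrow> bool" where
  "C_k 0 f \<longleftrightarrow> continuous_on UNIV f"
| "C_k (Suc k) f \<longleftrightarrow> (\<forall>x. f differentiable (at x)) \<and> (\<forall>v. C_k k (\<lambda>x. frechet_derivative f (at x) v))"

definition grad :: "('a::euclidean_space \<Rightarrow> real) \<Rightarrow> 'a \<Rightarrow> 'a" where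
  "grad F z = (THE d. GDERIV F z :> d)"

text \<open>The second derivative is represented by the linear map that sends a direction to the derivative
  of the gradient in that direction. Its size is measured below by the operator norm; any other
  norm only changes the structure constants.\<close>

definition hess :: "('a::euclidean_space \<Rightarrow> real) \<Rightarrow> 'a \<Rightarrow> 'a \<Rightarrow> 'a" where
  "hess F z = frechet_derivative (grad F) (at z)"

definition test_functions :: "'a::euclidean_space set \<Rightarrow> ('a \<Rightarrow> 'b::real_normed_vector) set" where
  "test_functions \<Omega> = {\<phi>. (\<forall>k. C_k k \<phi>) \<and> compact (closure {x. \<phi> x \<noteq> 0}) \<and> closure {x. \<phi> x \<noteq> 0} \<subseteq> \<Omega>}"

definition compactly_in :: "'a::euclidean_space set \<Rightarrow> 'a set \<Rightarrow> bool" (infix "\<Subset>" 50) where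
  "\<Omega>' \<Subset> \<Omega> \<longleftrightarrow> compact (closure \<Omega>') \<and> closure \<Omega>' \<subseteq> \<Omega>"

definition Lp :: "real \<Rightarrow> 'a::euclidean_space set \<Rightarrow> ('a \<Rightarrow> 'b::euclidean_space) set" where
  "Lp p \<Omega> = {f. f \<in> borel_measurable (lebesgue_on \<Omega>) \<and>
                 integrable (lebesgue_on \<Omega>) (\<lambda>x. norm (f x) powr p)}"

definition Lp_loc :: "real \<Rightarrow> 'a::euclidean_space set \<Rightarrow> ('a \<Rightarrow> 'b::euclidean_space) set" where
  "Lp_loc p \<Omega> = {f. \<forall>\<Omega>'. open \<Omega>' \<and> \<Omega>' \<Subset> \<Omega> \<longrightarrow> f \<in> Lp p \<Omega>'}"

definition has_weak_grad :: "(real^'n) set \<Rightarrow> (real^'n \<Rightarrow> real^'N) \<Rightarrow> (real^'n \<Rightarrow> real^'n^'N) \<Rightarrow> bool" where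
  "has_weak_grad \<Omega> u G \<longleftrightarrow> u \<in> Lp_loc 1 \<Omega> \<and> G \<in> Lp_loc 1 \<Omega> \<and>
     (\<forall>\<phi> \<in> test_functions \<Omega>. \<forall>i j.
        (LINT x|lebesgue_on \<Omega>. u x $ i * frechet_derivative \<phi> (at x) (axis j 1)) =
        - (LINT x|lebesgue_on \<Omega>. G x $ i $ j * \<phi> x))"

definition weak_grad :: "(real^'n) set \<Rightarrow> (real^'n \<Rightarrow> real^'N) \<Rightarrow> real^'n \<Rightarrow> real^'n^'N" where
  "weak_grad \<Omega> u = (SOME G. has_weak_grad \<Omega> u G)"

definition W1p :: "real \<Rightarrow> (real^'n) set \<Rightarrow> (real^'n \<Rightarrow> real^'N) set" where
  "W1p p \<Omega> = {u \<in> Lp p \<Omega>. \<exists>G \<in> Lp p \<Omega>. has_weak_grad \<Omega> u G}"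

definition W1p_loc :: "real \<Rightarrow> (real^'n) set \<Rightarrow> (real^'n \<Rightarrow> real^'N) set" where
  "W1p_loc p \<Omega> = {u \<in> Lp_loc p \<Omega>. \<exists>G \<in> Lp_loc p \<Omega>. has_weak_grad \<Omega> u G}"

definition W1p_norm :: "real \<Rightarrow> (real^'n) set \<Rightarrow> (real^'n \<Rightarrow> real^'N) \<Rightarrow> real" where
  "W1p_norm p \<Omega> u = ((LINT x|lebesgue_on \<Omega>. norm (u x) powr p) +
                     (LINT x|lebesgue_on \<Omega>. norm (weak_grad \<Omega> u x) powr p)) powr (1 / p)"

definition W1p_0 :: "real \<Rightarrow> (real^'n) set \<Rightarrow> (real^'n \<Rightarrow> real^'N) set" where
  "W1p_0 p \<Omega> = {\<phi> \<in> W1p p \<Omega>. \<exists>\<psi>. (\<forall>k::nat. \<psi> k \<in> test_functions \<Omega>) \<and>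
                   (\<lambda>k. W1p_norm p \<Omega> (\<lambda>x. \<psi> k x - \<phi> x)) \<longlonglongrightarrow> 0}"

text \<open>Membership of an almost-everywhere class: some representative is locally Hoelder continuous.\<close>

definition holder_loc :: "real \<Rightarrow> 'a::euclidean_space set \<Rightarrow> ('a \<Rightarrow> 'b::euclidean_space) set" where
  "holder_loc \<alpha> \<Omega> = {u. \<exists>v. (AE x in lebesgue_on \<Omega>. v x = u x) \<and>
     (\<forall>\<Omega>'. open \<Omega>' \<and> \<Omega>' \<Subset> \<Omega> \<longrightarrow>
        (\<exists>C. \<forall>x\<in>\<Omega>'. \<forall>y\<in>\<Omega>'. norm (v x - v y) \<le> C * norm (x - y) powr \<alpha>))}"

text \<open>The integral is extended-real valued. \<^const>\<open>ennreal\<close> truncates negative values,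
  which is harmless because the structural assumptions force the integrand to be nonnegative.\<close>

definition energy :: "(real^'n^'N \<Rightarrow> real) \<Rightarrow> (real^'n \<Rightarrow> real^'N) \<Rightarrow> (real^'n) set \<Rightarrow> ennreal" where
  "energy F w \<Omega> = (\<integral>\<^sup>+x. ennreal (F (weak_grad \<Omega> w x)) \<partial>lebesgue_on \<Omega>)"

definition local_minimizer ::
  "real \<Rightarrow> (real^'n^'N \<Rightarrow> real) \<Rightarrow> (real^'n) set \<Rightarrow> (real^'n \<Rightarrow> real^'N) \<Rightarrow> bool" where
  "local_minimizer p F \<Omega> u \<longleftrightarrow> u \<in> W1p_loc p \<Omega> \<and>
     (\<forall>\<Omega>'. open \<Omega>' \<and> \<Omega>' \<Subset> \<Omega> \<longrightarrow>
        energy F u \<Omega>' < \<infinity> \<and>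
        (\<forall>\<phi> \<in> W1p_0 p \<Omega>'. energy F u \<Omega>' \<le> energy F (\<lambda>x. u x + \<phi> x) \<Omega>'))"

text \<open>The library has 0 powr 0 = 0. The growth conditions need the convention that the value is 1:
  otherwise, for p = 2 and \<mu> = 0, the upper bound on the second derivative would force
  it to vanish at the origin.\<close>

definition rpow :: "real \<Rightarrow> real \<Rightarrow> real" where
  "rpow t a = (if a = 0 then 1 else t powr a)"

definition ell :: "real \<Rightarrow> 'a::real_normed_vector \<Rightarrow> real" where
  "ell \<mu> z = sqrt (\<mu>\<^sup>2 + (norm z)\<^sup>2)"

definition structural :: "real \<Rightarrow> real \<Rightarrow> real \<Rightarrow> real \<Rightarrow> ('a::euclidean_space \<Rightarrow> real) \<Rightarrow> bool" where
  "structural p q L \<mu> F \<longleftrightarrow>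
     L > 1 \<and> 0 \<le> \<mu> \<and> \<mu> \<le> 1 \<and> C_k 2 F \<and>
     (\<forall>z. inverse L * rpow (ell \<mu> z) p \<le> F z \<and>
          F z \<le> L * rpow (ell \<mu> z) p + L * rpow (ell \<mu> z) q) \<and>
     (\<forall>z \<xi>. inverse L * rpow (ell \<mu> z) (p - 2) * (norm \<xi>)\<^sup>2 \<le> hess F z \<xi> \<bullet> \<xi>) \<and>
     (\<forall>z. onorm (hess F z) \<le> L * (1 + rpow (norm (grad F z)) ((q - 2) / (q - 1)))) \<and>
     (\<mu> = 0 \<longrightarrow> (\<exists>L\<^sub>0>1. \<forall>z. onorm (hess F z) \<le>
        rpow (norm z) (p - 2) * (L\<^sub>0 + L\<^sub>0 * rpow (norm (grad F z)) ((q - p) / (q - 1)))))"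

end

theory Submission imports Defs "HOL-Analysis.Analysis" begin

text \<open>
The difference \<open>u (x + h) - u x\<close> is tested against itself, multiplied by a cutoff \<open>\<eta>\<close>, in the
variational inequality that minimality and convexity give directly; this controls the excess
\<open>(F' (\<nabla>u (x + h)) - F' (\<nabla>u x)) \<bullet> (\<nabla>u (x + h) - \<nabla>u x)\<close>. The cutoff is a product of functions
\<open>\<theta>\<^sub>i (x\<^sub>i)\<close> whose derivatives live on sets of good slices selected by Chebyshev's inequality, so
the error terms are only evaluated on hyperplanes, where the Sobolev inequality in dimension
\<open>n - 1\<close> applies: this is the source of the bound \<open>q < p (n - 1) / (n - 3)\<close>. Absorbing the excess
bounds its integral by a multiple of \<open>\<bar>h\<bar>\<^sup>2\<close>. Hence \<open>\<bar>\<nabla>u\<bar>\<close> to the power \<open>p / 2\<close> has local difference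
quotients bounded in \<open>L\<^sup>2\<close>; Sobolev's inequality gives \<open>\<nabla>u\<close> locally in \<open>L\<close> to the power
\<open>n p / (n - 2)\<close>, and Morrey's inequality the Hoelder continuity.
\<close>

text \<open>The size of a gradient z is measured by K(z), comparable to (1 + |F'(z)|) to the power
  1/(q-1), and not by |z|. The growth condition on F'' makes K Lipschitz, and a gradient step for F
  shows K^q <= 1 + C F, so finite energy bounds K^q while the q-th power of |\<nabla>u| is not yet
  under control. A Baillon-Haddad argument at scale K bounds the squared stress difference by
  K^(q-2) times the excess. Hoelder's inequality for the error term then has exponents 1/2 on the
  excess, (q-2)/(2q) on K^q and 1/q on the q-th power of the increment of u, which is interpolated
  between its p-th power and the hyperplane Sobolev norm. The excess returns with total exponent 1/2
  + \<theta> s / (2q), below 1 because p is at least 2, so it can be absorbed by an iteration over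
  radii. The Sobolev norm involves gradients between x and x + h, that is, the excess for all
  shorter increments \<tau> h; therefore a supremum over increments is iterated, with a quadratic
  weight regularised so that it is finite. Integrability is gained by applying Sobolev's inequality
  to the increments of u before dividing by |h|.\<close>

abbreviation nn_lborel :: "('a::euclidean_space \<Rightarrow> ennreal) \<Rightarrow> ennreal" (binder "NBINT " 10) where
 "nn_lborel f \<equiv> nn_integral lborel f"

abbreviation np :: "'a::real_normed_vector \<Rightarrow> real \<Rightarrow> ennreal" where
 "np x p \<equiv> ennreal (norm x powr p)"

abbreviation pd :: "(real^'n \<Rightarrow> 'b::real_normed_vector) \<Rightarrow> 'n \<Rightarrow> real^'n \<Rightarrow> 'b" where
 "pd f j x \<equiv> frechet_derivative f (at x) (axis j 1)"

abbreviation "en \<equiv> ennreal"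
abbreviation lims ("(_/ ----> _)" [60, 60] 60) where "f ----> l \<equiv> f \<longlonglongrightarrow> l"
abbreviation "ind \<equiv> indicator"
abbreviation "lintegrable \<equiv> integrable lborel"
abbreviation "borelfun \<equiv> borel_measurable borel"

lemmas integrable_bound' = Bochner_Integration.integrable_bound

section \<open>Consequences of the structural assumptions\<close>

lemma rpow_nonneg [simp]: "0 <= rpow t a"
 by (simp add: rpow_def)

lemma rpow_mono: "0 <= x ==> x <= y ==> 0 <= a ==> rpow x a <= rpow y a"
 by (simp add: rpow_def powr_mono2)

lemma rpow_mult: "0 <= x ==> 0 <= y ==> rpow (x * y) a = rpow x a * rpow y a"
 by (simp add: rpow_def powr_mult)

lemma rpow_eq_powr: "0 < x ==> rpow x a = x powr a"
 by (simp add: rpow_def)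

text \<open>\<open>grad\<close> is a definite description, so both existence and uniqueness of the
  representing vector are shown: existence by expanding the Frechet derivative in
  \<open>Basis\<close>, uniqueness because inner products separate points.\<close>

lemma GDERIV_grad:
 assumes "F differentiable (at z)"
 shows "GDERIV F z :> grad F z"
proof -
 let ?F = "frechet_derivative F (at z)"
 have D: "(F has_derivative ?F) (at z)"
  using assms frechet_derivative_works by blast
 then interpret bounded_linear ?F by (rule has_derivative_bounded_linear)
 have "?F h = h \<bullet> (\<Sum>b\<in>Basis. ?F b *\<^sub>R b)" for h
 proof -
  have "?F h = ?F (\<Sum>b\<in>Basis. (h \<bullet> b) *\<^sub>R b)" by (simp add: euclidean_representation)
  also have "... = (\<Sum>b\<in>Basis. (h \<bullet> b) * ?F b)" by (simp add: sum scaleR)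
  also have "... = h \<bullet> (\<Sum>b\<in>Basis. ?F b *\<^sub>R b)"
   by (simp add: inner_sum_right mult.commute)
  finally show ?thesis .
 qed
 hence "?F = (%h. h \<bullet> (\<Sum>b\<in>Basis. ?F b *\<^sub>R b))" by blast
 hence G: "GDERIV F z :> (\<Sum>b\<in>Basis. ?F b *\<^sub>R b)"
  unfolding gderiv_def using D by simp
 show ?thesis
  unfolding grad_def
 proof (rule theI[where P="%d. GDERIV F z :> d", OF G])
  fix d assume "GDERIV F z :> d"
  hence "(%h. h \<bullet> d) = (%h. h \<bullet> (\<Sum>b\<in>Basis. ?F b *\<^sub>R b))"
   using G unfolding gderiv_def by (rule has_derivative_unique)
  thus "d = (\<Sum>b\<in>Basis. ?F b *\<^sub>R b)"
   unfolding fun_eq_iff vector_eq_ldot .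
 qed
qed

text \<open>\<open>C_k\<close> speaks about the derivative in each fixed direction; writing the
  gradient as a finite sum of such directional derivatives is what turns \<open>C_k 2 F\<close> into
  differentiability of the gradient.\<close>

lemma grad_eq_sum:
 assumes "F differentiable (at z)"
 shows "grad F z = (\<Sum>b\<in>Basis. frechet_derivative F (at z) b *\<^sub>R b)"
proof -
 have "frechet_derivative F (at z) = (%h. h \<bullet> grad F z)"
  using GDERIV_grad[OF assms] unfolding gderiv_def by (metis frechet_derivative_at)
 hence "frechet_derivative F (at z) b = grad F z \<bullet> b" for b by (simp add: inner_commute)
 thus ?thesis by (simp add: euclidean_representation)
qed

section \<open>Convexity and the intrinsic scale of the integrand\<close>

locale pq_integrand =
 fixes p q L \<mu> :: real and F :: "'a::euclidean_space => real"
 assumes struct: "structural p q L \<mu> F" and p2: "2 <= p" and pq: "p <= q"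
begin

abbreviation \<sigma> :: "'a => 'a" where "\<sigma> \<equiv> grad F"

lemmas structD = struct[unfolded structural_def, THEN conjunct2, THEN conjunct2, THEN conjunct2]

lemma L1: "1 < L" by (rule struct[unfolded structural_def, THEN conjunct1])
lemma q2: "2 <= q" using p2 pq by simp

lemma F_nonneg: "0 <= F z"
proof -
 have "0 <= inverse L * rpow (ell \<mu> z) p" using L1 by simp
 also have "... <= F z" by (rule structD[THEN conjunct2, THEN conjunct1, THEN spec, THEN conjunct1])
 finally show ?thesis .
qed

lemma C2: "C_k (Suc (Suc 0)) F"
 by (rule structD[THEN conjunct1, unfolded numeral_2_eq_2])

lemma F_deriv: "(F has_derivative (%h. \<sigma> z \<bullet> h)) (at z)"
 using GDERIV_grad[of F z] C2 by (simp add: gderiv_def inner_commute)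

lemma \<sigma>_deriv: "(\<sigma> has_derivative hess F z) (at z)"
proof -
 have *: "\<sigma> = (%z. \<Sum>b\<in>Basis. frechet_derivative F (at z) b *\<^sub>R b)"
  using C2 by (auto intro!: grad_eq_sum)
 have "\<sigma> differentiable (at z)"
  unfolding * using C2 by (intro differentiable_sum) (auto intro!: differentiable_scaleR)
 thus ?thesis unfolding hess_def using frechet_derivative_works by blast
qed

lemma continuous_\<sigma>: "continuous_on S \<sigma>"
 by (meson \<sigma>_deriv continuous_at_imp_continuous_on has_derivative_continuous)

lemma continuous_F: "continuous_on S F"
 by (meson F_deriv continuous_at_imp_continuous_on has_derivative_continuous)

text \<open>\<open>J\<close> is a smooth substitute for the size of the stress, and \<open>K\<close>
  is the length scale attached to it. Relative to \<open>K\<close> the integrand behaves as if it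
  had q-growth from both sides: the stress is at most \<open>K^(q-1)\<close>, the second derivative
  is of order \<open>K^(q-2)\<close>, and \<open>K^q\<close> is bounded by a multiple of
  \<open>1 + F\<close>. The 1 under the root keeps \<open>K\<close> at least 1 and
  differentiable.\<close>

definition J :: "'a => real" where "J z = sqrt (1 + \<sigma> z \<bullet> \<sigma> z)"
definition K :: "'a => real" where "K z = J z powr (1 / (q - 1))"

lemma J1: "1 <= J z" by (simp add: J_def)
lemma norm_\<sigma>_J: "norm (\<sigma> z) <= J z"
 by (simp add: J_def norm_eq_sqrt_inner)
lemma K1: "1 <= K z" unfolding K_def using J1 q2 by (simp add: ge_one_powr_ge_zero)

lemma K_J: "K z powr (q - 1) = J z"
 using J1[of z] q2 by (simp add: K_def powr_powr)

lemma norm_\<sigma>_K: "norm (\<sigma> z) <= K z powr (q - 1)"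
 by (simp add: K_J norm_\<sigma>_J)

lemma hess_linear: "bounded_linear (hess F z)"
 using \<sigma>_deriv has_derivative_bounded_linear by blast

text \<open>The exponent \<open>(q - 2) / (q - 1)\<close> of the growth condition is the one that
  turns a power of \<open>J\<close> into \<open>K powr (q - 2)\<close>; the constant 1 is absorbed
  because \<open>K\<close> is at least 1.\<close>

lemma onorm_hess: "onorm (hess F z) <= 2 * L * K z powr (q - 2)"
proof -
 have "onorm (hess F z) <= L * (1 + rpow (norm (\<sigma> z)) ((q - 2) / (q - 1)))"
  by (rule structD[THEN conjunct2, THEN conjunct2, THEN conjunct2, THEN conjunct1, THEN spec])
 also have "rpow (norm (\<sigma> z)) ((q - 2) / (q - 1)) <= rpow (J z) ((q - 2) / (q - 1))"
  using q2 norm_\<sigma>_J by (intro rpow_mono) auto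
 also have "... = J z powr ((q - 2) / (q - 1))" using J1[of z] by (simp add: rpow_eq_powr)
 also have "... = K z powr (q - 2)" by (simp add: K_def powr_powr)
 also have "L * (1 + K z powr (q - 2)) <= L * (K z powr (q - 2) + K z powr (q - 2))"
  using L1 K1[of z] q2 by (intro mult_left_mono add_right_mono ge_one_powr_ge_zero) auto
 finally show ?thesis using L1 by simp
qed

lemma K_eq: "K z = (1 + \<sigma> z \<bullet> \<sigma> z) powr (1 / (2 * (q - 1)))"
 by (simp add: K_def J_def powr_half_sqrt[symmetric] powr_powr)

lemma norm_hess: "norm (hess F z h) <= 2 * L * K z powr (q - 2) * norm h"
 by (meson hess_linear mult_right_mono norm_ge_zero onorm onorm_hess order_trans)

lemma K_deriv:
 "(K has_derivative (%h. 1 / (q - 1) * (1 + \<sigma> z \<bullet> \<sigma> z) powr (1 / (2 * (q - 1)) - 1) * (\<sigma> z \<bullet> hess F z h))) (at z)"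
proof -
 let ?a = "1 / (2 * (q - 1))"
 have pos: "0 < 1 + \<sigma> z \<bullet> \<sigma> z" by (simp add: add_pos_nonneg)
 have 1: "((%z. 1 + \<sigma> z \<bullet> \<sigma> z) has_derivative (%h. 2 * (\<sigma> z \<bullet> hess F z h))) (at z)"
  by (auto intro!: derivative_eq_intros \<sigma>_deriv simp: inner_commute)
 have 2: "((%t. t powr ?a) has_derivative (%h. h * (?a * (1 + \<sigma> z \<bullet> \<sigma> z) powr (?a - 1)))) (at (1 + \<sigma> z \<bullet> \<sigma> z))"
  by (rule has_derivative_eq_rhs[OF has_real_derivative_powr[OF pos, of ?a, unfolded has_field_derivative_def]])
   (simp add: fun_eq_iff)
 have "((%z. (1 + \<sigma> z \<bullet> \<sigma> z) powr ?a) has_derivative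
   (%h. (2 * (\<sigma> z \<bullet> hess F z h)) * (?a * (1 + \<sigma> z \<bullet> \<sigma> z) powr (?a - 1)))) (at z)"
  by (rule has_derivative_compose[OF 1 2])
 moreover have "K = (%z. (1 + \<sigma> z \<bullet> \<sigma> z) powr ?a)" using K_eq by auto
 moreover have "2 * u * (?a * v) = 1 / (q - 1) * v * u" for u v :: real
  using q2 by (simp add: field_simps)
 ultimately show ?thesis by simp
qed

text \<open>In the chain rule all powers of \<open>J\<close> cancel: the growth condition on the
  second derivative is calibrated so that this power of the stress has bounded derivative. It
  follows that \<open>K\<close> at most doubles along segments that are short compared with
  \<open>K\<close>, which is how local bounds on the second derivative become usable.\<close>

lemma K_lipschitz: "\<bar>K w - K z\<bar> <= 2 * L * norm (w - z)"
proof -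
 have "norm (K w - K z) <= 2 * L * norm (w - z)"
 proof (rule differentiable_bound[of UNIV K])
  fix x :: 'a
  let ?a = "1 / (2 * (q - 1))"
  let ?D = "%h. 1 / (q - 1) * (1 + \<sigma> x \<bullet> \<sigma> x) powr (?a - 1) * (\<sigma> x \<bullet> hess F x h)"
  show "(K has_derivative ?D) (at x within UNIV)" using K_deriv by simp
  show "onorm ?D <= 2 * L"
  proof (rule onorm_le)
   fix h
   have pos: "0 < J x" using J1[of x] by simp
   have J2: "1 + \<sigma> x \<bullet> \<sigma> x = J x powr 2" using J1[of x]
    by (simp add: J_def powr_numeral add_nonneg_nonneg)
   have "norm (?D h) <= 1 / (q - 1) * (1 + \<sigma> x \<bullet> \<sigma> x) powr (?a - 1) * (norm (\<sigma> x) * norm (hess F x h))"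
    using q2 by (simp add: abs_mult mult_left_mono Cauchy_Schwarz_ineq2 divide_right_mono)
   also have "... <= 1 / (q - 1) * (1 + \<sigma> x \<bullet> \<sigma> x) powr (?a - 1) * (J x * (2 * L * K x powr (q - 2) * norm h))"
    using q2 L1 pos by (intro mult_left_mono mult_mono norm_hess norm_\<sigma>_J) auto
   also have "... = 1 / (q - 1) * (2 * L * norm h) * (J x powr (2 * (?a - 1)) * J x powr 1 * J x powr ((q - 2) / (q - 1)))"
   proof -
    have "J x powr 1 = J x" using pos by simp
    moreover have "K x powr (q - 2) = J x powr ((q - 2) / (q - 1))" by (simp add: K_def powr_powr)
    moreover have "(1 + \<sigma> x \<bullet> \<sigma> x) powr (?a - 1) = J x powr (2 * (?a - 1))" unfolding J2 powr_powr ..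
    ultimately show ?thesis by (simp only: mult_ac)
   qed
   also have "J x powr (2 * (?a - 1)) * J x powr 1 * J x powr ((q - 2) / (q - 1))
     = J x powr (2 * (?a - 1) + 1 + (q - 2) / (q - 1))"
    by (simp only: powr_add)
   also have "2 * (?a - 1) + 1 + (q - 2) / (q - 1) = 0" using q2 by (simp add: field_simps)
   also have "1 / (q - 1) * (2 * L * norm h) * J x powr 0 <= 1 * (2 * L * norm h)"
    using q2 pos L1 by (simp only: powr_zero_eq_one mult_1_right if_False less_imp_neq[symmetric]) (intro mult_right_mono, auto)
   finally show "norm (?D h) <= 2 * L * norm h" by simp
  qed
 qed auto
 thus ?thesis by simp
qed

lemma F_mvt: obtains x where "x : closed_segment z w" "F w - F z = \<sigma> x \<bullet> (w - z)"
proof -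
 have "\<exists>t\<in>{0<..<1}. F (z + 1 *\<^sub>R (w - z)) - F (z + 0 *\<^sub>R (w - z)) = (1 - 0) * (\<sigma> (z + t *\<^sub>R (w - z)) \<bullet> (w - z))"
 proof (rule mvt_simple[where f="%t. F (z + t *\<^sub>R (w - z))"
    and f'="%t s. s * (\<sigma> (z + t *\<^sub>R (w - z)) \<bullet> (w - z))"])
  fix x :: real
  show "((%t. F (z + t *\<^sub>R (w - z))) has_derivative (%s. s * (\<sigma> (z + x *\<^sub>R (w - z)) \<bullet> (w - z)))) (at x within {0..1})"
   by (rule has_derivative_eq_rhs, rule has_derivative_compose[OF _ F_deriv])
    (auto intro!: derivative_eq_intros)
 qed simp
 then obtain t where t: "0 < t" "t < 1" "F w - F z = \<sigma> (z + t *\<^sub>R (w - z)) \<bullet> (w - z)" by auto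
 have "z + t *\<^sub>R (w - z) : closed_segment z w"
  using t unfolding closed_segment_def by (auto intro!: exI[of _ t] simp: algebra_simps)
 thus thesis using t that by blast
qed

text \<open>Mean value theorem for the stress on a parameter interval where the segment stays at
  distance at least \<open>m\<close> from the origin. Since \<open>ell \<mu>\<close> dominates the
  norm, the bound does not depend on \<mu>.\<close>

lemma \<sigma>_monotone_aux:
 assumes "0 <= a" "a < b" "b <= 1" "0 <= m"
  and m: "!!t. a <= t ==> t <= b ==> m <= norm (z + t *\<^sub>R \<xi>)"
 shows "(b - a) * (inverse L * rpow m (p - 2) * (norm \<xi>)\<^sup>2) <= (\<sigma> (z + b *\<^sub>R \<xi>) - \<sigma> (z + a *\<^sub>R \<xi>)) \<bullet> \<xi>"
proof -
 have "\<exists>t\<in>{a<..<b}. \<sigma> (z + b *\<^sub>R \<xi>) \<bullet> \<xi> - \<sigma> (z + a *\<^sub>R \<xi>) \<bullet> \<xi> = hess F (z + t *\<^sub>R \<xi>) ((b - a) *\<^sub>R \<xi>) \<bullet> \<xi>"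
 proof (rule mvt_simple[where f="%t. \<sigma> (z + t *\<^sub>R \<xi>) \<bullet> \<xi>" and f'="%t s. hess F (z + t *\<^sub>R \<xi>) (s *\<^sub>R \<xi>) \<bullet> \<xi>"])
  fix x :: real
  show "((%t. \<sigma> (z + t *\<^sub>R \<xi>) \<bullet> \<xi>) has_derivative (%s. hess F (z + x *\<^sub>R \<xi>) (s *\<^sub>R \<xi>) \<bullet> \<xi>)) (at x within {a..b})"
   by (rule has_derivative_inner_left, rule has_derivative_compose[OF _ \<sigma>_deriv])
    (auto intro!: derivative_eq_intros)
 qed fact
 then obtain t where t: "a < t" "t < b"
  and eq: "(\<sigma> (z + b *\<^sub>R \<xi>) - \<sigma> (z + a *\<^sub>R \<xi>)) \<bullet> \<xi> = hess F (z + t *\<^sub>R \<xi>) ((b - a) *\<^sub>R \<xi>) \<bullet> \<xi>"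
  by (auto simp: inner_diff_left)
 have lin: "hess F (z + t *\<^sub>R \<xi>) ((b - a) *\<^sub>R \<xi>) = (b - a) *\<^sub>R hess F (z + t *\<^sub>R \<xi>) \<xi>"
  using hess_linear by (simp add: bounded_linear.linear linear_cmul)
 have "m <= norm (z + t *\<^sub>R \<xi>)" using m t by simp
 also have "... <= ell \<mu> (z + t *\<^sub>R \<xi>)" by (simp add: ell_def real_le_rsqrt)
 finally have "rpow m (p - 2) <= rpow (ell \<mu> (z + t *\<^sub>R \<xi>)) (p - 2)"
  using p2 assms by (intro rpow_mono) auto
 hence "inverse L * rpow m (p - 2) * (norm \<xi>)\<^sup>2 <= inverse L * rpow (ell \<mu> (z + t *\<^sub>R \<xi>)) (p - 2) * (norm \<xi>)\<^sup>2"
  using L1 by (intro mult_right_mono mult_left_mono) auto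
 also have "... <= hess F (z + t *\<^sub>R \<xi>) \<xi> \<bullet> \<xi>"
  by (rule structD[THEN conjunct2, THEN conjunct2, THEN conjunct1, THEN spec, THEN spec])
 finally show ?thesis unfolding eq lin using t by (simp add: mult_left_mono)
qed

lemma \<sigma>_monotone: "0 <= (\<sigma> w - \<sigma> z) \<bullet> (w - z)"
proof -
 have "(1 - 0) * (inverse L * rpow 0 (p - 2) * (norm (w - z))\<^sup>2) <= (\<sigma> (z + 1 *\<^sub>R (w - z)) - \<sigma> (z + 0 *\<^sub>R (w - z))) \<bullet> (w - z)"
  by (rule \<sigma>_monotone_aux) auto
 moreover have "0 <= inverse L * rpow 0 (p - 2) * (norm (w - z))\<^sup>2" using L1 by simp
 ultimately show ?thesis by simp
qed

lemma F_convex: "F z + \<sigma> z \<bullet> (w - z) <= F w"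
proof -
 obtain x where x: "x : closed_segment z w" "F w - F z = \<sigma> x \<bullet> (w - z)" by (rule F_mvt)
 obtain t where t: "0 <= t" "t <= 1" "x = z + t *\<^sub>R (w - z)"
  using x(1) unfolding closed_segment_def by (auto simp: algebra_simps)
 have "0 <= (\<sigma> x - \<sigma> z) \<bullet> (w - z)"
 proof (cases "t = 0")
  case False
  have "0 <= (\<sigma> x - \<sigma> z) \<bullet> (x - z)" by (rule \<sigma>_monotone)
  thus ?thesis using t False by (simp add: zero_le_mult_iff)
 qed (use t in simp)
 thus ?thesis using x(2) by (simp add: inner_diff_left)
qed

lemma F_convex_on: "convex_on UNIV F"
proof (rule convex_onI)
 fix t :: real and x y :: 'a assume t: "0 < t" "t < 1"
 let ?w = "(1 - t) *\<^sub>R x + t *\<^sub>R y"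
 have "(1 - t) * (F ?w + \<sigma> ?w \<bullet> (x - ?w)) + t * (F ?w + \<sigma> ?w \<bullet> (y - ?w)) <= (1 - t) * F x + t * F y"
  using t by (intro add_mono mult_left_mono F_convex) auto
 moreover have "(1 - t) * (F ?w + \<sigma> ?w \<bullet> (x - ?w)) + t * (F ?w + \<sigma> ?w \<bullet> (y - ?w)) = F ?w"
  by (simp add: inner_simps algebra_simps)
 ultimately show "F ?w <= (1 - t) * F x + t * F y" by simp
qed simp

text \<open>The factor \<open>1 / 4\<close> is the length of the parameter interval and
  \<open>1 / 8\<close> the relative distance from the origin that are secured in
  \<open>\<sigma>_coercive\<close>; \<open>L\<close> is the ellipticity constant.\<close>

definition cA :: real where "cA = 1 / (4 * L) * (1 / 8) powr (p - 2)"

lemma cA_pos: "0 < cA" using L1 by (simp add: cA_def)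

text \<open>Ellipticity may degenerate at the origin, but the segment from \<open>z\<close> to
  \<open>w\<close> cannot stay near it: for at least a quarter of the parameter range its distance
  from the origin is at least \<open>max (norm z) (norm (w - z)) / 8\<close>. Monotonicity makes the
  remaining parts contribute nonnegatively. One form is weighted by the gradient at an end point,
  the other by the increment; the energy of finite differences needs both.\<close>

lemma \<sigma>_coercive:
 "cA * rpow (norm z) (p - 2) * (norm (w - z))\<^sup>2 <= (\<sigma> w - \<sigma> z) \<bullet> (w - z)" (is ?A)
 "cA * rpow (norm (w - z)) (p - 2) * (norm (w - z))\<^sup>2 <= (\<sigma> w - \<sigma> z) \<bullet> (w - z)" (is ?B)
proof -
 define \<xi> where "\<xi> = w - z"
 define m where "m = max (norm z) (norm \<xi>) / 8"
 have m0: "0 <= m" by (simp add: m_def le_max_iff_disj)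
 \<comment> \<open>The good interval is the whole segment if \<open>z\<close> is large compared with
   \<xi>, the first quarter if the two are comparable, and the last quarter if \<open>z\<close> is
   small, where \<open>z + \<xi>\<close> has at least half the norm of \<xi>.\<close>
 have main: "\<exists>a b. 0 <= a \<and> b <= 1 \<and> 1/4 <= b - a \<and> (\<forall>t. a <= t --> t <= b --> m <= norm (z + t *\<^sub>R \<xi>))"
 proof (cases "norm z \<ge> 2 * norm \<xi>")
  case True
  have "m <= norm (z + t *\<^sub>R \<xi>)" if "0 <= t" "t <= 1" for t
  proof -
   have "norm z - t * norm \<xi> <= norm (z + t *\<^sub>R \<xi>)" using norm_diff_ineq[of z "t *\<^sub>R \<xi>"] that by simp
   moreover have "t * norm \<xi> <= 1 * norm \<xi>" using that by (intro mult_right_mono) auto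
   ultimately show ?thesis using True unfolding m_def using norm_ge_zero[of \<xi>] by linarith
  qed
  thus ?thesis by (intro exI[of _ 0] exI[of _ 1]) auto
 next
  case False
  have tri: "norm \<xi> <= norm z + norm (z + \<xi>)" using norm_triangle_ineq4[of "z + \<xi>" z] by simp
  show ?thesis
  proof (cases "norm z \<ge> norm \<xi> / 2")
   case True
   have "m <= norm (z + t *\<^sub>R \<xi>)" if "0 <= t" "t <= 1/4" for t
   proof -
    have "norm z - t * norm \<xi> <= norm (z + t *\<^sub>R \<xi>)" using norm_diff_ineq[of z "t *\<^sub>R \<xi>"] that by simp
    moreover have "t * norm \<xi> <= 1/4 * norm \<xi>" using that by (intro mult_right_mono) auto
    ultimately show ?thesis using False True unfolding m_def by linarith
   qed
   thus ?thesis by (intro exI[of _ 0] exI[of _ "1/4"]) auto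
  next
   case 2: False
   have "m <= norm (z + t *\<^sub>R \<xi>)" if "3/4 <= t" "t <= 1" for t
   proof -
    have "z + \<xi> - (1 - t) *\<^sub>R \<xi> = z + t *\<^sub>R \<xi>" by (simp add: algebra_simps)
    hence "norm (z + \<xi>) - norm ((1 - t) *\<^sub>R \<xi>) <= norm (z + t *\<^sub>R \<xi>)"
     using norm_triangle_ineq2[of "z + \<xi>" "(1 - t) *\<^sub>R \<xi>"] by (simp only:)
    moreover have "norm ((1 - t) *\<^sub>R \<xi>) <= 1/4 * norm \<xi>"
     using that unfolding norm_scaleR by (intro mult_right_mono) auto
    ultimately show ?thesis using False 2 tri unfolding m_def by linarith
   qed
   thus ?thesis by (intro exI[of _ "3/4"] exI[of _ 1]) auto
  qed
 qed
 then obtain a b where ab: "0 <= a" "b <= 1" "1/4 <= b - a" "!!t. a <= t ==> t <= b ==> m <= norm (z + t *\<^sub>R \<xi>)" by blast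
 \<comment> \<open>Along the segment the stress component in direction \<xi> is nondecreasing, so
   restricting to the interval from \<open>a\<close> to \<open>b\<close> only discards nonnegative
   terms.\<close>
 define g where "g t = \<sigma> (z + t *\<^sub>R \<xi>) \<bullet> \<xi>" for t
 have mono: "g s <= g t" if "s <= t" for s t
 proof (cases "s = t")
  case False
  have "0 <= (\<sigma> (z + t *\<^sub>R \<xi>) - \<sigma> (z + s *\<^sub>R \<xi>)) \<bullet> (z + t *\<^sub>R \<xi> - (z + s *\<^sub>R \<xi>))" by (rule \<sigma>_monotone)
  also have "... = (t - s) * (g t - g s)" by (simp add: g_def inner_diff_left inner_diff_right algebra_simps)
  finally show ?thesis using that False by (simp add: zero_le_mult_iff)
 qed simp
 have key: "1 / (4 * L) * rpow m (p - 2) * (norm \<xi>)\<^sup>2 <= (\<sigma> w - \<sigma> z) \<bullet> \<xi>"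
 proof -
  have "1 / (4 * L) * rpow m (p - 2) * (norm \<xi>)\<^sup>2 = 1/4 * (inverse L * rpow m (p - 2) * (norm \<xi>)\<^sup>2)"
   by (simp add: field_simps)
  also have "... <= (b - a) * (inverse L * rpow m (p - 2) * (norm \<xi>)\<^sup>2)"
   using ab L1 by (intro mult_right_mono) auto
  also have "... <= g b - g a"
   using \<sigma>_monotone_aux[of a b m z \<xi>] ab m0 by (simp add: g_def inner_diff_left)
  also have "... <= g 1 - g 0" using mono[of b 1] mono[of 0 a] ab by simp
  also have "... = (\<sigma> w - \<sigma> z) \<bullet> \<xi>" by (simp add: g_def \<xi>_def inner_diff_left)
  finally show ?thesis .
 qed
 have aux: "cA * rpow y (p - 2) * (norm \<xi>)\<^sup>2 <= 1 / (4 * L) * rpow m (p - 2) * (norm \<xi>)\<^sup>2"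
  if y: "0 <= y" "y <= max (norm z) (norm \<xi>)" for y
 proof -
  have "(1 / 8) powr (p - 2) * rpow y (p - 2) = rpow (1 / 8 * y) (p - 2)"
   using y by (subst rpow_mult) (auto simp: rpow_eq_powr)
  also have "... <= rpow m (p - 2)" using y p2 by (intro rpow_mono) (auto simp: m_def)
  finally have "1 / (4 * L) * ((1 / 8) powr (p - 2) * rpow y (p - 2)) <= 1 / (4 * L) * rpow m (p - 2)"
   using L1 by (intro mult_left_mono) auto
  hence "cA * rpow y (p - 2) <= 1 / (4 * L) * rpow m (p - 2)" by (simp add: cA_def)
  thus ?thesis by (rule mult_right_mono) simp
 qed
 show ?A using aux[of "norm z"] key by (simp add: \<xi>_def)
 show ?B using aux[of "norm \<xi>"] key by (simp add: \<xi>_def)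
qed

section \<open>Gradient steps, cocoercivity and perturbation of the integrand\<close>

lemma F_upper:
 assumes B: "!!x. x : closed_segment z w ==> K x <= B"
 shows "F w <= F z + \<sigma> z \<bullet> (w - z) + 2 * L * B powr (q - 2) * (norm (w - z))\<^sup>2"
proof -
 let ?H = "2 * L * B powr (q - 2)"
 obtain x where x: "x : closed_segment z w" "F w - F z = \<sigma> x \<bullet> (w - z)" by (rule F_mvt)
 have "norm (\<sigma> x - \<sigma> z) <= ?H * norm (x - z)"
 proof (rule differentiable_bound[where S="closed_segment z w"])
  fix y assume y: "y : closed_segment z w"
  show "(\<sigma> has_derivative hess F y) (at y within closed_segment z w)"
   using \<sigma>_deriv has_derivative_at_withinI by blast
  have "K y powr (q - 2) <= B powr (q - 2)" using B[OF y] K1[of y] q2 by (intro powr_mono2) auto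
  thus "onorm (hess F y) <= ?H" using onorm_hess[of y] L1
   by (meson mult_left_mono order_trans less_imp_le mult_pos_pos zero_less_numeral less_trans zero_less_one)
 qed (use x in auto)
 also have "... <= ?H * norm (w - z)"
  using x(1) L1 by (intro mult_left_mono) (auto simp: dist_norm[symmetric] dist_commute dest: dist_in_closed_segment)
 finally have n: "norm (\<sigma> x - \<sigma> z) <= ?H * norm (w - z)" .
 have "F w - F z - \<sigma> z \<bullet> (w - z) = (\<sigma> x - \<sigma> z) \<bullet> (w - z)" using x by (simp add: inner_diff_left)
 also have "... <= norm (\<sigma> x - \<sigma> z) * norm (w - z)" by (rule norm_cauchy_schwarz)
 also have "... <= (?H * norm (w - z)) * norm (w - z)" using n by (rule mult_right_mono) simp
 finally show ?thesis by (simp add: power2_eq_square algebra_simps)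
qed

text \<open>Step size for gradient descent, relative to the scale \<open>B\<close>. Its value serves
  two purposes: \<open>2 * L * cB \<le> 1\<close>, so that a step stays where
  \<open>K \<le> 2 * B\<close>, and the second-order coefficient in \<open>F_descent\<close> becomes
  exactly \<open>1 / 2\<close>.\<close>

definition cB :: real where "cB = 1 / (L * 2 powr q)"

lemma cB_pos: "0 < cB" using L1 by (simp add: cB_def)

text \<open>A step of size \<open>cB / B powr (q - 2)\<close> moves by at most
  \<open>cB * B\<close>. By the Lipschitz bound \<open>K\<close> stays below \<open>2 * B\<close> on
  the way, so Taylor's estimate applies at that scale and its quadratic term costs only half of
  \<open>s * (norm d)\<^sup>2\<close>.\<close>

lemma F_descent:
 assumes "K z <= B" and d: "norm d <= B powr (q - 1)" and s: "s = cB / B powr (q - 2)"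
 shows "F (z - s *\<^sub>R d) <= F z - s * (\<sigma> z \<bullet> d) + s / 2 * (norm d)\<^sup>2"
proof -
 have B1: "1 <= B" using K1[of z] assms by simp
 have s0: "0 < s" using s cB_pos B1 by simp
 have "s * norm d <= s * B powr (q - 1)" using d s0 by simp
 also have "... = cB * B"
 proof -
  have "B powr (q - 1) = B powr (q - 2) * B powr 1" by (subst powr_add[symmetric]) simp
  thus ?thesis using s B1 by simp
 qed
 finally have sd: "s * norm d <= cB * B" .
 have cL: "2 * L * cB <= 1"
 proof -
  have "2 powr 1 <= (2::real) powr q" using q2 by (intro powr_mono) auto
  thus ?thesis using L1 by (simp add: cB_def field_simps)
 qed
 have "K x <= 2 * B" if x: "x : closed_segment z (z - s *\<^sub>R d)" for x
 proof -
  have "norm (x - z) <= norm (s *\<^sub>R d)"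
   using x dist_in_closed_segment[OF x] by (simp add: dist_norm norm_minus_commute)
  hence "norm (x - z) <= cB * B" using sd s0 by simp
  hence "2 * L * norm (x - z) <= 2 * L * (cB * B)" using L1 by (intro mult_left_mono) auto
  also have "... = (2 * L * cB) * B" by simp
  also have "... <= 1 * B" using cL B1 by (intro mult_right_mono) auto
  finally show ?thesis using K_lipschitz[of x z] assms by simp
 qed
 hence "F (z - s *\<^sub>R d) <= F z + \<sigma> z \<bullet> (z - s *\<^sub>R d - z) + 2 * L * (2 * B) powr (q - 2) * (norm (z - s *\<^sub>R d - z))\<^sup>2"
  by (rule F_upper)
 also have "... = F z - s * (\<sigma> z \<bullet> d) + s * (s * (2 * L * (2 * B) powr (q - 2))) * (norm d)\<^sup>2"
  using s0 by (simp add: power_mult_distrib) (simp add: power2_eq_square)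
 also have "s * (2 * L * (2 * B) powr (q - 2)) = 1 / 2"
 proof -
  have "(2 * B) powr (q - 2) = 2 powr (q - 2) * B powr (q - 2)" using B1 by (simp add: powr_mult)
  moreover have "(2::real) powr q = 2 powr (q - 2) * 4"
   by (simp add: powr_diff powr_numeral)
  ultimately show ?thesis using L1 B1 by (simp add: s cB_def field_simps)
 qed
 finally show ?thesis by simp
qed

text \<open>Baillon-Haddad argument at the scale \<open>B = K z + K w\<close>: a descent step from
  \<open>w\<close> in direction \<open>\<sigma> w - \<sigma> z\<close> must stay above the tangent
  plane at \<open>z\<close>, so the guaranteed gain is bounded by the Bregman distance, hence by the
  monotonicity product. It converts the stress difference of the error terms into a square root of
  the excess, which is what makes absorption possible.\<close>

lemma \<sigma>_cocoercive:
 "cB / 2 * (norm (\<sigma> w - \<sigma> z))\<^sup>2 <= (K z + K w) powr (q - 2) * ((\<sigma> w - \<sigma> z) \<bullet> (w - z))"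
proof -
 define B where "B = K z + K w"
 define d where "d = \<sigma> w - \<sigma> z"
 define s where "s = cB / B powr (q - 2)"
 have B1: "1 <= B" using K1[of z] K1[of w] by (simp add: B_def)
 have s0: "0 < s" using s_def cB_pos B1 by simp
 have nd: "norm d <= B powr (q - 1)"
 proof -
  have "norm d <= K w powr (q - 1) + K z powr (q - 1)"
   unfolding d_def by (meson add_mono norm_\<sigma>_K norm_triangle_ineq4 order_trans)
  also have "... = K w powr (q - 2) * K w + K z powr (q - 2) * K z"
   using K1[of w] K1[of z] powr_add[of "K w" "q - 2" 1] powr_add[of "K z" "q - 2" 1] by simp
  also have "... <= B powr (q - 2) * K w + B powr (q - 2) * K z"
   using K1[of w] K1[of z] q2 by (intro add_mono mult_right_mono powr_mono2) (auto simp: B_def)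
  also have "... = B powr (q - 2) * B powr 1" using B1 by (simp add: B_def algebra_simps)
  also have "... = B powr (q - 1)" by (subst powr_add[symmetric]) simp
  finally show ?thesis .
 qed
 have "F z + \<sigma> z \<bullet> (w - s *\<^sub>R d - z) <= F (w - s *\<^sub>R d)" by (rule F_convex)
 also have "... <= F w - s * (\<sigma> w \<bullet> d) + s / 2 * (norm d)\<^sup>2"
  by (rule F_descent[of _ B]) (use K1[of z] nd s_def in \<open>auto simp: B_def\<close>)
 finally have "F z + \<sigma> z \<bullet> (w - z) + s * (\<sigma> w \<bullet> d - \<sigma> z \<bullet> d) - s / 2 * (norm d)\<^sup>2 <= F w"
  by (simp add: inner_diff_right algebra_simps)
 moreover have "\<sigma> w \<bullet> d - \<sigma> z \<bullet> d = (norm d)\<^sup>2"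
  by (simp add: d_def power2_norm_eq_inner inner_diff_left)
 ultimately have "s / 2 * (norm d)\<^sup>2 <= F w - F z - \<sigma> z \<bullet> (w - z)" by simp
 also have "... <= (\<sigma> w - \<sigma> z) \<bullet> (w - z)"
  using F_convex[of w z] by (simp add: inner_diff_left inner_diff_right)
 finally have "B powr (q - 2) * (s / 2 * (norm d)\<^sup>2) <= B powr (q - 2) * ((\<sigma> w - \<sigma> z) \<bullet> (w - z))"
  by (intro mult_left_mono) auto
 thus ?thesis using B1 by (simp add: s_def B_def d_def)
qed

text \<open>One descent step from \<open>z\<close> along \<open>\<sigma> z\<close> cannot make
  \<open>F\<close> negative, so the squared stress is at most a constant times
  \<open>K powr (q - 2)\<close> times \<open>F\<close>. Finite energy therefore controls
  \<open>K powr q\<close>, although it gives only the p-th power of the gradient itself.\<close>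

lemma K_le_F: "K z powr q <= 1 + 2 / cB * F z"
proof -
 define s where "s = cB / K z powr (q - 2)"
 have k0: "0 < K z" using K1[of z] by simp
 have "0 <= F (z - s *\<^sub>R \<sigma> z)" by (rule F_nonneg)
 also have "... <= F z - s * (\<sigma> z \<bullet> \<sigma> z) + s / 2 * (norm (\<sigma> z))\<^sup>2"
  by (rule F_descent[of _ "K z"]) (auto simp: s_def norm_\<sigma>_K)
 finally have "s / 2 * (norm (\<sigma> z))\<^sup>2 <= F z" by (simp add: power2_norm_eq_inner)
 moreover have "(norm (\<sigma> z))\<^sup>2 = K z powr (2 * (q - 1)) - 1"
 proof -
  have "K z powr (2 * (q - 1)) = (K z powr (q - 1)) powr 2" by (simp add: powr_powr mult.commute)
  also have "... = 1 + \<sigma> z \<bullet> \<sigma> z" using J1[of z] by (simp add: K_J powr_numeral) (simp add: J_def add_nonneg_nonneg)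
  finally show ?thesis by (simp add: power2_norm_eq_inner)
 qed
 ultimately have "cB / 2 * (K z powr (2 * (q - 1)) - 1) <= F z * K z powr (q - 2)"
  using k0 by (simp add: s_def field_simps)
 hence 1: "K z powr (2 * (q - 1)) - 1 <= 2 / cB * F z * K z powr (q - 2)"
  using cB_pos by (simp add: field_simps)
 have 2: "K z powr (2 * (q - 1)) = K z powr q * K z powr (q - 2)" by (simp flip: powr_add)
 have "(K z powr q - 1) * K z powr (q - 2) <= 2 / cB * F z * K z powr (q - 2)"
  using 1 2 ge_one_powr_ge_zero[OF K1[of z], of "q - 2"] q2 by (simp add: algebra_simps)
 hence "K z powr q - 1 <= 2 / cB * F z" by (rule mult_right_le_imp_le) (use k0 in simp)
 thus ?thesis by simp
qed

lemma powr_add_le: 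
 fixes a b r :: real
 assumes "0 <= a" "0 <= b" "0 <= r"
 shows "(a + b) powr r <= 2 powr r * (a powr r + b powr r)"
proof -
 have "(a + b) powr r <= (2 * max a b) powr r" using assms by (intro powr_mono2) auto
 also have "... = 2 powr r * max a b powr r" using assms by (simp add: powr_mult)
 also have "... <= 2 powr r * (a powr r + b powr r)" by (intro mult_left_mono) (auto simp: max_def)
 finally show ?thesis .
qed

lemma \<sigma>_mult_le:
 assumes "K z <= B" "0 <= b"
 shows "norm (\<sigma> z) * b <= B powr q + b powr q"
proof -
 have B0: "0 < B" using K1[of z] assms by simp
 have "norm (\<sigma> z) * b <= B powr (q - 1) * b"
  using assms K1[of z] q2 by (intro mult_right_mono order_trans[OF norm_\<sigma>_K] powr_mono2) auto
 also have "... <= max B b powr (q - 1) * max B b powr 1"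
  using assms B0 q2 by (intro mult_mono powr_mono2) auto
 also have "... = max B b powr q" by (subst powr_add[symmetric]) simp
 also have "... <= B powr q + b powr q" by (auto simp: max_def)
 finally show ?thesis .
qed

text \<open>Makes competitors admissible: a perturbation whose q-th power is integrable keeps the
  energy finite. Convexity reduces the increment to \<open>\<sigma> (z + w) \<bullet> w\<close>,
  where \<open>K (z + w)\<close> exceeds \<open>K z\<close> by at most a multiple of
  \<open>norm w\<close>, and \<open>K_le_F\<close> leads back from \<open>K z\<close> to
  \<open>F z\<close>.\<close>

lemma F_perturb: "\<exists>C>0. \<forall>z w. F (z + w) <= C * (1 + F z + norm w powr q)"
proof -
 define C where "C = 2 powr q * (2 / cB + 1 + (2 * L) powr q) + 2"
 have "F (z + w) <= C * (1 + F z + norm w powr q)" for z w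
 proof -
  have K: "K (z + w) <= K z + 2 * L * norm w" using K_lipschitz[of "z + w" z] by simp
  have "F (z + w) <= F z + \<sigma> (z + w) \<bullet> w" using F_convex[of "z + w" z] by simp
  also have "... <= F z + norm (\<sigma> (z + w)) * norm w" by (simp add: norm_cauchy_schwarz)
  also have "norm (\<sigma> (z + w)) * norm w <= (K z + 2 * L * norm w) powr q + norm w powr q"
   by (rule \<sigma>_mult_le[OF K]) simp
  also have "(K z + 2 * L * norm w) powr q <= 2 powr q * (K z powr q + (2 * L * norm w) powr q)"
   using K1[of z] L1 q2 by (intro powr_add_le) auto
  also have "(2 * L * norm w) powr q = (2 * L) powr q * norm w powr q" using L1 by (simp add: powr_mult)
  also have "2 powr q * (K z powr q + (2 * L) powr q * norm w powr q)
    <= 2 powr q * ((1 + 2 / cB * F z) + (2 * L) powr q * norm w powr q)"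
   by (intro mult_left_mono add_right_mono K_le_F) auto
  finally have "F (z + w) <= F z + (2 powr q * ((1 + 2 / cB * F z) + (2 * L) powr q * norm w powr q) + norm w powr q)" by simp
  also have "... <= C * (1 + F z + norm w powr q)"
  proof -
   have eq: "C * (1 + F z + norm w powr q) - (F z + (2 powr q * ((1 + 2 / cB * F z) + (2 * L) powr q * norm w powr q) + norm w powr q))
    = 2 powr q * (2 / cB + (2 * L) powr q) + 2 + F z * (2 powr q * (1 + (2 * L) powr q) + 1) + norm w powr q * (2 powr q * (2 / cB + 1) + 1)"
    unfolding C_def by (simp only: ring_distribs mult_1_left mult_1_right) (simp add: algebra_simps add_divide_distrib)
   have "0 <= 2 powr q * (2 / cB + (2 * L) powr q) + 2 + F z * (2 powr q * (1 + (2 * L) powr q) + 1) + norm w powr q * (2 powr q * (2 / cB + 1) + 1)"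
    using F_nonneg[of z] cB_pos by (intro add_nonneg_nonneg mult_nonneg_nonneg) auto
   thus ?thesis using eq by linarith
  qed
  finally show ?thesis .
 qed
 moreover have "0 < C" unfolding C_def using cB_pos by (intro add_nonneg_pos mult_nonneg_nonneg) auto
 ultimately show ?thesis by blast
qed

end

section \<open>Powers of extended nonnegative reals\<close>

text \<open>Real powers on \<open>ennreal\<close>, so that Hoelder's inequality can be used without
  finiteness assumptions. The convention that exponent 0 gives 1 even at 0 and at infinity allows
  weights to vanish, which happens below for \<open>\<theta> = 0\<close> and for
  \<open>q = 2\<close>.\<close>

definition epow :: "ennreal => real => ennreal" where
 "epow x a = (if a = 0 then 1 else if x = \<infinity> then \<infinity> else en (enn2real x powr a))"

lemma epow_0 [simp]: "epow x 0 = 1"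
 by (simp add: epow_def)

lemma epow_ennreal: "0 <= x ==> a ~= 0 ==> epow (en x) a = en (x powr a)"
 by (simp add: epow_def)

lemma epow_zero [simp]: "a ~= 0 ==> epow 0 a = 0"
 by (simp add: epow_def)

lemma epow_top [simp]: "a ~= 0 ==> epow \<infinity> a = \<infinity>"  "a ~= 0 ==> epow top a = top"
 by (simp_all add: epow_def)

lemma epow_1 [simp]: "epow x 1 = x"
 by (cases x) (auto simp: epow_def)

lemma epow_one [simp]: "epow 1 a = 1"
 by (simp add: epow_def)

lemma borel_measurable_epow [measurable]:
 assumes [measurable]: "f : borel_measurable M"
 shows "(%x. epow (f x) a) : borel_measurable M"
 unfolding epow_def by measurable

lemma epow_mono: "0 <= a ==> x <= y ==> epow x a <= epow y a"
 by (cases x; cases y) (auto simp: epow_def top_unique powr_mono2)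

lemma epow_eq_0_iff: "0 < a ==> epow x a = 0 \<longleftrightarrow> x = 0"
 by (cases x) (auto simp: epow_def)

lemma epow_less_top: "0 <= a ==> x < top ==> epow x a < top"
 by (cases x) (auto simp: epow_def)

lemma epow_mult: "0 <= a ==> epow (x * y) a = epow x a * epow y a"
 by (cases "a = 0"; cases "x = 0"; cases "y = 0"; cases x; cases y)
  (auto simp: ennreal_mult_top ennreal_top_mult epow_ennreal powr_mult top_unique 
   ennreal_mult[symmetric] powr_eq_0_iff)

lemma epow_add: "0 <= a ==> 0 <= b ==> epow x (a + b) = epow x a * epow x b"
 by (cases "a = 0"; cases "b = 0"; cases "a + b = 0"; cases x)
  (auto simp: epow_ennreal powr_add ennreal_mult[symmetric])

lemma epow_epow: "0 <= a ==> 0 <= b ==> epow (epow x a) b = epow x (a * b)"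
 by (cases "a = 0"; cases "b = 0"; cases x) (auto simp: epow_ennreal powr_powr)

lemma epow_prod: "0 <= a ==> epow (\<Prod>i\<in>I. f i) a = (\<Prod>i\<in>I. epow (f i) a)"
 by (induction I rule: infinite_finite_induct) (auto simp: epow_mult)

lemma epow_young:
 assumes "0 <= a" "0 <= b" "a + b = 1"
 shows "epow x a * epow y b <= en a * x + en b * y"
proof (cases "a = 0 \<or> b = 0")
 case True
 thus ?thesis using assms by auto
next
 case False
 hence ab: "0 < a" "0 < b" using assms by auto
 show ?thesis
 proof (cases "x = 0 \<or> y = 0 \<or> x = top \<or> y = top")
  case True
  thus ?thesis using ab by (auto simp: ennreal_mult_top)
 next
  case False
  then obtain u v where uv: "x = en u" "y = en v" "0 < u" "0 < v"
   by (cases x; cases y) (auto simp: less_le)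
  show ?thesis using Youngs_inequality_0[OF assms uv(3,4)] ab uv
   by (simp add: epow_ennreal ennreal_mult[symmetric] ennreal_plus[symmetric] ennreal_leI del: ennreal_plus)
 qed
qed

text \<open>Weights with sum 1 replace conjugate exponents, which makes the passage to several
  factors immediate. After dividing by the two integrals this is Young's inequality; integrals equal
  to 0 or infinity are separated beforehand because the division is then meaningless.\<close>

lemma nn_integral_Holder2:
 assumes [measurable]: "f : borel_measurable M" "g : borel_measurable M"
  and ab: "0 <= a" "0 <= b" "a + b = 1"
 shows "(\<integral>\<^sup>+x. epow (f x) a * epow (g x) b \<partial>M) <= epow (\<integral>\<^sup>+x. f x \<partial>M) a * epow (\<integral>\<^sup>+x. g x \<partial>M) b"
proof (cases "a = 0 \<or> b = 0")
 case True
 thus ?thesis using ab by auto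
next
 case False
 hence ab': "0 < a" "0 < b" using ab by auto
 define A where "A = (\<integral>\<^sup>+x. f x \<partial>M)"
 define B where "B = (\<integral>\<^sup>+x. g x \<partial>M)"
 show ?thesis
 proof (cases "A = 0 \<or> B = 0")
  case True
  hence "AE x in M. f x = 0 \<or> g x = 0"
   unfolding A_def B_def by (auto simp: nn_integral_0_iff_AE)
  hence "AE x in M. epow (f x) a * epow (g x) b = 0"
   by eventually_elim (use ab' in auto)
  hence "(\<integral>\<^sup>+x. epow (f x) a * epow (g x) b \<partial>M) = 0" by (simp add: nn_integral_0_iff_AE)
  thus ?thesis by simp
 next
  case nz: False
  show ?thesis
  proof (cases "A = top \<or> B = top")
   case True
   hence "epow A a * epow B b = top"
    using nz ab' by (auto simp: ennreal_top_mult ennreal_mult_top epow_eq_0_iff)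
   thus ?thesis by (simp add: A_def B_def)
  next
   case False
   have "epow (f x) a * epow (g x) b <= (epow A a * epow B b) * (en a * (f x / A) + en b * (g x / B))" for x
   proof -
    have 1: "f x = A * (f x / A)" "g x = B * (g x / B)"
     using nz False by (auto simp: ennreal_times_divide ennreal_mult_divide_eq mult.commute[of A] mult.commute[of B] ennreal_divide_times)
    have "epow (f x) a = epow A a * epow (f x / A) a" "epow (g x) b = epow B b * epow (g x / B) b"
     using epow_mult[of a A "f x / A"] epow_mult[of b B "g x / B"] ab unfolding 1[symmetric] by blast+
    hence "epow (f x) a * epow (g x) b = (epow A a * epow B b) * (epow (f x / A) a * epow (g x / B) b)"
     by (simp only: mult_ac)
    also have "... <= (epow A a * epow B b) * (en a * (f x / A) + en b * (g x / B))"
     by (intro mult_left_mono epow_young ab) auto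
    finally show ?thesis .
   qed
   hence "(\<integral>\<^sup>+x. epow (f x) a * epow (g x) b \<partial>M)
     <= (\<integral>\<^sup>+x. (epow A a * epow B b) * (en a * (f x / A) + en b * (g x / B)) \<partial>M)"
    by (intro nn_integral_mono) auto
   also have "... = (epow A a * epow B b) * (en a * (A / A) + en b * (B / B))"
    by (simp add: nn_integral_cmult nn_integral_add nn_integral_divide A_def B_def)
   also have "... = epow A a * epow B b"
    using nz False ab by (simp add: ennreal_divide_self less_top flip: ennreal_plus)
   finally show ?thesis by (simp add: A_def B_def)
  qed
 qed
qed

text \<open>Induction on the factors: one weight is split off by the two-factor case, and the others
  are divided by \<open>1 - w j\<close> so that they again sum to 1.\<close>

lemma nn_integral_Holder:
 assumes "finite I" "I ~= {}"
  and "!!i. i : I ==> f i : borel_measurable M"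
  and "!!i. i : I ==> 0 <= w i" "(\<Sum>i\<in>I. w i) = 1"
 shows "(\<integral>\<^sup>+x. (\<Prod>i\<in>I. epow (f i x) (w i)) \<partial>M) <= (\<Prod>i\<in>I. epow (\<integral>\<^sup>+x. f i x \<partial>M) (w i))"
 using assms
proof (induction I arbitrary: w rule: finite_ne_induct)
 case (singleton x)
 thus ?case by simp
next
 case (insert j I)
 note [measurable] = insert.prems(1)
 have wj: "0 <= w j" "w j <= 1"
  using insert.prems insert.hyps sum_nonneg[of I w] by auto
 have sum: "(\<Sum>i\<in>I. w i) = 1 - w j" using insert.prems insert.hyps by simp
 show ?case
 proof (cases "w j = 1")
  case True
  hence "\<forall>i\<in>I. w i = 0" using sum insert by (subst sum_nonneg_eq_0_iff[symmetric]) auto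
  thus ?thesis using True insert.hyps by simp
 next
  case False
  define v where "v = 1 - w j"
  have v: "0 < v" using False wj by (simp add: v_def)
  have eq: "(\<Prod>i\<in>I. epow (y i) (w i)) = epow (\<Prod>i\<in>I. epow (y i) (w i / v)) v" for y
   using v insert.prems by (auto simp: epow_prod epow_epow intro!: prod.cong)
  have IH: "(\<integral>\<^sup>+x. (\<Prod>i\<in>I. epow (f i x) (w i / v)) \<partial>M) <= (\<Prod>i\<in>I. epow (\<integral>\<^sup>+x. f i x \<partial>M) (w i / v))"
   using v insert.prems sum by (intro insert.IH) (auto simp: sum_divide_distrib[symmetric] v_def)
  have "(\<integral>\<^sup>+x. (\<Prod>i\<in>insert j I. epow (f i x) (w i)) \<partial>M) = (\<integral>\<^sup>+x. epow (f j x) (w j) * epow (\<Prod>i\<in>I. epow (f i x) (w i / v)) v \<partial>M)"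
   using insert.hyps by (simp add: eq)
  also have "... <= epow (\<integral>\<^sup>+x. f j x \<partial>M) (w j) * epow (\<integral>\<^sup>+x. (\<Prod>i\<in>I. epow (f i x) (w i / v)) \<partial>M) v"
   using v wj by (intro nn_integral_Holder2) (auto simp: v_def intro!: borel_measurable_prod_ennreal)
  also have "... <= epow (\<integral>\<^sup>+x. f j x \<partial>M) (w j) * epow (\<Prod>i\<in>I. epow (\<integral>\<^sup>+x. f i x \<partial>M) (w i / v)) v"
   using v by (intro mult_left_mono epow_mono IH) auto
  also have "... = (\<Prod>i\<in>insert j I. epow (\<integral>\<^sup>+x. f i x \<partial>M) (w i))"
   using insert.hyps by (simp add: eq)
  finally show ?thesis .
 qed
qed

lemma nn_integral_Holder3:
 assumes [measurable]: "f : borel_measurable M" "g : borel_measurable M" "h : borel_measurable M"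
  and w: "0 <= a" "0 <= b" "0 <= c" "a + b + c = 1"
 shows "(\<integral>\<^sup>+x. epow (f x) a * epow (g x) b * epow (h x) c \<partial>M)
  <= epow (\<integral>\<^sup>+x. f x \<partial>M) a * epow (\<integral>\<^sup>+x. g x \<partial>M) b * epow (\<integral>\<^sup>+x. h x \<partial>M) c"
proof -
 define F where "F i = (if i = 0 then f else if i = 1 then g else h)" for i :: nat
 define W where "W i = (if i = 0 then a else if i = 1 then b else c)" for i :: nat
 have "(\<integral>\<^sup>+x. (\<Prod>i\<in>{0,1,2}. epow (F i x) (W i)) \<partial>M) <= (\<Prod>i\<in>{0,1,2}. epow (\<integral>\<^sup>+x. F i x \<partial>M) (W i))"
  using w by (intro nn_integral_Holder) (auto simp: F_def W_def)
 thus ?thesis by (simp add: F_def W_def mult.assoc)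
qed

section \<open>Marginals and Sobolev inequalities\<close>

abbreviation PL :: "'i set => ('i => real) measure" where "PL I \<equiv> \<Pi>\<^sub>M i\<in>I. lborel"

interpretation PL: product_sigma_finite "%_::'i. lborel :: real measure"
 by standard

lemma measurable_update_PL [measurable]:
 assumes "finite I" "i \<notin> I" "f : borel_measurable (PL (insert i I))"
 shows "(%(x, y). f (x(i := y))) : borel_measurable (PL I \<Otimes>\<^sub>M lborel)"
 using measurable_compose[OF measurable_add_dim[of i I "%_. lborel"] assms(3)] by (simp add: split_beta')

text \<open>An inequality of Loomis-Whitney and Gagliardo type. At the endpoint, where
  \<open>(card A - 1) * \<alpha> = 1\<close>, the factor \<open>f\<close> drops out and only line
  integrals remain. When the coordinate \<open>k\<close> is integrated out, the line integral in
  direction \<open>k\<close> is constant, and Hoelder's inequality with one weight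
  \<open>1 - m * \<alpha>\<close> and \<open>m\<close> weights \<alpha> handles the other
  factors.\<close>

lemma marginal_inequality:
 assumes "finite A" "0 <= \<alpha>" "(real (card A) - 1) * \<alpha> <= 1" and f: "f : borel_measurable (PL A)"
 shows "(\<integral>\<^sup>+x. epow (f x) (1 - (real (card A) - 1) * \<alpha>) * (\<Prod>i\<in>A. epow (NBINT y. f (x(i := y))) \<alpha>) \<partial>PL A)
  <= epow (\<integral>\<^sup>+x. f x \<partial>PL A) (1 + \<alpha>)"
 using assms
proof (induction A arbitrary: f rule: finite_induct)
 case empty
 thus ?case by (simp add: PL.nn_integral_empty)
next
 case (insert k A)
 note [measurable] = insert.prems(3)
 note [simp] = insert.hyps
 define m where "m = real (card A)"
 have m: "real (card (insert k A)) = m + 1" by (simp add: m_def)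
 have ma: "m * \<alpha> <= 1" "0 <= m * \<alpha>" using insert.prems m by (simp_all add: m_def)
 have upd: "(%(x, y). f (x(k := y))) : borel_measurable (PL A \<Otimes>\<^sub>M lborel)"
  by (rule measurable_update_PL) auto
 define G where "G x = (NBINT y. f (x(k := y)))" for x
 have G[measurable]: "G : borel_measurable (PL A)"
  unfolding G_def using upd by (auto intro!: lborel.borel_measurable_nn_integral simp: split_beta')
 have updi: "(%x. (NBINT y. f (x(i := y)))) : borel_measurable (PL (insert k A))" if i: "i : insert k A" for i
 proof -
  have "insert i (insert k A - {i}) = insert k A" using i by auto
  have "(%p. (fst p)(i := snd p)) : PL (insert k A) \<Otimes>\<^sub>M lborel \<rightarrow>\<^sub>M PL (insert k A)"
   using i by (intro measurable_PiM_single') (auto simp: space_pair_measure space_PiM PiE_def extensional_def)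
  hence "(%p. f ((fst p)(i := snd p))) : borel_measurable (PL (insert k A) \<Otimes>\<^sub>M lborel)"
   by (rule measurable_compose) (rule insert.prems)
  thus ?thesis by (auto intro!: lborel.borel_measurable_nn_integral simp: split_beta')
 qed
 have comp: "!!x. x : space (PL A) ==> (%y. x(k := y)) : lborel \<rightarrow>\<^sub>M PL (insert k A)"
  by (rule measurable_component_update) auto
 have "(\<integral>\<^sup>+x. epow (f x) (1 - (real (card (insert k A)) - 1) * \<alpha>) * (\<Prod>i\<in>insert k A. epow (NBINT y. f (x(i := y))) \<alpha>) \<partial>PL (insert k A))
  = (\<integral>\<^sup>+x. (NBINT t. epow (f (x(k:=t))) (1 - m * \<alpha>) * (\<Prod>i\<in>insert k A. epow (NBINT y. f (x(k:=t, i := y))) \<alpha>)) \<partial>PL A)"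
  unfolding m using updi by (subst PL.product_nn_integral_insert) (auto intro!: borel_measurable_prod_ennreal)
 also have "... <= (\<integral>\<^sup>+x. epow (G x) (1 - (m - 1) * \<alpha>) * (\<Prod>i\<in>A. epow (NBINT y. G (x(i := y))) \<alpha>) \<partial>PL A)"
 proof (rule nn_integral_mono)
  fix x assume x: "x : space (PL A)"
  note [measurable] = comp[OF x]
  have [measurable]: "(%t. f (x(k := t))) : borel_measurable lborel"
   using comp[OF x] insert.prems(3) by (rule measurable_compose)
  have [measurable]: "(%t. (NBINT y. f (x(k:=t, i := y)))) : borel_measurable lborel" if "i : insert k A" for i
   using comp[OF x] updi[OF that] by (rule measurable_compose)
  define W where "W i = (if i = k then 1 - m * \<alpha> else \<alpha>)" for i
  define FF where "FF i t = (if i = k then f (x(k:=t)) else (NBINT y. f (x(k:=t, i := y))))" for i t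
  have "(NBINT t. (\<Prod>i\<in>insert k A. epow (FF i t) (W i))) <= (\<Prod>i\<in>insert k A. epow (NBINT t. FF i t) (W i))"
  proof (rule nn_integral_Holder)
   show "(\<Sum>i\<in>insert k A. W i) = 1"
   proof -
    have "(\<Sum>i\<in>A. W i) = (\<Sum>i\<in>A. \<alpha>)" using insert.hyps by (intro sum.cong) (auto simp: W_def)
    thus ?thesis by (simp add: W_def m_def)
   qed
   show "FF i : borel_measurable lborel" if "i : insert k A" for i
    using that unfolding FF_def by auto
  qed (use insert.prems ma in \<open>auto simp: W_def\<close>)
  moreover have "(\<Prod>i\<in>A. epow (FF i t) (W i)) = (\<Prod>i\<in>A. epow (NBINT y. f (x(k:=t, i := y))) \<alpha>)" for t
   using insert.hyps by (intro prod.cong) (auto simp: FF_def W_def)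
  moreover have "(\<Prod>i\<in>A. epow (NBINT t. FF i t) (W i)) = (\<Prod>i\<in>A. epow (NBINT y. G (x(i := y))) \<alpha>)"
  proof (rule prod.cong)
   fix i assume i: "i : A"
   hence ik: "i ~= k" using insert.hyps by auto
   have "(NBINT t. FF i t) = (NBINT t. (NBINT y. f (x(k:=t, i := y))))"
    using ik by (simp add: FF_def)
   \<comment> \<open>Line integrals commute: integrating the marginal in direction \<open>i\<close>
     over the coordinate \<open>k\<close> gives the marginal of \<open>G\<close> in direction
     \<open>i\<close>.\<close>
   also have "... = (NBINT y. (NBINT t. f (x(k:=t, i := y))))"
   proof (rule lborel_pair.Fubini'[symmetric])
    have "(%p. x(k := fst p, i := snd p)) : lborel \<Otimes>\<^sub>M lborel \<rightarrow>\<^sub>M PL (insert k A)"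
     using i x by (intro measurable_PiM_single') (auto simp: space_pair_measure space_PiM PiE_def extensional_def)
    hence "(%p. f (x(k := fst p, i := snd p))) : borel_measurable (lborel \<Otimes>\<^sub>M lborel)"
     by (rule measurable_compose) (rule insert.prems)
    thus "(%(xa, y). f (x(k := xa, i := y))) : borel_measurable (lborel \<Otimes>\<^sub>M lborel)" by (simp add: split_beta')
   qed
   also have "... = (NBINT y. G (x(i := y)))"
    unfolding G_def using ik by (simp add: fun_upd_twist)
   finally show "epow (NBINT t. FF i t) (W i) = epow (NBINT y. G (x(i := y))) \<alpha>"
    using ik by (simp add: W_def)
  qed simp
  moreover have "epow (NBINT t. FF k t) (W k) = epow (G x) (1 - m * \<alpha>)" by (simp add: FF_def W_def G_def)
  ultimately have H: "(NBINT t. epow (f (x(k:=t))) (1 - m * \<alpha>) * (\<Prod>i\<in>A. epow (NBINT y. f (x(k:=t, i := y))) \<alpha>))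
   <= epow (G x) (1 - m * \<alpha>) * (\<Prod>i\<in>A. epow (NBINT y. G (x(i := y))) \<alpha>)"
   by (simp add: FF_def W_def)
  \<comment> \<open>The factor with \<open>i = k\<close> does not see the coordinate
    \<open>k\<close>. It leaves the inner integral as \<open>epow (G x) \<alpha>\<close> and
    restores the exponent of \<open>G\<close> that the induction hypothesis expects.\<close>
  have "(NBINT t. epow (f (x(k:=t))) (1 - m * \<alpha>) * (\<Prod>i\<in>insert k A. epow (NBINT y. f (x(k:=t, i := y))) \<alpha>))
   = (NBINT t. epow (G x) \<alpha> * (epow (f (x(k:=t))) (1 - m * \<alpha>) * (\<Prod>i\<in>A. epow (NBINT y. f (x(k:=t, i := y))) \<alpha>)))"
   by (simp add: G_def mult_ac)
  also have "... = epow (G x) \<alpha> * (NBINT t. epow (f (x(k:=t))) (1 - m * \<alpha>) * (\<Prod>i\<in>A. epow (NBINT y. f (x(k:=t, i := y))) \<alpha>))"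
   by (rule nn_integral_cmult) (auto intro!: borel_measurable_prod_ennreal borel_measurable_times_ennreal)
  also have "... <= epow (G x) \<alpha> * (epow (G x) (1 - m * \<alpha>) * (\<Prod>i\<in>A. epow (NBINT y. G (x(i := y))) \<alpha>))"
   by (intro mult_left_mono H) auto
  also have "... = epow (G x) (1 - (m - 1) * \<alpha>) * (\<Prod>i\<in>A. epow (NBINT y. G (x(i := y))) \<alpha>)"
  proof -
   have "1 - (m - 1) * \<alpha> = \<alpha> + (1 - m * \<alpha>)" by (simp add: algebra_simps)
   thus ?thesis using insert.prems ma epow_add[of \<alpha> "1 - m * \<alpha>" "G x"] by (simp only: mult.assoc)
  qed
  finally show "(NBINT t. epow (f (x(k:=t))) (1 - m * \<alpha>) * (\<Prod>i\<in>insert k A. epow (NBINT y. f (x(k:=t, i := y))) \<alpha>))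
   <= epow (G x) (1 - (m - 1) * \<alpha>) * (\<Prod>i\<in>A. epow (NBINT y. G (x(i := y))) \<alpha>)" .
 qed
 also have "... <= epow (\<integral>\<^sup>+x. G x \<partial>PL A) (1 + \<alpha>)"
  unfolding m_def
 proof (rule insert.IH)
  show "(real (card A) - 1) * \<alpha> <= 1" using ma insert.prems by (simp add: m_def algebra_simps)
 qed (use insert.prems in auto)
 also have "(\<integral>\<^sup>+x. G x \<partial>PL A) = (\<integral>\<^sup>+x. f x \<partial>PL (insert k A))"
  unfolding G_def by (subst PL.product_nn_integral_insert) auto
 finally show ?case .
qed

lemma prod_mono_ennreal':
 fixes f g :: "'i => ennreal"
 shows "(!!i. i : I ==> f i <= g i) ==> (\<Prod>i\<in>I. f i) <= (\<Prod>i\<in>I. g i)"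
 by (induction I rule: infinite_finite_induct) (auto intro!: mult_mono)

text \<open>With \<open>m\<close> coordinates, the exponent \<open>1 + \<alpha>\<close> splits into
  \<open>1 - (m - 1) * \<alpha>\<close> and \<open>m\<close> copies of \<alpha>, one for each
  direction; every copy is replaced by the line integral of \<open>g\<close> in its direction.
  Passing to the sum \<open>f + g\<close> puts both roles into a single function.\<close>

lemma gagliardo_marginal:
 fixes f g :: "('i => real) => ennreal"
 assumes I: "finite I" and \<alpha>: "0 <= \<alpha>" "(real (card I) - 1) * \<alpha> <= 1"
  and [measurable]: "f : borel_measurable (PL I)" "g : borel_measurable (PL I)"
  and le: "!!y i. y : space (PL I) ==> i : I ==> f y <= (NBINT t. g (y(i := t)))"
 shows "(\<integral>\<^sup>+y. epow (f y) (1 + \<alpha>) \<partial>PL I) <= epow (\<integral>\<^sup>+y. f y + g y \<partial>PL I) (1 + \<alpha>)"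
proof -
 let ?m = "real (card I)"
 let ?F = "%y. f y + g y"
 have "(\<integral>\<^sup>+y. epow (f y) (1 + \<alpha>) \<partial>PL I)
   <= (\<integral>\<^sup>+y. epow (?F y) (1 - (?m - 1) * \<alpha>) * (\<Prod>i\<in>I. epow (NBINT t. ?F (y(i := t))) \<alpha>) \<partial>PL I)"
 proof (rule nn_integral_mono)
  fix y assume y: "y : space (PL I)"
  have "epow (f y) (1 + \<alpha>) = epow (f y) (1 - (?m - 1) * \<alpha>) * epow (f y) (?m * \<alpha>)"
  proof -
   have "1 + \<alpha> = (1 - (?m - 1) * \<alpha>) + ?m * \<alpha>" by (simp add: algebra_simps)
   moreover have "0 <= ?m * \<alpha>" "0 <= 1 - (?m - 1) * \<alpha>" using \<alpha> by auto
   ultimately show ?thesis by (metis epow_add)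
  qed
  also have "epow (f y) (?m * \<alpha>) = (\<Prod>i\<in>I. epow (f y) \<alpha>)"
  proof -
   have "epow x (real n * \<alpha>) = epow x \<alpha> ^ n" for x n
    using \<alpha> by (induction n) (simp_all add: algebra_simps epow_add)
   thus ?thesis by simp
  qed
  finally have eq: "epow (f y) (1 + \<alpha>) = epow (f y) (1 - (?m - 1) * \<alpha>) * (\<Prod>i\<in>I. epow (f y) \<alpha>)" .
  have le: "(\<Prod>i\<in>I. epow (f y) \<alpha>) <= (\<Prod>i\<in>I. epow (NBINT t. ?F (y(i := t))) \<alpha>)"
  proof (intro prod_mono_ennreal' epow_mono \<alpha>(1))
   fix i assume i: "i : I"
   have "f y <= (NBINT t. g (y(i := t)))" by (rule le[OF y i])
   also have "... <= (NBINT t. ?F (y(i := t)))" by (intro nn_integral_mono) simp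
   finally show "f y <= (NBINT t. ?F (y(i := t)))" .
  qed
  show "epow (f y) (1 + \<alpha>) <= epow (?F y) (1 - (?m - 1) * \<alpha>) * (\<Prod>i\<in>I. epow (NBINT t. ?F (y(i := t))) \<alpha>)"
   unfolding eq using \<alpha> by (intro mult_mono epow_mono le) auto
 qed
 also have "... <= epow (\<integral>\<^sup>+y. ?F y \<partial>PL I) (1 + \<alpha>)"
  using I \<alpha> by (intro marginal_inequality) auto
 finally show ?thesis .
qed

text \<open>Sobolev's inequality for square integrable derivatives, from Gagliardo's: it is applied
  to \<open>epow h \<gamma>\<close> with \<open>2 * (\<gamma> - 1) = s\<close>, so that
  Cauchy-Schwarz produces the square roots of the \<open>s\<close>-integral and of the gradient
  integral. The \<open>s\<close>-integral reappears with an exponent below 1 and is divided out,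
  which is why it is assumed finite. The condition on \<open>s\<close>, written without division,
  says that \<open>s\<close> is at most the Sobolev exponent in dimension \<open>card I\<close>; it
  leaves \<open>s\<close> unbounded in dimensions 1 and 2.\<close>

lemma sobolev_marginal:
 fixes h d :: "('i => real) => ennreal"
 assumes I: "finite I" "I ~= {}" and s: "2 <= s" "(real (card I) - 2) * s <= 2 * real (card I)"
  and [measurable]: "h : borel_measurable (PL I)" "d : borel_measurable (PL I)"
  and \<gamma>: "\<gamma> = (s + 2) / 2"
  and le: "!!y i. y : space (PL I) ==> i : I ==>
   epow (h y) \<gamma> <= (NBINT t. en \<gamma> * epow (h (y(i := t))) (\<gamma> - 1) * d (y(i := t)))"
  and fin: "(\<integral>\<^sup>+y. epow (h y) s \<partial>PL I) < \<infinity>"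
 shows "epow (\<integral>\<^sup>+y. epow (h y) s \<partial>PL I) (2 / s) <= en (\<gamma>\<^sup>2) * (\<integral>\<^sup>+y. (h y + d y)\<^sup>2 \<partial>PL I)"
proof -
 define X where "X = (\<integral>\<^sup>+y. epow (h y) s \<partial>PL I)"
 define Y where "Y = (\<integral>\<^sup>+y. (h y + d y)\<^sup>2 \<partial>PL I)"
 \<comment> \<open>Chosen so that \<open>\<gamma> * (1 + \<alpha>) = s\<close>; the restriction on
   \<open>s\<close> then becomes \<open>(card I - 1) * \<alpha> \<le> 1\<close>.\<close>
 define \<alpha> where "\<alpha> = (s - 2) / (s + 2)"
 have \<gamma>2: "2 <= \<gamma>" using \<gamma> s by simp
 have "1 + \<alpha> = 2 * s / (s + 2)" using s by (simp add: \<alpha>_def field_simps)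
 hence "\<gamma> * (1 + \<alpha>) = s" using s unfolding \<gamma> by simp
 moreover have "0 <= \<alpha>" "(real (card I) - 1) * \<alpha> <= 1"
  using s by (auto simp: \<alpha>_def field_simps)
 ultimately have \<alpha>: "0 <= \<alpha>" "(real (card I) - 1) * \<alpha> <= 1" "\<gamma> * (1 + \<alpha>) = s" by auto
 have "X = (\<integral>\<^sup>+y. epow (epow (h y) \<gamma>) (1 + \<alpha>) \<partial>PL I)"
  using \<alpha> \<gamma>2 by (simp add: X_def epow_epow)
 also have "... <= epow (\<integral>\<^sup>+y. epow (h y) \<gamma> + en \<gamma> * epow (h y) (\<gamma> - 1) * d y \<partial>PL I) (1 + \<alpha>)"
  using I \<alpha> le by (intro gagliardo_marginal) auto
 also have "... <= epow (en \<gamma> * (epow X (1/2) * epow Y (1/2))) (1 + \<alpha>)"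
 proof (intro epow_mono)
  have "(\<integral>\<^sup>+y. epow (h y) \<gamma> + en \<gamma> * epow (h y) (\<gamma> - 1) * d y \<partial>PL I)
    <= (\<integral>\<^sup>+y. en \<gamma> * (epow (epow (h y) s) (1/2) * epow ((h y + d y)\<^sup>2) (1/2)) \<partial>PL I)"
  proof (intro nn_integral_mono)
   fix y
   have "epow (h y) \<gamma> = epow (h y) (\<gamma> - 1) * h y" using epow_add[of "\<gamma> - 1" 1 "h y"] \<gamma>2 by simp
   moreover have "epow (epow (h y) s) (1/2) = epow (h y) (\<gamma> - 1)" using s \<gamma> by (simp add: epow_epow diff_divide_distrib add_divide_distrib)
   moreover have "epow ((h y + d y)\<^sup>2) (1/2) = h y + d y"
    using epow_add[of "1/2" "1/2" "h y + d y"] by (simp add: power2_eq_square epow_mult)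
   moreover have "epow (h y) (\<gamma> - 1) * h y <= en \<gamma> * (epow (h y) (\<gamma> - 1) * h y)"
   proof -
    have "1 <= en \<gamma>" using \<gamma>2 by (simp flip: ennreal_1)
    from mult_right_mono[OF this, of "epow (h y) (\<gamma> - 1) * h y"] show ?thesis by simp
   qed
   ultimately show "epow (h y) \<gamma> + en \<gamma> * epow (h y) (\<gamma> - 1) * d y
     <= en \<gamma> * (epow (epow (h y) s) (1/2) * epow ((h y + d y)\<^sup>2) (1/2))"
    by (simp add: distrib_left mult.assoc)
  qed
  also have "... = en \<gamma> * (\<integral>\<^sup>+y. epow (epow (h y) s) (1/2) * epow ((h y + d y)\<^sup>2) (1/2) \<partial>PL I)"
   by (rule nn_integral_cmult) measurable
  also have "... <= en \<gamma> * (epow X (1/2) * epow Y (1/2))"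
   unfolding X_def Y_def by (intro mult_left_mono nn_integral_Holder2) auto
  finally show "(\<integral>\<^sup>+y. epow (h y) \<gamma> + en \<gamma> * epow (h y) (\<gamma> - 1) * d y \<partial>PL I) <= en \<gamma> * (epow X (1/2) * epow Y (1/2))" .
 qed (use \<alpha> in simp)
 finally have main: "X <= epow (en \<gamma> * (epow X (1/2) * epow Y (1/2))) (1 + \<alpha>)" .
 have "epow X (2 / s) <= en (\<gamma>\<^sup>2) * Y"
 proof (cases "X = 0 \<or> Y = top")
  case True
  thus ?thesis using s \<gamma>2 by (auto simp: ennreal_mult_top)
 next
  case False
  then obtain x y where xy: "X = en x" "Y = en y" "0 < x" "0 <= y"
   using fin by (cases X; cases Y) (auto simp: X_def[symmetric] less_le)
  define r where "r = 1 + \<alpha>"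
  have r: "r = 2 * s / (s + 2)" using s by (simp add: r_def \<alpha>_def field_simps)
  have r0: "0 < r" using s r by simp
  have "x <= (\<gamma> * (x powr (1/2) * y powr (1/2))) powr r"
   using main xy \<gamma>2 r0 by (simp add: epow_ennreal ennreal_mult[symmetric] r_def[symmetric])
  also have "... = \<gamma> powr r * (x powr (r/2) * y powr (r/2))"
   using xy \<gamma>2 by (simp add: powr_mult powr_powr)
  finally have "x * x powr (- (r/2)) <= \<gamma> powr r * (x powr (r/2) * y powr (r/2)) * x powr (- (r/2))"
   by (rule mult_right_mono) simp
  also have "... = \<gamma> powr r * y powr (r/2) * (x powr (r/2) * x powr (- (r/2)))" by simp
  also have "x powr (r/2) * x powr (- (r/2)) = 1" using xy by (simp flip: powr_add)
  also have "x * x powr (- (r/2)) = x powr (1 - r/2)"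
  proof -
   have "x powr (1 - r/2) = x powr 1 * x powr (- (r/2))" by (subst powr_add[symmetric]) simp
   thus ?thesis using xy by simp
  qed
  finally have "(x powr (1 - r/2)) powr (2 / r) <= (\<gamma> powr r * y powr (r/2)) powr (2 / r)"
   using r0 by (intro powr_mono2) auto
  also have "... = \<gamma>\<^sup>2 * y" using r0 \<gamma>2 xy by (simp add: powr_mult powr_powr powr_numeral)
  also have "(x powr (1 - r/2)) powr (2 / r) = x powr (2 / s)"
  proof -
   have "1 - r/2 = 2 / (s + 2)" "2 / r = (s + 2) / s" using s by (auto simp: r field_simps)
   moreover have "2 / (s + 2) * ((s + 2) / s) = 2 / s"
   proof -
    have "2 / c * (c / s) = 2 / s" if "c ~= 0" for c using that by simp
    from this[of "s + 2"] show ?thesis using s by linarith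
   qed
   ultimately have "(1 - r/2) * (2 / r) = 2 / s" by (simp only:)
   thus ?thesis by (simp only: powr_powr)
  qed
  finally show ?thesis using xy s by (simp add: epow_ennreal ennreal_mult[symmetric])
 qed
 thus ?thesis by (simp add: X_def Y_def)
qed

section \<open>Sobolev inequality for smooth maps on coordinate planes\<close>

lemma has_derivative_norm_powr:
 fixes v :: "'b::real_inner"
 assumes a: "1 < a"
 shows "((%v. norm v powr a) has_derivative (%k. a * norm v powr (a - 2) * (v \<bullet> k))) (at v)"
proof (cases "v = 0")
 case False
 hence "((%v. norm v powr a) has_derivative (%k. norm v powr a * (0 * ln (norm v) + (k \<bullet> sgn v) * a / norm v))) (at v)"
  by (intro has_derivative_powr has_derivative_norm derivative_intros) auto
 moreover have "norm v powr a * (0 * ln (norm v) + (k \<bullet> sgn v) * a / norm v) = a * norm v powr (a - 2) * (v \<bullet> k)" for k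
 proof -
  have "norm v powr a = norm v powr (a - 2) * (norm v * norm v)"
   using False by (simp add: powr_diff powr_numeral power2_eq_square)
  thus ?thesis using False by (simp add: sgn_div_norm inner_commute field_simps)
 qed
 ultimately show ?thesis by (metis (no_types, lifting) ext)
next
 case True
 have "((%y. norm y powr (a - 1)) \<longlongrightarrow> 0) (at 0)"
  using a by (intro tendsto_zero_powrI[where b="a - 1"] tendsto_norm_zero tendsto_ident_at tendsto_const) auto
 hence "((%y. norm (norm y powr a) / norm y) \<longlongrightarrow> 0) (at (0::'b))"
 proof (rule Lim_transform_eventually)
  show "\<forall>\<^sub>F y in at (0::'b). norm y powr (a - 1) = norm (norm y powr a) / norm y"
   by (auto simp: eventually_at_filter powr_diff)
 qed
 thus ?thesis using True a
  by (auto simp: has_derivative_at bounded_linear_zero)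
qed

text \<open>Fundamental theorem of calculus for \<open>norm (\<phi> t) powr a\<close>, started at a
  point to the left of the support. As \<open>a\<close> exceeds 1, the power is differentiable also
  at the zeros of \<phi>.\<close>

lemma powr_norm_le_line_integral:
 fixes \<phi> :: "real => 'b::real_inner" and e :: "real => real"
 assumes a: "1 < a" and der: "!!t. (\<phi> has_vector_derivative D t) (at t)"
  and De: "!!t. norm (D t) <= e t" and e: "continuous_on UNIV e"
  and supp: "!!t. R <= \<bar>t\<bar> ==> \<phi> t = 0"
 shows "np (\<phi> t) a <= (NBINT t. en (a * norm (\<phi> t) powr (a - 1) * e t))"
proof -
 define c where "c = min (t - 1) (- \<bar>R\<bar>)"
 have ct: "c < t" and c0: "\<phi> c = 0" using supp[of c] by (auto simp: c_def)
 define g where "g t = a * norm (\<phi> t) powr (a - 1) * e t" for t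
 have \<phi>c: "continuous_on UNIV \<phi>"
  by (meson continuous_at_imp_continuous_on der has_vector_derivative_continuous)
 have gc: "continuous_on UNIV g"
  unfolding g_def using a by (intro continuous_intros continuous_on_powr' \<phi>c e) auto
 have g0: "0 <= g t" for t unfolding g_def using a order_trans[OF norm_ge_zero De[of t]] by auto
 have "norm (norm (\<phi> t) powr a - norm (\<phi> c) powr a) <= integral {c..t} g - integral {c..c} g"
 proof (rule differentiable_bound_general[OF ct, where f'="%x. a * norm (\<phi> x) powr (a - 2) * (\<phi> x \<bullet> D x)" and \<phi>'=g])
  show "continuous_on {c..t} (%x. norm (\<phi> x) powr a)"
   using a by (intro continuous_on_powr' continuous_intros continuous_on_subset[OF \<phi>c]) auto
  show "continuous_on {c..t} (%u. integral {c..u} g)"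
   by (intro indefinite_integral_continuous_1 integrable_continuous_interval continuous_on_subset[OF gc]) auto
  fix x assume x: "c < x" "x < t"
  have "((%x. norm (\<phi> x) powr a) has_derivative (%h. a * norm (\<phi> x) powr (a - 2) * (\<phi> x \<bullet> (h *\<^sub>R D x)))) (at x)"
   by (rule has_derivative_compose[OF der[unfolded has_vector_derivative_def] has_derivative_norm_powr[OF a]])
  thus "((%x. norm (\<phi> x) powr a) has_vector_derivative a * norm (\<phi> x) powr (a - 2) * (\<phi> x \<bullet> D x)) (at x)"
   by (simp add: has_vector_derivative_def mult_ac)
  have "((%u. integral {c..u} g) has_vector_derivative g x) (at x within {c..t})"
   using x by (intro integral_has_vector_derivative continuous_on_subset[OF gc]) auto
  thus "((%u. integral {c..u} g) has_vector_derivative g x) (at x)"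
   using x by (metis at_within_Icc_at)
  have "norm (a * norm (\<phi> x) powr (a - 2) * (\<phi> x \<bullet> D x)) = a * norm (\<phi> x) powr (a - 2) * \<bar>\<phi> x \<bullet> D x\<bar>"
   using a by (simp add: abs_mult)
  also have "... <= a * norm (\<phi> x) powr (a - 2) * (norm (\<phi> x) * e x)"
   using a De[of x] Cauchy_Schwarz_ineq2[of "\<phi> x" "D x"]
   by (intro mult_left_mono order_trans[OF Cauchy_Schwarz_ineq2] mult_left_mono) auto
  also have "... = g x"
  proof -
   have "norm (\<phi> x) powr (a - 2) * norm (\<phi> x) = norm (\<phi> x) powr (a - 1)"
    by (cases "\<phi> x = 0") (auto simp: powr_diff powr_numeral power2_eq_square)
   thus ?thesis by (simp add: g_def mult.assoc[symmetric])
  qed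
  finally show "norm (a * norm (\<phi> x) powr (a - 2) * (\<phi> x \<bullet> D x)) <= g x" .
 qed
 hence "norm (\<phi> t) powr a <= integral {c..t} g" using c0 a by simp
 moreover have "(NBINT x. en (g x * ind {c..t} x)) = en (integral {c..t} g)"
 proof (rule nn_integral_has_integral_lborel)
  have "(g has_integral integral {c..t} g) {c..t}"
   by (intro integrable_integral integrable_continuous_interval continuous_on_subset[OF gc]) auto
  hence "((%x. if x : {c..t} then g x else 0) has_integral integral {c..t} g) UNIV"
   unfolding has_integral_restrict_UNIV .
  thus "((%x. g x * ind {c..t} x) has_integral integral {c..t} g) UNIV"
   by (rule has_integral_eq[rotated]) auto
  show "(%x. g x * ind {c..t} x) : borelfun"
   using borel_measurable_continuous_onI[OF gc] by measurable
 qed (use g0 in auto)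
 moreover have "(NBINT x. en (g x * ind {c..t} x)) <= (NBINT x. en (g x))"
  by (intro nn_integral_mono) (auto split: split_indicator)
 ultimately show ?thesis unfolding g_def[symmetric]
  by (metis ennreal_leI order_trans)
qed

text \<open>Product measures live on functions while points of the domain are vectors. This map
  parametrises the coordinate plane through \<open>z\<close> with free directions \<open>I\<close>:
  all of space for \<open>I = UNIV\<close>, a hyperplane for \<open>I = UNIV - {j}\<close>.\<close>

definition vec_upd :: "'n set => real^'n => ('n => real) => real^'n" where
 "vec_upd I z y = (\<chi> i. if i : I then y i else z $ i)"

lemma measurable_vec_lambda:
 "(!!i. (%x. f x i) : borel_measurable M) ==> (%x. (\<chi> i. f x i) :: real^'n) : borel_measurable M"
 by (subst borel_measurable_euclidean_space) (auto simp: Basis_vec_def inner_axis)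

lemma measurable_vec_upd [measurable]: "vec_upd I z : PL I \<rightarrow>\<^sub>M borel"
 unfolding vec_upd_def
proof (rule measurable_vec_lambda)
 show "(%y. if i : I then y i else z $ i) : borel_measurable (PL I)" for i
  by (cases "i : I") auto
qed

lemma vec_upd_upd: "i : I ==> vec_upd I z (y(i := t)) = vec_upd I z y + (t - y i) *\<^sub>R axis i 1"
 by (simp add: vec_upd_def vec_eq_iff axis_def)

lemma lborel_vec: "(lborel :: (real^'n) measure) = distr (PL UNIV) borel (%y. \<chi> i. y i)"
proof (rule lborel_eqI)
 fix l u :: "real^'n" assume le: "!!b. b : Basis ==> l \<bullet> b <= u \<bullet> b"
 have [measurable]: "(%y. (\<chi> i. y i) :: real^'n) : PL UNIV \<rightarrow>\<^sub>M borel"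
  by (intro measurable_vec_lambda) auto
 have le': "l $ i <= u $ i" for i using le[of "axis i 1"] by (simp add: inner_axis axis_in_Basis_iff)
 have "emeasure (distr (PL UNIV) borel (%y. \<chi> i. y i)) (box l u) = emeasure (PL UNIV) (\<Pi>\<^sub>E i\<in>UNIV. {l $ i<..<u $ i})"
  by (subst emeasure_distr) (auto intro!: arg_cong[where f="emeasure _"] simp: mem_box_cart space_PiM PiE_def Pi_def)
 also have "... = (\<Prod>i\<in>UNIV. emeasure lborel {l $ i<..<u $ i})"
  by (rule PL.emeasure_PiM) auto
 also have "... = (\<Prod>i\<in>UNIV. en ((u - l) $ i))"
  using le' by (intro prod.cong) auto
 also have "... = (\<Prod>b\<in>Basis. en ((u - l) \<bullet> b))"
 proof -
  have "bij_betw (%i. axis i 1 :: real^'n) UNIV Basis"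
   by (auto simp: bij_betw_def inj_on_def axis_eq_axis Basis_vec_def)
  from prod.reindex_bij_betw[OF this, of "%b. en ((u - l) \<bullet> b)"]
  show ?thesis by (simp add: inner_axis)
 qed
 also have "... = en (\<Prod>b\<in>Basis. (u - l) \<bullet> b)"
  using le by (intro prod_ennreal) (auto simp: inner_diff_left)
 finally show "emeasure (distr (PL UNIV) borel (%y. \<chi> i. y i)) (box l u) = en (\<Prod>b\<in>Basis. (u - l) \<bullet> b)" .
qed simp

lemma nn_integral_lborel_vec:
 fixes f :: "real^'n => ennreal"
 assumes [measurable]: "f : borelfun"
 shows "(NBINT x. f x) = (\<integral>\<^sup>+y. f (vec_upd UNIV 0 y) \<partial>PL UNIV)"
 by (subst lborel_vec) (simp add: nn_integral_distr measurable_vec_lambda vec_upd_def)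

text \<open>The integral over the hyperplane on which the j-th coordinate equals
  \<open>t\<close>.\<close>

definition slice :: "'n => (real^'n => ennreal) => real => ennreal" where
 "slice j f t = (\<integral>\<^sup>+y. f (vec_upd (UNIV - {j}) (axis j t) y) \<partial>PL (UNIV - {j}))"

lemma vec_upd_slice: "vec_upd UNIV z (y(j := t)) = vec_upd (UNIV - {j}) (axis j t) y"
 by (simp add: vec_upd_def vec_eq_iff axis_def)

lemma measurable_vec_upd_slice [measurable]:
 "(%(t, y). vec_upd (UNIV - {j}) (axis j t) y) : lborel \<Otimes>\<^sub>M PL (UNIV - {j}) \<rightarrow>\<^sub>M borel"
proof -
 have eq: "(%(t, y). vec_upd (UNIV - {j}) (axis j t) y) = (%p. \<chi> i. if i = j then fst p else snd p i)"
  by (auto simp: vec_upd_def vec_eq_iff axis_def)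
 have "(%p. if i = j then fst p else snd p i) : borel_measurable (lborel \<Otimes>\<^sub>M PL (UNIV - {j}))" for i
  by (cases "i = j") auto
 thus ?thesis unfolding eq by (intro measurable_vec_lambda)
qed

lemma borel_measurable_slice [measurable]:
 assumes [measurable]: "f : borelfun"
 shows "slice j f : borelfun"
proof -
 interpret sigma_finite_measure "PL (UNIV - {j})"
  by (rule PL.sigma_finite) simp
 have "(%t. \<integral>\<^sup>+y. f (vec_upd (UNIV - {j}) (axis j t) y) \<partial>PL (UNIV - {j})) : borel_measurable lborel"
  by measurable
 thus ?thesis by (simp add: slice_def[abs_def])
qed

lemma nn_integral_slice:
 assumes [measurable]: "f : borelfun"
 shows "(NBINT x. f x) = (NBINT t. slice j f t)"
proof -
 have UN: "insert j (UNIV - {j}) = UNIV" by auto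
 have "(NBINT x. f x) = (\<integral>\<^sup>+y. f (vec_upd UNIV 0 y) \<partial>PL (insert j (UNIV - {j})))"
  unfolding UN by (rule nn_integral_lborel_vec) fact
 also have "... = (NBINT t. (\<integral>\<^sup>+y. f (vec_upd UNIV 0 (y(j := t))) \<partial>PL (UNIV - {j})))"
  by (rule PL.product_nn_integral_insert_rev) (auto simp: UN)
 finally show ?thesis by (simp add: vec_upd_slice slice_def)
qed

text \<open>The j-th component of the cutoff gradient will be bounded by a function of
  \<open>x $ j\<close> alone; this identity then reduces the error terms to integrals over the
  selected slices.\<close>

lemma nn_integral_slice_weight:
 fixes f :: "real^'n => ennreal"
 assumes [measurable]: "f : borelfun" "g : borelfun"
 shows "(NBINT x. g (x $ j) * f x) = (NBINT t. g t * slice j f t)"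
proof -
 have [measurable]: "(%x::real^'n. x $ j) : borelfun"
  by (intro borel_measurable_continuous_onI continuous_intros)
 have "(NBINT x. g (x $ j) * f x) = (NBINT t. slice j (%x. g (x $ j) * f x) t)"
  by (rule nn_integral_slice) measurable
 also have "... = (NBINT t. g t * slice j f t)"
 proof (intro nn_integral_cong)
  fix t
  have "vec_upd (UNIV - {j}) (axis j t) y $ j = t" for y by (simp add: vec_upd_def axis_def)
  thus "slice j (%x. g (x $ j) * f x) t = g t * slice j f t"
   unfolding slice_def by (simp add: nn_integral_cmult)
 qed
 finally show ?thesis .
qed

lemma slice_mono: "(!!x. f x <= g x) ==> slice j f t <= slice j g t"
 unfolding slice_def by (intro nn_integral_mono)

lemma powr_half_square: "(x powr (a / 2))\<^sup>2 = x powr a" for x :: real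
 by (simp add: power2_eq_square flip: powr_add)

text \<open>Sobolev's inequality for \<open>norm (w x) powr (p / 2)\<close>. The derivative stays in
  the weighted form, \<open>norm (w x) powr (p - 2)\<close> times a square, because for finite
  differences this weighted quantity has the right order in the increment, while the p-th power of
  the derivative has not. Leaving \<open>I\<close> free covers the whole space and hyperplanes at
  once. The constant is \<open>\<gamma>\<^sup>2\<close> from \<open>sobolev_marginal\<close> times
  \<open>p\<^sup>2 / 2\<close>.\<close>

lemma sobolev_smooth:
 fixes w :: "real^'n => 'b::real_inner" and e :: "real^'n => real"
 assumes p: "2 <= p" and I: "I ~= {}" and s: "2 <= s" "(real (card I) - 2) * s <= 2 * real (card I)"
  and der: "!!x. (w has_derivative D x) (at x)"
  and e: "continuous_on UNIV e" "!!x i. norm (D x (axis i 1)) <= e x"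
  and supp: "!!x. R <= norm x ==> w x = 0"
 shows "epow (\<integral>\<^sup>+y. np (w (vec_upd I z y)) (p * s / 2) \<partial>PL I) (2 / s)
  <= en ((s + 2)\<^sup>2 * p\<^sup>2 / 8) *
   (\<integral>\<^sup>+y. en (norm (w (vec_upd I z y)) powr p + rpow (norm (w (vec_upd I z y))) (p - 2) * (e (vec_upd I z y))\<^sup>2) \<partial>PL I)"
proof -
 define \<gamma> where "\<gamma> = (s + 2) / 2"
 have \<gamma>2: "2 <= \<gamma>" using s by (simp add: \<gamma>_def)
 define h where "h x = np (w x) (p / 2)" for x
 define d where "d x = en (p / 2 * rpow (norm (w x)) (p / 2 - 1) * e x)" for x
 have e0: "0 <= e x" for x using e(2)[of x] norm_ge_zero order_trans by blast
 have wc: "continuous_on UNIV w"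
  by (meson continuous_at_imp_continuous_on der has_derivative_continuous)
 have [measurable]: "(%x. norm (w x)) : borelfun" "e : borelfun"
  by (auto intro!: borel_measurable_continuous_onI continuous_intros wc e)
 have [measurable]: "h : borelfun" "d : borelfun"
  unfolding h_def d_def rpow_def by measurable
 have hs: "epow (h x) s = np (w x) (p * s / 2)" for x
  using s by (simp add: h_def epow_ennreal powr_powr)
 have "epow (\<integral>\<^sup>+y. epow (h (vec_upd I z y)) s \<partial>PL I) (2 / s) <= en (\<gamma>\<^sup>2) * (\<integral>\<^sup>+y. (h (vec_upd I z y) + d (vec_upd I z y))\<^sup>2 \<partial>PL I)"
 proof (rule sobolev_marginal[OF _ I s _ _ \<gamma>_def])
  fix y i assume "y : space (PL I)" and i: "i : I"
  define \<phi> where "\<phi> t = w (vec_upd I z (y(i := t)))" for t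
  have \<phi>: "\<phi> = (%t. w (vec_upd I z y + (t - y i) *\<^sub>R axis i 1))"
   unfolding \<phi>_def vec_upd_upd[OF i] ..
  \<comment> \<open>\<open>a - 1\<close> splits as
    \<open>p / 2 * (\<gamma> - 1) + (p / 2 - 1)\<close>, which distributes the line integrand over
    \<open>h\<close> and \<open>d\<close>.\<close>
  define a where "a = p / 2 * \<gamma>"
  have a1: "2 <= a" using p \<gamma>2 mult_mono[of 1 "p / 2" 2 \<gamma>] by (simp add: a_def)
  have "np (\<phi> (y i)) a <= (NBINT t. en (a * norm (\<phi> t) powr (a - 1) * e (vec_upd I z (y(i := t)))))"
  proof (rule powr_norm_le_line_integral)
   show "(\<phi> has_vector_derivative D (vec_upd I z (y(i := t))) (axis i 1)) (at t)" for t
   proof -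
    have "((%t. w (vec_upd I z y + (t - y i) *\<^sub>R axis i 1)) has_derivative (%k. D (vec_upd I z y + (t - y i) *\<^sub>R axis i 1) (k *\<^sub>R axis i 1))) (at t)"
     by (rule has_derivative_compose[OF _ der]) (auto intro!: derivative_eq_intros)
    thus ?thesis
     unfolding \<phi> has_vector_derivative_def vec_upd_upd[OF i]
     by (rule has_derivative_eq_rhs)
      (simp add: fun_eq_iff linear_cmul bounded_linear.linear[OF has_derivative_bounded_linear[OF der]])
   qed
   show "continuous_on UNIV (%t. e (vec_upd I z (y(i := t))))"
    unfolding vec_upd_upd[OF i] by (intro continuous_on_compose2[OF e(1)] continuous_intros) auto
   show "\<phi> t = 0" if "R + 0 <= \<bar>t\<bar>" for t
   proof -
    have "\<bar>t\<bar> = \<bar>vec_upd I z (y(i := t)) $ i\<bar>" using i by (simp add: vec_upd_def)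
    also have "... <= norm (vec_upd I z (y(i := t)))" by (rule component_le_norm_cart)
    finally show ?thesis unfolding \<phi>_def using that by (intro supp) simp
   qed
  qed (use a1 e in auto)
  also have "np (\<phi> (y i)) a = epow (h (vec_upd I z y)) \<gamma>"
   using \<gamma>2 by (simp add: \<phi>_def h_def epow_ennreal powr_powr a_def)
  also have "(NBINT t. en (a * norm (\<phi> t) powr (a - 1) * e (vec_upd I z (y(i := t)))))
   = (NBINT t. en \<gamma> * epow (h (vec_upd I z (y(i := t)))) (\<gamma> - 1) * d (vec_upd I z (y(i := t))))"
  proof (intro nn_integral_cong)
   fix t
   let ?x = "vec_upd I z (y(i := t))"
   have "norm (w ?x) powr (a - 1) = norm (w ?x) powr (p / 2 * (\<gamma> - 1)) * rpow (norm (w ?x)) (p / 2 - 1)"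
   proof (cases "w ?x = 0")
    case True
    thus ?thesis by simp
   next
    case False
    have "a - 1 = p / 2 * (\<gamma> - 1) + (p / 2 - 1)" by (simp add: a_def algebra_simps diff_divide_distrib)
    thus ?thesis using False by (simp only: rpow_eq_powr[of "norm (w ?x)"] powr_add zero_less_norm_iff not_False_eq_True)
   qed
   hence eq: "a * norm (w ?x) powr (a - 1) * e ?x = \<gamma> * norm (w ?x) powr (p / 2 * (\<gamma> - 1)) * (p / 2 * rpow (norm (w ?x)) (p / 2 - 1) * e ?x)"
    by (simp add: a_def)
   show "en (a * norm (\<phi> t) powr (a - 1) * e ?x) = en \<gamma> * epow (h ?x) (\<gamma> - 1) * d ?x"
   proof -
    have "epow (h ?x) (\<gamma> - 1) = np (w ?x) (p / 2 * (\<gamma> - 1))"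
     using \<gamma>2 by (simp add: h_def epow_ennreal powr_powr)
    moreover have "0 <= p / 2 * rpow (norm (w ?x)) (p / 2 - 1) * e ?x" using p e0 by simp
    ultimately show ?thesis
     unfolding \<phi>_def eq using \<gamma>2 by (simp only: d_def ennreal_mult mult_nonneg_nonneg powr_ge_zero)
   qed
  qed
  finally show "epow (h (vec_upd I z y)) \<gamma> <= (NBINT t. en \<gamma> * epow (h (vec_upd I z (y(i := t)))) (\<gamma> - 1) * d (vec_upd I z (y(i := t))))" .
 next
  \<comment> \<open>The finiteness required by \<open>sobolev_marginal\<close>: \<open>w\<close> is
    continuous and vanishes off a ball, so it is bounded and the integrand lives in a box.\<close>
  have "compact ((%x. norm (w x)) ` cball 0 R)"
   by (intro compact_continuous_image continuous_intros continuous_on_subset[OF wc]) auto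
  then obtain M where M: "!!x. x : cball 0 R ==> norm (w x) <= M"
   by (fastforce dest!: compact_imp_bounded simp: bounded_iff)
  have "(\<integral>\<^sup>+y. epow (h (vec_upd I z y)) s \<partial>PL I) <= (\<integral>\<^sup>+y. en (\<bar>M\<bar> powr (p * s / 2)) * ind (\<Pi>\<^sub>E i\<in>I. {-\<bar>R\<bar>..\<bar>R\<bar>}) y \<partial>PL I)"
  proof (rule nn_integral_mono)
   fix y :: "'n => real" assume y: "y : space (PL I)"
   let ?x = "vec_upd I z y"
   show "epow (h ?x) s <= en (\<bar>M\<bar> powr (p * s / 2)) * ind (\<Pi>\<^sub>E i\<in>I. {-\<bar>R\<bar>..\<bar>R\<bar>}) y"
   proof (cases "R <= norm ?x")
    case True
    thus ?thesis using supp[OF True] s p by (simp add: hs)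
   next
    case False
    have "y i : {-\<bar>R\<bar>..\<bar>R\<bar>}" if "i : I" for i
     using component_le_norm_cart[of ?x i] that False by (auto simp: vec_upd_def abs_le_iff)
    hence "y : (\<Pi>\<^sub>E i\<in>I. {-\<bar>R\<bar>..\<bar>R\<bar>})" using y unfolding space_PiM PiE_iff by blast
    moreover have "norm (w ?x) <= \<bar>M\<bar>" using M[of ?x] False by simp
    ultimately show ?thesis unfolding hs using p s by (simp add: powr_mono2 ennreal_leI)
   qed
  qed
  also have "... = en (\<bar>M\<bar> powr (p * s / 2)) * emeasure (PL I) (\<Pi>\<^sub>E i\<in>I. {-\<bar>R\<bar>..\<bar>R\<bar>})"
   by (simp add: nn_integral_cmult_indicator sets_PiM_I_finite)
  also have "... < \<infinity>"
   by (subst PL.emeasure_PiM) (auto simp: ennreal_mult_less_top ennreal_power)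
  finally show "(\<integral>\<^sup>+y. epow (h (vec_upd I z y)) s \<partial>PL I) < \<infinity>" .
 qed (auto)
 also have "en (\<gamma>\<^sup>2) * (\<integral>\<^sup>+y. (h (vec_upd I z y) + d (vec_upd I z y))\<^sup>2 \<partial>PL I)
  <= en (\<gamma>\<^sup>2) * (\<integral>\<^sup>+y. en (p\<^sup>2 / 2) * en (norm (w (vec_upd I z y)) powr p + rpow (norm (w (vec_upd I z y))) (p - 2) * (e (vec_upd I z y))\<^sup>2) \<partial>PL I)"
 proof (intro mult_left_mono nn_integral_mono)
  fix y
  let ?x = "vec_upd I z y"
  let ?b = "p / 2 * rpow (norm (w ?x)) (p / 2 - 1) * e ?x"
  have r: "(rpow (norm (w ?x)) (p / 2 - 1))\<^sup>2 = rpow (norm (w ?x)) (p - 2)"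
   using powr_half_square[of "norm (w ?x)" "p - 2"] by (auto simp: rpow_def diff_divide_distrib)
  have "(norm (w ?x) powr (p / 2) + ?b)\<^sup>2 <= 2 * ((norm (w ?x) powr (p / 2))\<^sup>2 + ?b\<^sup>2)"
   using sum_squares_bound[of "norm (w ?x) powr (p / 2)" ?b] by (simp add: power2_sum algebra_simps)
  also have "(norm (w ?x) powr (p / 2))\<^sup>2 = norm (w ?x) powr p" by (rule powr_half_square)
  also have "?b\<^sup>2 = p\<^sup>2 / 4 * (rpow (norm (w ?x)) (p - 2) * (e ?x)\<^sup>2)"
   by (simp add: power_mult_distrib r power_divide)
  also have "2 * (norm (w ?x) powr p + p\<^sup>2 / 4 * (rpow (norm (w ?x)) (p - 2) * (e ?x)\<^sup>2))
    <= p\<^sup>2 / 2 * (norm (w ?x) powr p + rpow (norm (w ?x)) (p - 2) * (e ?x)\<^sup>2)"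
  proof -
   have "4 <= p\<^sup>2" using p power_mono[of 2 p 2] by simp
   hence "4 * norm (w ?x) powr p <= p\<^sup>2 * norm (w ?x) powr p" by (intro mult_right_mono) auto
   thus ?thesis by (simp add: algebra_simps)
  qed
  finally show "(h ?x + d ?x)\<^sup>2 <= en (p\<^sup>2 / 2) * en (norm (w ?x) powr p + rpow (norm (w ?x)) (p - 2) * (e ?x)\<^sup>2)"
   using p e0[of ?x] by (simp add: h_def d_def ennreal_mult[symmetric] ennreal_plus[symmetric] ennreal_power ennreal_leI del: ennreal_plus)
 qed simp
 also have "... = en (\<gamma>\<^sup>2) * (en (p\<^sup>2 / 2) * (\<integral>\<^sup>+y. en (norm (w (vec_upd I z y)) powr p + rpow (norm (w (vec_upd I z y))) (p - 2) * (e (vec_upd I z y))\<^sup>2) \<partial>PL I))"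
 proof -
  have [measurable]: "(%x. en (norm (w x) powr p + rpow (norm (w x)) (p - 2) * (e x)\<^sup>2)) : borelfun"
   unfolding rpow_def by measurable
  have "(%y. en (norm (w (vec_upd I z y)) powr p + rpow (norm (w (vec_upd I z y))) (p - 2) * (e (vec_upd I z y))\<^sup>2)) : borel_measurable (PL I)"
   by measurable
  from nn_integral_cmult[OF this] show ?thesis by simp
 qed
 also have "... = en ((s + 2)\<^sup>2 * p\<^sup>2 / 8) * (\<integral>\<^sup>+y. en (norm (w (vec_upd I z y)) powr p + rpow (norm (w (vec_upd I z y))) (p - 2) * (e (vec_upd I z y))\<^sup>2) \<partial>PL I)"
  by (simp add: mult.assoc[symmetric] ennreal_mult[symmetric] \<gamma>_def power_divide)
 finally show ?thesis by (simp add: hs)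
qed

section \<open>Smooth functions and test functions\<close>

lemma C_k_SucI:
 assumes "!!x. (f has_derivative D x) (at x)" "!!v. C_k k (%x. D x v)"
 shows "C_k (Suc k) f"
proof -
 have "frechet_derivative f (at x) = D x" for x
  using assms(1) frechet_derivative_at by (metis)
 thus ?thesis using assms by (auto simp: differentiable_def)
qed

lemma C_k_Suc_derivative: "C_k (Suc k) f ==> (f has_derivative frechet_derivative f (at x)) (at x)"
 using frechet_derivative_works by auto

lemma C_k_continuous: "C_k k f ==> continuous_on S f"
proof (cases k)
 case 0
 thus "C_k k f ==> continuous_on S f" using continuous_on_subset by auto
next
 case (Suc l)
 thus "C_k k f ==> continuous_on S f"
  by (auto intro!: continuous_at_imp_continuous_on differentiable_imp_continuous_within)
qed

lemma C_k_Suc_imp: "C_k (Suc k) f ==> C_k k f"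
proof (induction k arbitrary: f)
 case 0
 thus ?case using C_k_continuous[of "Suc 0" f UNIV] by simp
next
 case (Suc k)
 thus ?case by (metis C_k.simps(2))
qed

lemma C_k_const: "C_k k (%x. c)"
proof (induction k arbitrary: c)
 case (Suc k)
 show ?case by (rule C_k_SucI[where D="%x v. 0"]) (auto intro: Suc)
qed simp

lemma C_k_add: "C_k k f ==> C_k k g ==> C_k k (%x. f x + g x)"
proof (induction k arbitrary: f g)
 case (Suc k)
 show ?case
  by (rule C_k_SucI[where D="%x v. frechet_derivative f (at x) v + frechet_derivative g (at x) v"])
   (use Suc in \<open>auto intro!: has_derivative_add C_k_Suc_derivative\<close>)
qed (auto intro: continuous_on_add)

lemma C_k_scaleR:
 fixes f :: "'a::euclidean_space => real" and g :: "'a => 'b::real_normed_vector"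
 shows "C_k k f ==> C_k k g ==> C_k k (%x. f x *\<^sub>R g x)"
proof (induction k arbitrary: f g)
 case (Suc k)
 have "C_k k f" "C_k k g" using Suc.prems C_k_Suc_imp by auto
 thus ?case using Suc
  by (intro C_k_SucI[where D="%x v. f x *\<^sub>R frechet_derivative g (at x) v + frechet_derivative f (at x) v *\<^sub>R g x"])
   (auto intro!: has_derivative_scaleR C_k_Suc_derivative C_k_add)
qed (auto intro: continuous_on_scaleR)

lemma C_k_mult: "C_k k f ==> C_k k g ==> C_k k (%x. f x * g x :: real)"
 using C_k_scaleR[of k f g] by simp

lemma C_k_prod: "(!!i. i : I ==> C_k k (f i)) ==> C_k k (%x. \<Prod>i\<in>I. f i x :: real)"
 by (induction I rule: infinite_finite_induct) (auto simp: C_k_const intro!: C_k_mult)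

lemma C_k_bounded_linear_comp:
 fixes T :: "'a::euclidean_space => 'b::euclidean_space" and f :: "'b => 'c::real_normed_vector"
 assumes T: "bounded_linear T"
 shows "C_k k f ==> C_k k (%x. f (c + T x))"
proof (induction k arbitrary: f)
 case 0
 thus ?case
  using continuous_on_compose2[of UNIV f UNIV "%x. c + T x"] linear_continuous_on[OF T, of UNIV]
  by (simp add: continuous_on_add)
next
 case (Suc k)
 have d: "((%x. f (c + T x)) has_derivative (%v. frechet_derivative f (at (c + T x)) (T v))) (at x)" for x
  by (rule has_derivative_compose[OF _ C_k_Suc_derivative[OF Suc.prems]])
   (auto intro!: derivative_eq_intros bounded_linear_imp_has_derivative T)
 show ?case by (rule C_k_SucI[OF d]) (use Suc in auto)
qed

lemma C_k_linear_post:
 assumes T: "bounded_linear T"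
 shows "C_k k f ==> C_k k (%x. T (f x))"
proof (induction k arbitrary: f)
 case 0
 thus ?case by (auto intro: bounded_linear.continuous_on[OF T])
next
 case (Suc k)
 show ?case
  by (rule C_k_SucI[where D="%x v. T (frechet_derivative f (at x) v)"])
   (use Suc in \<open>auto intro!: bounded_linear.has_derivative[OF T] C_k_Suc_derivative\<close>)
qed

text \<open>The classical function exp(-1/t), divided by powers of \<open>t\<close>. The family is
  closed under differentiation up to linear combinations, so smoothness follows by induction on the
  order.\<close>

definition flat :: "nat => real => real" where
 "flat m t = (if t <= 0 then 0 else exp (- (1 / t)) / t ^ m)"

text \<open>Quadratic flatness at the origin, read off from a single term of the exponential series;
  it supplies the derivative at 0.\<close>

lemma flat_bound: "flat m t <= fact (m + 2) * t\<^sup>2"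
proof (cases "t <= 0")
 case False
 hence t: "0 < t" by simp
 have "(1 / t) ^ (m + 2) / fact (m + 2) <= exp (1 / t)"
 proof -
  have "(\<Sum>n\<in>{m + 2}. inverse (fact n) *\<^sub>R (1 / t) ^ n) <= (\<Sum>n. inverse (fact n) *\<^sub>R (1 / t) ^ n)"
   using t by (intro sum_le_suminf summable_exp_generic) auto
  thus ?thesis by (simp add: exp_def divide_inverse mult.commute)
 qed
 moreover have "1 / a / F <= E ==> inverse E <= F * a" if "0 < a" "0 < F" "0 < E" for a F E :: real
  using that by (simp add: field_simps)
 ultimately have "inverse (exp (1 / t)) <= fact (m + 2) * t ^ (m + 2)"
  using t by (simp only: power_one_over zero_less_power fact_gt_zero exp_gt_zero)
 hence "exp (- (1 / t)) <= fact (m + 2) * t\<^sup>2 * t ^ m"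
  by (simp only: exp_minus power_add mult_ac)
 thus ?thesis using t by (simp add: flat_def divide_le_eq del: fact_Suc)
qed (auto simp: flat_def)

lemma flat_nonneg: "0 <= flat m t"
 by (auto simp: flat_def)

lemma flat_deriv: "(flat m has_real_derivative flat (m + 2) t - m * flat (m + 1) t) (at t)"
proof (cases "t = 0")
 case True
 have "(flat m has_derivative (%h. 0)) (at 0)"
  unfolding has_derivative_at
 proof (intro conjI)
  have "((%h::real. fact (m + 2) * \<bar>h\<bar>) \<longlongrightarrow> fact (m + 2) * \<bar>0\<bar>) (at 0)" by (intro tendsto_intros)
  hence l: "((%h::real. fact (m + 2) * \<bar>h\<bar>) \<longlongrightarrow> 0) (at 0)" by simp
  show "(%h. norm (flat m (0 + h) - flat m 0 - 0) / norm h) \<midarrow>0\<rightarrow> 0"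
  proof (rule Lim_null_comparison[OF _ l])
   show "\<forall>\<^sub>F x in at 0. norm (norm (flat m (0 + x) - flat m 0 - 0) / norm x) <= fact (m + 2) * \<bar>x\<bar>"
    unfolding eventually_at_filter
   proof (rule always_eventually, intro allI impI)
    fix x :: real assume "x ~= 0"
    thus "norm (norm (flat m (0 + x) - flat m 0 - 0) / norm x) <= fact (m + 2) * \<bar>x\<bar>"
     using flat_bound[of m x] flat_nonneg[of m x]
     by (simp add: flat_def[of m 0] divide_le_eq power2_eq_square abs_mult[symmetric] mult.assoc)
   qed
  qed
 qed simp
 thus ?thesis using True by (simp add: has_field_derivative_def flat_def mult_zero_left[abs_def])
next
 case False
 show ?thesis
 proof (cases "t < 0")
  case True
  have "((%t. 0) has_real_derivative 0) (at t)" by simp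
  hence "(flat m has_real_derivative 0) (at t)"
   by (rule has_field_derivative_transform_within_open[where S="{..<0}"]) (use True in \<open>auto simp: flat_def\<close>)
  thus ?thesis using True by (simp add: flat_def)
 next
  case f: False
  hence t: "0 < t" using False by simp
  have "((%t. exp (- (1 / t)) / t ^ m) has_real_derivative exp (- (1 / t)) / t ^ (m + 2) - m * (exp (- (1 / t)) / t ^ (m + 1))) (at t)"
  proof -
   have E: "((%t. exp (- (1 / t))) has_real_derivative exp (- (1 / t)) / t\<^sup>2) (at t)"
    using t by (auto intro!: derivative_eq_intros simp: field_simps power2_eq_square)
   show ?thesis
   proof (cases m)
    case 0
    thus ?thesis using E by (simp add: power2_eq_square)
   next
    case (Suc l)
    have P: "((%t. t ^ Suc l) has_real_derivative (1 + real l) * t ^ l) (at t)"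
     by (rule DERIV_cong[OF DERIV_power_Suc[OF DERIV_ident]]) simp
    show ?thesis unfolding Suc
     by (rule DERIV_cong[OF DERIV_quotient[OF E P]]) (use t in \<open>auto simp: field_simps power2_eq_square\<close>)
   qed
  qed
  hence "(flat m has_real_derivative exp (- (1 / t)) / t ^ (m + 2) - m * (exp (- (1 / t)) / t ^ (m + 1))) (at t)"
   by (rule has_field_derivative_transform_within_open[where S="{0<..}"]) (use t in \<open>auto simp: flat_def\<close>)
  thus ?thesis using t by (simp add: flat_def)
 qed
qed

lemma C_k_flat: "C_k k (flat m)"
proof (induction k arbitrary: m)
 case 0
 show ?case by (auto intro!: continuous_at_imp_continuous_on DERIV_isCont flat_deriv)
next
 case (Suc k)
 show ?case
 proof (rule C_k_SucI[where D="%t v. (flat (m + 2) t - m * flat (m + 1) t) * v"])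
  show "(flat m has_derivative (*) (flat (m + 2) x - real m * flat (m + 1) x)) (at x)" for x
   using flat_deriv[of m x] by (simp add: has_field_derivative_def)
  have "C_k k (%t. v * flat (m + 2) t + (- m * v) * flat (m + 1) t)" for v :: real
   by (intro C_k_add C_k_mult C_k_const Suc.IH)
  thus "C_k k (%t. (flat (m + 2) t - m * flat (m + 1) t) * v)" for v
   by (simp add: algebra_simps)
 qed
qed

section \<open>Test functions and their uniform estimates\<close>

abbreviation tests :: "('a::euclidean_space => 'b::real_normed_vector) set" where
 "tests \<equiv> test_functions UNIV"

lemma tests_iff: "\<phi> : tests \<longleftrightarrow> (\<forall>k. C_k k \<phi>) \<and> bounded {x. \<phi> x ~= 0}"
 using bounded_subset[OF _ closure_subset] by (auto simp: test_functions_def compact_eq_bounded_closed)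

lemma tests_derivative:
 assumes "\<phi> : tests"
 shows "(\<phi> has_derivative frechet_derivative \<phi> (at x)) (at x)"
 using assms by (auto simp: test_functions_def intro: C_k_Suc_derivative)

lemma test_functions_UNIV: "\<phi> : test_functions S ==> \<phi> : tests"
 by (auto simp: test_functions_def)

lemma derivative_zero_outside:
 assumes "x \<notin> closure {x. \<phi> x ~= 0}"
 shows "frechet_derivative \<phi> (at x) = (%_. 0)"
proof -
 have "((%_. 0) has_derivative (%_. 0)) (at x)" by simp
 hence "(\<phi> has_derivative (%_. 0)) (at x)"
  by (rule has_derivative_transform_within_open[where s="- closure {x. \<phi> x ~= 0}"])
   (use assms closure_subset[of "{x. \<phi> x ~= 0}"] in auto)
 thus ?thesis by (metis frechet_derivative_at)
qed

lemma test_functions_derivative: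
 assumes "\<phi> : test_functions S"
 shows "(%x. frechet_derivative \<phi> (at x) v) : test_functions S"
proof -
 have sub: "{x. frechet_derivative \<phi> (at x) v ~= 0} <= closure {x. \<phi> x ~= 0}"
  using derivative_zero_outside by fastforce
 hence sub': "closure {x. frechet_derivative \<phi> (at x) v ~= 0} <= closure {x. \<phi> x ~= 0}"
  by (simp add: closure_minimal)
 have "C_k k (%x. frechet_derivative \<phi> (at x) v)" for k
  using assms by (auto simp: test_functions_def dest: spec[of _ "Suc k"])
 thus ?thesis
  using assms sub' unfolding test_functions_def
  by (auto simp: compact_eq_bounded_closed intro: bounded_subset)
qed

lemma tests_bounded:
 assumes "\<phi> : tests"
 obtains B where "0 <= B" "!!x. norm (\<phi> x) <= B"
proof -
 let ?K = "closure {x. \<phi> x ~= 0}"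
 have "compact (\<phi> ` ?K)"
  using assms by (intro compact_continuous_image) (auto simp: test_functions_def intro: C_k_continuous)
 then obtain B where B: "!!x. x : ?K ==> norm (\<phi> x) <= B"
  by (fastforce dest!: compact_imp_bounded simp: bounded_iff)
 have "norm (\<phi> x) <= \<bar>B\<bar>" for x
 proof (cases "\<phi> x = 0")
  case False
  hence "x : ?K" using closure_subset[of "{x. \<phi> x ~= 0}"] by auto
  thus ?thesis using B[of x] by simp
 qed simp
 thus thesis using that[of "\<bar>B\<bar>"] by simp
qed

lemma linear_norm_le_Basis:
 assumes "bounded_linear f"
 shows "norm (f (h :: 'a::euclidean_space)) <= (\<Sum>b\<in>Basis. norm (f b)) * norm h"
proof -
 interpret bounded_linear f by fact
 have "f h = f (\<Sum>b\<in>Basis. (h \<bullet> b) *\<^sub>R b)" by (simp add: euclidean_representation)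
 also have "... = (\<Sum>b\<in>Basis. (h \<bullet> b) *\<^sub>R f b)" by (simp add: sum scaleR)
 finally have "norm (f h) <= (\<Sum>b\<in>Basis. norm ((h \<bullet> b) *\<^sub>R f b))" by (metis norm_sum)
 also have "... <= (\<Sum>b\<in>Basis. norm (f b) * norm h)"
  by (intro sum_mono) (auto simp: mult.commute[of _ "norm h"] intro!: mult_right_mono Basis_le_norm)
 finally show ?thesis by (simp add: sum_distrib_right)
qed

lemma tests_lipschitz:
 assumes "\<phi> : tests"
 obtains B where "0 <= B" "!!x y. norm (\<phi> x - \<phi> y) <= B * norm (x - y)"
proof -
 have "\<forall>b. \<exists>B\<ge>0. \<forall>x. norm (frechet_derivative \<phi> (at x) b) <= B"
  using tests_bounded[OF test_functions_derivative[OF assms]] by metis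
 then obtain B where B: "!!b. 0 <= B b" "!!b x. norm (frechet_derivative \<phi> (at x) b) <= B b" by metis
 have "norm (\<phi> x - \<phi> y) <= (\<Sum>b\<in>Basis. B b) * norm (x - y)" for x y
 proof (rule differentiable_bound[of UNIV \<phi> "%x. frechet_derivative \<phi> (at x)"])
  fix x
  have bl: "bounded_linear (frechet_derivative \<phi> (at x))"
   using tests_derivative[OF assms] has_derivative_bounded_linear by blast
  show "onorm (frechet_derivative \<phi> (at x)) <= (\<Sum>b\<in>Basis. B b)"
  proof (rule onorm_le)
   fix h
   show "norm (frechet_derivative \<phi> (at x) h) <= (\<Sum>b\<in>Basis. B b) * norm h"
    by (rule order_trans[OF linear_norm_le_Basis[OF bl]]) (intro mult_right_mono sum_mono B norm_ge_zero)
  qed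
 qed (use tests_derivative[OF assms] in auto)
 thus thesis using that[of "\<Sum>b\<in>Basis. B b"] B by (simp add: sum_nonneg)
qed

text \<open>A second-order remainder that is uniform in the base point. It justifies differentiation
  under convolution integrals and the integrations by parts below, which compare with a finite
  difference and let its step tend to 0.\<close>

lemma tests_taylor:
 assumes "\<phi> : tests"
 obtains B where "0 <= B" "!!x h. norm (\<phi> (x + h) - \<phi> x - frechet_derivative \<phi> (at x) h) <= B * norm h * norm h"
proof -
 have "\<forall>b. \<exists>B\<ge>0. \<forall>x y. norm (frechet_derivative \<phi> (at x) b - frechet_derivative \<phi> (at y) b) <= B * norm (x - y)"
  using tests_lipschitz[OF test_functions_derivative[OF assms]] by metis
 then obtain B where B: "!!b. 0 <= B b"
  "!!b x y. norm (frechet_derivative \<phi> (at x) b - frechet_derivative \<phi> (at y) b) <= B b * norm (x - y)" by metis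
 let ?B = "\<Sum>b\<in>Basis. B b"
 have "norm (\<phi> (x + h) - \<phi> x - frechet_derivative \<phi> (at x) h) <= ?B * norm h * norm h" for x h
 proof -
  let ?D = "frechet_derivative \<phi> (at x)"
  have bl: "bounded_linear (frechet_derivative \<phi> (at y))" for y
   using tests_derivative[OF assms] has_derivative_bounded_linear by blast
  have "norm ((\<phi> (x + h) - ?D (x + h)) - (\<phi> x - ?D x)) <= (?B * norm h) * norm (x + h - x)"
  proof (rule differentiable_bound[where S="closed_segment x (x + h)" and f="%y. \<phi> y - ?D y" and f'="%y v. frechet_derivative \<phi> (at y) v - ?D v"])
   fix y assume y: "y : closed_segment x (x + h)"
   show "((%y. \<phi> y - ?D y) has_derivative (%v. frechet_derivative \<phi> (at y) v - ?D v)) (at y within closed_segment x (x + h))"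
    by (intro has_derivative_diff has_derivative_at_withinI[OF tests_derivative[OF assms]] bounded_linear_imp_has_derivative bl)
   have yx: "norm (y - x) <= norm h"
    using dist_in_closed_segment[OF y] by (simp add: dist_norm norm_minus_commute)
   show "onorm (%v. frechet_derivative \<phi> (at y) v - ?D v) <= ?B * norm h"
   proof (rule onorm_le)
    fix v
    have "norm (frechet_derivative \<phi> (at y) v - ?D v) <= (\<Sum>b\<in>Basis. norm (frechet_derivative \<phi> (at y) b - ?D b)) * norm v"
     by (rule linear_norm_le_Basis) (intro bounded_linear_sub bl)
    also have "... <= (\<Sum>b\<in>Basis. B b * norm h) * norm v"
     by (intro mult_right_mono sum_mono order_trans[OF B(2)] mult_left_mono yx B(1)) auto
    finally show "norm (frechet_derivative \<phi> (at y) v - ?D v) <= ?B * norm h * norm v"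
     by (simp add: sum_distrib_right)
   qed
  qed auto
  moreover have "?D (x + h) = ?D x + ?D h" using bl by (simp add: bounded_linear.linear linear_add)
  ultimately show ?thesis by (simp add: algebra_simps)
 qed
 thus thesis using that[of ?B] B by (simp add: sum_nonneg)
qed

lemma tests_continuous: "\<phi> : tests ==> continuous_on S \<phi>"
 unfolding tests_iff using C_k_continuous by blast

lemma tests_borel [measurable_dest]: "\<phi> : tests ==> \<phi> : borelfun"
 by (intro borel_measurable_continuous_onI tests_continuous)

lemma tests_reflect:
 fixes \<phi> :: "'a::euclidean_space => 'b::real_normed_vector"
 assumes "\<phi> : tests" shows "(%y. \<phi> (x - y)) : tests"
proof -
 have "C_k k (%y. \<phi> (x + (- y)))" for k
  using assms by (intro C_k_bounded_linear_comp bounded_linear_minus bounded_linear_ident) (auto simp: test_functions_def)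
 moreover have "bounded {y. \<phi> (x - y) ~= 0}"
 proof -
  obtain B where "!!y. \<phi> y ~= 0 ==> norm y <= B" using assms unfolding tests_iff bounded_iff by blast
  hence "norm y <= norm x + B" if "\<phi> (x - y) ~= 0" for y
   using that norm_triangle_ineq4[of x "x - y"] by fastforce
  thus ?thesis unfolding bounded_iff by blast
 qed
 ultimately show ?thesis unfolding tests_iff by simp
qed

text \<open>Positive exactly on the open cube of half-side 1. Each factor is \<open>flat\<close>
  composed with an affine map, the shape that \<open>C_k_bounded_linear_comp\<close>
  accepts.\<close>

definition bump :: "'a::euclidean_space => real" where
 "bump x = (\<Prod>b\<in>Basis. flat 0 (1 + x \<bullet> - b) * flat 0 (1 + x \<bullet> b))"

lemma C_k_bump: "C_k k bump"
 unfolding bump_def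
 by (intro C_k_prod C_k_mult C_k_bounded_linear_comp bounded_linear_inner_left C_k_flat)

lemma bump_nonneg: "0 <= bump x"
 unfolding bump_def by (intro prod_nonneg mult_nonneg_nonneg ballI flat_nonneg)

lemma bump_support: "bump x ~= 0 ==> norm x <= real DIM('a)" for x :: "'a::euclidean_space"
proof -
 assume "bump x ~= 0"
 hence "\<bar>x \<bullet> b\<bar> <= 1" if "b : Basis" for b
  using that by (auto simp: bump_def flat_def split: if_splits dest!: bspec[OF _ that])
 hence "(\<Sum>b\<in>Basis. \<bar>x \<bullet> b\<bar>) <= (\<Sum>b\<in>(Basis::'a set). 1)" by (intro sum_mono) auto
 thus ?thesis using norm_le_l1[of x] by simp
qed

lemma bump_0: "0 < bump 0"
 by (simp add: bump_def flat_def prod_pos)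

text \<open>\<open>bump\<close> vanishes outside the ball of radius \<open>DIM('a)\<close>, so this
  rescaling puts the support into the ball of radius \<open>1 / real (Suc k)\<close>.\<close>

definition moll :: "nat => 'a::euclidean_space => real" where
 "moll k x = bump ((real DIM('a) * real (Suc k)) *\<^sub>R x) / (LBINT y. bump ((real DIM('a) * real (Suc k)) *\<^sub>R (y::'a)))"

context fixes k :: nat
begin

private abbreviation (input) g where "g \<equiv> (%y::'a::euclidean_space. bump ((real DIM('a) * real (Suc k)) *\<^sub>R y))"

private lemma g_supp: "g y ~= 0 ==> norm (y::'a::euclidean_space) <= 1 / real (Suc k)"
proof -
 assume "g y ~= 0"
 from bump_support[OF this] have "real DIM('a) * (real (Suc k) * norm y) <= real DIM('a) * 1"
  by (simp only: norm_scaleR abs_mult abs_of_nat mult.assoc mult_1_right)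
 hence "real (Suc k) * norm y <= 1" by (rule mult_left_le_imp_le) simp
 thus ?thesis by (simp add: field_simps)
qed

private lemma g_tests: "(g :: 'a::euclidean_space => real) : tests"
 unfolding tests_iff
proof
 have "C_k m (%y::'a. bump (0 + (real DIM('a) * real (Suc k)) *\<^sub>R y))" for m
  by (intro C_k_bounded_linear_comp bounded_linear_scaleR_right C_k_bump)
 thus "\<forall>m. C_k m (g :: 'a => real)" by simp
 show "bounded {x::'a. g x ~= 0}"
  unfolding bounded_iff using g_supp by auto
qed

private lemma g_integrable: "lintegrable (g :: 'a::euclidean_space => real)"
proof -
 have "lintegrable (%x::'a. ind (cball 0 (1 / real (Suc k))) x *\<^sub>R g x)"
  by (rule borel_integrable_compact[OF compact_cball tests_continuous[OF g_tests]])
 moreover have "ind (cball 0 (1 / real (Suc k))) x *\<^sub>R g x = g x" for x :: 'a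
  using g_supp[of x] by (cases "g x = 0") (simp_all add: indicator_def)
 ultimately show ?thesis by (simp only:)
qed

private lemma g_integral_pos: "0 < (LBINT y. g (y::'a::euclidean_space))"
proof -
 have "(LBINT y. g (y::'a)) ~= 0"
 proof
  assume "(LBINT y. g (y::'a)) = 0"
  hence "AE y in lborel. g (y::'a) = 0"
   using integral_nonneg_eq_0_iff_AE[OF g_integrable] bump_nonneg by auto
  moreover have c: "continuous_on UNIV (g :: 'a => real)" by (rule tests_continuous[OF g_tests])
  have "open {y::'a. g y ~= 0}"
   by (intro open_Collect_neq c continuous_on_const)
  moreover have "0 : {y::'a. g y ~= 0}" using bump_0[where 'a='a] by simp
  ultimately obtain e where e: "0 < e" "ball (0::'a) e <= {y. g y ~= 0}" using open_contains_ball by blast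
  have "{y::'a. g y ~= 0} : null_sets lborel"
   using \<open>AE y in lborel. g (y::'a) = 0\<close> \<open>open {y::'a. g y ~= 0}\<close> by (subst AE_iff_null_sets) (auto intro: borel_open)
  hence "ball (0::'a) e : null_sets lborel" using e(2) null_sets_subset by (metis borel_open open_ball sets_lborel)
  thus False using e(1) content_ball_pos[of e "0::'a"] by (auto simp: measure_def null_sets_def)
 qed
 moreover have "0 <= (LBINT y. g (y::'a))" using bump_nonneg by (intro integral_nonneg_AE) auto
 ultimately show ?thesis by simp
qed

lemma moll_tests: "(moll k :: 'a::euclidean_space => real) : tests"
proof -
 have "C_k m (%x::'a. g x * inverse (LBINT y. g (y::'a)))" for m
  using g_tests[where 'a='a] unfolding tests_iff by (intro C_k_mult C_k_const) (elim conjE allE)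
 moreover have "(moll k :: 'a => real) = (%x. g x * inverse (LBINT y. g (y::'a)))"
  by (rule ext) (simp only: moll_def divide_inverse)
 ultimately have "C_k m (moll k :: 'a => real)" for m by (simp only:)
 moreover have "{x::'a. moll k x ~= 0} <= {x. g x ~= 0}" by (auto simp: moll_def)
 ultimately show ?thesis using g_tests unfolding tests_iff using bounded_subset by auto
qed

lemma moll_nonneg: "0 <= moll k (x::'a::euclidean_space)"
 unfolding moll_def using g_integral_pos[where 'a='a] bump_nonneg by (intro divide_nonneg_nonneg) auto

lemma moll_support: "moll k x ~= 0 ==> norm (x::'a::euclidean_space) <= 1 / real (Suc k)"
 using g_supp by (auto simp: moll_def)

lemma integral_moll: "lintegrable (moll k :: 'a::euclidean_space => real)" "(LBINT x. moll k (x::'a)) = 1"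
 unfolding moll_def using g_integrable[where 'a='a] g_integral_pos[where 'a='a] by auto

lemma nn_integral_moll: "(NBINT x. en (moll k (x::'a::euclidean_space))) = 1"
 using integral_moll[where 'a='a] by (subst nn_integral_eq_integral) (auto simp: moll_nonneg)

end

lemma moll_borel [measurable]: "moll k : borelfun"
 using tests_borel[OF moll_tests] .

definition conv :: "('a::euclidean_space => real) => ('a => 'b::euclidean_space) => 'a => 'b" where
 "conv \<phi> f x = (LBINT y. \<phi> (x - y) *\<^sub>R f y)"

abbreviation mconv :: "nat \<Rightarrow> ('a::euclidean_space \<Rightarrow> 'b::euclidean_space) \<Rightarrow> 'a \<Rightarrow> 'b" where
 "mconv k \<equiv> conv (moll k)"

lemma conv_integrable:
 fixes f :: "'a::euclidean_space => 'b::euclidean_space"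
 assumes "\<phi> : tests" and f: "lintegrable f"
 shows "lintegrable (%y. \<phi> (x - y) *\<^sub>R f y)"
proof -
 obtain B where B: "0 <= B" "!!x. norm (\<phi> x) <= B" using tests_bounded[OF assms(1)] by blast
 note [measurable] = tests_borel[OF assms(1)]
 show ?thesis
 proof (rule integrable_bound')
  show "lintegrable (%y. B * norm (f y))" using f by auto
  show "AE y in lborel. norm (\<phi> (x - y) *\<^sub>R f y) <= norm (B * norm (f y))"
   using B by (auto intro!: AE_I2 mult_right_mono simp: abs_of_nonneg)
  show "(%y. \<phi> (x - y) *\<^sub>R f y) : borel_measurable lborel" using f by measurable
 qed
qed

text \<open>The derivative falls on the kernel; Taylor's remainder is bounded by the square of
  \<open>norm h\<close> times the L1 norm of \<open>f\<close>.\<close>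

lemma conv_has_derivative:
 fixes f :: "'a::euclidean_space => 'b::euclidean_space"
 assumes \<phi>: "\<phi> : tests" and f: "lintegrable f"
 shows "(conv \<phi> f has_derivative (%v. conv (%x. frechet_derivative \<phi> (at x) v) f x)) (at x)"
proof -
 let ?D = "%v x. frechet_derivative \<phi> (at x) v"
 have bl: "bounded_linear (frechet_derivative \<phi> (at y))" for y
  using tests_derivative[OF \<phi>] has_derivative_bounded_linear by blast
 obtain B where B: "0 <= B" "!!x h. norm (\<phi> (x + h) - \<phi> x - frechet_derivative \<phi> (at x) h) <= B * norm h * norm h"
  using tests_taylor[OF \<phi>] by blast
 let ?M = "(LBINT y. norm (f y))"
 note int = conv_integrable[OF \<phi> f] conv_integrable[OF test_functions_derivative[OF \<phi>] f]
 have lin: "linear (%v. conv (?D v) f x)"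
 proof (rule linearI)
  show "conv (?D (v + w)) f x = conv (?D v) f x + conv (?D w) f x" for v w
   unfolding conv_def using int bl
   by (simp add: bounded_linear.linear linear_add scaleR_add_left flip: Bochner_Integration.integral_add)
  fix c v
  have "?D (c *\<^sub>R v) y = c * ?D v y" for y
   using linear_cmul[OF bounded_linear.linear[OF bl], of y c v] by simp
  hence "(%y. ?D (c *\<^sub>R v) (x - y) *\<^sub>R f y) = (%y. c *\<^sub>R (?D v (x - y) *\<^sub>R f y))"
   by (simp add: fun_eq_iff)
  thus "conv (?D (c *\<^sub>R v)) f x = c *\<^sub>R conv (?D v) f x"
   unfolding conv_def by (simp only: integral_scaleR_right)
 qed
 show ?thesis
  unfolding has_derivative_at
 proof (intro conjI)
  show "bounded_linear (%v. conv (?D v) f x)" using lin linear_conv_bounded_linear by blast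
  have l: "((%h::'a. B * ?M * norm h) \<longlongrightarrow> 0) (at 0)"
   by (intro tendsto_mult_right_zero tendsto_norm_zero tendsto_ident_at)
  show "(%h. norm (conv \<phi> f (x + h) - conv \<phi> f x - conv (?D h) f x) / norm h) \<midarrow>0\<rightarrow> 0"
  proof (rule Lim_null_comparison[OF _ l], unfold eventually_at_filter, rule always_eventually, intro allI impI)
   fix h :: 'a assume h: "h ~= 0"
   note ints = conv_integrable[OF \<phi> f, of "x + h"] int(1)[of x] conv_integrable[OF test_functions_derivative[OF \<phi>, of h] f, of x]
   have "conv \<phi> f (x + h) - conv \<phi> f x - conv (?D h) f x
     = (LBINT y. \<phi> (x + h - y) *\<^sub>R f y - \<phi> (x - y) *\<^sub>R f y - ?D h (x - y) *\<^sub>R f y)"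
    unfolding conv_def using ints by (simp only: Bochner_Integration.integral_diff Bochner_Integration.integrable_diff)
   also have "norm ... <= (LBINT y. (B * norm h * norm h) * norm (f y))"
   proof (rule Bochner_Integration.integral_norm_bound_integral)
    show "lintegrable (%y. \<phi> (x + h - y) *\<^sub>R f y - \<phi> (x - y) *\<^sub>R f y - ?D h (x - y) *\<^sub>R f y)"
     by (intro Bochner_Integration.integrable_diff ints)
    show "norm (\<phi> (x + h - y) *\<^sub>R f y - \<phi> (x - y) *\<^sub>R f y - ?D h (x - y) *\<^sub>R f y) <= B * norm h * norm h * norm (f y)" for y
    proof -
     have "norm ((\<phi> (x - y + h) - \<phi> (x - y) - ?D h (x - y)) *\<^sub>R f y) <= B * norm h * norm h * norm (f y)"
      unfolding norm_scaleR by (intro mult_right_mono) (use B(2)[of "x - y" h] in auto)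
     moreover have "x - y + h = x + h - y" by simp
     ultimately show ?thesis by (simp only: scaleR_diff_left)
    qed
   qed (use f in auto)
   also have "... = B * ?M * norm h * norm h" by simp
   finally show "norm (norm (conv \<phi> f (x + h) - conv \<phi> f x - conv (?D h) f x) / norm h) <= B * ?M * norm h"
    using h by (simp add: divide_le_eq)
  qed
 qed
qed

lemma C_k_conv:
 fixes f :: "'a::euclidean_space => 'b::euclidean_space"
 assumes f: "lintegrable f"
 shows "\<phi> : tests ==> C_k k (conv \<phi> f)"
proof (induction k arbitrary: \<phi>)
 case 0
 thus ?case
  using conv_has_derivative[OF 0 f] has_derivative_continuous continuous_at_imp_continuous_on by (metis C_k.simps(1))
next
 case (Suc k)
 show ?case by (rule C_k_SucI[OF conv_has_derivative[OF Suc.prems f]]) (intro Suc.IH test_functions_derivative Suc.prems)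
qed

lemma conv_eq_0:
 fixes f :: "'a::euclidean_space => 'b::euclidean_space"
 assumes "!!y. \<phi> (x - y) ~= 0 ==> f y = 0"
 shows "conv \<phi> f x = 0"
proof -
 have "(%y. \<phi> (x - y) *\<^sub>R f y) = (%_. 0)" using assms by (auto simp: fun_eq_iff)
 thus ?thesis by (simp add: conv_def)
qed

lemma conv_inner:
 fixes f :: "'a::euclidean_space => 'b::euclidean_space"
 assumes "\<phi> : tests" "lintegrable f"
 shows "conv \<phi> f x \<bullet> c = (LBINT y. \<phi> (x - y) * (f y \<bullet> c))"
 unfolding conv_def using integral_inner_left[OF conv_integrable[OF assms, of x], of c] by simp

lemma lborel_integral_shift:
 fixes f :: "'a::euclidean_space => 'b::{banach, second_countable_topology}"
 assumes [measurable]: "f : borelfun"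
 shows "(LBINT x. f (x + a)) = (LBINT x. f x)"
  and "lintegrable (%x. f (x + a)) \<longleftrightarrow> lintegrable f"
proof -
 have d: "distr lborel borel (%x::'a. a + x) = lborel" by (rule lborel_distr_plus)
 have "(\<integral>x. f x \<partial>distr lborel borel (%x. a + x)) = (LBINT x. f (a + x))"
  by (rule integral_distr) auto
 thus "(LBINT x. f (x + a)) = (LBINT x. f x)" unfolding d by (simp add: add.commute)
 have "integrable (distr lborel borel (%x. a + x)) f \<longleftrightarrow> lintegrable (%x. f (a + x))"
  by (rule integrable_distr_eq) auto
 thus "lintegrable (%x. f (x + a)) \<longleftrightarrow> lintegrable f" unfolding d by (simp add: add.commute)
qed

lemma nn_integral_lborel_shift:
 fixes f :: "'a::euclidean_space => ennreal"
 assumes [measurable]: "f : borelfun"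
 shows "(NBINT x. f (x + a)) = (NBINT x. f x)"
proof -
 have "(NBINT x. f x) = (\<integral>\<^sup>+x. f x \<partial>distr lborel borel (%x. a + x))" by (simp add: lborel_distr_plus)
 also have "... = (NBINT x. f (x + a))" by (subst nn_integral_distr) (auto simp: add.commute)
 finally show ?thesis ..
qed

lemma nn_integral_lborel_reflect:
 fixes f :: "'a::euclidean_space => ennreal"
 assumes [measurable]: "f : borelfun"
 shows "(NBINT x. f (a - x)) = (NBINT x. f x)"
proof -
 have "(lborel :: 'a measure) = density (distr lborel borel (%x. a + (-1) *\<^sub>R x)) (%_. 1)"
  using lborel_affine[of "-1" a] by simp
 hence "(NBINT x. f x) = (\<integral>\<^sup>+x. f x \<partial>distr lborel borel (%x. a + (-1) *\<^sub>R x))"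
  by (simp add: density_1)
 also have "... = (NBINT x. f (a - x))" by (subst nn_integral_distr) auto
 finally show ?thesis ..
qed

section \<open>Mollification\<close>

text \<open>The majorants \<open>H i\<close> vary with \<open>i\<close>, and only their integrals
  are compared with that of the limit; Fatou's lemma is applied to
  \<open>H i + H0 - \<bar>f i - f0\<bar>\<close>. Mollified gradients in general have no common
  integrable majorant, but Jensen's inequality gives exactly this comparison of integrals.\<close>

lemma generalized_dominated_convergence:
 fixes f H :: "nat => 'a => real" and f0 H0 :: "'a => real"
 assumes [measurable]: "!!i. f i : borel_measurable M" "f0 : borel_measurable M"
  and lim: "AE x in M. (%i. f i x) ----> f0 x" "AE x in M. (%i. H i x) ----> H0 x"
  and bound: "!!i. AE x in M. \<bar>f i x\<bar> <= H i x"
  and int: "!!i. integrable M (H i)" "integrable M H0" and le: "!!i. (\<integral>x. H i x \<partial>M) <= (\<integral>x. H0 x \<partial>M)"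
 shows "integrable M f0" "!!i. integrable M (f i)" "(%i. \<integral>x. \<bar>f i x - f0 x\<bar> \<partial>M) ----> 0"
proof -
 have [measurable]: "!!i. H i : borel_measurable M" "H0 : borel_measurable M" using int by auto
 have bound': "AE x in M. \<forall>i. \<bar>f i x\<bar> <= H i x" using bound by (simp add: AE_all_countable)
 have b0: "AE x in M. \<bar>f0 x\<bar> <= H0 x"
  using lim bound'
 proof eventually_elim
  case (elim x)
  thus ?case by (intro LIMSEQ_le[OF tendsto_rabs]) auto
 qed
 show if0: "integrable M f0"
  by (rule integrable_bound'[OF int(2)]) (use b0 in auto)
 show if1: "integrable M (f i)" for i
  by (rule integrable_bound'[OF int(1)[of i]]) (use bound[of i] in auto)
 define a where "a i = (\<integral>x. \<bar>f i x - f0 x\<bar> \<partial>M)" for i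
 define g where "g i x = H i x + H0 x - \<bar>f i x - f0 x\<bar>" for i x
 have ig: "integrable M (g i)" for i unfolding g_def using int if0 if1 by auto
 have gint: "(\<integral>x. g i x \<partial>M) = (\<integral>x. H i x \<partial>M) + (\<integral>x. H0 x \<partial>M) - a i" for i
  unfolding g_def a_def using int if0 if1 by simp
 have g0: "AE x in M. 0 <= g i x" for i
  using bound[of i] b0 by eventually_elim (auto simp: g_def)
 have "en (2 * (\<integral>x. H0 x \<partial>M)) = (\<integral>\<^sup>+x. en (2 * H0 x) \<partial>M)"
 proof -
  have "AE x in M. 0 <= 2 * H0 x" using b0 by eventually_elim auto
  thus ?thesis using int by (subst nn_integral_eq_integral) auto
 qed
 also have "... = (\<integral>\<^sup>+x. liminf (%i. en (g i x)) \<partial>M)"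
 proof (rule nn_integral_cong_AE)
  show "AE x in M. en (2 * H0 x) = liminf (%i. en (g i x))"
   using lim
  proof eventually_elim
   case (elim x)
   have "(%i. g i x) ----> H0 x + H0 x - \<bar>f0 x - f0 x\<bar>"
    unfolding g_def by (intro tendsto_intros elim)
   hence "(%i. en (g i x)) ----> en (2 * H0 x)" by (intro tendsto_ennrealI) simp
   thus ?case by (simp add: lim_imp_Liminf)
  qed
 qed
 also have "... <= liminf (%i. \<integral>\<^sup>+x. en (g i x) \<partial>M)"
  by (rule nn_integral_liminf) (simp add: g_def)
 also have "(%i. \<integral>\<^sup>+x. en (g i x) \<partial>M) = (%i. en (\<integral>x. g i x \<partial>M))"
  using ig g0 by (intro ext nn_integral_eq_integral) auto
 finally have L: "en (2 * (\<integral>x. H0 x \<partial>M)) <= liminf (%i. en (\<integral>x. g i x \<partial>M))" .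
 have a0: "0 <= a i" for i unfolding a_def by (intro integral_nonneg_AE) auto
 have gi0: "0 <= (\<integral>x. g i x \<partial>M)" for i using g0 by (intro integral_nonneg_AE)
 have "a ----> 0"
 proof (rule LIMSEQ_I)
  fix e :: real assume e: "0 < e"
  have h0: "0 <= (\<integral>x. H0 x \<partial>M)" using b0 by (intro integral_nonneg_AE) (auto elim!: eventually_mono)
  show "\<exists>no. \<forall>n\<ge>no. norm (a n - 0) < e"
  \<comment> \<open>The lower bound used in the other case subtracts \<open>e\<close>; if it were
    negative, \<open>ennreal\<close> would truncate it. In that situation the claim is
    elementary.\<close>
  proof (cases "2 * (\<integral>x. H0 x \<partial>M) < e")
   case True
   have "a i < e" for i using gint[of i] le[of i] gi0[of i] True by linarith
   thus ?thesis using a0 by auto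
  next
   case False
   have "en (2 * (\<integral>x. H0 x \<partial>M) - e) < en (2 * (\<integral>x. H0 x \<partial>M))"
    using e False by (intro ennreal_lessI) auto
   hence "en (2 * (\<integral>x. H0 x \<partial>M) - e) < liminf (%i. en (\<integral>x. g i x \<partial>M))" using L by order
   hence "\<forall>\<^sub>F i in sequentially. en (2 * (\<integral>x. H0 x \<partial>M) - e) < en (\<integral>x. g i x \<partial>M)"
    by (rule less_LiminfD)
   hence "\<forall>\<^sub>F i in sequentially. a i < e"
   proof eventually_elim
    case (elim i)
    hence "2 * (\<integral>x. H0 x \<partial>M) - e < (\<integral>x. g i x \<partial>M)" using False by (simp add: ennreal_less_iff)
    thus ?case using gint[of i] le[of i] by linarith
   qed
   thus ?thesis using a0 by (auto simp: eventually_sequentially)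
  qed
 qed
 thus "(%i. \<integral>x. \<bar>f i x - f0 x\<bar> \<partial>M) ----> 0" by (simp add: a_def[abs_def])
qed

lemma conv_continuous:
 fixes f :: "'a::euclidean_space => 'b::euclidean_space"
 shows "\<phi> : tests ==> lintegrable f ==> continuous_on S (conv \<phi> f)"
 by (rule C_k_continuous[OF C_k_conv])

lemma conv_borel [measurable]:
 fixes f :: "'a::euclidean_space => 'b::euclidean_space"
 shows "lintegrable f ==> mconv k f : borelfun"
 by (intro borel_measurable_continuous_onI conv_continuous moll_tests)

text \<open>Jensen's inequality for the probability density \<open>moll k (x - y)\<close>, obtained
  from Hoelder's inequality with the weights \<open>1 - 1 / p\<close> and
  \<open>1 / p\<close>.\<close>

lemma conv_Jensen_pointwise:
 fixes f :: "'a::euclidean_space => 'b::euclidean_space"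
 assumes f: "lintegrable f" and p: "1 <= p"
 shows "np (mconv k f x) p <= (NBINT y. en (moll k (x - y)) * np (f y) p)"
proof -
 have [measurable]: "f : borelfun" using f by auto
 let ?R = "(NBINT y. en (moll k (x - y)) * np (f y) p)"
 have "en (norm (mconv k f x)) <= (NBINT y. en (norm (moll k (x - y) *\<^sub>R f y)))"
  unfolding conv_def by (intro integral_norm_bound_ennreal conv_integrable moll_tests f)
 also have "... = (NBINT y. epow (en (moll k (x - y))) (1 - 1 / p) * epow (en (moll k (x - y)) * np (f y) p) (1 / p))"
 proof (intro nn_integral_cong)
  fix y
  have "en (norm (moll k (x - y) *\<^sub>R f y)) = en (moll k (x - y)) * en (norm (f y))"
   by (simp add: moll_nonneg ennreal_mult)
  also have "en (norm (f y)) = epow (np (f y) p) (1 / p)"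
   using p by (simp add: epow_ennreal powr_powr)
  also have "en (moll k (x - y)) = epow (en (moll k (x - y))) (1 - 1 / p) * epow (en (moll k (x - y))) (1 / p)"
   using p epow_add[of "1 - 1 / p" "1 / p" "en (moll k (x - y))"] by simp
  finally show "en (norm (moll k (x - y) *\<^sub>R f y)) = epow (en (moll k (x - y))) (1 - 1 / p) * epow (en (moll k (x - y)) * np (f y) p) (1 / p)"
   using p by (simp add: epow_mult mult.assoc)
 qed
 also have "... <= epow (NBINT y. en (moll k (x - y))) (1 - 1 / p) * epow ?R (1 / p)"
  using p by (intro nn_integral_Holder2) auto
 also have "(NBINT y. en (moll k (x - y))) = 1"
  using nn_integral_lborel_reflect[of "%y. en (moll k y)" x] nn_integral_moll by simp
 finally have "epow (en (norm (mconv k f x))) p <= epow (epow ?R (1 / p)) p"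
  using p by (intro epow_mono) auto
 thus ?thesis using p by (simp add: epow_ennreal epow_epow)
qed

lemma conv_Jensen:
 fixes f :: "'a::euclidean_space => 'b::euclidean_space"
 assumes f: "lintegrable f" and p: "1 <= p"
 shows "(NBINT x. np (mconv k f x) p) <= (NBINT x. np (f x) p)"
proof -
 have [measurable]: "f : borelfun" using f by auto
 have "(NBINT x. np (mconv k f x) p)
   <= (NBINT x. (NBINT y. en (moll k (x - y)) * np (f y) p))"
  by (intro nn_integral_mono conv_Jensen_pointwise assms)
 also have "... = (NBINT y. (NBINT x. en (moll k (x - y)) * np (f y) p))"
  by (rule lborel_pair.Fubini'[symmetric]) measurable
 also have "... = (NBINT y. np (f y) p)"
 proof (intro nn_integral_cong)
  fix y :: 'a
  have "(NBINT x. en (moll k (x - y))) = 1"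
   using nn_integral_lborel_shift[of "%y. en (moll k y)" "- y"] nn_integral_moll by simp
  thus "(NBINT x. en (moll k (x - y)) * np (f y) p) = np (f y) p"
   by (simp add: nn_integral_multc)
 qed
 finally show ?thesis .
qed

lemma moll_integral_reflect:
 "lintegrable (%y. moll k (x - y))" "(LBINT y. moll k (x - y :: 'a::euclidean_space)) = 1"
proof -
 have n: "(NBINT y. en (moll k (x - y))) = 1"
  using nn_integral_lborel_reflect[of "%y. en (moll k y)" x] nn_integral_moll by simp
 thus "lintegrable (%y. moll k (x - y))" by (intro integrableI_nonneg) (auto simp: moll_nonneg)
 show "(LBINT y. moll k (x - y)) = 1" using n by (subst integral_eq_nn_integral) (auto simp: moll_nonneg)
qed

lemma conv_contraction:
 fixes f :: "'a::euclidean_space => 'b::euclidean_space"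
 assumes f: "lintegrable f"
 shows "lintegrable (mconv k f)" "(LBINT x. norm (mconv k f x)) <= (LBINT x. norm (f x))"
proof -
 have [measurable]: "mconv k f : borelfun" using f by (rule conv_borel)
 have J: "(NBINT x. en (norm (mconv k f x))) <= en (LBINT x. norm (f x))"
  using conv_Jensen[OF f, of 1 k] f by (simp add: nn_integral_eq_integral)
 show i: "lintegrable (mconv k f)"
  by (rule integrableI_bounded) (use J in \<open>auto intro: order_le_less_trans\<close>)
 show "(LBINT x. norm (mconv k f x)) <= (LBINT x. norm (f x))"
  using J i by (simp add: nn_integral_eq_integral)
qed

lemmas integrable_conv = conv_contraction(1)

lemma conv_diff:
 fixes f g :: "'a::euclidean_space => 'b::euclidean_space"
 assumes "lintegrable f" "lintegrable g"
 shows "mconv k (%x. f x - g x) x = mconv k f x - mconv k g x"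
  "mconv k (%x. f x + g x) x = mconv k f x + mconv k g x"
 unfolding conv_def scaleR_diff_right scaleR_add_right using assms by (simp_all add: conv_integrable moll_tests)

text \<open>Inside \<open>U\<close> the mollified indicator is eventually 1. Nothing is known
  pointwise on the boundary, but mollification does not increase the total mass, so the mass
  retained inside \<open>U\<close> bounds what can leak out.\<close>

lemma conv_moll_open:
 fixes U :: "'a::euclidean_space set"
 assumes U: "open U" "emeasure lborel U < \<infinity>"
 shows "(%k. (LBINT x. \<bar>mconv k (ind U) x - ind U x\<bar>)) ----> (0::real)"
proof -
 have [measurable]: "U : sets borel" using U by auto
 have iU: "lintegrable (ind U :: 'a => real)" using U by (simp add: integrable_indicator_iff)
 let ?C = "%k. mconv k (ind U :: 'a => real)"
 note [measurable] = conv_borel[OF iU] and iC = conv_contraction[OF iU]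
 have C01: "0 <= ?C k x" "?C k x <= 1" for k x
 proof -
  show "0 <= ?C k x" unfolding conv_def by (intro integral_nonneg_AE) (auto simp: moll_nonneg)
  have "?C k x <= (LBINT y. moll k (x - y))" unfolding conv_def
   by (intro integral_mono conv_integrable moll_tests iU moll_integral_reflect) (auto simp: indicator_def moll_nonneg)
  thus "?C k x <= 1" by (simp add: moll_integral_reflect)
 qed
 have C1: "\<forall>\<^sub>F k in sequentially. ?C k x = 1" if x: "x : U" for x
 proof -
  obtain d where d: "0 < d" "cball x d <= U" using U(1) x open_contains_cball by blast
  obtain n where n: "1 / real (Suc n) < d" using d(1) nat_approx_posE by metis
  have "?C k x = 1" if k: "n <= k" for k
  proof -
   have "1 / real (Suc k) <= 1 / real (Suc n)" using k by (simp add: frac_le)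
   hence "moll k (x - y) *\<^sub>R ind U y = moll k (x - y)" for y
    using moll_support[of k "x - y"] n d(2) by (cases "y : U"; cases "moll k (x - y) = 0") (auto simp: subset_iff dist_norm)
   thus ?thesis by (simp only: conv_def moll_integral_reflect)
  qed
  thus ?thesis by (auto simp: eventually_sequentially)
 qed
 have iP: "lintegrable (%x. ind U x * ?C k x)" for k
  by (rule integrable_bound'[OF iC(1)[of k]]) (auto simp: indicator_def)
 have "(%k. (LBINT x. ind U x * ?C k x)) ----> ((LBINT x. ind U x) :: real)"
 proof (rule integral_dominated_convergence[where w="ind U"])
  have "(%k. ind U x * ?C k x) ----> ind U x" for x
   using C1[of x] by (cases "x : U") (auto intro!: tendsto_eventually)
  thus "AE x in lborel. (%k. ind U x * ?C k x) ----> ind U x" by simp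
 qed (use C01 iU in \<open>auto simp: indicator_def\<close>)
 hence "(%k. 2 * measure lborel U - 2 * (LBINT x. ind U x * ?C k x)) ----> 2 * measure lborel U - 2 * measure lborel U"
  by (intro tendsto_intros) simp
 hence L: "(%k. 2 * measure lborel U - 2 * (LBINT x. ind U x * ?C k x)) ----> 0" by simp
 have "(LBINT x. \<bar>?C k x - ind U x\<bar>) <= 2 * measure lborel U - 2 * (LBINT x. ind U x * ?C k x)" for k
 proof -
  have "(LBINT x. \<bar>?C k x - ind U x\<bar>) = (LBINT x. ?C k x + ind U x - 2 * (ind U x * ?C k x))"
   using C01 by (intro Bochner_Integration.integral_cong) (auto simp: indicator_def)
  also have "... = (LBINT x. ?C k x) + measure lborel U - 2 * (LBINT x. ind U x * ?C k x)"
   using iC(1)[of k] iU iP by simp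
  also have "(LBINT x. ?C k x) <= measure lborel U" using iC(2)[of k] C01 by simp
  finally show ?thesis by simp
 qed
 thus ?thesis by (intro tendsto_sandwich[OF _ _ tendsto_const L]) (auto intro!: always_eventually)
qed

text \<open>Induction over integrable functions: indicators are compared with an open superset from
  outer regularity, and limits use that mollification is an L1 contraction.\<close>

lemma conv_tendsto_L1:
 fixes f :: "'a::euclidean_space => 'b::euclidean_space"
 assumes f: "lintegrable f"
 shows "(%k. (LBINT x. norm (mconv k f x - f x))) ----> 0"
 using f
proof (induction rule: integrable_induct)
 case (base A c)
 have [measurable]: "A : sets borel" using base by simp
 have iA: "lintegrable (ind A :: 'a => real)" using base by (simp add: integrable_indicator_iff)
 have ind: "(%k. (LBINT x. \<bar>mconv k (ind A) x - ind A x\<bar>)) ----> (0::real)"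
 proof (rule LIMSEQ_I)
  fix e :: real assume e: "0 < e"
  obtain U where U: "open U" "A <= U" "emeasure lborel (U - A) < en (e / 3)"
   using outer_regular_lborel[of A "e / 3"] base e by auto
  have [measurable]: "U : sets borel" using U by auto
  have fU: "emeasure lborel U < \<infinity>"
  proof -
   have "emeasure lborel U <= emeasure lborel (U - A) + emeasure lborel A"
    using U(2) by (subst plus_emeasure) (auto simp: Un_absorb2)
   also have "... < \<infinity>" using U(3) base by (simp add: less_top order_less_trans)
   finally show ?thesis .
  qed
  have fD: "emeasure lborel (U - A) < \<infinity>" using U(3) by (simp add: order_less_trans)
  have mD: "measure lborel (U - A) < e / 3"
   using U(3) fD e by (simp add: emeasure_eq_ennreal_measure less_top ennreal_less_iff)
  have i: "lintegrable (ind U :: 'a => real)" "lintegrable (ind (U - A) :: 'a => real)"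
   using fU fD by (auto simp: integrable_indicator_iff)
  note ic = conv_contraction(1)[OF i(1)] conv_contraction(1)[OF i(2)]
  have iD: "ind A = (%x. ind U x - ind (U - A) x :: real)" using U(2) by (auto simp: indicator_def fun_eq_iff)
  obtain no where no: "!!k. k \<ge> no ==> norm ((LBINT x. \<bar>mconv k (ind U) x - ind U x\<bar>) - (0::real)) < e / 3"
   using LIMSEQ_D[OF conv_moll_open[OF U(1) fU], of "e / 3"] e by auto
  have "norm ((LBINT x. \<bar>mconv k (ind A) x - ind A x\<bar>) - (0::real)) < e" if "k \<ge> no" for k
  proof -
   have "(LBINT x. \<bar>mconv k (ind A) x - ind A x\<bar>)
     <= ((LBINT x. \<bar>mconv k (ind U) x - ind U x\<bar> + \<bar>mconv k (ind (U - A)) x\<bar> + ind (U - A) x) :: real)"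
   proof (rule integral_mono')
    fix x
    have "mconv k (ind A) x = mconv k (ind U) x - (mconv k (ind (U - A)) x :: real)"
     unfolding iD by (rule conv_diff(1)[OF i])
    moreover have "ind A x = ind U x - (ind (U - A) x :: real)" "0 <= (ind (U - A) x :: real)" by (simp_all add: iD)
    ultimately show "\<bar>mconv k (ind A) x - ind A x\<bar> <= \<bar>mconv k (ind U) x - ind U x\<bar>
     + \<bar>mconv k (ind (U - A)) x\<bar> + (ind (U - A) x :: real)" by linarith
   next
    show "lintegrable (%x. \<bar>mconv k (ind U) x - ind U x\<bar> + \<bar>mconv k (ind (U - A)) x\<bar> + (ind (U - A) x :: real))"
     by (intro Bochner_Integration.integrable_add integrable_abs Bochner_Integration.integrable_diff i ic)
   qed simp
   also have "... = (LBINT x. \<bar>mconv k (ind U) x - ind U x\<bar>) + (LBINT x. \<bar>mconv k (ind (U - A)) x :: real\<bar>) + measure lborel (U - A)"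
    using i ic by simp
   also have "... < e" using no[OF that] mD conv_contraction(2)[OF i(2), of k] by simp
   finally show ?thesis by (simp add: abs_of_nonneg)
  qed
  thus "\<exists>no. \<forall>k\<ge>no. norm ((LBINT x. \<bar>mconv k (ind A) x - ind A x\<bar>) - (0::real)) < e" by blast
 qed
 have "mconv k (%x. ind A x *\<^sub>R c) x = mconv k (ind A) x *\<^sub>R c" for k x
  unfolding conv_def using integral_scaleR_left[OF conv_integrable[OF moll_tests iA, of k x], of c] by simp
 hence "norm (mconv k (%x. ind A x *\<^sub>R c) x - ind A x *\<^sub>R c) = norm c * \<bar>mconv k (ind A) x - ind A x\<bar>" for x k
  by (simp flip: scaleR_diff_left)
 thus ?case using tendsto_mult_right_zero[OF ind, of "norm c"] by simp
next
 case (add f g)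
 note i = conv_contraction(1)[OF add(1)] conv_contraction(1)[OF add(2)]
 show ?case
 proof (rule tendsto_sandwich[OF _ _ tendsto_const])
  show "(%k. (LBINT x. norm (mconv k f x - f x)) + (LBINT x. norm (mconv k g x - g x))) ----> 0"
   using tendsto_add[OF add(3) add(4)] by simp
  have "(LBINT x. norm (mconv k (%x. f x + g x) x - (f x + g x))) <= (LBINT x. norm (mconv k f x - f x) + norm (mconv k g x - g x))" for k
   by (rule integral_mono') (use i add(1,2) in \<open>auto intro!: order_trans[OF _ norm_triangle_ineq] simp: algebra_simps conv_diff\<close>)
  thus "\<forall>\<^sub>F k in sequentially. (LBINT x. norm (mconv k (%x. f x + g x) x - (f x + g x))) <= (LBINT x. norm (mconv k f x - f x)) + (LBINT x. norm (mconv k g x - g x))"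
   using i add(1,2) by simp
 qed auto
next
 case (lim f s)
 have bnd: "norm (s i x) <= 2 * norm (f x)" for i x using lim by auto
 have P: "(%k. (LBINT x. norm (mconv k (s i) x - s i x))) ----> 0" for i using lim by auto
 have [measurable]: "f : borelfun" "!!i. s i : borelfun" using lim by auto
 have "(%i. (LBINT x. norm (s i x - f x))) ----> (\<integral>x. norm (0::'b) \<partial>(lborel::'a measure))"
 proof (rule integral_dominated_convergence[where w="%x. 3 * norm (f x)"])
  show "AE x in lborel. (%i. norm (s i x - f x)) ----> norm (0::'b)"
   by (intro AE_I2 tendsto_norm LIM_zero) (use lim in auto)
  show "AE x in lborel. norm (norm (s i x - f x)) <= 3 * norm (f x)" for i
  proof (intro AE_I2)
   fix x
   show "norm (norm (s i x - f x)) <= 3 * norm (f x)"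
    using bnd[of i x] norm_triangle_ineq4[of "s i x" "f x"] by simp
  qed
 qed (use lim in auto)
 hence L: "(%i. (LBINT x. norm (s i x - f x))) ----> 0" by simp
 show ?case
 proof (rule LIMSEQ_I)
  fix e :: real assume e: "0 < e"
  obtain i where i: "(LBINT x. norm (s i x - f x)) < e / 3"
   using LIMSEQ_D[OF L, of "e / 3"] e by (auto simp: abs_of_nonneg)
  obtain no where no: "!!k. k \<ge> no ==> (LBINT x. norm (mconv k (s i) x - s i x)) < e / 3"
   using LIMSEQ_D[OF P[of i], of "e / 3"] e by (auto simp: abs_of_nonneg)
  have "norm ((LBINT x. norm (mconv k f x - f x)) - 0) < e" if "k \<ge> no" for k
  proof -
   have si: "lintegrable (s i)" "lintegrable f" "lintegrable (%x. s i x - f x)" using lim by auto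
   note sc = conv_contraction(1)[OF si(1)] conv_contraction(1)[OF si(2)] conv_contraction(1)[OF si(3)]
   have "(LBINT x. norm (mconv k f x - f x))
    <= (LBINT x. norm (mconv k (s i) x - s i x) + norm (mconv k (%x. s i x - f x) x) + norm (s i x - f x))"
   proof (rule integral_mono')
    show "norm (mconv k f x - f x) <= norm (mconv k (s i) x - s i x) + norm (mconv k (%x. s i x - f x) x) + norm (s i x - f x)" for x
     unfolding conv_diff[OF si(1,2)]
     using norm_triangle_ineq4[of "mconv k (s i) x - s i x" "mconv k (s i) x - mconv k f x"]
      norm_triangle_ineq[of "mconv k f x - s i x" "s i x - f x"] by simp
   qed (use si sc in auto)
   also have "... = (LBINT x. norm (mconv k (s i) x - s i x)) + (LBINT x. norm (mconv k (%x. s i x - f x) x)) + (LBINT x. norm (s i x - f x))"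
    using si sc by simp
   finally show ?thesis using i no[OF that] conv_contraction(2)[OF si(3), of k] by (simp add: abs_of_nonneg)
  qed
  thus "\<exists>no. \<forall>k\<ge>no. norm ((LBINT x. norm (mconv k f x - f x)) - 0) < e" by blast
 qed
qed

lemma conv_L1:
 fixes f :: "'a::euclidean_space => 'b::euclidean_space"
 assumes f: "lintegrable f"
 shows "lintegrable (%x. mconv k f x - f x)"
  and "(%k. (LBINT x. norm (mconv k f x - f x))) ----> 0"
 using integrable_conv[OF f] f conv_tendsto_L1[OF f] by auto

text \<open>Starts from a given subsequence, so that almost everywhere convergence for several
  functions is reached by thinning out repeatedly.\<close>

lemma conv_AE_subseq:
 fixes f :: "'a::euclidean_space => 'b::euclidean_space"
 assumes f: "lintegrable f" and r: "strict_mono (r :: nat => nat)"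
 obtains s where "strict_mono s" "AE x in lborel. (%k. mconv (r (s k)) f x) ----> f x"
proof -
 have "(%k. (LBINT x. norm (mconv (r k) f x - f x))) ----> 0"
  using LIMSEQ_subseq_LIMSEQ[OF conv_tendsto_L1[OF f] r] by (simp add: o_def)
 then obtain s where s: "strict_mono s" "AE x in lborel. (%k. mconv (r (s k)) f x - f x) ----> 0"
  using tendsto_L1_AE_subseq[of lborel "%k x. mconv (r k) f x - f x"] Bochner_Integration.integrable_diff[OF conv_contraction(1)[OF f] f] by auto
 have "AE x in lborel. (%k. mconv (r (s k)) f x) ----> f x"
  using s(2) by eventually_elim (simp add: LIM_zero_iff)
 thus thesis using that s(1) by blast
qed

lemma conv_AE_subseq2:
 fixes f :: "'a::euclidean_space => 'b::euclidean_space" and g :: "'a => 'c::euclidean_space"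
 assumes f: "lintegrable f" and g: "lintegrable g"
 obtains s where "strict_mono s" "AE x in lborel. (%k. mconv (s k) f x) ----> f x"
  "AE x in lborel. (%k. mconv (s k) g x) ----> g x"
proof -
 obtain s where s: "strict_mono s" "AE x in lborel. (%k. mconv (s k) f x) ----> f x"
  using conv_AE_subseq[OF f strict_mono_id] by auto
 obtain t where t: "strict_mono t" "AE x in lborel. (%k. mconv (s (t k)) g x) ----> g x"
  using conv_AE_subseq[OF g s(1)] by auto
 have "AE x in lborel. (%k. mconv (s (t k)) f x) ----> f x"
  using s(2) by eventually_elim (use LIMSEQ_subseq_LIMSEQ[OF _ t(1)] in \<open>auto simp: o_def\<close>)
 thus thesis using that[of "%k. s (t k)"] s(1) t by (auto simp: strict_mono_def)
qed

section \<open>Weak gradients of globally defined functions\<close>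

text \<open>Weak gradients of Borel functions that are integrable on the whole space, with test
  functions restricted to \<open>S\<close>. Global integrability makes mollification and translation
  available without shrinking domains; local minimizers are brought into this form by extension by
  zero.\<close>

definition wgrad :: "(real^'n) set => (real^'n => real^'N) => (real^'n => real^'n^'N) => bool" where
 "wgrad S u G \<longleftrightarrow> lintegrable u \<and> lintegrable G \<and>
  (\<forall>\<phi>\<in>test_functions S. \<forall>i j. (LBINT x. u x $ i * pd \<phi> j x) = - (LBINT x. G x $ i $ j * \<phi> x))"

lemma wgradD:
 assumes "wgrad S u G"
 shows "lintegrable u" "lintegrable G" "u : borelfun" "G : borelfun"
  and "\<phi> : test_functions S ==> (LBINT x. u x $ i * pd \<phi> j x) = - (LBINT x. G x $ i $ j * \<phi> x)"
 using assms unfolding wgrad_def by auto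

lemma test_functions_mono: "S <= T ==> test_functions S <= test_functions T"
 by (auto simp: test_functions_def)

lemma wgrad_mono: "wgrad T u G ==> S <= T ==> wgrad S u G"
 unfolding wgrad_def using test_functions_mono by blast

lemma component_eq_inner: "x $ i = x \<bullet> axis i (1::real)"
 by (simp add: inner_axis)

lemma component2_eq_inner: "(A :: real^'n^'N) $ i $ j = A \<bullet> axis i (axis j 1)"
 by (simp add: inner_axis)

lemma conv_component:
 assumes "\<phi> : tests" "lintegrable (f :: real^'n => real^'N)"
 shows "conv \<phi> f x $ i = (LBINT y. \<phi> (x - y) * f y $ i)"
 unfolding component_eq_inner by (rule conv_inner[OF assms])

lemma conv_component2:
 assumes "\<phi> : tests" "lintegrable (f :: real^'n => real^'k^'N)"
 shows "conv \<phi> f x $ i $ j = (LBINT y. \<phi> (x - y) * f y $ i $ j)"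
 unfolding component2_eq_inner by (rule conv_inner[OF assms])

lemma frechet_derivative_reflect:
 assumes "\<phi> : tests"
 shows "frechet_derivative (%y. \<phi> (x - y)) (at y) v = - frechet_derivative \<phi> (at (x - y)) v"
proof -
 have "((%y. \<phi> (x - y)) has_derivative (%v. frechet_derivative \<phi> (at (x - y)) (- v))) (at y)"
  by (rule has_derivative_compose[OF _ tests_derivative[OF assms]]) (auto intro!: derivative_eq_intros)
 hence "frechet_derivative (%y. \<phi> (x - y)) (at y) = (%v. frechet_derivative \<phi> (at (x - y)) (- v))"
  by (metis frechet_derivative_at)
 moreover have "linear (frechet_derivative \<phi> (at (x - y)))"
  using tests_derivative[OF assms] has_derivative_linear by blast
 ultimately show ?thesis by (simp add: linear_neg)
qed

lemma matrix_mult_axis: "((A :: real^'n^'N) *v axis j 1) $ i = A $ i $ j"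
 by (simp add: matrix_vector_mult_def axis_def if_distrib cong: if_cong)

lemma norm_matrix_mult_le: "norm ((A :: real^'n^'N) *v v) <= norm A * norm v"
proof -
 have "(norm (A *v v))\<^sup>2 = (\<Sum>i\<in>UNIV. (A $ i \<bullet> v)\<^sup>2)"
  unfolding power2_norm_eq_inner by (simp add: inner_vec_def matrix_vector_mult_def power2_eq_square)
 also have "... <= (\<Sum>i\<in>UNIV. (norm (A $ i))\<^sup>2 * (norm v)\<^sup>2)"
  by (intro sum_mono) (metis Cauchy_Schwarz_ineq power2_norm_eq_inner)
 also have "... = (norm A * norm v)\<^sup>2"
  by (simp add: power_mult_distrib norm_vec_def L2_set_def sum_nonneg sum_distrib_right)
 finally show ?thesis by (rule power2_le_imp_le) simp
qed

text \<open>The translated and reflected kernel is itself a test function, so the weak identity is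
  only used where this kernel lives, that is, near \<open>x\<close>.\<close>

lemma conv_wgrad:
 assumes w: "wgrad S u G" and \<phi>: "\<phi> : tests" and S: "(%y. \<phi> (x - y)) : test_functions S"
 shows "(conv \<phi> u has_derivative (%v. conv \<phi> G x *v v)) (at x)"
proof -
 note w' = wgradD[OF w]
 let ?D = "%v. conv (%x. frechet_derivative \<phi> (at x) v) u x"
 have d: "(conv \<phi> u has_derivative ?D) (at x)" by (rule conv_has_derivative[OF \<phi> w'(1)])
 have "?D = (%v. conv \<phi> G x *v v)"
 proof -
  have l1: "linear ?D" using d has_derivative_linear by blast
  have eq: "?D (axis j 1) = conv \<phi> G x *v axis j 1" for j
  proof (subst vec_eq_iff, rule allI)
   fix i
   have "?D (axis j 1) $ i = (LBINT y. frechet_derivative \<phi> (at (x - y)) (axis j 1) * u y $ i)"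
    by (rule conv_component[OF test_functions_derivative[OF \<phi>] w'(1)])
   also have "... = - (LBINT y. u y $ i * frechet_derivative (%y. \<phi> (x - y)) (at y) (axis j 1))"
    by (simp add: frechet_derivative_reflect[OF \<phi>] mult.commute)
   also have "... = (LBINT y. G y $ i $ j * \<phi> (x - y))" using w'(5)[OF S, of i j] by simp
   also have "... = conv \<phi> G x $ i $ j" by (simp add: conv_component2[OF \<phi> w'(2)] mult.commute)
   finally show "?D (axis j 1) $ i = (conv \<phi> G x *v axis j 1) $ i" by (simp add: matrix_mult_axis)
  qed
  show ?thesis
  proof
   fix v
   show "?D v = conv \<phi> G x *v v"
   proof (rule linear_eq_on_span[OF l1 matrix_vector_mul_linear, where B=Basis])
    show "?D b = conv \<phi> G x *v b" if "b : Basis" for b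
     using that eq by (auto simp: Basis_vec_def)
   qed simp
  qed
 qed
 thus ?thesis using d by simp
qed

lemma moll_reflect_test:
 fixes x :: "'a::euclidean_space"
 assumes "cball x (1 / real (Suc k)) <= S"
 shows "(%y. moll k (x - y)) : test_functions S"
proof -
 have "{y. moll k (x - y) ~= 0} <= cball x (1 / real (Suc k))"
  using moll_support by (auto simp: dist_norm)
 hence "closure {y. moll k (x - y) ~= 0} <= cball x (1 / real (Suc k))"
  by (rule closure_minimal) auto
 thus ?thesis
  using tests_reflect[OF moll_tests] assms unfolding test_functions_def by auto
qed

lemma conv_moll_wgrad:
 assumes "wgrad S u G" "cball x (1 / real (Suc k)) <= S"
 shows "(mconv k u has_derivative (%v. mconv k G x *v v)) (at x)"
 by (rule conv_wgrad[OF assms(1) moll_tests moll_reflect_test[OF assms(2)]])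

lemma tests_bounded_set_integrable:
 fixes \<phi> :: "'a::euclidean_space => 'b::euclidean_space"
 assumes "\<phi> : tests" shows "lintegrable \<phi>"
proof -
 let ?K = "closure {x. \<phi> x ~= 0}"
 have "lintegrable (%x. ind ?K x *\<^sub>R \<phi> x)"
  using assms by (intro borel_integrable_compact tests_continuous) (auto simp: test_functions_def)
 moreover have "ind ?K x *\<^sub>R \<phi> x = \<phi> x" for x
  using closure_subset[of "{x. \<phi> x ~= 0}"] by (cases "\<phi> x = 0") (auto simp: indicator_def)
 ultimately show ?thesis by simp
qed

text \<open>By translation invariance the integral of
  \<open>\<phi> (x + t *\<^sub>R v) - \<phi> x\<close> vanishes, so the integral of the derivative
  equals, up to sign, a Taylor remainder divided by \<open>t\<close>, which is of order
  \<open>t\<close>.\<close>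

lemma integral_derivative_test:
 fixes \<phi> :: "'a::euclidean_space => real"
 assumes "\<phi> : tests"
 shows "(LBINT x. frechet_derivative \<phi> (at x) v) = 0"
proof -
 let ?D = "%x. frechet_derivative \<phi> (at x) v"
 obtain B where B: "0 <= B" "!!x h. norm (\<phi> (x + h) - \<phi> x - frechet_derivative \<phi> (at x) h) <= B * norm h * norm h"
  using tests_taylor[OF assms] by blast
 obtain R where R: "!!x. \<phi> x ~= 0 ==> norm x <= R" "!!x. ?D x ~= 0 ==> norm x <= R"
 proof -
  obtain R1 where "!!x. \<phi> x ~= 0 ==> norm x <= R1" using assms unfolding tests_iff bounded_iff by blast
  moreover obtain R2 where "!!x. ?D x ~= 0 ==> norm x <= R2"
   using test_functions_derivative[OF assms, of v] unfolding tests_iff bounded_iff by blast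
  ultimately show thesis using that[of "max R1 R2"] by (meson max.coboundedI1 max.coboundedI2)
 qed
 have ip: "lintegrable \<phi>" and iD: "lintegrable ?D"
  using assms test_functions_derivative by (auto intro: tests_bounded_set_integrable)
 have [measurable]: "\<phi> : borelfun" using ip by auto
 define M where "M = measure lborel (cball (0::'a) (R + norm v))"
 define C where "C = B * norm v * norm v * M"
 have main: "\<bar>(LBINT x. ?D x)\<bar> <= C * t" if t: "0 < t" "t <= 1" for t
 proof -
  have lin: "frechet_derivative \<phi> (at x) (t *\<^sub>R v) = t * ?D x" for x
   using tests_derivative[OF assms] has_derivative_linear linear_cmul by (metis real_scaleR_def)
  have ip': "lintegrable (%x. \<phi> (x + t *\<^sub>R v))" "(LBINT x. \<phi> (x + t *\<^sub>R v)) = (LBINT x. \<phi> x)"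
   using ip lborel_integral_shift[of \<phi> "t *\<^sub>R v"] by auto
  have "t * \<bar>(LBINT x. ?D x)\<bar> = \<bar>(LBINT x. \<phi> (x + t *\<^sub>R v) - \<phi> x - t * ?D x)\<bar>"
   using ip ip' iD t by (simp add: abs_mult)
  also have "... <= (LBINT x. B * norm v * norm v * t * t * ind (cball (0::'a) (R + norm v)) x)"
  proof -
   have "norm (LBINT x. \<phi> (x + t *\<^sub>R v) - \<phi> x - t * ?D x) <= (LBINT x. B * norm v * norm v * t * t * ind (cball (0::'a) (R + norm v)) x)"
   proof (rule Bochner_Integration.integral_norm_bound_integral)
    show "norm (\<phi> (x + t *\<^sub>R v) - \<phi> x - t * ?D x) <= B * norm v * norm v * t * t * ind (cball 0 (R + norm v)) x" for x
    proof (cases "norm x <= R + norm v")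
     case True
     have "norm (\<phi> (x + t *\<^sub>R v) - \<phi> x - t * ?D x) <= B * norm (t *\<^sub>R v) * norm (t *\<^sub>R v)"
      using B(2)[of x "t *\<^sub>R v"] by (simp add: lin)
     thus ?thesis using True t by (simp add: mult_ac)
    next
     case False
     have "norm (t *\<^sub>R v) <= norm v" using t by (simp add: mult_left_le_one_le)
     hence "R < norm (x + t *\<^sub>R v)"
      using False norm_triangle_ineq2[of x "- (t *\<^sub>R v)"] by auto
     moreover have "R < norm x" using False norm_ge_zero[of v] by linarith
     ultimately have "\<phi> (x + t *\<^sub>R v) = 0" "\<phi> x = 0" "?D x = 0" using R by force+
     thus ?thesis using False by simp
    qed
   qed (use ip ip' iD emeasure_lborel_cball_finite in \<open>auto simp: integrable_indicator_iff\<close>)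
   thus ?thesis by simp
  qed
  also have "... = t * (C * t)" by (simp add: C_def M_def)
  finally show ?thesis using t by simp
 qed
 have "\<bar>(LBINT x. ?D x)\<bar> <= 0 + e" if e: "0 < e" for e
 proof -
  have C0: "0 <= C" using B by (simp add: C_def M_def)
  have "\<bar>(LBINT x. ?D x)\<bar> <= C * min 1 (e / (C + 1))" using e C0 by (intro main) auto
  also have "... <= C * (e / (C + 1))" using C0 by (intro mult_left_mono) auto
  also have "... <= e" using C0 e by (simp add: divide_le_eq mult.commute) 
  finally show ?thesis by simp
 qed
 hence "\<bar>(LBINT x. ?D x)\<bar> <= 0" by (rule field_le_epsilon)
 thus ?thesis by simp
qed

lemma test_functions_mult:
 fixes \<phi> \<psi> :: "'a::euclidean_space => real"
 assumes "!!k. C_k k \<psi>" "\<phi> : test_functions S"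
 shows "(%x. \<psi> x * \<phi> x) : test_functions S"
proof -
 have "closure {x. \<psi> x * \<phi> x ~= 0} <= closure {x. \<phi> x ~= 0}" by (intro closure_mono) auto
 thus ?thesis
  using assms unfolding test_functions_def
  by (auto intro!: C_k_mult simp: compact_eq_bounded_closed intro: bounded_subset)
qed

lemma frechet_derivative_mult_real:
 fixes f g :: "'a::euclidean_space => real"
 assumes "(f has_derivative D) (at x)" "(g has_derivative E) (at x)"
 shows "frechet_derivative (%x. f x * g x) (at x) v = f x * E v + D v * g x"
 using has_derivative_mult[OF assms] by (metis frechet_derivative_at)

lemma matrix_sum_axis: "(\<Sum>i\<in>UNIV. \<Sum>j\<in>UNIV. f i j *\<^sub>R (axis i (axis j 1) :: real^'n^'N)) $ a $ b = f a b"
proof -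
 have "(\<Sum>j\<in>UNIV. f i j * axis i (axis j 1) $ a $ b) = (if i = a then f i b else 0)" for i
 proof (cases "i = a")
  case True
  have "f i j * axis i (axis j 1) $ a $ b = (if j = b then f i b else 0)" for j
   using True by (simp add: axis_def)
  thus ?thesis using True by simp
 qed (simp add: axis_def)
 thus ?thesis by simp
qed

lemma wgrad_smooth:
 fixes w :: "real^'n => real^'N"
 assumes w: "w : tests"
 shows "wgrad UNIV w (%x. \<chi> i j. pd w j x $ i)"
proof -
 let ?G = "%x. \<chi> i j. pd w j x $ i"
 have iw: "lintegrable w" using w by (rule tests_bounded_set_integrable)
 have iD: "lintegrable (%x. pd w j x)" for j
  using test_functions_derivative[OF w] by (rule tests_bounded_set_integrable)
 have "?G = (%x. \<Sum>i\<in>UNIV. \<Sum>j\<in>UNIV. (pd w j x $ i) *\<^sub>R axis i (axis j 1))"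
  by (simp only: fun_eq_iff vec_eq_iff matrix_sum_axis vec_lambda_beta simp_thms)
 moreover have "lintegrable (%x. \<Sum>i\<in>UNIV. \<Sum>j\<in>UNIV. (pd w j x $ i) *\<^sub>R (axis i (axis j 1) :: real^'n^'N))"
  unfolding component_eq_inner
  by (intro Bochner_Integration.integrable_sum integrable_scaleR_left integrable_inner_left iD)
 ultimately have iG: "lintegrable ?G" by simp
 have "(LBINT x. w x $ i * pd \<phi> j x) = - (LBINT x. ?G x $ i $ j * \<phi> x)"
  if \<phi>: "\<phi> : tests" for \<phi> :: "real^'n => real" and i j
 proof -
  have bl: "bounded_linear (%v::real^'N. v $ i)" by (rule bounded_linear_vec_nth)
  have wi: "(%x. w x $ i) : tests"
  proof -
   have "{x. w x $ i ~= 0} <= {x. w x ~= 0}" by auto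
   thus ?thesis using w C_k_linear_post[OF bl] unfolding tests_iff by (blast intro: bounded_subset)
  qed
  have dw: "((%x. w x $ i) has_derivative (%v. frechet_derivative w (at x) v $ i)) (at x)" for x
   by (rule bounded_linear.has_derivative[OF bl tests_derivative[OF w]])
  note dphi = tests_derivative[OF \<phi>]
  let ?\<chi> = "%x. w x $ i * \<phi> x"
  have \<chi>: "?\<chi> : tests" using wi \<phi> by (intro test_functions_mult) (auto simp: tests_iff)
  have i1: "lintegrable (%x. w x $ i * pd \<phi> j x)"
   using wi test_functions_derivative[OF \<phi>] by (intro tests_bounded_set_integrable test_functions_mult) (auto simp: tests_iff)
  have wj: "(%x. pd (%x. w x $ i) j x) : tests" by (rule test_functions_derivative[OF wi])
  have fd: "frechet_derivative (%x. w x $ i) (at x) = (%v. frechet_derivative w (at x) v $ i)" for x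
   using dw by (metis frechet_derivative_at)
  have i2: "lintegrable (%x. pd w j x $ i * \<phi> x)"
   using wj \<phi> unfolding fd by (intro tests_bounded_set_integrable test_functions_mult) (auto simp: tests_iff)
  have "0 = (LBINT x. pd ?\<chi> j x)" using integral_derivative_test[OF \<chi>] by simp
  also have "... = (LBINT x. w x $ i * pd \<phi> j x + pd w j x $ i * \<phi> x)"
   by (simp add: frechet_derivative_mult_real[OF dw dphi])
  also have "... = (LBINT x. w x $ i * pd \<phi> j x) + (LBINT x. pd w j x $ i * \<phi> x)"
   using i1 i2 by simp
  finally show ?thesis by simp
 qed
 thus ?thesis unfolding wgrad_def using iw iG by auto
qed

lemma wgrad_translate:
 assumes w: "wgrad S u G"
 shows "wgrad ((%x. x - h) ` S) (%x. u (x + h)) (%x. G (x + h))"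
proof -
 note w' = wgradD[OF w]
 note [measurable] = w'(3,4)
 have "(LBINT x. u (x + h) $ i * pd \<phi> j x) = - (LBINT x. G (x + h) $ i $ j * \<phi> x)"
  if \<phi>: "\<phi> : test_functions ((%x. x - h) ` S)" for \<phi> i j
 proof -
  let ?\<psi> = "%x. \<phi> (x - h)"
  have \<phi>': "\<phi> : tests" using \<phi> by (rule test_functions_UNIV)
  have d: "frechet_derivative ?\<psi> (at x) v = frechet_derivative \<phi> (at (x - h)) v" for x v
  proof -
   have "(?\<psi> has_derivative (%v. frechet_derivative \<phi> (at (x - h)) v)) (at x)"
    by (rule has_derivative_compose[OF _ tests_derivative[OF \<phi>']]) (auto intro!: derivative_eq_intros)
   thus ?thesis by (metis frechet_derivative_at)
  qed
  have \<psi>: "?\<psi> : test_functions S"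
   unfolding test_functions_def mem_Collect_eq
  proof (intro conjI allI)
   show "C_k k ?\<psi>" for k
    using C_k_bounded_linear_comp[OF bounded_linear_ident, of k \<phi> "- h"] \<phi>' by (simp add: tests_iff)
   have eq: "{x. ?\<psi> x ~= 0} = (%x. h + x) ` {x. \<phi> x ~= 0}"
    by (auto simp: image_iff intro!: exI[of _ "_ - h"])
   have cl: "closure {x. ?\<psi> x ~= 0} = (%x. h + x) ` closure {x. \<phi> x ~= 0}"
    unfolding eq by (rule closure_translation)
   show "compact (closure {x. ?\<psi> x ~= 0})"
    unfolding cl using \<phi> by (intro compact_translation) (auto simp: test_functions_def)
   show "closure {x. ?\<psi> x ~= 0} <= S" unfolding cl using \<phi> by (auto simp: test_functions_def)
  qed
  have m: "\<phi> : borelfun" "(%x. frechet_derivative \<phi> (at x) v) : borelfun" for v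
   using tests_borel \<phi>' test_functions_derivative by auto
  note [measurable] = m
  have [measurable]: "(%x. u x $ i) : borelfun" "(%x. G x $ i $ j) : borelfun"
   unfolding component_eq_inner[of _ i] component2_eq_inner by auto
  have "(LBINT x. u (x + h) $ i * pd \<phi> j x) = (LBINT x. u x $ i * frechet_derivative \<phi> (at (x - h)) (axis j 1))"
   using lborel_integral_shift(1)[of "%x. u x $ i * frechet_derivative \<phi> (at (x - h)) (axis j 1)" h] by simp
  also have "... = - (LBINT x. G x $ i $ j * \<phi> (x - h))" using w'(5)[OF \<psi>, of i j] by (simp add: d)
  also have "(LBINT x. G x $ i $ j * \<phi> (x - h)) = (LBINT x. G (x + h) $ i $ j * \<phi> x)"
   using lborel_integral_shift(1)[of "%x. G x $ i $ j * \<phi> (x - h)" h] by simp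
  finally show ?thesis .
 qed
 moreover have "lintegrable (%x. u (x + h))" "lintegrable (%x. G (x + h))"
  using w' by (simp_all add: lborel_integral_shift(2))
 ultimately show ?thesis unfolding wgrad_def by auto
qed

lemma test_integrable_component:
 assumes \<phi>: "\<phi> : tests" and u: "lintegrable (u :: real^'n => real^'N)"
 shows "lintegrable (%x. u x $ i * \<phi> x)"
proof -
 obtain B where B: "0 <= B" "!!x. norm (\<phi> x) <= B" using tests_bounded[OF \<phi>] by blast
 note [measurable] = tests_borel[OF \<phi>]
 have ui: "lintegrable (%x. u x $ i)" unfolding component_eq_inner using u by auto
 hence [measurable]: "(%x. u x $ i) : borelfun" by auto
 show ?thesis
  by (rule integrable_bound'[where f="%x. u x $ i * B"])
   (use ui B in \<open>auto simp: abs_mult intro!: mult_left_mono\<close>)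
qed

lemma wgrad_diff:
 assumes "wgrad S u G" "wgrad S v H"
 shows "wgrad S (%x. u x - v x) (%x. G x - H x)"
proof -
 note u = wgradD[OF assms(1)] and v = wgradD[OF assms(2)]
 have "(LBINT x. (u x - v x) $ i * pd \<phi> j x) = - (LBINT x. (G x - H x) $ i $ j * \<phi> x)"
  if \<phi>: "\<phi> : test_functions S" for \<phi> i j
 proof -
  have \<phi>': "\<phi> : tests" using \<phi> by (rule test_functions_UNIV)
  have comp: "lintegrable (%x. (A x :: real^'n^'b) $ i)" if "lintegrable A" for A i
   using integrable_bounded_linear[OF bounded_linear_vec_nth that] .
  show ?thesis
   using u(5)[OF \<phi>, of i j] v(5)[OF \<phi>, of i j]
    test_integrable_component[OF test_functions_derivative[OF \<phi>'] u(1)] test_integrable_component[OF test_functions_derivative[OF \<phi>'] v(1)]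
    test_integrable_component[OF \<phi>' comp[OF u(2)]] test_integrable_component[OF \<phi>' comp[OF v(2)]]
   by (simp add: left_diff_distrib)
 qed
 thus ?thesis unfolding wgrad_def using u v by auto
qed

lemma wgrad_scaleR:
 assumes "wgrad S u G"
 shows "wgrad S (%x. c *\<^sub>R u x) (%x. c *\<^sub>R G x)"
 using wgradD[OF assms] unfolding wgrad_def by (auto simp: mult.assoc)

section \<open>Bounded cutoffs with discontinuous gradients and the product rule\<close>

lemma conv_bounded_tendsto:
 fixes f :: "'a::euclidean_space => 'b::euclidean_space"
 assumes f: "lintegrable f" and b: "b : borelfun" "!!x. \<bar>b x\<bar> <= B"
 shows "(%k. (LBINT x. b x * (mconv k f x \<bullet> c))) ----> (LBINT x. b x * (f x \<bullet> c))"
  and "lintegrable (%x. b x * (f x \<bullet> c))"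
proof -
 note [measurable] = b(1)
 have B0: "0 <= B" using b(2)[of 0] by simp
 have ig: "lintegrable (%x. b x * (g x \<bullet> c))" if g: "lintegrable g" for g :: "'a => 'b"
 proof (rule integrable_bound'[where f="%x. B * (norm (g x) * norm c)"])
  have [measurable]: "g : borelfun" using g by auto
  show "(%x. b x * (g x \<bullet> c)) : borel_measurable lborel" by measurable
  have "\<bar>b x * (g x \<bullet> c)\<bar> <= B * (norm (g x) * norm c)" for x
   unfolding abs_mult using b(2)[of x] B0 by (intro mult_mono Cauchy_Schwarz_ineq2) auto
  thus "AE x in lborel. norm (b x * (g x \<bullet> c)) <= norm (B * (norm (g x) * norm c))"
   using B0 by (auto simp: abs_mult)
 qed (use g in auto)
 show "lintegrable (%x. b x * (f x \<bullet> c))" by (rule ig[OF f])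
 have "norm ((LBINT x. b x * (mconv k f x \<bullet> c)) - (LBINT x. b x * (f x \<bullet> c)))
   <= B * norm c * (LBINT x. norm (mconv k f x - f x))" for k
 proof -
  have "(LBINT x. b x * (mconv k f x \<bullet> c)) - (LBINT x. b x * (f x \<bullet> c)) = (LBINT x. b x * ((mconv k f x - f x) \<bullet> c))"
   using ig[OF f] ig[OF integrable_conv[OF f]] by (simp add: inner_diff_left right_diff_distrib)
  also have "norm ... <= (LBINT x. B * norm c * norm (mconv k f x - f x))"
  proof (rule Bochner_Integration.integral_norm_bound_integral)
   show "norm (b x * ((mconv k f x - f x) \<bullet> c)) <= B * norm c * norm (mconv k f x - f x)" for x
   proof -
    have "\<bar>b x\<bar> * \<bar>(mconv k f x - f x) \<bullet> c\<bar> <= B * (norm (mconv k f x - f x) * norm c)"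
     using b(2)[of x] B0 by (intro mult_mono Cauchy_Schwarz_ineq2) auto
    thus ?thesis by (simp add: abs_mult mult_ac)
   qed
  qed (use ig[OF conv_L1(1)[OF f]] conv_L1(1)[OF f] in auto)
  finally show ?thesis by simp
 qed
 hence "(%k. (LBINT x. b x * (mconv k f x \<bullet> c)) - (LBINT x. b x * (f x \<bullet> c))) ----> 0"
  by (intro Lim_null_comparison[OF always_eventually tendsto_mult_right_zero[OF conv_L1(2)[OF f]]]) blast
 thus "(%k. (LBINT x. b x * (mconv k f x \<bullet> c))) ----> (LBINT x. b x * (f x \<bullet> c))"
  by (simp add: LIM_zero_iff)
qed

text \<open>The cutoffs used later have gradients built from indicators of measurable sets of
  slices, hence merely bounded; the weak identity is required against all smooth functions of
  compact support.\<close>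

definition bounded_wgrad :: "(real^'n => real) => (real^'n => real^'n) => bool" where
 "bounded_wgrad \<eta> g \<longleftrightarrow> \<eta> : borelfun \<and> g : borelfun \<and>
  (\<exists>B. \<forall>x. \<bar>\<eta> x\<bar> <= B \<and> norm (g x) <= B) \<and>
  (\<forall>\<phi>\<in>tests. \<forall>j. (LBINT x. \<eta> x * pd \<phi> j x) = - (LBINT x. g x $ j * \<phi> x))"

lemma compact_in_open_cball:
 fixes K :: "'a::euclidean_space set"
 assumes "compact K" "open S" "K <= S"
 obtains d where "0 < d" "!!x. x : K ==> cball x d <= S"
proof -
 obtain d where d: "0 < d" "(\<Union>x\<in>K. ball x d) <= S"
  using compact_subset_open_imp_ball_epsilon_subset[OF assms] by blast
 have "cball x (d / 2) <= S" if "x : K" for x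
 proof -
  have "cball x (d / 2) <= ball x d" using d(1) by auto
  thus ?thesis using d(2) that by blast
 qed
 thus thesis using that[of "d / 2"] d(1) by simp
qed

text \<open>Only \<open>w\<close> is mollified. Its mollification times \<phi> is a smooth test
  function for the cutoff, and the resulting identity survives the limit because mollifications
  converge in L1 and the coefficients are bounded. Compactness of \<open>K\<close> in
  \<open>S\<close> leaves room for the mollification radius.\<close>

lemma wgrad_product:
 fixes w :: "real^'n => real^'N"
 assumes w: "wgrad S w G" and \<eta>: "bounded_wgrad \<eta> g" and K: "compact K" "K <= S" "open S"
  and zero: "!!x. x \<notin> K ==> \<eta> x = 0" "!!x. x \<notin> K ==> g x = 0"
 shows "wgrad UNIV (%x. \<eta> x *\<^sub>R w x) (%x. \<eta> x *\<^sub>R G x + (\<chi> i j. w x $ i * g x $ j))"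
proof -
 note w' = wgradD[OF w]
 have [measurable]: "\<eta> : borelfun" "g : borelfun" using \<eta> by (auto simp: bounded_wgrad_def)
 note [measurable] = w'(3,4)
 obtain B where B: "!!x. \<bar>\<eta> x\<bar> <= B" "!!x. norm (g x) <= B" using \<eta> unfolding bounded_wgrad_def by blast
 have [measurable]: "(%x. g x $ j) : borelfun" for j unfolding component_eq_inner by measurable
 have gj: "\<bar>g x $ j\<bar> <= B" for x j using component_le_norm_cart[of "g x" j] B(2)[of x] by linarith
 have i1: "lintegrable (%x. \<eta> x *\<^sub>R w x)"
  by (rule integrable_bound'[where f="%x. B *\<^sub>R w x"]) (use w' B in \<open>auto intro!: mult_mono order_trans[OF B(1)]\<close>)
 have i2: "lintegrable (%x. \<eta> x *\<^sub>R G x)"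
  by (rule integrable_bound'[where f="%x. B *\<^sub>R G x"]) (use w' B in \<open>auto intro!: mult_mono order_trans[OF B(1)]\<close>)
 have wg: "lintegrable (%x. g x $ j * (w x \<bullet> c))" for j c
  by (rule conv_bounded_tendsto(2)[OF w'(1)]) (auto intro: gj)
 have i3: "lintegrable (%x. (\<chi> i j. w x $ i * g x $ j) :: real^'n^'N)"
 proof -
  have "(%x. (\<chi> i j. w x $ i * g x $ j) :: real^'n^'N) = (%x. \<Sum>i\<in>UNIV. \<Sum>j\<in>UNIV. (g x $ j * (w x \<bullet> axis i 1)) *\<^sub>R axis i (axis j 1))"
   by (simp only: fun_eq_iff vec_eq_iff matrix_sum_axis vec_lambda_beta simp_thms) (simp add: inner_axis mult.commute)
  moreover have "lintegrable (%x. \<Sum>i\<in>UNIV. \<Sum>j\<in>UNIV. (g x $ j * (w x \<bullet> axis i 1)) *\<^sub>R (axis i (axis j 1) :: real^'n^'N))"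
   by (intro Bochner_Integration.integrable_sum integrable_scaleR_left wg)
  ultimately show ?thesis by simp
 qed
 have "(LBINT x. (\<eta> x *\<^sub>R w x) $ i * pd \<phi> j x)
   = - (LBINT x. (\<eta> x *\<^sub>R G x + (\<chi> i j. w x $ i * g x $ j)) $ i $ j * \<phi> x)"
  if \<phi>: "\<phi> : tests" for \<phi> :: "real^'n => real" and i j
 proof -
  obtain Bp where Bp: "0 <= Bp" "!!x. norm (\<phi> x) <= Bp" using tests_bounded[OF \<phi>] by blast
  obtain Bd where Bd: "0 <= Bd" "!!x. norm (pd \<phi> j x) <= Bd"
   using tests_bounded[OF test_functions_derivative[OF \<phi>]] by blast
  have B0: "0 <= B" using B(1)[of 0] by simp
  have [measurable]: "\<phi> : borelfun" "(%x. pd \<phi> j x) : borelfun"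
   using tests_borel \<phi> test_functions_derivative by auto
  obtain d where d: "0 < d" "!!x. x : K ==> cball x d <= S" using compact_in_open_cball[OF K(1,3,2)] by blast
  obtain no where no: "1 / real (Suc no) < d" using d(1) nat_approx_posE by metis
  let ?b1 = "%x. \<eta> x * pd \<phi> j x" and ?b2 = "%x. \<eta> x * \<phi> x" and ?b3 = "%x. g x $ j * \<phi> x"
  have b: "\<bar>?b1 x\<bar> <= B * Bd" "\<bar>?b2 x\<bar> <= B * Bp" "\<bar>?b3 x\<bar> <= B * Bp" for x
   unfolding abs_mult using B0 B(1)[of x] gj[of x j] Bp(2)[of x] Bd(2)[of x] by (auto intro!: mult_mono)
  have bm: "?b1 : borelfun" "?b2 : borelfun" "?b3 : borelfun" by measurable
  note T1 = conv_bounded_tendsto[OF w'(1) bm(1) b(1), of "axis i 1"]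
  note T2 = conv_bounded_tendsto[OF w'(2) bm(2) b(2), of "axis i (axis j 1)"]
  note T3 = conv_bounded_tendsto[OF w'(1) bm(3) b(3), of "axis i 1"]
  have eq: "(LBINT x. ?b1 x * (mconv k w x \<bullet> axis i 1))
    = - (LBINT x. ?b2 x * (mconv k G x \<bullet> axis i (axis j 1))) - (LBINT x. ?b3 x * (mconv k w x \<bullet> axis i 1))"
   if k: "no <= k" for k
  proof -
   let ?w = "%x. mconv k w x $ i"
   have bl: "bounded_linear (%v::real^'N. v $ i)" by (rule bounded_linear_vec_nth)
   have Cw: "C_k m ?w" for m by (intro C_k_linear_post[OF bl] C_k_conv w' moll_tests)
   have dw: "(?w has_derivative (%v. frechet_derivative (mconv k w) (at x) v $ i)) (at x)" for x
    using C_k_conv[OF w'(1) moll_tests, of "Suc 0" k] by (intro bounded_linear.has_derivative[OF bl] C_k_Suc_derivative)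
   have t: "(%x. ?w x * \<phi> x) : tests" by (rule test_functions_mult[OF Cw \<phi>])
   have fd: "frechet_derivative (%x. ?w x * \<phi> x) (at x) v = ?w x * frechet_derivative \<phi> (at x) v + frechet_derivative (mconv k w) (at x) v $ i * \<phi> x" for x v
    by (rule frechet_derivative_mult_real[OF dw tests_derivative[OF \<phi>]])
   have kd: "1 / real (Suc k) <= d"
   proof -
    have "1 / real (Suc k) <= 1 / real (Suc no)" using k by (simp add: frac_le)
    thus ?thesis using no by simp
   qed
   \<comment> \<open>Off \<open>K\<close> both sides vanish, so the gradient of
     \<open>mconv k w\<close> has to be identified with \<open>mconv k G\<close> only on
     \<open>K\<close>.\<close>
   have dG: "\<eta> x * (pd (mconv k w) j x $ i) = \<eta> x * (mconv k G x \<bullet> axis i (axis j 1))" for x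
   proof (cases "x : K")
    case True
    have "cball x (1 / real (Suc k)) <= S" using d(2)[OF True] kd by (meson order_trans subset_cball)
    hence "(mconv k w has_derivative (%v. mconv k G x *v v)) (at x)" by (rule conv_moll_wgrad[OF w])
    hence "frechet_derivative (mconv k w) (at x) = (%v. mconv k G x *v v)" by (metis frechet_derivative_at)
    thus ?thesis by (simp add: matrix_mult_axis inner_axis)
   qed (simp add: zero)
   have e1: "?b1 x * (mconv k w x \<bullet> axis i 1) + ?b2 x * (mconv k G x \<bullet> axis i (axis j 1))
     = \<eta> x * pd (%x. ?w x * \<phi> x) j x" for x
   proof -
    have "?b2 x * (mconv k G x \<bullet> axis i (axis j 1)) = \<phi> x * (\<eta> x * (mconv k G x \<bullet> axis i (axis j 1)))" by simp
    also have "... = \<phi> x * (\<eta> x * (pd (mconv k w) j x $ i))" by (simp only: dG)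
    finally show ?thesis unfolding fd by (simp add: inner_axis algebra_simps)
   qed
   have "(LBINT x. \<eta> x * pd (%x. ?w x * \<phi> x) j x) = - (LBINT x. g x $ j * (?w x * \<phi> x))"
    using \<eta> t unfolding bounded_wgrad_def by blast
   hence "(LBINT x. ?b1 x * (mconv k w x \<bullet> axis i 1) + ?b2 x * (mconv k G x \<bullet> axis i (axis j 1))) = - (LBINT x. ?b3 x * (mconv k w x \<bullet> axis i 1))"
    unfolding e1 by (simp add: inner_axis mult_ac)
   moreover have "lintegrable (%x. ?b1 x * (mconv k w x \<bullet> axis i 1))" "lintegrable (%x. ?b2 x * (mconv k G x \<bullet> axis i (axis j 1)))"
    using conv_bounded_tendsto(2)[OF integrable_conv[OF w'(1)] bm(1) b(1)] conv_bounded_tendsto(2)[OF integrable_conv[OF w'(2)] bm(2) b(2)] by auto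
   ultimately show ?thesis by (simp add: algebra_simps)
  qed
  have "(LBINT x. ?b1 x * (w x \<bullet> axis i 1)) = - (LBINT x. ?b2 x * (G x \<bullet> axis i (axis j 1))) - (LBINT x. ?b3 x * (w x \<bullet> axis i 1))"
  proof (rule LIMSEQ_unique[OF T1(1)])
   show "(%k. (LBINT x. ?b1 x * (mconv k w x \<bullet> axis i 1))) ----> - (LBINT x. ?b2 x * (G x \<bullet> axis i (axis j 1))) - (LBINT x. ?b3 x * (w x \<bullet> axis i 1))"
    by (rule Lim_transform_eventually[OF tendsto_diff[OF tendsto_minus[OF T2(1)] T3(1)]])
     (use eq in \<open>auto simp: eventually_sequentially intro!: exI[of _ no]\<close>)
  qed
  thus ?thesis using T2(2) T3(2)
   by (simp add: inner_axis algebra_simps)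
 qed
 thus ?thesis unfolding wgrad_def using i1 i2 i3 by auto
qed

section \<open>Sobolev inequalities for weakly differentiable maps\<close>

lemma AE_lborel_shift:
 assumes "AE x in lborel. P (x::'a::euclidean_space)"
 shows "AE x in lborel. P (x + h)"
proof -
 obtain N where "N : null_sets lborel" "!!x. x : space lborel - N ==> P x" using AE_E3[OF assms] by blast
 hence N: "{x. \<not> P x} <= N" "N : null_sets lborel" by auto
 have [measurable]: "N : sets borel" using N by auto
 have "(NBINT x. ind N (x + h)) = (NBINT x. ind N x)"
  by (rule nn_integral_lborel_shift) measurable
 also have "... = 0" using N by (simp add: null_sets_def)
 finally have "AE x in lborel. ind N (x + h) = (0::ennreal)" by (subst (asm) nn_integral_0_iff_AE) auto
 thus ?thesis using N(1) by (auto elim!: eventually_mono simp: indicator_def split: if_splits)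
qed

lemma AE_slice:
 assumes "AE x in lborel. P (x::real^'n)"
 shows "AE t in lborel. AE y in PL (UNIV - {j}). P (vec_upd (UNIV - {j}) (axis j t) y)"
proof -
 obtain N where "N : null_sets lborel" "!!x. x : space lborel - N ==> P x" using AE_E3[OF assms] by blast
 hence N: "{x. \<not> P x} <= N" "N : null_sets lborel" by auto
 have [measurable]: "N : sets borel" using N by auto
 have "(NBINT t. slice j (ind N) t) = (NBINT x. ind N x)"
  by (rule nn_integral_slice[symmetric]) measurable
 also have "... = 0" using N by (simp add: null_sets_def)
 finally have "AE t in lborel. slice j (ind N) t = 0" by (subst (asm) nn_integral_0_iff_AE) auto
 thus ?thesis
 proof eventually_elim
  case (elim t)
  hence "AE y in PL (UNIV - {j}). ind N (vec_upd (UNIV - {j}) (axis j t) y) = (0::ennreal)"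
   unfolding slice_def by (subst (asm) nn_integral_0_iff_AE) auto
  thus ?case using N(1) by (auto elim!: eventually_mono simp: indicator_def split: if_splits)
 qed
qed

lemma slice_cong_AE:
 assumes "AE x in lborel. f x = g x"
 shows "AE t in lborel. slice j f t = slice j g t"
 using AE_slice[OF assms, of j] unfolding slice_def by eventually_elim (rule nn_integral_cong_AE)

text \<open>A companion of Fatou's lemma: a power is monotone with monotone inverse, so it passes
  through the lower limit in the direction needed there.\<close>

lemma epow_liminf:
 assumes a: "0 < a"
 shows "epow (liminf x) a <= liminf (%n. epow (x n) a)"
 unfolding le_Liminf_iff
proof (intro allI impI)
 fix y assume y: "y < epow (liminf x) a"
 have eq: "epow (epow z (1 / a)) a = z" for z using a by (simp add: epow_epow)
 have "epow y (1 / a) < liminf x"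
 proof (rule ccontr)
  assume "\<not> epow y (1 / a) < liminf x"
  hence "epow (liminf x) a <= epow (epow y (1 / a)) a" using a by (intro epow_mono) auto
  thus False using y eq[of y] by simp
 qed
 hence "\<forall>\<^sub>F n in sequentially. epow y (1 / a) < x n" by (rule less_LiminfD)
 thus "\<forall>\<^sub>F n in sequentially. y < epow (x n) a"
 proof eventually_elim
  case (elim n)
  show ?case
  proof (rule ccontr)
   assume "\<not> y < epow (x n) a"
   hence "epow (epow (x n) a) (1 / a) <= epow y (1 / a)" using a by (intro epow_mono) auto
   thus False using elim a by (simp add: epow_epow)
  qed
 qed
qed

lemma rpow_young:
 assumes "0 <= a" "0 <= b" "2 <= (p::real)"
 shows "rpow a (p - 2) * b\<^sup>2 <= a powr p + b powr p"
proof (cases "max a b = 0")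
 case True
 hence "a = 0" "b = 0" using assms by (auto simp: max_def split: if_splits)
 thus ?thesis by simp
next
 case False
 define m where "m = max a b"
 have m: "0 < m" using False assms by (simp add: m_def max_def split: if_splits)
 have "rpow a (p - 2) * b\<^sup>2 <= rpow m (p - 2) * m\<^sup>2"
  using assms by (intro mult_mono rpow_mono power_mono) (auto simp: m_def)
 also have "... = m powr (p - 2) * m powr 2" using m by (simp add: rpow_eq_powr powr_numeral)
 also have "... = m powr p" by (simp only: powr_add[symmetric]) simp
 also have "... <= a powr p + b powr p" by (auto simp: m_def max_def)
 finally show ?thesis .
qed

lemma tendsto_rpow_norm:
 assumes "x ----> (l::'b::real_normed_vector)" "0 <= a"
 shows "(%n. rpow (norm (x n)) a) ----> rpow (norm l) a"
 using assms by (cases "a = 0") (auto simp: rpow_def intro!: tendsto_powr2 tendsto_norm)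

lemma borel_measurable_rpow [measurable]: "f : borel_measurable M ==> (%x. rpow (f x) a) : borel_measurable M"
 unfolding rpow_def by (cases "a = 0") auto

lemma integral_conv_Jensen:
 fixes f :: "'a::euclidean_space => 'b::euclidean_space"
 assumes f: "lintegrable f" and p: "1 <= p" and fp: "lintegrable (%x. norm (f x) powr p)"
 shows "lintegrable (%x. norm (mconv k f x) powr p)"
  "(LBINT x. norm (mconv k f x) powr p) <= (LBINT x. norm (f x) powr p)"
proof -
 have [measurable]: "mconv k f : borelfun" using f by measurable
 have le: "(NBINT x. np (mconv k f x) p) <= en (LBINT x. norm (f x) powr p)"
  using conv_Jensen[OF f p, of k] nn_integral_eq_integral[OF fp] by simp
 show i: "lintegrable (%x. norm (mconv k f x) powr p)"
  by (rule integrableI_nonneg) (use le in \<open>auto simp: order_le_less_trans\<close>)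
 show "(LBINT x. norm (mconv k f x) powr p) <= (LBINT x. norm (f x) powr p)"
  using le nn_integral_eq_integral[OF i] by (simp add: integral_nonneg_AE)
qed

lemma conv_zero_outside:
 assumes "!!x. R <= norm x ==> f x = 0" "R + 1 <= norm x"
 shows "mconv k f x = 0"
proof (rule conv_eq_0)
 fix y assume "moll k (x - y) ~= 0"
 hence "norm (x - y) <= 1 / real (Suc k)" by (rule moll_support)
 also have "... <= 1" by simp
 finally show "f y = 0" using assms(2) norm_triangle_ineq2[of x y] by (intro assms(1)) (simp add: norm_minus_commute)
qed

context
 fixes \<Phi> :: "real^'n => real^'N" and \<Psi> :: "real^'n => real^'n^'N" and p s R :: real
 assumes w: "wgrad UNIV \<Phi> \<Psi>" and p: "2 <= p" and s: "2 <= s"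
  and supp: "!!x. R <= norm x ==> \<Phi> x = 0"
  and int: "lintegrable (%x. norm (\<Phi> x) powr p)" "lintegrable (%x. norm (\<Psi> x) powr p)"
begin

private abbreviation (input) "wk k \<equiv> mconv k \<Phi>"
private abbreviation (input) "ek k \<equiv> (%x. norm (mconv k \<Psi> x))"
private abbreviation (input) "fk k \<equiv> (%x. norm (wk k x) powr p + rpow (norm (wk k x)) (p - 2) * (ek k x)\<^sup>2)"
private abbreviation (input) "f0 \<equiv> (%x. norm (\<Phi> x) powr p + rpow (norm (\<Phi> x)) (p - 2) * (norm (\<Psi> x))\<^sup>2)"

private lemma meas: "\<Phi> : borelfun" "\<Psi> : borelfun"
 "wk k : borelfun" "mconv k \<Psi> : borelfun"
 using wgradD[OF w] by measurable

private lemma smooth_slice: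
 assumes "I ~= {}" "(real (card I) - 2) * s <= 2 * real (card I)"
 shows "epow (\<integral>\<^sup>+y. np (wk k (vec_upd I z y)) (p * s / 2) \<partial>PL I) (2 / s)
  <= en ((s + 2)\<^sup>2 * p\<^sup>2 / 8) * (\<integral>\<^sup>+y. en (fk k (vec_upd I z y)) \<partial>PL I)"
proof (rule sobolev_smooth[OF p assms(1) s assms(2)])
 show "(wk k has_derivative (%v. mconv k \<Psi> x *v v)) (at x)" for x
  by (rule conv_moll_wgrad[OF w]) simp
 show "continuous_on UNIV (ek k)"
  by (intro continuous_on_norm conv_continuous moll_tests wgradD[OF w])
 show "norm (mconv k \<Psi> x *v axis i 1) <= ek k x" for x i
  using norm_matrix_mult_le[of "mconv k \<Psi> x" "axis i 1"] by (simp add: norm_axis_1)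
 show "wk k x = 0" if "R + 1 <= norm x" for x
  using supp that by (rule conv_zero_outside)
qed

text \<open>The right-hand sides converge along a subsequence. Young's inequality bounds them by
  twice the sum of the p-th powers of the mollified map and gradient, and Jensen's inequality bounds
  the integrals of these majorants; this is the situation of
  \<open>generalized_dominated_convergence\<close>.\<close>

private lemma limits:
 obtains r where "strict_mono r" "AE x in lborel. (%k. wk (r k) x) ----> \<Phi> x"
  "lintegrable f0"
  "(%k. (NBINT x. en (fk (r k) x))) ----> (NBINT x. en (f0 x))"
proof -
 note [measurable] = meas
 note w' = wgradD[OF w]
 obtain r where r: "strict_mono r" "AE x in lborel. (%k. wk (r k) x) ----> \<Phi> x" "AE x in lborel. (%k. mconv (r k) \<Psi> x) ----> \<Psi> x"
  using conv_AE_subseq2[OF w'(1,2)] by blast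
 let ?H = "%k x. 2 * (norm (wk (r k) x) powr p + ek (r k) x powr p)" and ?HL = "%x. 2 * (norm (\<Phi> x) powr p + norm (\<Psi> x) powr p)"
 note J1 = integral_conv_Jensen[OF w'(1) _ int(1)] and J2 = integral_conv_Jensen[OF w'(2) _ int(2)]
 have p1: "1 <= p" using p by simp
 have g0: "0 <= fk k x" "0 <= f0 x" for k x by auto
 have G: "lintegrable f0" "!!k. lintegrable (fk (r k))" "(%k. (LBINT x. \<bar>fk (r k) x - f0 x\<bar>)) ----> 0"
 proof (atomize(full), rule conjI, goal_cases)
  have D: "AE x in lborel. (%k. fk (r k) x) ----> f0 x" "AE x in lborel. (%k. ?H k x) ----> ?HL x"
  proof -
   show "AE x in lborel. (%k. fk (r k) x) ----> f0 x" using r(2,3)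
    by eventually_elim (use p in \<open>intro tendsto_intros tendsto_powr2 tendsto_rpow_norm; simp\<close>)
   show "AE x in lborel. (%k. ?H k x) ----> ?HL x" using r(2,3)
    by eventually_elim (use p in \<open>intro tendsto_intros tendsto_powr2 tendsto_norm; simp\<close>)
  qed
  have bd: "AE x in lborel. \<bar>fk (r k) x\<bar> <= ?H k x" for k
  proof (rule AE_I2)
   fix x
   show "\<bar>fk (r k) x\<bar> <= ?H k x"
    using rpow_young[of "norm (wk (r k) x)" "ek (r k) x" p] p powr_ge_zero[of "ek (r k) x" p]
     powr_ge_zero[of "norm (wk (r k) x)" p] unfolding abs_of_nonneg[OF g0(1)] by (simp only: norm_ge_zero True_implies_equals) argo
  qed
  have iH: "lintegrable (?H k)" "lintegrable ?HL" "(LBINT x. ?H k x) <= (LBINT x. ?HL x)" for k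
   using J1[OF p1, of "r k"] J2[OF p1, of "r k"] int by auto
  note GD = generalized_dominated_convergence[where f="%k. fk (r k)" and ?f0.0=f0 and H="?H" and ?H0.0="?HL" and M=lborel, OF _ _ D bd iH]
  {
   case 1 show ?case by (rule GD(1)) measurable
  next
   case 2 show ?case by (intro conjI allI GD(2,3)) measurable
  }
 qed
 have "(%k. (LBINT x. fk (r k) x)) ----> (LBINT x. f0 x)"
 proof (rule LIM_zero_cancel, rule Lim_null_comparison[OF _ G(3)], rule always_eventually, rule allI)
  fix k
  have "(LBINT x. fk (r k) x) - (LBINT x. f0 x) = (LBINT x. fk (r k) x - f0 x)"
   by (rule Bochner_Integration.integral_diff[symmetric, OF G(2) G(1)])
  thus "norm ((LBINT x. fk (r k) x) - (LBINT x. f0 x)) <= (LBINT x. \<bar>fk (r k) x - f0 x\<bar>)"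
   using integral_norm_bound[of lborel "%x. fk (r k) x - f0 x"] by (simp only: real_norm_def)
 qed
 hence "(%k. en (LBINT x. fk (r k) x)) ----> en (LBINT x. f0 x)" by (rule tendsto_ennrealI)
 moreover have "(NBINT x. en (fk (r k) x)) = en (LBINT x. fk (r k) x)" for k
  by (rule nn_integral_eq_integral[OF G(2)]) (auto intro!: AE_I2 g0)
 moreover have "(NBINT x. en (f0 x)) = en (LBINT x. f0 x)"
  by (rule nn_integral_eq_integral[OF G(1)]) (auto intro!: AE_I2 g0)
 ultimately show thesis using that[of r] r G(1) by (simp only:)
qed

private lemma liminf_eq:
 assumes "(%k. wk (r k) x) ----> \<Phi> x"
 shows "np (\<Phi> x) (p * s / 2) = liminf (%k. np (wk (r k) x) (p * s / 2))"
proof -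
 have "(%k. np (wk (r k) x) (p * s / 2)) ----> np (\<Phi> x) (p * s / 2)"
  using p s by (intro tendsto_ennrealI tendsto_powr2 tendsto_norm assms) auto
 from lim_imp_Liminf[OF _ this] show ?thesis by simp
qed

text \<open>The smooth inequality passes to the limit by Fatou's lemma on the left and by
  convergence of the weighted energies on the right.\<close>

lemma sobolev_full:
 assumes "(real CARD('n) - 2) * s <= 2 * real CARD('n)"
 shows "epow (NBINT x. np (\<Phi> x) (p * s / 2)) (2 / s)
  <= en ((s + 2)\<^sup>2 * p\<^sup>2 / 8) * (NBINT x. en (f0 x))"
proof -
 note [measurable] = meas
 let ?C = "en ((s + 2)\<^sup>2 * p\<^sup>2 / 8)"
 obtain r where r: "strict_mono r" "AE x in lborel. (%k. wk (r k) x) ----> \<Phi> x"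
  "(%k. (NBINT x. en (fk (r k) x))) ----> (NBINT x. en (f0 x))"
  by (rule limits)
 have "(NBINT x. np (\<Phi> x) (p * s / 2)) = (NBINT x. liminf (%k. np (wk (r k) x) (p * s / 2)))"
  using r(2) by (intro nn_integral_cong_AE) (auto elim!: eventually_mono intro: liminf_eq)
 also have "... <= liminf (%k. (NBINT x. np (wk (r k) x) (p * s / 2)))"
  by (rule nn_integral_liminf) measurable
 finally have "epow (NBINT x. np (\<Phi> x) (p * s / 2)) (2 / s)
   <= epow (liminf (%k. (NBINT x. np (wk (r k) x) (p * s / 2)))) (2 / s)"
  using s by (intro epow_mono) auto
 also have "... <= liminf (%k. epow (NBINT x. np (wk (r k) x) (p * s / 2)) (2 / s))"
  using s by (intro epow_liminf) auto
 also have "... <= liminf (%k. ?C * (NBINT x. en (fk (r k) x)))"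
 proof (intro Liminf_mono always_eventually allI)
  fix k
  have "epow (\<integral>\<^sup>+y. np (wk (r k) (vec_upd UNIV 0 y)) (p * s / 2) \<partial>PL UNIV) (2 / s)
   <= ?C * (\<integral>\<^sup>+y. en (fk (r k) (vec_upd UNIV 0 y)) \<partial>PL UNIV)"
   using assms by (intro smooth_slice) auto
  thus "epow (NBINT x. np (wk (r k) x) (p * s / 2)) (2 / s) <= ?C * (NBINT x. en (fk (r k) x))"
   by (subst (1 2) nn_integral_lborel_vec) measurable
 qed
 also have "... = ?C * (NBINT x. en (f0 x))"
  by (intro lim_imp_Liminf ennreal_tendsto_cmult r) auto
 finally show ?thesis .
qed

text \<open>The inequality in dimension n-1 holds for the mollified maps on every hyperplane and is
  integrated in \<open>t\<close> before the limit is taken, so traces of the limit map do not enter.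
  The condition on \<open>s\<close> is the Sobolev one in dimension n-1.\<close>

lemma sobolev_slices:
 assumes "2 <= CARD('n)" "(real CARD('n) - 3) * s <= 2 * (real CARD('n) - 1)"
 shows "(NBINT t. epow (slice j (%x. np (\<Phi> x) (p * s / 2)) t) (2 / s))
  <= en ((s + 2)\<^sup>2 * p\<^sup>2 / 8) * (NBINT x. en (f0 x))"
proof -
 note [measurable] = meas
 let ?C = "en ((s + 2)\<^sup>2 * p\<^sup>2 / 8)"
 obtain r where r: "strict_mono r" "AE x in lborel. (%k. wk (r k) x) ----> \<Phi> x"
  "(%k. (NBINT x. en (fk (r k) x))) ----> (NBINT x. en (f0 x))"
  by (rule limits)
 have card: "card (UNIV - {j}) = CARD('n) - 1" by (simp add: card_Diff_singleton)
 have ne: "UNIV - {j} ~= {}"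
 proof
  assume "UNIV - {j} = {}"
  hence "CARD('n) = card {j}" by (intro arg_cong[where f=card]) auto
  thus False using assms(1) by simp
 qed
 let ?g = "%k x. np (wk (r k) x) (p * s / 2)"
 have "AE x in lborel. np (\<Phi> x) (p * s / 2) = liminf (%k. ?g k x)"
  using r(2) by (auto elim!: eventually_mono intro: liminf_eq)
 hence "(NBINT t. epow (slice j (%x. np (\<Phi> x) (p * s / 2)) t) (2 / s))
   = (NBINT t. epow (slice j (%x. liminf (%k. ?g k x)) t) (2 / s))"
  by (intro nn_integral_cong_AE) (auto dest!: slice_cong_AE[where j=j] elim!: eventually_mono)
 also have "... <= (NBINT t. liminf (%k. epow (slice j (?g k) t) (2 / s)))"
 proof (rule nn_integral_mono)
  fix t
  have "slice j (%x. liminf (%k. ?g k x)) t <= liminf (%k. slice j (?g k) t)"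
   unfolding slice_def by (rule nn_integral_liminf) measurable
  hence "epow (slice j (%x. liminf (%k. ?g k x)) t) (2 / s) <= epow (liminf (%k. slice j (?g k) t)) (2 / s)"
   using s by (intro epow_mono) auto
  also have "... <= liminf (%k. epow (slice j (?g k) t) (2 / s))" using s by (intro epow_liminf) auto
  finally show "epow (slice j (%x. liminf (%k. ?g k x)) t) (2 / s) <= liminf (%k. epow (slice j (?g k) t) (2 / s))" .
 qed
 also have "... <= liminf (%k. (NBINT t. epow (slice j (?g k) t) (2 / s)))"
  by (rule nn_integral_liminf) measurable
 also have "... <= liminf (%k. ?C * (NBINT x. en (fk (r k) x)))"
 proof (intro Liminf_mono always_eventually allI)
  fix k
  have "(NBINT t. epow (slice j (?g k) t) (2 / s)) <= (NBINT t. ?C * slice j (%x. en (fk (r k) x)) t)"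
   unfolding slice_def using assms card by (intro nn_integral_mono smooth_slice[OF ne]) (simp add: of_nat_diff)
  also have "... = ?C * (NBINT t. slice j (%x. en (fk (r k) x)) t)"
   by (rule nn_integral_cmult) measurable
  also have "(NBINT t. slice j (%x. en (fk (r k) x)) t) = (NBINT x. en (fk (r k) x))"
   by (rule nn_integral_slice[symmetric]) measurable
  finally show "(NBINT t. epow (slice j (?g k) t) (2 / s)) <= ?C * (NBINT x. en (fk (r k) x))" .
 qed
 also have "... = ?C * (NBINT x. en (f0 x))"
  by (intro lim_imp_Liminf ennreal_tendsto_cmult r) auto
 finally show ?thesis .
qed

end

section \<open>Line estimates and a criterion for weak gradients of cutoffs\<close>

lemma fundamental_lemma_variations:
 fixes g :: "'a::euclidean_space => real"
 assumes g: "lintegrable g" and S: "open S"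
  and zero: "!!\<phi>. \<phi> : test_functions S ==> (LBINT x. g x * \<phi> x) = 0"
 shows "AE x\<in>S in lborel. g x = 0"
proof -
 obtain r where r: "strict_mono r" "AE x in lborel. (%k. mconv (r k) g x) ----> g x"
  using conv_AE_subseq[OF g strict_mono_id] by auto
 show ?thesis using r(2)
 proof eventually_elim
  case (elim x)
  show ?case
  proof
   assume "x : S"
   then obtain d where d: "0 < d" "cball x d <= S" using S open_contains_cball by blast
   obtain no where no: "1 / real (Suc no) < d" using d(1) nat_approx_posE by metis
   have "mconv (r k) g x = 0" if "no <= k" for k
   proof -
    have "1 / real (Suc (r k)) <= 1 / real (Suc no)"
     using seq_suble[OF r(1), of k] that by (intro frac_le) auto
    hence "cball x (1 / real (Suc (r k))) <= S" using d(2) no by (meson less_imp_le order_trans subset_cball)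
    from zero[OF moll_reflect_test[OF this]] show ?thesis by (simp add: conv_def mult.commute)
   qed
   hence "(%k. mconv (r k) g x) ----> 0"
    by (intro tendsto_eventually) (auto simp: eventually_sequentially)
   thus "g x = 0" using elim LIMSEQ_unique by blast
  qed
 qed
qed

lemma norm_diff_le_nn_integral:
 fixes f :: "real => 'b::euclidean_space"
 assumes ab: "a < b" and der: "!!t. a <= t ==> t <= b ==> (f has_vector_derivative D t) (at t)"
  and De: "!!t. norm (D t) <= e t" and e: "continuous_on UNIV e"
 shows "en (norm (f b - f a)) <= (NBINT t. en (e t) * ind {a..b} t)"
proof -
 have e0: "0 <= e t" for t using De[of t] norm_ge_zero order_trans by blast
 have "norm (f b - f a) <= integral {a..b} e - integral {a..a} e"
 proof (rule differentiable_bound_general[OF ab, where f'=D and \<phi>'=e])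
  show "continuous_on {a..b} f"
   using der by (intro continuous_at_imp_continuous_on ballI has_vector_derivative_continuous) auto
  show "continuous_on {a..b} (%u. integral {a..u} e)"
   by (intro indefinite_integral_continuous_1 integrable_continuous_interval continuous_on_subset[OF e]) auto
  fix x assume x: "a < x" "x < b"
  show "(f has_vector_derivative D x) (at x)" using der x by simp
  have "((%u. integral {a..u} e) has_vector_derivative e x) (at x within {a..b})"
   using x by (intro integral_has_vector_derivative continuous_on_subset[OF e]) auto
  thus "((%u. integral {a..u} e) has_vector_derivative e x) (at x)"
   using x by (metis at_within_Icc_at)
 qed (rule De)
 moreover have "(NBINT t. en (e t * ind {a..b} t)) = en (integral {a..b} e)"
 proof (rule nn_integral_has_integral_lborel)
  have "(e has_integral integral {a..b} e) {a..b}"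
   by (intro integrable_integral integrable_continuous_interval continuous_on_subset[OF e]) auto
  hence "((%x. if x : {a..b} then e x else 0) has_integral integral {a..b} e) UNIV"
   unfolding has_integral_restrict_UNIV .
  thus "((%x. e x * ind {a..b} x) has_integral integral {a..b} e) UNIV"
   by (rule has_integral_eq[rotated]) auto
  show "(%x. e x * ind {a..b} x) : borelfun"
   using borel_measurable_continuous_onI[OF e] by measurable
 qed (use e0 in auto)
 moreover have "en (e t * ind {a..b} t) = en (e t) * ind {a..b} t" for t
  by (auto simp: indicator_def)
 ultimately show ?thesis by (simp add: ennreal_leI)
qed

text \<open>Takes the place of absolute continuity on lines. For mollifications the bound is
  classical; the error \<open>E k\<close>, integrated along the segment, tends to 0 in L1 by
  translation invariance, so its lower limit vanishes almost everywhere by Fatou's lemma.\<close>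

lemma wgrad_line_bound:
 fixes u :: "real^'n => real^'N"
 assumes w: "wgrad S u G" and d: "0 < d" "!!x t. x : Q ==> 0 <= t ==> t <= 1 ==> cball (x + t *\<^sub>R h) d <= S"
 shows "AE x in lborel. x : Q -->
  en (norm (u (x + h) - u x)) <= (NBINT t. en (norm (G (x + t *\<^sub>R h)) * norm h) * ind {0..1} t)"
proof -
 note w' = wgradD[OF w]
 note [measurable] = w'(3,4)
 have [measurable]: "mconv k G : borelfun" for k using w' by measurable
 obtain r where r: "strict_mono r" "AE x in lborel. (%k. mconv (r k) u x) ----> u x"
  using conv_AE_subseq[OF w'(1) strict_mono_id] by auto
 define E where "E k x = (NBINT t. en (norm (mconv (r k) G (x + t *\<^sub>R h) - G (x + t *\<^sub>R h)) * norm h) * ind {0..1} t)" for k x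
 have [measurable]: "E k : borelfun" for k unfolding E_def by measurable
 have intE: "(NBINT x. E k x) = en (norm h * (LBINT x. norm (mconv (r k) G x - G x)))" for k
 proof -
  let ?f = "%x. en (norm (mconv (r k) G x - G x) * norm h)"
  have "(NBINT x. E k x) = (NBINT t. (NBINT x. ?f (x + t *\<^sub>R h) * ind {0..1} t))"
   unfolding E_def by (rule lborel_pair.Fubini'[symmetric]) measurable
  also have "... = (NBINT t. (NBINT x. ?f x) * ind {0..1::real} t)"
  proof (rule nn_integral_cong)
   fix t :: real
   have "(NBINT x. ?f (x + t *\<^sub>R h)) = (NBINT x. ?f x)"
    by (rule nn_integral_lborel_shift) measurable
   thus "(NBINT x. ?f (x + t *\<^sub>R h) * ind {0..1} t) = (NBINT x. ?f x) * ind {0..1} t"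
    by (subst nn_integral_multc) auto
  qed
  also have "... = (NBINT x. ?f x)" by (simp add: nn_integral_cmult_indicator)
  also have "... = en (LBINT x. norm (mconv (r k) G x - G x) * norm h)"
   using conv_L1(1)[OF w'(2)] by (intro nn_integral_eq_integral) auto
  finally show ?thesis by (simp add: mult.commute)
 qed
 have "(%k. norm h * (LBINT x. norm (mconv (r k) G x - G x))) ----> 0"
  using LIMSEQ_subseq_LIMSEQ[OF conv_L1(2)[OF w'(2)] r(1)] by (intro tendsto_mult_right_zero) (simp add: o_def)
 hence "(%k. (NBINT x. E k x)) ----> 0" unfolding intE using tendsto_ennrealI by fastforce
 hence "liminf (%k. (NBINT x. E k x)) = 0" by (simp add: lim_imp_Liminf)
 hence "(NBINT x. liminf (%k. E k x)) <= 0"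
  using nn_integral_liminf[of E lborel] by simp
 hence "AE x in lborel. liminf (%k. E k x) = 0" by (simp add: nn_integral_0_iff_AE)
 thus ?thesis using r(2) AE_lborel_shift[OF r(2), of h]
 proof eventually_elim
  case (elim x)
  show ?case
  proof
   assume x: "x : Q"
   let ?R = "(NBINT t. en (norm (G (x + t *\<^sub>R h)) * norm h) * ind {0..1} t)"
   obtain no where no: "1 / real (Suc no) < d" using d(1) nat_approx_posE by metis
   have le: "en (norm (mconv (r k) u (x + h) - mconv (r k) u x)) <= ?R + E k x" if k: "no <= k" for k
   proof -
    let ?u = "mconv (r k) u" and ?G = "mconv (r k) G"
    have "1 / real (Suc (r k)) <= 1 / real (Suc no)"
     using seq_suble[OF r(1), of k] k by (intro frac_le) auto
    hence kd: "cball (x + t *\<^sub>R h) (1 / real (Suc (r k))) <= S" if "0 <= t" "t <= 1" for t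
     using d(2)[OF x that] no by (meson less_imp_le order_trans subset_cball)
    have "en (norm (?u (x + 1 *\<^sub>R h) - ?u (x + 0 *\<^sub>R h))) <= (NBINT t. en (norm (?G (x + t *\<^sub>R h)) * norm h) * ind {0..1} t)"
    proof (rule norm_diff_le_nn_integral[where D="%t. ?G (x + t *\<^sub>R h) *v h"])
     fix t :: real assume t: "0 <= t" "t <= 1"
     have "((%t. ?u (x + t *\<^sub>R h)) has_derivative (%s. ?G (x + t *\<^sub>R h) *v (s *\<^sub>R h))) (at t)"
      by (rule has_derivative_compose[where f="%t. x + t *\<^sub>R h" and g="?u", OF _ conv_moll_wgrad[OF w kd[OF t]]]) (auto intro!: derivative_eq_intros)
     thus "((%t. ?u (x + t *\<^sub>R h)) has_vector_derivative ?G (x + t *\<^sub>R h) *v h) (at t)"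
      unfolding has_vector_derivative_def by (simp add: matrix_vector_mult_scaleR)
    next
     show "continuous_on UNIV (%t. norm (?G (x + t *\<^sub>R h)) * norm h)"
      by (intro continuous_intros continuous_on_compose2[OF conv_continuous[OF moll_tests w'(2), of UNIV]]) auto
    qed (auto intro: norm_matrix_mult_le)
    also have "... <= (NBINT t. en (norm (G (x + t *\<^sub>R h)) * norm h) * ind {0..1} t + en (norm (?G (x + t *\<^sub>R h) - G (x + t *\<^sub>R h)) * norm h) * ind {0..1} t)"
    proof (intro nn_integral_mono)
     fix t :: real
     have "norm (?G (x + t *\<^sub>R h)) <= norm (G (x + t *\<^sub>R h)) + norm (?G (x + t *\<^sub>R h) - G (x + t *\<^sub>R h))"
      by (rule norm_triangle_sub)
     hence "norm (?G (x + t *\<^sub>R h)) * norm h <= norm (G (x + t *\<^sub>R h)) * norm h + norm (?G (x + t *\<^sub>R h) - G (x + t *\<^sub>R h)) * norm h"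
      by (simp add: mult_right_mono flip: distrib_right)
     thus "en (norm (?G (x + t *\<^sub>R h)) * norm h) * ind {0..1} t <= en (norm (G (x + t *\<^sub>R h)) * norm h) * ind {0..1} t + en (norm (?G (x + t *\<^sub>R h) - G (x + t *\<^sub>R h)) * norm h) * ind {0..1} t"
      by (auto simp: indicator_def ennreal_leI simp flip: ennreal_plus)
    qed
    also have "... = ?R + E k x" unfolding E_def by (rule nn_integral_add) measurable
    finally show ?thesis by simp
   qed
   have "(%k. en (norm (mconv (r k) u (x + h) - mconv (r k) u x))) ----> en (norm (u (x + h) - u x))"
    by (intro tendsto_ennrealI tendsto_norm tendsto_diff elim)
   hence "en (norm (u (x + h) - u x)) = liminf (%k. en (norm (mconv (r k) u (x + h) - mconv (r k) u x)))"
    by (intro lim_imp_Liminf[symmetric]) auto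
   also have "... <= liminf (%k. ?R + E k x)"
    using le by (intro Liminf_mono) (auto simp: eventually_sequentially)
   also have "... = ?R + liminf (%k. E k x)"
    by (rule Liminf_const_add) auto
   finally show "en (norm (u (x + h) - u x)) <= ?R" using elim by simp
  qed
 qed
qed

text \<open>The hypothesis \<open>diff\<close> is the fundamental theorem of calculus in each
  coordinate direction. Tested against \<phi>, it compares \<open>t * X\<close>, where
  \<open>X\<close> is the defect in the weak identity, with a Taylor error for \<phi> and a
  Lipschitz error for \<open>G\<close>, both of order \<open>t\<close> squared.\<close>

lemma bounded_wgradI:
 fixes \<eta> :: "real^'n => real" and g :: "real^'n => real^'n"
 assumes [measurable]: "\<eta> : borelfun" "g : borelfun"
  and B: "!!x. \<bar>\<eta> x\<bar> <= B" "!!x. norm (g x) <= B"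
  and int: "lintegrable \<eta>" "lintegrable g"
  and diff: "!!j t x. 0 < t ==> \<eta> x - \<eta> (x - t *\<^sub>R axis j 1) = (LBINT \<tau>. g (x - \<tau> *\<^sub>R axis j 1) $ j * ind {0..<t} \<tau>)"
 shows "bounded_wgrad \<eta> g"
proof -
 have "(LBINT x. \<eta> x * pd \<phi> j x) = - (LBINT x. g x $ j * \<phi> x)"
  if \<phi>: "\<phi> : tests" for \<phi> :: "real^'n => real" and j
 proof -
  let ?e = "axis j 1 :: real^'n"
  let ?D = "%x. frechet_derivative \<phi> (at x) ?e"
  let ?g = "%x. g x $ j"
  have gm[measurable]: "?g : borelfun" unfolding component_eq_inner by measurable
  have gi: "lintegrable ?g" unfolding component_eq_inner using int by auto
  have gB: "\<bar>g x $ j\<bar> <= B" for x using component_le_norm_cart[of "g x" j] B(2)[of x] by linarith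
  have B0: "0 <= B" using B(1)[of 0] by simp
  obtain Bp where Bp: "0 <= Bp" "!!x. norm (\<phi> x) <= Bp" using tests_bounded[OF \<phi>] by blast
  obtain Bl where Bl: "0 <= Bl" "!!x y. norm (\<phi> x - \<phi> y) <= Bl * norm (x - y)" using tests_lipschitz[OF \<phi>] by blast
  obtain Bt where Bt: "0 <= Bt" "!!x h. norm (\<phi> (x + h) - \<phi> x - frechet_derivative \<phi> (at x) h) <= Bt * norm h * norm h"
   using tests_taylor[OF \<phi>] by blast
  obtain Bd where Bd: "0 <= Bd" "!!x. norm (?D x) <= Bd" using tests_bounded[OF test_functions_derivative[OF \<phi>]] by blast
  note [measurable] = tests_borel[OF \<phi>] tests_borel[OF test_functions_derivative[OF \<phi>, of ?e]]
  have ip: "lintegrable \<phi>" by (rule tests_bounded_set_integrable[OF \<phi>])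
  have ib: "lintegrable (%x. f x * b x)" if "lintegrable f" "b : borelfun" "!!x. norm (b x) <= C" for f b :: "real^'n => real" and C
   by (rule integrable_bound'[where f="%x. f x * C"])
    (use that in \<open>auto simp: abs_mult intro!: mult_left_mono AE_I2 order_trans[OF that(3)[unfolded real_norm_def]]\<close>)
  define M where "M = (LBINT x. \<bar>\<eta> x\<bar>)"
  define I where "I = (LBINT x. \<bar>g x $ j\<bar>)"
  define G where "G \<tau> = (LBINT x. g x $ j * \<phi> (x + \<tau> *\<^sub>R ?e))" for \<tau>
  define X where "X = (LBINT x. \<eta> x * ?D x) + G 0"
  have iG: "lintegrable (%x. g x $ j * \<phi> (x + \<tau> *\<^sub>R ?e))" for \<tau> by (rule ib[OF gi _ Bp(2)]) measurable
  have [measurable]: "G : borelfun" unfolding G_def by measurable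
  have GL: "\<bar>G \<tau> - G 0\<bar> <= Bl * \<bar>\<tau>\<bar> * I" for \<tau>
  proof -
   have "G \<tau> - G 0 = (LBINT x. g x $ j * \<phi> (x + \<tau> *\<^sub>R ?e) - g x $ j * \<phi> x)" unfolding G_def using iG[of \<tau>] iG[of 0] by simp
   also have "norm ... <= (LBINT x. \<bar>g x $ j\<bar> * (Bl * \<bar>\<tau>\<bar>))"
   proof (rule Bochner_Integration.integral_norm_bound_integral)
    show "norm (g x $ j * \<phi> (x + \<tau> *\<^sub>R ?e) - g x $ j * \<phi> x) <= \<bar>g x $ j\<bar> * (Bl * \<bar>\<tau>\<bar>)" for x
     using Bl(2)[of "x + \<tau> *\<^sub>R ?e" x] by (simp add: abs_mult norm_axis_1 mult_left_mono flip: right_diff_distrib)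
   qed (use gi iG[of \<tau>] iG[of 0] in auto)
   finally show ?thesis by (simp add: I_def mult_ac)
  qed
  have main: "\<bar>X\<bar> <= (Bt * M + Bl * I) * t" if t: "0 < t" for t
  proof -
   let ?f = "%x \<tau>. g (x - \<tau> *\<^sub>R ?e) $ j * ind {0..<t} \<tau> * \<phi> x"
   have sh: "lintegrable (%x. \<eta> (x - t *\<^sub>R ?e))" using lborel_integral_shift(2)[of \<eta> "- t *\<^sub>R ?e"] int by simp
   have i1: "lintegrable (%x. \<eta> x * \<phi> (x + t *\<^sub>R ?e))" and i2: "lintegrable (%x. \<eta> x * \<phi> x)"
    and i3: "lintegrable (%x. \<eta> x * ?D x)" and i4: "lintegrable (%x. \<eta> (x - t *\<^sub>R ?e) * \<phi> x)"
    using ib[OF int(1) _ Bp(2)] ib[OF int(1) _ Bd(2)] ib[OF sh _ Bp(2)] ib[of \<eta> "%x. \<phi> (x + t *\<^sub>R ?e)" Bp] int Bp(2) by auto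
   have if1: "lintegrable (%\<tau>. ?f x \<tau>)" for x
    by (rule integrableI_bounded_set[where A="{0..<t}" and B="B * Bp"]) (use gB Bp B0 t in \<open>auto simp: indicator_def abs_mult intro!: mult_mono\<close>)
   have if2: "integrable (lborel \<Otimes>\<^sub>M lborel) (%(x, \<tau>). ?f x \<tau>)"
   proof (rule lborel_pair.Fubini_integrable)
    show "lintegrable (%x. (LBINT \<tau>. norm (case (x, \<tau>) of (x, \<tau>) => ?f x \<tau>)))"
    proof (rule integrable_bound')
     show "lintegrable (%x. (B * t) * \<phi> x)" using ip by simp
     have "(LBINT \<tau>. \<bar>?f x \<tau>\<bar>) <= (LBINT \<tau>. (B * \<bar>\<phi> x\<bar>) * ind {0..<t} \<tau>)" for x
     proof (rule integral_mono[OF integrable_abs[OF if1]])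
      show "lintegrable (%\<tau>. (B * \<bar>\<phi> x\<bar>) * ind {0..<t} \<tau>)" using t by (intro integrable_mult_right) auto
      show "\<bar>?f x \<tau>\<bar> <= (B * \<bar>\<phi> x\<bar>) * ind {0..<t} \<tau>" for \<tau>
       using gB B0 by (auto simp: indicator_def abs_mult intro!: mult_right_mono)
     qed
     thus "AE x in lborel. norm (LBINT \<tau>. norm (case (x, \<tau>) of (x, \<tau>) => ?f x \<tau>)) <= norm ((B * t) * \<phi> x)"
      using t B0 by (simp add: abs_mult mult_ac)
    qed simp
   qed (use if1 in auto)
   \<comment> \<open>Discrete integration by parts: a translation moves the difference from \<phi>
     to \<eta>, after which \<open>diff\<close> and Fubini's theorem apply.\<close>
   have "(LBINT x. \<eta> x * \<phi> x) - (LBINT x. \<eta> x * \<phi> (x + t *\<^sub>R ?e)) = (LBINT x. (\<eta> x - \<eta> (x - t *\<^sub>R ?e)) * \<phi> x)"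
    using lborel_integral_shift(1)[of "%x. \<eta> (x - t *\<^sub>R ?e) * \<phi> x" "t *\<^sub>R ?e"] i2 i4 by (simp add: left_diff_distrib)
   also have "... = (LBINT x. (LBINT \<tau>. ?f x \<tau>))" by (simp add: diff[OF t])
   also have "... = (LBINT \<tau>. (LBINT x. ?f x \<tau>))" by (rule lborel_pair.Fubini_integral[symmetric, OF if2])
   also have "... = (LBINT \<tau>. ind {0..<t} \<tau> * G \<tau>)"
   proof (rule Bochner_Integration.integral_cong)
    fix \<tau>
    have "(LBINT x. g (x - \<tau> *\<^sub>R ?e) $ j * \<phi> x) = G \<tau>"
     using lborel_integral_shift(1)[of "%x. g (x - \<tau> *\<^sub>R ?e) $ j * \<phi> x" "\<tau> *\<^sub>R ?e"] by (simp add: G_def)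
    thus "(LBINT x. ?f x \<tau>) = ind {0..<t} \<tau> * G \<tau>" by (cases "\<tau> : {0..<t}") auto
   qed simp
   finally have e: "(LBINT x. \<eta> x * \<phi> x) - (LBINT x. \<eta> x * \<phi> (x + t *\<^sub>R ?e)) = (LBINT \<tau>. ind {0..<t} \<tau> * G \<tau>)" .
   have iGt: "lintegrable (%\<tau>. ind {0..<t} \<tau> * G \<tau>)"
   proof (rule integrableI_bounded_set[where A="{0..<t}" and B="\<bar>G 0\<bar> + Bl * t * I"])
    have I0: "0 <= I" unfolding I_def by simp
    have "\<bar>G \<tau>\<bar> <= \<bar>G 0\<bar> + Bl * t * I" if "\<tau> : {0..<t}" for \<tau>
    proof -
     have "Bl * \<bar>\<tau>\<bar> * I <= Bl * t * I" using that Bl(1) I0 by (intro mult_right_mono mult_left_mono) auto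
     thus ?thesis using GL[of \<tau>] by linarith
    qed
    thus "AE \<tau> in lborel. \<tau> : {0..<t} --> norm (ind {0..<t} \<tau> * G \<tau>) <= \<bar>G 0\<bar> + Bl * t * I" by simp
   qed (use t in auto)
   let ?E = "%x. \<eta> x * (\<phi> (x + t *\<^sub>R ?e) - \<phi> x - t * ?D x)"
   have iE: "lintegrable ?E" using i1 i2 i3 by (simp add: right_diff_distrib mult.left_commute[of _ t])
   have "(LBINT x. ?E x) = - (LBINT \<tau>. ind {0..<t} \<tau> * G \<tau>) - t * (LBINT x. \<eta> x * ?D x)"
    using i1 i2 i3 e by (simp add: right_diff_distrib mult.left_commute[of _ t])
   moreover have "(LBINT \<tau>. ind {0..<t} \<tau> * (G \<tau> - G 0)) = (LBINT \<tau>. ind {0..<t} \<tau> * G \<tau>) - t * G 0"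
    using iGt t by (simp add: right_diff_distrib)
   ultimately have "t * X = - (LBINT x. ?E x) - (LBINT \<tau>. ind {0..<t} \<tau> * (G \<tau> - G 0))"
    by (simp add: X_def algebra_simps)
   hence "t * \<bar>X\<bar> <= norm (LBINT x. ?E x) + norm (LBINT \<tau>. ind {0..<t} \<tau> * (G \<tau> - G 0))"
    using t abs_mult[of t X] by simp
   also have "norm (LBINT x. ?E x) <= (LBINT x. \<bar>\<eta> x\<bar> * (Bt * t * t))"
   proof (rule Bochner_Integration.integral_norm_bound_integral[OF iE])
    have lin: "frechet_derivative \<phi> (at x) (t *\<^sub>R ?e) = t * ?D x" for x
     using tests_derivative[OF \<phi>] has_derivative_linear linear_cmul by (metis real_scaleR_def)
    show "norm (?E x) <= \<bar>\<eta> x\<bar> * (Bt * t * t)" for x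
     using Bt(2)[of x "t *\<^sub>R ?e"] t by (simp add: abs_mult lin norm_axis_1 mult_left_mono)
   qed (use int in auto)
   also have "norm (LBINT \<tau>. ind {0..<t} \<tau> * (G \<tau> - G 0)) <= (LBINT \<tau>. (Bl * t * I) * ind {0..<t} \<tau>)"
   proof (rule Bochner_Integration.integral_norm_bound_integral)
    have "0 <= I" unfolding I_def by simp
    hence "Bl * \<bar>\<tau>\<bar> * I <= Bl * t * I" if "\<tau> : {0..<t}" for \<tau> using that Bl(1) by (intro mult_right_mono mult_left_mono) auto
    thus "norm (ind {0..<t} \<tau> * (G \<tau> - G 0)) <= (Bl * t * I) * ind {0..<t} \<tau>" for \<tau>
     using GL[of \<tau>] by (auto simp: indicator_def intro: order_trans)
   qed (use iGt t in \<open>auto simp: right_diff_distrib\<close>)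
   finally have "t * \<bar>X\<bar> <= t * ((Bt * M + Bl * I) * t)" using t by (simp add: M_def algebra_simps)
   thus ?thesis using t by simp
  qed
  have "\<bar>X\<bar> <= 0"
  proof (rule LIMSEQ_le_const)
   have "(%k. (Bt * M + Bl * I) * inverse (real (Suc k))) ----> (Bt * M + Bl * I) * 0" by (intro tendsto_intros LIMSEQ_inverse_real_of_nat)
   thus "(%k. (Bt * M + Bl * I) * inverse (real (Suc k))) ----> 0" by simp
  qed (use main in auto)
  thus ?thesis by (simp add: X_def G_def)
 qed
 moreover have "\<exists>B. \<forall>x. \<bar>\<eta> x\<bar> <= B \<and> norm (g x) <= B" using B by (intro exI[of _ B]) auto
 ultimately show ?thesis unfolding bounded_wgrad_def by auto
qed

section \<open>Cutoffs supported on good slices\<close>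

text \<open>For each \<open>i\<close> the bad set has measure at most
  \<open>(b - a) / (2 * card I)\<close>, so at most half of the interval is lost altogether.\<close>

lemma chebyshev_set:
 fixes f :: "'i => real => ennreal"
 assumes I: "finite I" "I ~= {}" and [measurable]: "!!i. i : I ==> f i : borelfun"
  and ab: "a < b" and fin: "!!i. i : I ==> (NBINT t. f i t) < \<infinity>"
 obtains T where "T : sets borel" "T <= {a<..<b}" "(b - a) / 2 <= measure lborel T"
  "!!i t. i : I ==> t : T ==> f i t <= en (2 * real (card I) / (b - a)) * (NBINT t. f i t)"
proof -
 define c where "c = 2 * real (card I) / (b - a)"
 have c: "0 < c" using I ab by (simp add: c_def card_gt_0_iff)
 define N where "N i = {t. en c * (NBINT t. f i t) < f i t} \<inter> {a<..<b}" for i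
 have [measurable]: "N i : sets borel" if "i : I" for i
  unfolding N_def using that by measurable
 have fm: "emeasure lborel {a<..<b} < \<infinity>" using ab by simp
 have fN: "emeasure lborel (N i) < \<infinity>" if "i : I" for i
  using that emeasure_mono[of "N i" "{a<..<b}" lborel] fm by (auto simp: N_def order_le_less_trans)
 have mN: "measure lborel (N i) <= 1 / c" if i: "i : I" for i
 proof -
  obtain x where x: "0 <= x" "(NBINT t. f i t) = en x" using fin[OF i] by (cases "(NBINT t. f i t)") auto
  show ?thesis
  \<comment> \<open>If the integral is 0, the quotient in Chebyshev's inequality is void; then
    \<open>f i\<close> vanishes almost everywhere and the bad set is null.\<close>
  proof (cases "x = 0")
   case True
   have [measurable]: "f i : borelfun" "N i : sets borel" using i by auto
   have "AE t in lborel. f i t = 0" using x True by (simp add: nn_integral_0_iff_AE)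
   hence "AE t in lborel. t \<notin> N i" by eventually_elim (simp add: N_def)
   hence "emeasure lborel (N i) = 0" using AE_iff_null_sets[of "N i" lborel] i by (simp add: null_sets_def)
   thus ?thesis using c by (simp add: measure_def)
  next
   case False
   have [measurable]: "f i : borelfun" "N i : sets borel" using i by auto
   have "en (c * x) * emeasure lborel (N i) = (NBINT t. en (c * x) * ind (N i) t)"
    by (simp add: nn_integral_cmult_indicator)
   also have "... <= (NBINT t. f i t)"
    using c x by (intro nn_integral_mono) (auto simp: N_def indicator_def ennreal_mult)
   finally have "en (c * x * measure lborel (N i)) <= en x"
    using fN[OF i] c x by (simp add: emeasure_eq_ennreal_measure less_top ennreal_mult)
   hence "c * x * measure lborel (N i) <= x" using x by simp
   thus ?thesis using False x c by (simp add: field_simps)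
  qed
 qed
 define T where "T = {a<..<b} - (\<Union>i\<in>I. N i)"
 have mU: "measure lborel (\<Union>i\<in>I. N i) <= (b - a) / 2"
 proof -
  have "measure lborel (\<Union>i\<in>I. N i) <= (\<Sum>i\<in>I. measure lborel (N i))"
   using I(1) fN by (intro measure_UNION_le) auto
  also have "... <= (\<Sum>i\<in>I. 1 / c)" by (intro sum_mono mN)
  also have "... = (b - a) / 2" using I ab by (simp add: c_def card_gt_0_iff)
  finally show ?thesis .
 qed
 have "measure lborel T = measure lborel {a<..<b} - measure lborel (\<Union>i\<in>I. N i)"
  unfolding T_def using I(1) fm by (intro measure_Diff) (auto simp: N_def)
 hence "(b - a) / 2 <= measure lborel T" using mU ab by simp
 moreover have "T : sets borel" unfolding T_def using I(1) by (intro sets.Diff sets.finite_UN) auto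
 moreover have "T <= {a<..<b}" by (auto simp: T_def)
 moreover have "f i t <= en c * (NBINT t. f i t)" if "i : I" "t : T" for i t
  using that by (auto simp: T_def N_def not_less)
 ultimately show thesis using that unfolding c_def by blast
qed

definition bump_deriv :: "real set => real set => real => real" where
 "bump_deriv T1 T2 t = ind T1 t / measure lborel T1 - ind T2 t / measure lborel T2"

text \<open>The distribution function of the uniform probability on \<open>T1\<close> minus that of
  \<open>T2\<close>. It rises from 0 to 1 across \<open>T1\<close> and falls back across
  \<open>T2\<close>; its slope \<open>bump_deriv\<close> vanishes off these sets, however scattered
  they are.\<close>

definition trapezoid :: "real set => real set => real => real" where
 "trapezoid T1 T2 x = measure lborel (T1 \<inter> {..x}) / measure lborel T1 - measure lborel (T2 \<inter> {..x}) / measure lborel T2"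

context
 fixes T1 T2 :: "real set" and a a' b b' :: real
 assumes T [measurable]: "T1 : sets borel" "T2 : sets borel"
  and sub: "T1 <= {a<..<a'}" "T2 <= {b'<..<b}" and pos: "0 < measure lborel T1" "0 < measure lborel T2"
  and ab: "a < a'" "a' <= b'" "b' < b"
begin

private lemma fin: "emeasure lborel T1 < \<infinity>" "emeasure lborel T2 < \<infinity>"
 using emeasure_mono[OF sub(1), of lborel] emeasure_mono[OF sub(2), of lborel] ab by (auto simp: order_le_less_trans)

private lemma fm: "T1 : fmeasurable lborel" "T2 : fmeasurable lborel"
 using fin by (auto simp: fmeasurable_def)

private lemma fin': "emeasure lborel (T1 \<inter> {..x}) < \<infinity>" "emeasure lborel (T2 \<inter> {..x}) < \<infinity>"
 using emeasure_mono[of "T1 \<inter> {..x}" T1 lborel] emeasure_mono[of "T2 \<inter> {..x}" T2 lborel] fin by (auto simp: order_le_less_trans)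

private lemma le1: "measure lborel (T1 \<inter> {..x}) <= measure lborel T1" "measure lborel (T2 \<inter> {..x}) <= measure lborel T2"
 using fm by (auto intro!: measure_mono_fmeasurable)

lemma trapezoid_bounds: "0 <= trapezoid T1 T2 x" "trapezoid T1 T2 x <= 1"
proof -
 have A: "measure lborel (T2 \<inter> {..x}) = 0" if "x <= b'"
 proof -
  have "T2 \<inter> {..x} = {}" using that sub by auto
  thus ?thesis by simp
 qed
 have B: "measure lborel (T1 \<inter> {..x}) = measure lborel T1" if "b' < x"
 proof -
  have "T1 \<inter> {..x} = T1" using that sub ab by auto
  thus ?thesis by simp
 qed
 show "0 <= trapezoid T1 T2 x" "trapezoid T1 T2 x <= 1"
  using A B le1[of x] pos unfolding trapezoid_def by (cases "x <= b'"; simp)+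
qed

lemma trapezoid_inside: "a' <= x ==> x <= b' ==> trapezoid T1 T2 x = 1"
proof -
 assume x: "a' <= x" "x <= b'"
 have "T2 \<inter> {..x} = {}" "T1 \<inter> {..x} = T1" using x sub by auto
 thus ?thesis using pos by (simp add: trapezoid_def)
qed

lemma trapezoid_outside: "x <= a \<or> b <= x ==> trapezoid T1 T2 x = 0"
proof -
 assume "x <= a \<or> b <= x"
 hence "(T2 \<inter> {..x} = {} \<and> T1 \<inter> {..x} = {}) \<or> (T1 \<inter> {..x} = T1 \<and> T2 \<inter> {..x} = T2)" using sub ab by auto
 thus ?thesis using pos by (auto simp: trapezoid_def)
qed

lemma bump_deriv_outside: "x <= a \<or> b <= x ==> bump_deriv T1 T2 x = 0"
 using sub ab by (auto simp: bump_deriv_def indicator_def)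

lemma trapezoid_measurable: "trapezoid T1 T2 : borelfun"
proof -
 have m: "(%x. measure lborel (T' \<inter> {..x})) : borelfun" if "T' = T1 \<or> T' = T2" for T'
 proof (rule borel_measurable_mono)
  show "mono (%x. measure lborel (T' \<inter> {..x}))"
  proof (rule monoI)
   fix x y :: real assume "x <= y"
   thus "measure lborel (T' \<inter> {..x}) <= measure lborel (T' \<inter> {..y})"
    using that fin' by (intro measure_mono_fmeasurable) (auto simp: fmeasurable_def)
  qed
 qed
 show ?thesis unfolding trapezoid_def[abs_def] using m by measurable
qed

lemma trapezoid_diff:
 assumes t: "0 < t"
 shows "trapezoid T1 T2 x - trapezoid T1 T2 (x - t) = (LBINT \<tau>. bump_deriv T1 T2 (x - \<tau>) * ind {0..<t} \<tau>)"
proof -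
 have D: "measure lborel (T' \<inter> {..x}) - measure lborel (T' \<inter> {..x - t}) = (LBINT \<tau>. ind T' (x - \<tau>) * ind {0..<t} \<tau>)"
  "lintegrable (%\<tau>. ind T' (x - \<tau>) * ind {0..<t} \<tau> :: real)" if T': "T' = T1 \<or> T' = T2" for T'
 proof -
  have [measurable]: "T' : sets borel" using T' T by auto
  have "measure lborel (T' \<inter> {..x}) - measure lborel (T' \<inter> {..x - t}) = measure lborel (T' \<inter> {..x} - T' \<inter> {..x - t})"
   using t T' fin'[of x] by (intro measure_Diff[symmetric]) (auto simp: less_top)
  \<comment> \<open>The reflection about \<open>x\<close> carries this interval, open on the left,
    to \<open>{0..<t}\<close>; this is where the half-open interval in \<open>bounded_wgradI\<close>
    comes from.\<close>
  also have "T' \<inter> {..x} - T' \<inter> {..x - t} = T' \<inter> {x - t<..x}" by auto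
  also have "measure lborel (T' \<inter> {x - t<..x}) = (LBINT s. ind (T' \<inter> {x - t<..x}) s)" by simp
  also have "... = (LBINT \<tau>. ind (T' \<inter> {x - t<..x}) (x + (-1) * \<tau>))"
   using lborel_integral_real_affine[of "-1" "ind (T' \<inter> {x - t<..x}) :: real => real" x] by simp
  also have "... = (LBINT \<tau>. ind T' (x - \<tau>) * ind {0..<t} \<tau>)"
   by (intro Bochner_Integration.integral_cong) (auto simp: indicator_def)
  finally show "measure lborel (T' \<inter> {..x}) - measure lborel (T' \<inter> {..x - t}) = (LBINT \<tau>. ind T' (x - \<tau>) * ind {0..<t} \<tau>)" .
  show "lintegrable (%\<tau>. ind T' (x - \<tau>) * ind {0..<t} \<tau> :: real)"
   by (rule integrableI_bounded_set[where A="{0..<t}" and B=1]) (use t in \<open>auto simp: indicator_def\<close>)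
 qed
 have "trapezoid T1 T2 x - trapezoid T1 T2 (x - t)
  = (measure lborel (T1 \<inter> {..x}) - measure lborel (T1 \<inter> {..x - t})) / measure lborel T1
  - (measure lborel (T2 \<inter> {..x}) - measure lborel (T2 \<inter> {..x - t})) / measure lborel T2"
  by (simp add: trapezoid_def diff_divide_distrib)
 also have "... = (LBINT \<tau>. ind T1 (x - \<tau>) * ind {0..<t} \<tau> / measure lborel T1 - ind T2 (x - \<tau>) * ind {0..<t} \<tau> / measure lborel T2)"
  using D(2)[of T1] D(2)[of T2] by (simp add: D(1))
 also have "... = (LBINT \<tau>. bump_deriv T1 T2 (x - \<tau>) * ind {0..<t} \<tau>)"
  by (simp add: bump_deriv_def left_diff_distrib)
 finally show ?thesis .
qed

lemma bump_deriv_measurable: "bump_deriv T1 T2 : borelfun"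
 unfolding bump_deriv_def[abs_def] by measurable

lemma bump_deriv_le: "\<bar>bump_deriv T1 T2 x\<bar> <= ind T1 x / measure lborel T1 + ind T2 x / measure lborel T2"
proof -
 have "0 <= ind T1 x / measure lborel T1" "0 <= ind T2 x / measure lborel T2" using pos by auto
 thus ?thesis unfolding bump_deriv_def by (simp only: abs_le_iff) linarith
qed

end

text \<open>A product of one-dimensional trapezoids. A gradient component can be nonzero only if its
  coordinate lies in one of the two selected sets, and the lower bound \<kappa> on their measures
  limits its size. The construction serves twice: with full intervals as an ordinary cutoff, and
  with the sets from \<open>chebyshev_set\<close>.\<close>

lemma cutoff_cube:
 fixes c :: "real^'n" and T1 T2 :: "'n => real set"
 assumes r: "0 < r" "r < \<rho>"
  and T: "!!i. T1 i : sets borel" "!!i. T2 i : sets borel"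
  and sub: "!!i. T1 i <= {c $ i - \<rho><..<c $ i - r}" "!!i. T2 i <= {c $ i + r<..<c $ i + \<rho>}"
  and \<kappa>: "0 < \<kappa>" and pos: "!!i. \<kappa> <= measure lborel (T1 i)" "!!i. \<kappa> <= measure lborel (T2 i)"
 obtains \<eta> g where "bounded_wgrad \<eta> g" "!!x. 0 <= \<eta> x" "!!x. \<eta> x <= 1"
  "!!x. (!!i. \<bar>x $ i - c $ i\<bar> <= r) ==> \<eta> x = 1"
  "!!x i. \<rho> <= \<bar>x $ i - c $ i\<bar> ==> \<eta> x = 0" "!!x i. \<rho> <= \<bar>x $ i - c $ i\<bar> ==> g x = 0"
  "!!x. norm (g x) <= (\<Sum>j\<in>UNIV. (ind (T1 j) (x $ j) + ind (T2 j) (x $ j)) / \<kappa>)"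
proof -
 define \<theta> where "\<theta> i = trapezoid (T1 i) (T2 i)" for i
 define \<psi> where "\<psi> i = bump_deriv (T1 i) (T2 i)" for i
 have pos': "0 < measure lborel (T1 i)" "0 < measure lborel (T2 i)" for i using pos[of i] \<kappa> by auto
 have ord: "c $ i - \<rho> < c $ i - r" "c $ i - r <= c $ i + r" "c $ i + r < c $ i + \<rho>" for i using r by auto
 note asm = T(1) T(2) sub(1) sub(2) pos'(1) pos'(2) ord
 note \<theta>01 = trapezoid_bounds[OF asm, folded \<theta>_def]
 note \<theta>in = trapezoid_inside[OF asm, folded \<theta>_def]
 note \<theta>out = trapezoid_outside[OF asm, folded \<theta>_def]
 note \<psi>out = bump_deriv_outside[OF asm, folded \<psi>_def]
 note \<theta>diff = trapezoid_diff[OF asm, folded \<theta>_def \<psi>_def]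
 have [measurable]: "\<theta> i : borelfun" "\<psi> i : borelfun" for i
  using trapezoid_measurable[OF asm, of i] bump_deriv_measurable[OF asm, of i] by (auto simp: \<theta>_def \<psi>_def)
 have [measurable]: "(%x::real^'n. x $ i) : borelfun" for i unfolding component_eq_inner by measurable
 define \<eta> where "\<eta> x = (\<Prod>i\<in>UNIV. \<theta> i (x $ i))" for x :: "real^'n"
 define g where "g x = (\<chi> j. \<psi> j (x $ j) * (\<Prod>i\<in>UNIV - {j}. \<theta> i (x $ i)))" for x :: "real^'n"
 have \<eta>01: "0 <= \<eta> x" "\<eta> x <= 1" for x unfolding \<eta>_def by (auto intro!: prod_nonneg prod_le_1 \<theta>01)
 have P01: "0 <= (\<Prod>i\<in>UNIV - {j}. \<theta> i (x $ i))" "(\<Prod>i\<in>UNIV - {j}. \<theta> i (x $ i)) <= 1" for x j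
  by (auto intro!: prod_nonneg prod_le_1 \<theta>01)
 have out: "x $ i <= c $ i - \<rho> \<or> c $ i + \<rho> <= x $ i" if "\<rho> <= \<bar>x $ i - c $ i\<bar>" for x i using that by linarith
 have \<eta>out: "\<eta> x = 0" if "\<rho> <= \<bar>x $ i - c $ i\<bar>" for x i
  unfolding \<eta>_def using \<theta>out[OF out[OF that]] by (intro prod_zero) auto
 have gout: "g x = 0" if "\<rho> <= \<bar>x $ i - c $ i\<bar>" for x i
 proof -
  have "g x $ j = 0" for j
  proof (cases "j = i")
   case True
   thus ?thesis using \<psi>out[OF out[OF that]] by (simp add: g_def)
  next
   case False
   have "(\<Prod>k\<in>UNIV - {j}. \<theta> k (x $ k)) = 0"
    using \<theta>out[OF out[OF that]] False by (intro prod_zero) auto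
   thus ?thesis by (simp add: g_def)
  qed
  thus ?thesis by (simp add: vec_eq_iff)
 qed
 have \<psi>le: "\<bar>\<psi> j y\<bar> <= (ind (T1 j) y + ind (T2 j) y) / \<kappa>" for j y
 proof -
  have "\<bar>\<psi> j y\<bar> <= ind (T1 j) y / measure lborel (T1 j) + ind (T2 j) y / measure lborel (T2 j)"
   unfolding \<psi>_def by (rule bump_deriv_le[OF asm])
  also have "... <= ind (T1 j) y / \<kappa> + ind (T2 j) y / \<kappa>"
   using pos[of j] \<kappa> by (intro add_mono divide_left_mono) auto
  finally show ?thesis by (simp add: add_divide_distrib)
 qed
 have gle: "norm (g x) <= (\<Sum>j\<in>UNIV. (ind (T1 j) (x $ j) + ind (T2 j) (x $ j)) / \<kappa>)" for x
 proof -
  have "norm (g x) <= (\<Sum>j\<in>UNIV. \<bar>g x $ j\<bar>)" by (rule norm_le_l1_cart)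
  also have "... <= (\<Sum>j\<in>UNIV. (ind (T1 j) (x $ j) + ind (T2 j) (x $ j)) / \<kappa>)"
  proof (rule sum_mono)
   fix j
   have "\<bar>g x $ j\<bar> <= \<bar>\<psi> j (x $ j)\<bar> * 1" using P01[of x j] by (simp add: g_def abs_mult mult_left_le)
   thus "\<bar>g x $ j\<bar> <= (ind (T1 j) (x $ j) + ind (T2 j) (x $ j)) / \<kappa>" using \<psi>le[of j "x $ j"] by simp
  qed
  finally show ?thesis .
 qed
 have gB: "norm (g x) <= (\<Sum>j\<in>(UNIV::'n set). 2 / \<kappa>)" for x
  by (rule order_trans[OF gle], rule sum_mono) (use \<kappa> in \<open>auto simp: indicator_def divide_right_mono\<close>)
 have \<eta>m[measurable]: "\<eta> : borelfun" unfolding \<eta>_def[abs_def] by measurable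
 have gm[measurable]: "g : borelfun" unfolding g_def[abs_def] by (intro measurable_vec_lambda) measurable
 let ?Q = "cbox (c - (\<chi> i. \<rho>)) (c + (\<chi> i. \<rho>))"
 have inQ: "x \<notin> ?Q ==> \<exists>i. \<rho> <= \<bar>x $ i - c $ i\<bar>" for x
 proof -
  assume "x \<notin> ?Q"
  then obtain i where "\<not> (c $ i - \<rho> <= x $ i \<and> x $ i <= c $ i + \<rho>)" by (auto simp: mem_box_cart)
  hence "\<rho> <= \<bar>x $ i - c $ i\<bar>" by linarith
  thus ?thesis by blast
 qed
 have i\<eta>: "lintegrable \<eta>"
 proof (rule integrableI_bounded_set[where A="?Q" and B=1])
  show "AE x in lborel. x : ?Q --> norm (\<eta> x) <= 1" using \<eta>01 by (intro AE_I2) (simp add: abs_of_nonneg)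
  show "AE x in lborel. x \<notin> ?Q --> \<eta> x = 0" using \<eta>out inQ by (intro AE_I2) blast
 qed (use emeasure_lborel_cbox_finite in auto)
 have ig: "lintegrable g"
 proof (rule integrableI_bounded_set[where A="?Q" and B="\<Sum>j\<in>(UNIV::'n set). 2 / \<kappa>"])
  show "AE x in lborel. x : ?Q --> norm (g x) <= (\<Sum>j\<in>(UNIV::'n set). 2 / \<kappa>)" using gB by (intro AE_I2) blast
  show "AE x in lborel. x \<notin> ?Q --> g x = 0" using gout inQ by (intro AE_I2) blast
 qed (use emeasure_lborel_cbox_finite in auto)
 have "bounded_wgrad \<eta> g"
 proof (rule bounded_wgradI[OF \<eta>m gm _ _ i\<eta> ig])
  show "\<bar>\<eta> x\<bar> <= max 1 (\<Sum>j\<in>(UNIV::'n set). 2 / \<kappa>)" "norm (g x) <= max 1 (\<Sum>j\<in>(UNIV::'n set). 2 / \<kappa>)" for x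
   using \<eta>01[of x] gB[of x] by auto
  fix j and t :: real and x :: "real^'n" assume t: "0 < t"
  let ?P = "\<Prod>i\<in>UNIV - {j}. \<theta> i (x $ i)"
  have split: "\<eta> y = \<theta> j (y $ j) * (\<Prod>i\<in>UNIV - {j}. \<theta> i (y $ i))" for y
   unfolding \<eta>_def by (subst prod.remove[of UNIV j]) auto
  have P: "(\<Prod>i\<in>UNIV - {j}. \<theta> i ((x - s *\<^sub>R axis j 1) $ i)) = ?P" for s
   by (intro prod.cong) (auto simp: axis_def)
  have xj: "(x - s *\<^sub>R axis j 1) $ j = x $ j - s" for s by simp
  have "\<eta> x - \<eta> (x - t *\<^sub>R axis j 1) = (\<theta> j (x $ j) - \<theta> j (x $ j - t)) * ?P"
   unfolding split P xj by (simp add: left_diff_distrib)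
  also have "... = (LBINT \<tau>. \<psi> j (x $ j - \<tau>) * ind {0..<t} \<tau> * ?P)"
   by (simp add: \<theta>diff[OF t])
  also have "... = (LBINT \<tau>. g (x - \<tau> *\<^sub>R axis j 1) $ j * ind {0..<t} \<tau>)"
   unfolding g_def vec_lambda_beta P xj by (simp add: mult_ac)
  finally show "\<eta> x - \<eta> (x - t *\<^sub>R axis j 1) = (LBINT \<tau>. g (x - \<tau> *\<^sub>R axis j 1) $ j * ind {0..<t} \<tau>)" .
 qed
 moreover have "\<eta> x = 1" if "!!i. \<bar>x $ i - c $ i\<bar> <= r" for x
 proof -
  have "\<theta> i (x $ i) = 1" for i using that[of i] by (intro \<theta>in) auto
  thus ?thesis by (simp add: \<eta>_def)
 qed
 ultimately show thesis using that \<eta>01 \<eta>out gout gle by blast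
qed

section \<open>First variation and Caccioppoli inequality\<close>

text \<open>The rank-one matrix of \<open>a\<close> and \<open>b\<close>, produced by the product
  rule for a cutoff times a vector-valued map.\<close>

definition outer :: "real^'N => real^'n => real^'n^'N" where
 "outer a b = (\<chi> i j. a $ i * b $ j)"

lemma norm_outer: "norm (outer a b) = norm a * norm b"
proof -
 have "(norm (outer a b))\<^sup>2 = (norm a * norm b)\<^sup>2"
  unfolding power_mult_distrib power2_norm_eq_inner
  by (simp add: outer_def inner_vec_def sum_product mult_ac) (rule sum.swap)
 thus ?thesis by simp
qed

lemma outer_minus: "outer (- a) b = - outer a b"
 by (simp add: outer_def vec_eq_iff)

lemma outer_measurable [measurable]:
 assumes "f : borel_measurable M" "g : borel_measurable M"
 shows "(%x. outer (f x) (g x)) : borel_measurable M"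
proof -
 have [measurable]: "(%x. f x $ i) : borel_measurable M" "(%x. g x $ j) : borel_measurable M" for i j
  unfolding component_eq_inner using assms by measurable
 have "(%x. outer (f x) (g x)) = (%x. \<Sum>i\<in>UNIV. \<Sum>j\<in>UNIV. (f x $ i * g x $ j) *\<^sub>R axis i (axis j 1))"
  unfolding outer_def by (simp only: fun_eq_iff vec_eq_iff matrix_sum_axis vec_lambda_beta simp_thms)
 thus ?thesis by simp
qed

lemma norm_add_powr_le:
 "0 <= p ==> norm (a + b) powr p <= 2 powr p * (norm a powr p + norm (b::'b::real_normed_vector) powr p)"
proof -
 assume p: "0 <= p"
 have "norm (a + b) powr p <= (2 * max (norm a) (norm b)) powr p"
  using p norm_triangle_ineq[of a b] by (intro powr_mono2) auto
 also have "... = 2 powr p * max (norm a) (norm b) powr p" by (simp add: powr_mult le_max_iff_disj)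
 also have "... <= 2 powr p * (norm a powr p + norm b powr p)" by (intro mult_left_mono) (auto simp: max_def)
 finally show ?thesis .
qed

lemma integrable_powr_add:
 fixes f g :: "'a => 'b::euclidean_space"
 assumes "integrable M (%x. norm (f x) powr p)" "integrable M (%x. norm (g x) powr p)" "0 <= p"
  and "f : borel_measurable M" "g : borel_measurable M"
 shows "integrable M (%x. norm (f x + g x) powr p)"
proof (rule integrable_bound')
 show "integrable M (%x. 2 powr p * (norm (f x) powr p + norm (g x) powr p))" using assms by auto
 show "AE x in M. norm (norm (f x + g x) powr p) <= norm (2 powr p * (norm (f x) powr p + norm (g x) powr p))"
  using norm_add_powr_le[OF assms(3)] by (intro AE_I2) (simp add: abs_of_nonneg)
qed (use assms in measurable)

lemma integrable_powr_le:
 fixes f :: "'a => 'b::euclidean_space" and g :: "'a => 'c::euclidean_space"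
 assumes g: "integrable M (%x. norm (g x) powr p)" and "0 <= p" "f : borel_measurable M"
  and le: "!!x. norm (f x) <= C * norm (g x)" and C: "0 <= C"
 shows "integrable M (%x. norm (f x) powr p)"
proof (rule integrable_bound')
 show "integrable M (%x. C powr p * norm (g x) powr p)" using g by auto
 have "norm (f x) powr p <= C powr p * norm (g x) powr p" for x
  using powr_mono2[OF assms(2) norm_ge_zero le[of x]] C by (simp add: powr_mult)
 thus "AE x in M. norm (norm (f x) powr p) <= norm (C powr p * norm (g x) powr p)" by (simp add: abs_of_nonneg)
qed (use assms in measurable)

lemma bounded_wgrad_shift:
 fixes \<eta> :: "real^'n => real"
 assumes "bounded_wgrad \<eta> g"
 shows "bounded_wgrad (%x. \<eta> (x - h)) (%x. g (x - h))"
proof -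
 have [measurable]: "\<eta> : borelfun" "g : borelfun" using assms by (auto simp: bounded_wgrad_def)
 have "(LBINT x. \<eta> (x - h) * pd \<phi> j x) = - (LBINT x. g (x - h) $ j * \<phi> x)"
  if \<phi>: "\<phi> : tests" for \<phi> :: "real^'n => real" and j
 proof -
  let ?\<psi> = "%x. \<phi> (x + h)"
  have d: "frechet_derivative ?\<psi> (at x) v = frechet_derivative \<phi> (at (x + h)) v" for x v
  proof -
   have "(?\<psi> has_derivative (%v. frechet_derivative \<phi> (at (x + h)) v)) (at x)"
    by (rule has_derivative_compose[OF _ tests_derivative[OF \<phi>]]) (auto intro!: derivative_eq_intros)
   thus ?thesis by (metis frechet_derivative_at)
  qed
  have \<psi>: "?\<psi> : tests"
  proof -
   have "C_k k (%x. \<phi> (h + x))" for k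
    using C_k_bounded_linear_comp[OF bounded_linear_ident, of k \<phi> h] \<phi> by (simp add: tests_iff)
   moreover obtain B where B: "!!x. \<phi> x ~= 0 ==> norm x <= B" using \<phi> unfolding tests_iff bounded_iff by blast
   have "norm x <= B + norm h" if "\<phi> (h + x) ~= 0" for x
    using B[OF that] norm_triangle_ineq2[of x "- h"] by (simp add: add.commute)
   ultimately show ?thesis unfolding tests_iff bounded_iff by (auto simp: add.commute)
  qed
  note [measurable] = tests_borel[OF \<phi>] tests_borel[OF test_functions_derivative[OF \<phi>, of "axis j 1"]]
  have [measurable]: "(%x. g x $ j) : borelfun" unfolding component_eq_inner by measurable
  have "(LBINT x. \<eta> (x - h) * pd \<phi> j x) = (LBINT x. \<eta> x * frechet_derivative \<phi> (at (x + h)) (axis j 1))"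
   using lborel_integral_shift(1)[of "%x. \<eta> (x - h) * pd \<phi> j x" h] by simp
  also have "... = - (LBINT x. g x $ j * \<phi> (x + h))"
   using assms \<psi> unfolding bounded_wgrad_def d[symmetric] by blast
  also have "(LBINT x. g x $ j * \<phi> (x + h)) = (LBINT x. g (x - h) $ j * \<phi> x)"
   using lborel_integral_shift(1)[of "%x. g (x - h) $ j * \<phi> x" h] by simp
  finally show ?thesis .
 qed
 moreover have "\<exists>B. \<forall>x. \<bar>\<eta> (x - h)\<bar> <= B \<and> norm (g (x - h)) <= B"
  using assms unfolding bounded_wgrad_def by blast
 ultimately show ?thesis unfolding bounded_wgrad_def by auto
qed

text \<open>The setting of the estimates: Borel representatives on the whole space, finite energy on
  \<open>S\<close>, and minimality against competitors given by a global weak gradient and a compact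
  support in \<open>S\<close>. It replaces the unspecified representative \<open>weak_grad\<close>
  and the closure \<open>W1p_0\<close> by data that can be mollified and translated.\<close>

locale local_min = pq_integrand p q L \<mu> F for p q L \<mu> and F :: "real^'n^'N => real" +
 fixes S :: "(real^'n) set" and u :: "real^'n => real^'N" and Z :: "real^'n => real^'n^'N"
 assumes S: "open S" and wg: "wgrad S u Z"
  and up: "lintegrable (%x. norm (u x) powr p)" and Zp: "lintegrable (%x. norm (Z x) powr p)"
  and FZ: "lintegrable (%x. ind S x * F (Z x))"
  and minimal: "!!\<Phi> \<Psi> K. wgrad UNIV \<Phi> \<Psi> ==> compact K ==> K <= S ==> (!!x. x \<notin> K ==> \<Phi> x = 0) ==> (!!x. x \<notin> K ==> \<Psi> x = 0) ==>
   lintegrable (%x. norm (\<Phi> x) powr p) ==> lintegrable (%x. norm (\<Psi> x) powr p) ==>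
   (NBINT x. en (ind S x * F (Z x))) <= (NBINT x. en (ind S x * F (Z x + \<Psi> x)))"
begin

lemma measF [measurable]: "F : borelfun"
 by (rule borel_measurable_continuous_onI[OF continuous_F])

lemma meas\<sigma> [measurable]: "\<sigma> : borelfun"
 by (rule borel_measurable_continuous_onI[OF continuous_\<sigma>])

lemma measuZ [measurable]: "u : borelfun" "Z : borelfun"
 using wgradD[OF wg] by auto

lemma measS [measurable]: "S : sets borel" using S by auto

definition du :: "real^'n => real^'n => real^'N" where "du h x = u (x + h) - u x"
definition dZ :: "real^'n => real^'n => real^'n^'N" where "dZ h x = Z (x + h) - Z x"

lemma meas_du [measurable]: "du h : borelfun" "dZ h : borelfun"
 unfolding du_def[abs_def] dZ_def[abs_def] by measurable

lemma integrable_shift_powr: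
 "lintegrable (%x. norm (u (x + h)) powr p)" "lintegrable (%x. norm (Z (x + h)) powr p)"
 using up Zp lborel_integral_shift(2)[of "%x. norm (u x) powr p" h] lborel_integral_shift(2)[of "%x. norm (Z x) powr p" h] by auto

lemma du_powr: "lintegrable (%x. norm (du h x) powr p)" "lintegrable (%x. norm (dZ h x) powr p)"
 using integrable_powr_add[OF integrable_shift_powr(1) up[folded norm_minus_cancel[of "u _"]], of h]
  integrable_powr_add[OF integrable_shift_powr(2) Zp[folded norm_minus_cancel[of "Z _"]], of h] p2
 by (auto simp: du_def dZ_def)

lemma wgrad_du: "wgrad (S \<inter> (%x. x - h) ` S) (du h) (dZ h)"
 unfolding du_def[abs_def] dZ_def[abs_def]
 by (intro wgrad_diff wgrad_mono[OF wg] wgrad_mono[OF wgrad_translate[OF wg]]) auto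

lemma open_shift: "open (S \<inter> (%x. x - h) ` S)"
proof -
 have eq: "(%x. x - h) ` S = (+) (- h) ` S" by (intro image_cong) auto
 have "open ((%x. x - h) ` S)" unfolding eq by (rule open_translation[OF S])
 thus ?thesis using S by auto
qed

context
 fixes \<eta> :: "real^'n => real" and g :: "real^'n => real^'n" and K :: "(real^'n) set" and h :: "real^'n"
 assumes \<eta>: "bounded_wgrad \<eta> g" and \<eta>01: "!!x. 0 <= \<eta> x" "!!x. \<eta> x <= 1"
  and K: "compact K" "K <= S" "(%x. x + h) ` K <= S"
  and zero: "!!x. x \<notin> K ==> \<eta> x = 0" "!!x. x \<notin> K ==> g x = 0"
begin

lemma wgrad_test: "wgrad UNIV (%x. \<eta> x *\<^sub>R du h x) (%x. \<eta> x *\<^sub>R dZ h x + outer (du h x) (g x))"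
 unfolding outer_def
proof (rule wgrad_product[OF wgrad_du \<eta> K(1) _ open_shift zero])
 show "K <= S \<inter> (%x. x - h) ` S"
 proof
  fix x assume x: "x : K"
  hence "x + h : S" using K(3) by auto
  thus "x : S \<inter> (%x. x - h) ` S" using x K(2) by (auto simp: image_iff intro!: bexI[of _ "x + h"])
 qed
qed

private lemma meas_\<eta>: "\<eta> : borelfun" "g : borelfun"
 using \<eta> by (auto simp: bounded_wgrad_def)

lemma powr_test: "lintegrable (%x. norm (\<eta> x *\<^sub>R du h x) powr p)"
 "lintegrable (%x. norm (\<eta> x *\<^sub>R dZ h x + outer (du h x) (g x)) powr p)"
proof -
 note [measurable] = meas_\<eta>
 obtain B where B: "!!x. norm (g x) <= B" using \<eta> unfolding bounded_wgrad_def by blast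
 have B0: "0 <= B" using B[of 0] norm_ge_zero order_trans by blast
 show "lintegrable (%x. norm (\<eta> x *\<^sub>R du h x) powr p)"
  using \<eta>01 p2 by (intro integrable_powr_le[OF du_powr(1)[of h], where C=1]) (auto simp: mult_left_le_one_le)
 show "lintegrable (%x. norm (\<eta> x *\<^sub>R dZ h x + outer (du h x) (g x)) powr p)"
 proof (rule integrable_powr_add)
  show "lintegrable (%x. norm (\<eta> x *\<^sub>R dZ h x) powr p)"
   using \<eta>01 p2 by (intro integrable_powr_le[OF du_powr(2)[of h], where C=1]) (auto simp: mult_left_le_one_le)
  show "lintegrable (%x. norm (outer (du h x) (g x)) powr p)"
   using B B0 p2 by (intro integrable_powr_le[OF du_powr(1)[of h], where C=B]) (auto simp: norm_outer mult.commute intro!: mult_right_mono)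
 qed (use p2 in auto)
qed

text \<open>The competitor is \<open>u\<close> plus a small multiple of \<eta> times the finite
  difference. By convexity the difference quotients \<open>f k\<close> of the energy density lie
  below the integrable \<open>f 0\<close>, and by minimality their integrals are nonnegative;
  Fatou's lemma for \<open>f 0 - f k\<close> then yields both the integrability of the limit and its
  sign, although no growth bound on the product of stress and gradient is at hand.\<close>

lemma first_variation:
 assumes Bq: "lintegrable (%x. norm (outer (du h x) (g x)) powr q)"
 defines "\<Psi> \<equiv> %x. \<eta> x *\<^sub>R dZ h x + outer (du h x) (g x)"
 shows "lintegrable (%x. \<sigma> (Z x) \<bullet> \<Psi> x)" "0 <= (LBINT x. \<sigma> (Z x) \<bullet> \<Psi> x)"
proof -
 note [measurable] = meas_\<eta>
 have [measurable]: "\<Psi> : borelfun" unfolding \<Psi>_def by measurable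
 have pt: "lintegrable (%x. norm (\<Psi> x) powr p)" unfolding \<Psi>_def by (rule powr_test(2))
 have [measurable]: "K : sets borel" using K(1) compact_imp_closed by (intro borel_closed) auto
 have \<Psi>0: "\<Psi> x = 0" if "x \<notin> K" for x using zero[OF that] by (simp add: \<Psi>_def outer_def vec_eq_iff)
 let ?I = "%x. ind K x :: real"
 have iFZ: "lintegrable (%x. ?I x * F (Z x))"
  by (rule integrable_bound'[OF FZ]) (use K(2) F_nonneg in \<open>auto simp: indicator_def abs_of_nonneg intro!: AE_I2\<close>)
 have iFZh: "lintegrable (%x. ?I x * F (Z (x + h)))"
 proof (rule integrable_bound')
  show "lintegrable (%x. ind S (x + h) * F (Z (x + h)))"
   using lborel_integral_shift(2)[of "%x. ind S x * F (Z x)" h] FZ by simp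
  show "AE x in lborel. norm (?I x * F (Z (x + h))) <= norm (ind S (x + h) * F (Z (x + h)))"
   using K(3) F_nonneg by (auto simp: indicator_def image_subset_iff intro!: AE_I2)
 qed measurable
 have iK: "lintegrable ?I" using emeasure_compact_finite[OF K(1)] by (simp add: integrable_indicator_iff)
 obtain C where C: "0 < C" "!!z w. F (z + w) <= C * (1 + F z + norm w powr q)" using F_perturb by blast
 have iF1: "lintegrable (%x. ?I x * F (Z x + \<Psi> x))"
 proof (rule integrable_bound')
  show "lintegrable (%x. C * (?I x + ?I x * F (Z x) + ?I x * F (Z (x + h)) + norm (outer (du h x) (g x)) powr q))"
   using iFZ iFZh iK Bq by auto
  have "?I x * F (Z x + \<Psi> x) <= C * (?I x + ?I x * F (Z x) + ?I x * F (Z (x + h)) + norm (outer (du h x) (g x)) powr q)" for x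
  proof (cases "x : K")
   case True
   let ?A = "(1 - \<eta> x) *\<^sub>R Z x + \<eta> x *\<^sub>R Z (x + h)"
   have "F ?A <= (1 - \<eta> x) * F (Z x) + \<eta> x * F (Z (x + h))"
    using F_convex_on \<eta>01[of x] by (intro convex_onD[of UNIV]) auto
   also have "... <= 1 * F (Z x) + 1 * F (Z (x + h))"
    using \<eta>01[of x] F_nonneg by (intro add_mono mult_right_mono) auto
   finally have A: "F ?A <= F (Z x) + F (Z (x + h))" by simp
   have "Z x + \<Psi> x = ?A + outer (du h x) (g x)" by (simp add: \<Psi>_def dZ_def algebra_simps)
   hence "F (Z x + \<Psi> x) <= C * (1 + F ?A + norm (outer (du h x) (g x)) powr q)" using C(2) by metis
   also have "... <= C * (1 + (F (Z x) + F (Z (x + h))) + norm (outer (du h x) (g x)) powr q)"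
    using A C(1) by (intro mult_left_mono) auto
   finally show ?thesis using True by (simp add: add.assoc)
  qed (use C(1) in simp)
  thus "AE x in lborel. norm (?I x * F (Z x + \<Psi> x)) <= norm (C * (?I x + ?I x * F (Z x) + ?I x * F (Z (x + h)) + norm (outer (du h x) (g x)) powr q))"
   using F_nonneg C(1) by (intro AE_I2) (simp add: abs_of_nonneg)
 qed measurable
 \<comment> \<open>\<open>a 0 = 1\<close>, so \<open>f 0\<close> below is the full difference of the
   energy densities.\<close>
 define a where "a k = 1 / real (Suc k)" for k
 have a: "0 < a k" "a k <= 1" for k by (auto simp: a_def)
 have cvx: "F (Z x + a k *\<^sub>R \<Psi> x) <= (1 - a k) * F (Z x) + a k * F (Z x + \<Psi> x)" for k x
 proof -
  have "(1 - a k) *\<^sub>R Z x + a k *\<^sub>R (Z x + \<Psi> x) = Z x + a k *\<^sub>R \<Psi> x" by (simp add: algebra_simps)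
  thus ?thesis using convex_onD[OF F_convex_on, of "a k" "Z x" "Z x + \<Psi> x"] a[of k] by simp
 qed
 have iFk: "lintegrable (%x. ?I x * F (Z x + a k *\<^sub>R \<Psi> x))" for k
 proof (rule integrable_bound'[OF Bochner_Integration.integrable_add[OF iFZ iF1]])
  have "F (Z x + a k *\<^sub>R \<Psi> x) <= F (Z x) + F (Z x + \<Psi> x)" for x
  proof -
   have "(1 - a k) * F (Z x) + a k * F (Z x + \<Psi> x) <= 1 * F (Z x) + 1 * F (Z x + \<Psi> x)"
    using a[of k] F_nonneg by (intro add_mono mult_right_mono) auto
   thus ?thesis using cvx[of x k] by simp
  qed
  thus "AE x in lborel. norm (?I x * F (Z x + a k *\<^sub>R \<Psi> x)) <= norm (?I x * F (Z x) + ?I x * F (Z x + \<Psi> x))"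
   using F_nonneg by (intro AE_I2) (auto simp: indicator_def)
 qed measurable
 define f where "f k x = (?I x * F (Z x + a k *\<^sub>R \<Psi> x) - ?I x * F (Z x)) / a k" for k x
 have fi: "lintegrable (f k)" for k unfolding f_def using iFk[of k] iFZ by auto
 have f0: "0 <= (LBINT x. f k x)" for k
 proof -
  have eq: "ind S x * F (Z x + a k *\<^sub>R \<Psi> x) = ind S x * F (Z x) + (?I x * F (Z x + a k *\<^sub>R \<Psi> x) - ?I x * F (Z x))" for x
   using \<Psi>0[of x] K(2) by (auto simp: indicator_def)
  have iS: "lintegrable (%x. ind S x * F (Z x + a k *\<^sub>R \<Psi> x))"
   unfolding eq using FZ iFk[of k] iFZ by auto
  have "(NBINT x. en (ind S x * F (Z x))) <= (NBINT x. en (ind S x * F (Z x + a k *\<^sub>R \<Psi> x)))"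
  proof (rule minimal[OF _ K(1,2)])
   show "wgrad UNIV (%x. a k *\<^sub>R \<eta> x *\<^sub>R du h x) (%x. a k *\<^sub>R \<Psi> x)"
    unfolding \<Psi>_def by (rule wgrad_scaleR[OF wgrad_test])
   show "lintegrable (%x. norm (a k *\<^sub>R \<eta> x *\<^sub>R du h x) powr p)"
    using p2 a[of k] by (intro integrable_powr_le[OF powr_test(1), where C=1]) (auto simp: abs_mult intro!: mult_right_mono mult_left_le_one_le)
   show "lintegrable (%x. norm (a k *\<^sub>R \<Psi> x) powr p)"
    using p2 a[of k] by (intro integrable_powr_le[OF pt, where C=1]) (auto simp: mult_left_le_one_le)
  qed (use zero \<Psi>0 in auto)
  hence "(LBINT x. ind S x * F (Z x)) <= (LBINT x. ind S x * F (Z x + a k *\<^sub>R \<Psi> x))"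
   using FZ iS F_nonneg by (simp add: nn_integral_eq_integral integral_nonneg_AE)
  also have "... = (LBINT x. ind S x * F (Z x)) + (LBINT x. ?I x * F (Z x + a k *\<^sub>R \<Psi> x) - ?I x * F (Z x))"
   unfolding eq using FZ iFk[of k] iFZ by (intro Bochner_Integration.integral_add) auto
  finally have "0 <= (LBINT x. ?I x * F (Z x + a k *\<^sub>R \<Psi> x) - ?I x * F (Z x))" by simp
  thus ?thesis unfolding f_def using a[of k] by simp
 qed
 have fle: "f k x <= f 0 x" for k x
 proof (cases "x : K")
  case True
  have "F (Z x + a k *\<^sub>R \<Psi> x) - F (Z x) <= a k * (F (Z x + \<Psi> x) - F (Z x))" using cvx[of x k] by (simp add: algebra_simps)
  hence "(F (Z x + a k *\<^sub>R \<Psi> x) - F (Z x)) / a k <= F (Z x + \<Psi> x) - F (Z x)"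
   using a[of k] by (simp add: divide_le_eq mult.commute)
  thus ?thesis using True by (simp add: f_def a_def[of 0])
 qed (simp add: f_def)
 have flim: "(%k. f k x) ----> \<sigma> (Z x) \<bullet> \<Psi> x" for x
 proof (cases "x : K")
  case True
  have "((%t. F (Z x + t *\<^sub>R \<Psi> x)) has_derivative (%s. \<sigma> (Z x + 0 *\<^sub>R \<Psi> x) \<bullet> (s *\<^sub>R \<Psi> x))) (at 0)"
   by (rule has_derivative_compose[OF _ F_deriv]) (auto intro!: derivative_eq_intros)
  hence "((%t. F (Z x + t *\<^sub>R \<Psi> x)) has_real_derivative \<sigma> (Z x) \<bullet> \<Psi> x) (at 0)"
   unfolding has_field_derivative_def by (rule has_derivative_eq_rhs) (simp add: fun_eq_iff)
  hence "((%t. (F (Z x + t *\<^sub>R \<Psi> x) - F (Z x)) / t) \<longlongrightarrow> \<sigma> (Z x) \<bullet> \<Psi> x) (at 0)"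
   unfolding has_field_derivative_iff by simp
  moreover have "filterlim a (at 0) sequentially"
   unfolding filterlim_at using a(1) LIMSEQ_inverse_real_of_nat by (auto simp: a_def[abs_def] inverse_eq_divide)
  ultimately have "(%k. (F (Z x + a k *\<^sub>R \<Psi> x) - F (Z x)) / a k) ----> \<sigma> (Z x) \<bullet> \<Psi> x"
   by (rule filterlim_compose)
  thus ?thesis using True by (simp add: f_def)
 qed (simp add: f_def \<Psi>0)
 let ?\<sigma> = "%x. \<sigma> (Z x) \<bullet> \<Psi> x"
 have \<sigma>le: "?\<sigma> x <= f 0 x" for x using flim[of x] fle by (intro LIMSEQ_le_const2) auto
 have "(NBINT x. en (f 0 x - ?\<sigma> x)) = (NBINT x. liminf (%k. en (f 0 x - f k x)))"
 proof (rule nn_integral_cong)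
  fix x
  have "(%k. en (f 0 x - f k x)) ----> en (f 0 x - ?\<sigma> x)"
   by (intro tendsto_ennrealI tendsto_diff tendsto_const flim)
  thus "en (f 0 x - ?\<sigma> x) = liminf (%k. en (f 0 x - f k x))"
   by (intro lim_imp_Liminf[symmetric]) auto
 qed
 also have "... <= liminf (%k. (NBINT x. en (f 0 x - f k x)))"
  using fi by (intro nn_integral_liminf) auto
 also have "... <= liminf (%k. en (LBINT x. f 0 x))"
 proof (intro Liminf_mono always_eventually allI)
  fix k
  have "(NBINT x. en (f 0 x - f k x)) = en (LBINT x. f 0 x - f k x)"
   using fi fle[of k] by (intro nn_integral_eq_integral) auto
  also have "(LBINT x. f 0 x - f k x) = (LBINT x. f 0 x) - (LBINT x. f k x)"
   using fi by (intro Bochner_Integration.integral_diff)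
  finally show "(NBINT x. en (f 0 x - f k x)) <= en (LBINT x. f 0 x)"
   using f0[of k] by (simp add: ennreal_leI)
 qed
 also have "... = en (LBINT x. f 0 x)" by (rule Liminf_const) simp
 finally have le: "(NBINT x. en (f 0 x - ?\<sigma> x)) <= en (LBINT x. f 0 x)" .
 have id: "lintegrable (%x. f 0 x - ?\<sigma> x)"
 proof (rule integrableI_nonneg)
  show "(%x. f 0 x - ?\<sigma> x) : borel_measurable lborel" using fi[of 0] by measurable
  show "(NBINT x. en (f 0 x - ?\<sigma> x)) < \<infinity>" using le by (rule order_le_less_trans) simp
 qed (use \<sigma>le in auto)
 show i\<sigma>: "lintegrable ?\<sigma>" using Bochner_Integration.integrable_diff[OF fi[of 0] id] by simp
 have "en (LBINT x. f 0 x - ?\<sigma> x) <= en (LBINT x. f 0 x)"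
  using le nn_integral_eq_integral[OF id] \<sigma>le by simp
 hence "(LBINT x. f 0 x - ?\<sigma> x) <= (LBINT x. f 0 x)" using f0[of 0] by simp
 thus "0 <= (LBINT x. ?\<sigma> x)" using fi[of 0] i\<sigma> by simp
qed

end

text \<open>The symmetrised Bregman distance of \<open>F\<close> between the gradients at
  \<open>x\<close> and \<open>x + h\<close>, the quantity to which coercivity and cocoercivity both
  refer.\<close>

definition excess :: "real^'n => real^'n => real" where
 "excess h x = (\<sigma> (Z (x + h)) - \<sigma> (Z x)) \<bullet> dZ h x"

lemma excess_nonneg: "0 <= excess h x"
 unfolding excess_def dZ_def by (rule \<sigma>_monotone)

lemma meas_excess [measurable]: "excess h : borelfun"
 unfolding excess_def[abs_def] by measurable

text \<open>Since \<^term>\<open>q\<close> may exceed \<^term>\<open>p\<close>, the products \<^term>\<open>\<sigma> (Z x) \<bullet> Z (x + h)\<close> need not be integrable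
 by themselves; the first variation gives integrability of the combination only.\<close>

lemma excess_integral_le:
 fixes \<eta> :: "real^'n => real" and g :: "real^'n => real^'n" and K :: "(real^'n) set" and h :: "real^'n"
 assumes \<eta>: "bounded_wgrad \<eta> g" and \<eta>01: "!!x. 0 <= \<eta> x" "!!x. \<eta> x <= 1"
  and K: "compact K" "K <= S" "(%x. x + h) ` K <= S"
  and zero: "!!x. x \<notin> K ==> \<eta> x = 0" "!!x. x \<notin> K ==> g x = 0"
  and Bq: "lintegrable (%x. norm (outer (du h x) (g x)) powr q)"
 shows "(NBINT x. en (\<eta> x * excess h x))
  <= (NBINT x. en (norm (\<sigma> (Z (x + h)) - \<sigma> (Z x)) * norm (du h x) * norm (g x)))"
proof -
 have [measurable]: "\<eta> : borelfun" "g : borelfun"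
  using \<eta> by (auto simp: bounded_wgrad_def)
 let ?B = "%x. outer (du h x) (g x)"
 let ?E = "%x. \<sigma> (Z x) \<bullet> (\<eta> x *\<^sub>R dZ h x + ?B x)"
 \<comment> \<open>This expression comes from the first variation for the increment
   \<open>- h\<close> with the cutoff shifted by \<open>h\<close>, translated back. Added to the one
   for \<open>h\<close>, it leaves the excess and a term with the stress difference.\<close>
 let ?E' = "%x. \<sigma> (Z (x + h)) \<bullet> (\<eta> x *\<^sub>R (- dZ h x) - ?B x)"
 note E = first_variation[OF \<eta> \<eta>01 K zero Bq]
 have E': "lintegrable ?E'" "0 <= (LBINT x. ?E' x)"
 proof -
  let ?K = "(%x. x + h) ` K"
  have dm: "du (- h) (x + h) = - du h x" "dZ (- h) (x + h) = - dZ h x" for x by (simp_all add: du_def dZ_def)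
  have inK: "x - h : K" if "x : ?K" for x using that by auto
  have outK: "x - h \<notin> K" if "x \<notin> ?K" for x using that by (auto simp: image_iff dest: bspec[of _ _ "x - h"])
  have Bq': "lintegrable (%x. norm (outer (du (- h) x) (g (x - h))) powr q)"
  proof -
   have "(%x. norm (outer (du (- h) x) (g (x - h))) powr q) : borelfun" by measurable
   from lborel_integral_shift(2)[OF this, of h] Bq show ?thesis by (simp add: dm outer_minus)
  qed
  have cK: "compact ?K" using compact_translation[OF K(1), of h] by (simp add: add.commute[of h])
  have sK: "(%x. x + - h) ` ?K <= S" using K(2) by auto
  note F = first_variation[OF bounded_wgrad_shift[OF \<eta>, of h] \<eta>01 cK K(3) sK zero(1)[OF outK] zero(2)[OF outK] Bq']
  let ?f = "%x. \<sigma> (Z x) \<bullet> (\<eta> (x - h) *\<^sub>R dZ (- h) x + outer (du (- h) x) (g (x - h)))"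
  have fm: "?f : borelfun" by measurable
  have eq: "?f (x + h) = ?E' x" for x by (simp add: dm outer_minus)
  show "lintegrable ?E'" using F(1) lborel_integral_shift(2)[OF fm, of h] unfolding eq by simp
  show "0 <= (LBINT x. ?E' x)" using F(2) lborel_integral_shift(1)[OF fm, of h] unfolding eq by simp
 qed
 let ?G = "%x. (\<sigma> (Z (x + h)) - \<sigma> (Z x)) \<bullet> ?B x"
 have sum: "?E x + ?E' x = - (\<eta> x * excess h x) - ?G x" for x
  by (simp add: excess_def inner_simps algebra_simps)
 show ?thesis
 \<comment> \<open>If the right-hand side is infinite there is nothing to show; otherwise the error
   term \<open>?G\<close> is integrable and the excess inherits integrability from the sum.\<close>
 proof (cases "(NBINT x. en (norm (\<sigma> (Z (x + h)) - \<sigma> (Z x)) * norm (du h x) * norm (g x))) = \<infinity>")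
  case False
  have iG: "lintegrable ?G"
  proof (rule integrableI_bounded)
   have "(NBINT x. en (norm (?G x))) <= (NBINT x. en (norm (\<sigma> (Z (x + h)) - \<sigma> (Z x)) * norm (du h x) * norm (g x)))"
    by (intro nn_integral_mono ennreal_leI) (metis Cauchy_Schwarz_ineq2 mult.assoc norm_outer real_norm_def)
   thus "(NBINT x. en (norm (?G x))) < \<infinity>" using False by (simp add: less_top order_le_less_trans)
  qed measurable
  have i1: "lintegrable (%x. ?E x + ?E' x)" using E(1) E'(1) by (rule Bochner_Integration.integrable_add)
  have i2: "lintegrable (%x. - (?E x + ?E' x) - ?G x)"
   by (intro Bochner_Integration.integrable_diff integrable_minus i1 iG)
  have eq: "\<eta> x * excess h x = - (?E x + ?E' x) - ?G x" for x unfolding sum by simp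
  have iD: "lintegrable (%x. \<eta> x * excess h x)" unfolding eq by (rule i2)
  have "(LBINT x. \<eta> x * excess h x) = - ((LBINT x. ?E x) + (LBINT x. ?E' x)) - (LBINT x. ?G x)"
   unfolding eq using E(1) E'(1) iG i1 by simp
  also have "... <= norm (LBINT x. ?G x)" using E(2) E'(2) by simp
  finally have le: "(LBINT x. \<eta> x * excess h x) <= norm (LBINT x. ?G x)" .
  have "(NBINT x. en (\<eta> x * excess h x)) = en (LBINT x. \<eta> x * excess h x)"
   using iD \<eta>01 excess_nonneg by (intro nn_integral_eq_integral) auto
  also have "... <= en (norm (LBINT x. ?G x))" using le by (rule ennreal_leI)
  also have "... <= (NBINT x. en (norm (?G x)))" by (rule integral_norm_bound_ennreal[OF iG])
  also have "... <= (NBINT x. en (norm (\<sigma> (Z (x + h)) - \<sigma> (Z x)) * norm (du h x) * norm (g x)))"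
   by (intro nn_integral_mono ennreal_leI) (metis Cauchy_Schwarz_ineq2 mult.assoc norm_outer real_norm_def)
  finally show ?thesis .
 qed simp
qed

end

section \<open>Energy of finite differences and the Caccioppoli inequality on good slices\<close>

definition cube :: "real^'n => real => (real^'n) set" where
 "cube c r = {x. \<forall>i. \<bar>x $ i - c $ i\<bar> <= r}"

lemma cube_eq_cbox: "cube c r = cbox (c - (\<chi> i. r)) (c + (\<chi> i. r))"
 by (auto simp: cube_def mem_box_cart abs_le_iff algebra_simps)

lemma compact_cube: "compact (cube c r)" and cube_borel [measurable]: "cube c r : sets borel"
 by (simp_all add: cube_eq_cbox compact_cbox)

lemma cube_mono: "r <= \<rho> ==> cube c r <= cube c \<rho>"
 by (auto simp: cube_def intro: order_trans)

lemma rpow_mult_square: "0 <= a ==> 2 <= p ==> rpow a (p - 2) * a\<^sup>2 = a powr p" for p :: real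
proof -
 assume a: "0 <= a" and p: "2 <= p"
 show ?thesis
 proof (cases "a = 0")
  case False
  hence "rpow a (p - 2) * a\<^sup>2 = a powr (p - 2) * a powr 2" using a by (simp add: rpow_eq_powr powr_numeral)
  also have "... = a powr p" by (subst powr_add[symmetric]) simp
  finally show ?thesis .
 qed simp
qed

context local_min
begin

text \<open>Up to constants, the right-hand side of Sobolev's inequality for
  \<open>norm (du h x) powr (p / 2)\<close>; \<open>rpow\<close> makes the weight equal to 1 for
  \<open>p = 2\<close>.\<close>

definition energy_density :: "real^'n => real^'n => real" where
 "energy_density h x = norm (du h x) powr p + rpow (norm (du h x)) (p - 2) * (norm (dZ h x))\<^sup>2"

definition EN :: "real^'n => real^'n => real => ennreal" where
 "EN h c \<rho> = (NBINT x. ind (cube c \<rho>) x * en (energy_density h x))"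

lemma energy_density_nonneg: "0 <= energy_density h x"
 by (simp add: energy_density_def)

lemma meas_energy_density [measurable]: "energy_density h : borelfun"
 unfolding energy_density_def[abs_def] by measurable

text \<open>Localised Sobolev inequalities: an ordinary cutoff with slope of order
  \<open>1 / (\<rho> - r)\<close> multiplies \<open>du h\<close>, and the terms with its gradient go
  into the p-th power of \<open>du h\<close>.\<close>

lemma slice_energy:
 assumes s: "2 <= s" "(real CARD('n) - 3) * s <= 2 * (real CARD('n) - 1)" "2 <= CARD('n)"
  and r: "0 < r" "r < \<rho>" and cS: "cube c \<rho> <= S" "(%x. x + h) ` cube c \<rho> <= S"
 shows "(NBINT t. epow (slice j (%x. ind (cube c r) x * np (du h x) (p * s / 2)) t) (2 / s))
  <= en ((s + 2)\<^sup>2 * p\<^sup>2 / 8 * (2 + 8 * (real CARD('n))\<^sup>2 / (\<rho> - r)\<^sup>2)) * EN h c \<rho>" (is ?slices)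
  and "(real CARD('n) - 2) * s <= 2 * real CARD('n) ==>
   epow (NBINT x. ind (cube c r) x * np (du h x) (p * s / 2)) (2 / s)
  <= en ((s + 2)\<^sup>2 * p\<^sup>2 / 8 * (2 + 8 * (real CARD('n))\<^sup>2 / (\<rho> - r)\<^sup>2)) * EN h c \<rho>" (is "_ ==> ?full")
proof -
 obtain \<zeta> g where \<zeta>: "bounded_wgrad \<zeta> g" "!!x. 0 <= \<zeta> x" "!!x. \<zeta> x <= 1"
  "!!x. (!!i. \<bar>x $ i - c $ i\<bar> <= r) ==> \<zeta> x = 1"
  "!!x i. \<rho> <= \<bar>x $ i - c $ i\<bar> ==> \<zeta> x = 0" "!!x i. \<rho> <= \<bar>x $ i - c $ i\<bar> ==> g x = 0"
  "!!x. norm (g x) <= (\<Sum>j\<in>UNIV. (ind {c $ j - \<rho><..<c $ j - r} (x $ j) + ind {c $ j + r<..<c $ j + \<rho>} (x $ j)) / (\<rho> - r))"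
 proof (rule cutoff_cube[of r \<rho> "%i. {c $ i - \<rho><..<c $ i - r}" "%i. {c $ i + r<..<c $ i + \<rho>}" c "\<rho> - r"], goal_cases)
  case (10 \<eta> g)
  show thesis by (rule that[of \<eta> g]; fact 10)
 qed (use r in auto)
 \<comment> \<open>Each coordinate contributes at most \<open>2 / (\<rho> - r)\<close> to the cutoff
   gradient; \<open>2 * G\<^sup>2\<close> is the quotient that appears in the claim.\<close>
 define G where "G = 2 * real CARD('n) / (\<rho> - r)"
 have g: "norm (g x) <= G" for x
 proof -
  have "norm (g x) <= (\<Sum>j\<in>(UNIV::'n set). 2 / (\<rho> - r))"
   using r by (intro order_trans[OF \<zeta>(7)] sum_mono divide_right_mono) (auto simp: indicator_def)
  thus ?thesis by (simp add: G_def mult.commute)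
 qed
 have out: "x \<notin> cube c \<rho> ==> \<exists>i. \<rho> <= \<bar>x $ i - c $ i\<bar>" for x by (auto simp: cube_def not_le intro: less_imp_le)
 have z: "\<zeta> x = 0" "g x = 0" if "x \<notin> cube c \<rho>" for x using out[OF that] \<zeta>(5,6) by blast+
 let ?\<Phi> = "%x. \<zeta> x *\<^sub>R du h x" and ?\<Psi> = "%x. \<zeta> x *\<^sub>R dZ h x + outer (du h x) (g x)"
 note tst = wgrad_test[OF \<zeta>(1-3) compact_cube cS z] powr_test[OF \<zeta>(1-3) compact_cube cS z]
 obtain R where R: "!!x. x : cube c \<rho> ==> norm x <= R" using compact_imp_bounded[OF compact_cube] unfolding bounded_iff by blast
 have supp: "?\<Phi> x = 0" if "R + 1 <= norm x" for x using z(1)[of x] R[of x] that by force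
 let ?f0 = "%x. norm (?\<Phi> x) powr p + rpow (norm (?\<Phi> x)) (p - 2) * (norm (?\<Psi> x))\<^sup>2"
 have f0: "en (?f0 x) <= en (2 + 2 * G\<^sup>2) * (ind (cube c \<rho>) x * en (energy_density h x))" for x
 proof (cases "x : cube c \<rho>")
  case True
  let ?d = "norm (du h x)"
  have n: "norm (?\<Phi> x) <= ?d" using \<zeta>(2,3)[of x] by (simp add: mult_left_le_one_le)
  have "norm (?\<Psi> x) <= norm (dZ h x) + ?d * G"
  proof -
   have "norm (?\<Psi> x) <= norm (\<zeta> x *\<^sub>R dZ h x) + norm (outer (du h x) (g x))" by (rule norm_triangle_ineq)
   also have "... <= norm (dZ h x) + ?d * G"
    using \<zeta>(2,3)[of x] g[of x] by (intro add_mono) (auto simp: norm_outer mult_left_le_one_le intro!: mult_left_mono)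
   finally show ?thesis .
  qed
  hence "(norm (?\<Psi> x))\<^sup>2 <= (norm (dZ h x) + ?d * G)\<^sup>2" by (rule power_mono) simp
  also have "... <= 2 * (norm (dZ h x))\<^sup>2 + 2 * G\<^sup>2 * ?d\<^sup>2"
   using sum_squares_bound[of "norm (dZ h x)" "?d * G"] by (simp add: power2_sum power_mult_distrib mult_ac)
  finally have P: "(norm (?\<Psi> x))\<^sup>2 <= 2 * (norm (dZ h x))\<^sup>2 + 2 * G\<^sup>2 * ?d\<^sup>2" .
  have "?f0 x <= ?d powr p + rpow ?d (p - 2) * (2 * (norm (dZ h x))\<^sup>2 + 2 * G\<^sup>2 * ?d\<^sup>2)"
   using n P p2 by (intro add_mono mult_mono rpow_mono powr_mono2) auto
  also have "... = (1 + 2 * G\<^sup>2) * ?d powr p + 2 * (rpow ?d (p - 2) * (norm (dZ h x))\<^sup>2)"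
   using rpow_mult_square[of ?d p] p2 by (simp add: algebra_simps)
  also have "... <= (2 + 2 * G\<^sup>2) * ?d powr p + (2 + 2 * G\<^sup>2) * (rpow ?d (p - 2) * (norm (dZ h x))\<^sup>2)"
   by (intro add_mono mult_right_mono) auto
  also have "... = (2 + 2 * G\<^sup>2) * energy_density h x" by (simp add: energy_density_def algebra_simps)
  finally have "en (?f0 x) <= en ((2 + 2 * G\<^sup>2) * energy_density h x)" by (rule ennreal_leI)
  also have "... = en (2 + 2 * G\<^sup>2) * (ind (cube c \<rho>) x * en (energy_density h x))"
   using True energy_density_nonneg[of h x] by (subst ennreal_mult) auto
  finally show ?thesis .
 next
  case False
  thus ?thesis using z[OF False] p2 by (simp add: outer_def vec_eq_iff zero_vec_def)
 qed
 have C: "en ((s + 2)\<^sup>2 * p\<^sup>2 / 8) * (NBINT x. en (?f0 x))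
  <= en ((s + 2)\<^sup>2 * p\<^sup>2 / 8 * (2 + 8 * (real CARD('n))\<^sup>2 / (\<rho> - r)\<^sup>2)) * EN h c \<rho>"
 proof -
  have "(NBINT x. en (?f0 x)) <= (NBINT x. en (2 + 2 * G\<^sup>2) * (ind (cube c \<rho>) x * en (energy_density h x)))"
   by (intro nn_integral_mono f0)
  also have "... = en (2 + 2 * G\<^sup>2) * EN h c \<rho>" unfolding EN_def by (rule nn_integral_cmult) measurable
  finally have "en ((s + 2)\<^sup>2 * p\<^sup>2 / 8) * (NBINT x. en (?f0 x)) <= en ((s + 2)\<^sup>2 * p\<^sup>2 / 8) * (en (2 + 2 * G\<^sup>2) * EN h c \<rho>)"
   by (rule mult_left_mono) simp
  also have "... = en ((s + 2)\<^sup>2 * p\<^sup>2 / 8 * (2 + 2 * G\<^sup>2)) * EN h c \<rho>"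
   by (subst ennreal_mult[of "(s + 2)\<^sup>2 * p\<^sup>2 / 8"]) (simp_all only: mult.assoc, simp_all)
  also have "2 * G\<^sup>2 = 8 * (real CARD('n))\<^sup>2 / (\<rho> - r)\<^sup>2" by (simp add: G_def power_divide power_mult_distrib)
  finally show ?thesis .
 qed
 have ge: "ind (cube c r) x * np (du h x) (p * s / 2) <= np (?\<Phi> x) (p * s / 2)" for x
  using \<zeta>(4)[of x] by (cases "x : cube c r") (auto simp: cube_def)
 show ?slices
 proof -
  have "(NBINT t. epow (slice j (%x. ind (cube c r) x * np (du h x) (p * s / 2)) t) (2 / s))
   <= (NBINT t. epow (slice j (%x. np (?\<Phi> x) (p * s / 2)) t) (2 / s))"
   using s ge by (intro nn_integral_mono epow_mono slice_mono) auto
  also have "... <= en ((s + 2)\<^sup>2 * p\<^sup>2 / 8) * (NBINT x. en (?f0 x))"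
   by (rule sobolev_slices[OF tst(1) p2 s(1) supp tst(2,3) s(3,2)])
  finally show ?thesis using C by (rule order_trans)
 qed
 show ?full if "(real CARD('n) - 2) * s <= 2 * real CARD('n)"
 proof -
  have "epow (NBINT x. ind (cube c r) x * np (du h x) (p * s / 2)) (2 / s)
   <= epow (NBINT x. np (?\<Phi> x) (p * s / 2)) (2 / s)"
   using s ge by (intro nn_integral_mono epow_mono) auto
  also have "... <= en ((s + 2)\<^sup>2 * p\<^sup>2 / 8) * (NBINT x. en (?f0 x))"
   by (rule sobolev_full[OF tst(1) p2 s(1) supp tst(2,3) that])
  finally show ?thesis using C by (rule order_trans)
 qed
qed

lemma slice_Holder3:
 assumes [measurable]: "f : borelfun" "g : borelfun" "k : borelfun"
  and w: "0 <= a" "0 <= b" "0 <= e" "a + b + e = 1"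
 shows "slice j (%x. epow (f x) a * epow (g x) b * epow (k x) e) t <= epow (slice j f t) a * epow (slice j g t) b * epow (slice j k t) e"
 unfolding slice_def using w by (intro nn_integral_Holder3) measurable

lemma slice_Holder2:
 assumes [measurable]: "f : borelfun" "g : borelfun"
  and w: "0 <= a" "0 <= b" "a + b = 1"
 shows "slice j (%x. epow (f x) a * epow (g x) b) t <= epow (slice j f t) a * epow (slice j g t) b"
 unfolding slice_def using w by (intro nn_integral_Holder2) measurable

text \<open>The cutoff gradient lives on slices where four quantities are bounded by a multiple of
  their averages: the integrals of \<open>A\<close>, of \<open>B\<close> and of the p-th power of
  \<open>du h\<close>, and the hyperplane Sobolev norm. On such a slice Hoelder's inequality with
  exponents \<alpha>1, \<alpha>2 and \<open>1 / q\<close> bounds the error, the q-th power of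
  \<open>du h\<close> being interpolated with parameter \<theta>. \<open>A\<close> and
  \<open>B\<close> are kept abstract because the inequality is used once with \<open>K\<close>
  alone, for a crude bound, and once with the excess, for the absorption.\<close>

lemma caccioppoli:
 assumes s: "2 <= s" "(real CARD('n) - 3) * s <= 2 * (real CARD('n) - 1)" "2 <= CARD('n)"
  and \<theta>: "0 <= \<theta>" "\<theta> < 1" "q = (1 - \<theta>) * p + \<theta> * (p * s / 2)"
  and r: "0 < r" "r < \<rho>" and cS: "cube c \<rho> <= S" "(%x. x + h) ` cube c \<rho> <= S"
  and AB [measurable]: "A : borelfun" "B : borelfun"
  and \<alpha>: "0 <= \<alpha>1" "0 <= \<alpha>2" "\<alpha>1 + \<alpha>2 + 1 / q = 1"
  and C0: "0 <= C0" "!!x. en (norm (\<sigma> (Z (x + h)) - \<sigma> (Z x))) <= en C0 * (epow (A x) \<alpha>1 * epow (B x) \<alpha>2)"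
  and fin: "(NBINT x. ind (cube c \<rho>) x * A x) < \<infinity>" "(NBINT x. ind (cube c \<rho>) x * B x) < \<infinity>" "EN h c \<rho> < \<infinity>"
 defines "\<kappa> \<equiv> en (16 / (\<rho> - r))"
 shows "(NBINT x. ind (cube c r) x * en (excess h x)) <= en (4 * real CARD('n) * C0) *
  (epow (\<kappa> * (NBINT x. ind (cube c \<rho>) x * A x)) \<alpha>1 * epow (\<kappa> * (NBINT x. ind (cube c \<rho>) x * B x)) \<alpha>2
   * epow (epow (\<kappa> * (NBINT x. ind (cube c \<rho>) x * np (du h x) p)) (1 - \<theta>) *
     epow (\<kappa> * (en ((s + 2)\<^sup>2 * p\<^sup>2 / 8 * (2 + 32 * (real CARD('n))\<^sup>2 / (\<rho> - r)\<^sup>2)) * EN h c \<rho>)) (\<theta> * s / 2)) (1 / q))"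
  (is "_ <= en (4 * real CARD('n) * C0) * ?M")
proof -
 \<comment> \<open>The cutoff varies between \<open>r\<close> and \<rho>1; the shell up to \<rho> is
   left to the localised Sobolev inequality.\<close>
 define \<rho>1 where "\<rho>1 = (r + \<rho>) / 2"
 have \<rho>1: "r < \<rho>1" "\<rho>1 < \<rho>" "\<rho> - \<rho>1 = (\<rho> - r) / 2" "\<rho>1 - r = (\<rho> - r) / 2" using r by (auto simp: \<rho>1_def field_simps)
 have q0: "0 < q" "2 <= q" using p2 pq by auto
 let ?cR = "%x. ind (cube c \<rho>) x :: ennreal" and ?c1 = "%x. ind (cube c \<rho>1) x :: ennreal"
 let ?CG = "en ((s + 2)\<^sup>2 * p\<^sup>2 / 8 * (2 + 32 * (real CARD('n))\<^sup>2 / (\<rho> - r)\<^sup>2))"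
 let ?P = "%x. ?cR x * np (du h x) p" and ?N = "%x. ?c1 x * np (du h x) (p * s / 2)"
 \<comment> \<open>The last function is the slice norm controlled by the hyperplane Sobolev
   inequality; the power \<open>2 / s\<close> makes its integral linear in the energy, so
   Chebyshev's inequality can be applied to it.\<close>
 define f where "f j i = (if i = 0 then slice j (%x. ?cR x * A x) else if i = 1 then slice j (%x. ?cR x * B x)
  else if i = 2 then slice j ?P else (%t. epow (slice j ?N t) (2 / s)))" for j :: 'n and i :: nat
 have fm: "f j i : borelfun" for j i unfolding f_def by simp
 have e2: "8 * (real CARD('n))\<^sup>2 / (\<rho> - \<rho>1)\<^sup>2 = 32 * (real CARD('n))\<^sup>2 / (\<rho> - r)\<^sup>2"
  unfolding \<rho>1(3) by (simp add: power_divide)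
 have f0: "(NBINT t. f j 0 t) = (NBINT x. ?cR x * A x)" and f1: "(NBINT t. f j 1 t) = (NBINT x. ?cR x * B x)" for j
  by (simp_all add: f_def nn_integral_slice[symmetric])
 have f2: "(NBINT t. f j 2 t) = (NBINT x. ?P x)" for j
  by (simp add: f_def nn_integral_slice[symmetric])
 have Pfin: "(NBINT x. ?P x) < \<infinity>"
 proof -
  have "(NBINT x. ?P x) <= EN h c \<rho>" unfolding EN_def
   by (intro nn_integral_mono mult_left_mono ennreal_leI) (auto simp: energy_density_def)
  thus ?thesis using fin(3) by (rule order_le_less_trans)
 qed
 have f3: "(NBINT t. f j 3 t) <= ?CG * EN h c \<rho>" for j
  using slice_energy(1)[OF s _ \<rho>1(2) cS, of j] r \<rho>1 unfolding e2 by (simp add: f_def)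
 have ffin: "(NBINT t. f j i t) < \<infinity>" if "i : {0,1,2,3}" for j i
 proof -
  have "?CG * EN h c \<rho> < \<infinity>" using fin(3) by (simp add: ennreal_mult_less_top)
  hence "(NBINT t. f j 3 t) < \<infinity>" using f3 by (rule order_le_less_trans[rotated])
  thus ?thesis using that fin(1,2) f0[of j] f1[of j] f2[of j] Pfin by auto
 qed
 define ok where "ok j a b T \<longleftrightarrow> T : sets borel \<and> T <= {a<..<b} \<and> (\<rho> - r) / 4 <= measure lborel T \<and>
  (\<forall>i\<in>{0,1,2,3}. \<forall>t\<in>T. f j i t <= \<kappa> * (NBINT t. f j i t))" for j a b T
 have okD: "T : sets borel" "T <= {a<..<b}" "(\<rho> - r) / 4 <= measure lborel T"
  "!!i t. i : {0,1,2,3} ==> t : T ==> f j i t <= \<kappa> * (NBINT t. f j i t)" if "ok j a b T" for j a b T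
  using that unfolding ok_def by blast+
 \<comment> \<open>Four functions on an interval of length \<open>(\<rho> - r) / 2\<close>:
   Chebyshev's constant becomes \<open>16 / (\<rho> - r)\<close>, and at least half of the interval
   is kept.\<close>
 have good: "\<exists>T. ok j a b T"
  if ab: "b - a = (\<rho> - r) / 2" for j a b
 proof -
  have "a < b" using ab r by (simp add: field_simps)
  have c4: "card {0,1,2,3::nat} = 4" by simp
  have eq: "2 * real (card {0,1,2,3::nat}) / (b - a) = 16 / (\<rho> - r)" unfolding ab c4 by simp
  have m: "(b - a) / 2 = (\<rho> - r) / 4" using ab by simp
  show ?thesis
   by (rule chebyshev_set[of "{0,1,2,3::nat}" "f j", OF _ _ fm \<open>a < b\<close> ffin, unfolded eq m, folded \<kappa>_def]) (simp, simp, assumption, unfold ok_def, blast)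
 qed
 have "\<forall>j. \<exists>T. ok j (c $ j - \<rho>1) (c $ j - r) T" "\<forall>j. \<exists>T. ok j (c $ j + r) (c $ j + \<rho>1) T"
  using \<rho>1(4) by (auto intro!: good)
 then obtain T1 T2 where T12: "!!j. ok j (c $ j - \<rho>1) (c $ j - r) (T1 j)" "!!j. ok j (c $ j + r) (c $ j + \<rho>1) (T2 j)"
  by metis
 note T1 = okD[OF T12(1)] and T2 = okD[OF T12(2)]
 obtain \<eta> g where \<eta>: "bounded_wgrad \<eta> g" "!!x. 0 <= \<eta> x" "!!x. \<eta> x <= 1"
  "!!x. (!!i. \<bar>x $ i - c $ i\<bar> <= r) ==> \<eta> x = 1"
  "!!x i. \<rho>1 <= \<bar>x $ i - c $ i\<bar> ==> \<eta> x = 0" "!!x i. \<rho>1 <= \<bar>x $ i - c $ i\<bar> ==> g x = 0"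
  "!!x. norm (g x) <= (\<Sum>j\<in>UNIV. (ind (T1 j) (x $ j) + ind (T2 j) (x $ j)) / ((\<rho> - r) / 4))"
  using cutoff_cube[of r \<rho>1 T1 T2 c "(\<rho> - r) / 4", OF r(1) \<rho>1(1) T1(1) T2(1) T1(2) T2(2) _ T1(3) T2(3)] r by auto
 have z: "\<eta> x = 0" "g x = 0" if xc: "x \<notin> cube c \<rho>1" for x
 proof -
  obtain i where "\<rho>1 < \<bar>x $ i - c $ i\<bar>" using xc by (auto simp: cube_def not_le)
  hence "\<rho>1 <= \<bar>x $ i - c $ i\<bar>" by simp
  thus "\<eta> x = 0" "g x = 0" using \<eta>(5,6) by blast+
 qed
 have cS1: "cube c \<rho>1 <= S" "(%x. x + h) ` cube c \<rho>1 <= S" using cS cube_mono[of \<rho>1 \<rho> c] \<rho>1 by auto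
 have gm [measurable]: "g : borelfun" using \<eta>(1) by (auto simp: bounded_wgrad_def)
 let ?w = "%j t. ind (T1 j) t + ind (T2 j) t :: ennreal"
 note [measurable] = T1(1) T2(1)
 \<comment> \<open>A bound on the slice integrals over the good slices in direction \<open>j\<close>
   is integrated over all of them. Their total width is at most \<open>\<rho> - r\<close>, which
   later cancels the slope of the cutoff.\<close>
 have weight: "(NBINT x. ?w j (x $ j) * k x) <= M * en (\<rho> - r)"
  if [measurable]: "k : borelfun" and le: "!!t. t : T1 j \<union> T2 j ==> slice j k t <= M" for j k M
 proof -
  have "(NBINT x. ?w j (x $ j) * k x) = (NBINT t. ?w j t * slice j k t)"
   by (rule nn_integral_slice_weight) measurable
  also have "... <= (NBINT t. M * ?w j t)"
  proof (rule nn_integral_mono)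
   fix t
   show "?w j t * slice j k t <= M * ?w j t"
    using mult_left_mono[OF le, of t "?w j t"] by (cases "t : T1 j \<union> T2 j") (auto simp: mult.commute)
  qed
  also have "... = M * (emeasure lborel (T1 j) + emeasure lborel (T2 j))"
   by (simp add: nn_integral_cmult nn_integral_add)
  also have "... <= M * (emeasure lborel {c $ j - \<rho>1<..<c $ j - r} + emeasure lborel {c $ j + r<..<c $ j + \<rho>1})"
   using T1(2)[of j] T2(2)[of j] by (intro mult_left_mono add_mono emeasure_mono) auto
  also have "... = M * en (\<rho>1 - r + (\<rho>1 - r))" using \<rho>1(1) by (subst ennreal_plus) auto
  also have "\<rho>1 - r + (\<rho>1 - r) = \<rho> - r" using \<rho>1(4) by simp
  finally show ?thesis .
 qed
 let ?Q = "%x. ?c1 x * np (du h x) q"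
 let ?H = "epow (\<kappa> * (NBINT x. ?P x)) (1 - \<theta>) * epow (\<kappa> * (?CG * EN h c \<rho>)) (\<theta> * s / 2)"
 \<comment> \<open>Interpolation of the exponent \<open>q\<close> between \<open>p\<close> and
   \<open>p * s / 2\<close> on a single good slice.\<close>
 have sQ: "slice j ?Q t <= ?H" if t: "t : T1 j \<union> T2 j" for j t
 proof -
  have "?Q x <= epow (?P x) (1 - \<theta>) * epow (?N x) \<theta>" for x
  proof (cases "x : cube c \<rho>1")
   case True
   hence x: "x : cube c \<rho>" using cube_mono[of \<rho>1 \<rho> c] \<rho>1 by auto
   have "np (du h x) q = epow (np (du h x) p) (1 - \<theta>) * epow (np (du h x) (p * s / 2)) \<theta>"
   proof (cases "\<theta> = 0")
    case False
    have "q = p * (1 - \<theta>) + p * s / 2 * \<theta>" using \<theta>(3) by (simp add: algebra_simps)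
    hence "norm (du h x) powr q = norm (du h x) powr (p * (1 - \<theta>)) * norm (du h x) powr (p * s / 2 * \<theta>)" by (simp only: powr_add)
    thus ?thesis using False \<theta> by (simp add: epow_ennreal powr_powr ennreal_mult)
   qed (use \<theta>(3) in simp)
   thus ?thesis using True x by simp
  qed simp
  hence "slice j ?Q t <= slice j (%x. epow (?P x) (1 - \<theta>) * epow (?N x) \<theta>) t" by (rule slice_mono)
  also have "... <= epow (slice j ?P t) (1 - \<theta>) * epow (slice j ?N t) \<theta>" using \<theta> by (intro slice_Holder2) auto
  also have "epow (slice j ?N t) \<theta> = epow (f j 3 t) (\<theta> * s / 2)" using s \<theta> by (simp add: f_def epow_epow)
  also have "epow (slice j ?P t) (1 - \<theta>) * ... <= ?H"
  proof (intro mult_mono epow_mono)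
   have "slice j ?P t = f j 2 t" by (simp add: f_def)
   also have "... <= \<kappa> * (NBINT t. f j 2 t)" using t T1(4)[of 2 t j] T2(4)[of 2 t j] by auto
   finally show "slice j ?P t <= \<kappa> * (NBINT x. ?P x)" unfolding f2 .
   have "f j 3 t <= \<kappa> * (NBINT t. f j 3 t)" using t T1(4)[of 3 t j] T2(4)[of 3 t j] by auto
   also have "... <= \<kappa> * (?CG * EN h c \<rho>)" by (intro mult_left_mono f3) simp
   finally show "f j 3 t <= \<kappa> * (?CG * EN h c \<rho>)" .
  qed (use \<theta> s in auto)
  finally show ?thesis .
 qed
 have Hfin: "?H < \<infinity>"
 proof -
  have "\<kappa> * (NBINT x. ?P x) < \<infinity>" "\<kappa> * (?CG * EN h c \<rho>) < \<infinity>" using fin(3) Pfin by (simp_all add: \<kappa>_def ennreal_mult_less_top)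
  thus ?thesis using \<theta> s by (auto simp: ennreal_mult_less_top intro!: epow_less_top)
 qed
 define Gb where "Gb = (\<Sum>j\<in>(UNIV::'n set). 2 / ((\<rho> - r) / 4))"
 have Gb: "norm (g x) <= Gb" "0 <= Gb" for x
  subgoal unfolding Gb_def using r by (intro order_trans[OF \<eta>(7)] sum_mono divide_right_mono) (auto simp: indicator_def)
  subgoal unfolding Gb_def using r by (intro sum_nonneg) auto
  done
 \<comment> \<open>Admissibility of the test map: on a full cube the q-th power of
   \<open>du h\<close> is not known to be integrable, but it is on the good slices, which carry the
   gradient of the cutoff.\<close>
 have iq: "lintegrable (%x. norm (outer (du h x) (g x)) powr q)"
 proof (rule integrableI_nonneg)
  have le: "np (outer (du h x) (g x)) q <= en (Gb powr q) * (\<Sum>j\<in>UNIV. ?w j (x $ j) * ?Q x)" for x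
  proof (cases "g x = 0")
   case False
   hence x: "x : cube c \<rho>1" using z(2) by blast
   have "\<exists>j. x $ j : T1 j \<union> T2 j"
   proof (rule ccontr)
    assume "\<not> ?thesis"
    hence "norm (g x) <= 0" using \<eta>(7)[of x] by simp
    thus False using False by simp
   qed
   then obtain j where j: "x $ j : T1 j \<union> T2 j" by blast
   have "norm (outer (du h x) (g x)) powr q <= (norm (du h x) * Gb) powr q"
    using Gb q0 by (intro powr_mono2) (auto simp: norm_outer intro!: mult_left_mono)
   also have "... = Gb powr q * norm (du h x) powr q" using Gb(2) by (simp add: powr_mult)
   finally have "np (outer (du h x) (g x)) q <= en (Gb powr q) * ?Q x"
    using x by (simp add: ennreal_mult[symmetric] ennreal_leI)
   also have "?Q x <= ?w j (x $ j) * ?Q x"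
   proof -
    have "1 * ?Q x <= ?w j (x $ j) * ?Q x" using j by (intro mult_right_mono) (auto simp: indicator_def)
    thus ?thesis by simp
   qed
   also have "... <= (\<Sum>j\<in>UNIV. ?w j (x $ j) * ?Q x)"
    by (rule member_le_sum[where f="%j. ?w j (x $ j) * ?Q x"]) auto
   finally show ?thesis by (simp add: mult_left_mono)
  qed (simp add: norm_outer)
  have xm [measurable]: "(%x::real^'n. x $ i) : borelfun" for i unfolding component_eq_inner by measurable
  have "(NBINT x. np (outer (du h x) (g x)) q) <= (NBINT x. en (Gb powr q) * (\<Sum>j\<in>UNIV. ?w j (x $ j) * ?Q x))"
   by (intro nn_integral_mono le)
  also have "... = en (Gb powr q) * (\<Sum>j\<in>UNIV. (NBINT x. ?w j (x $ j) * ?Q x))"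
   by (simp add: nn_integral_cmult nn_integral_sum)
  also have "... <= en (Gb powr q) * (\<Sum>j\<in>(UNIV::'n set). ?H * en (\<rho> - r))"
   by (intro mult_left_mono sum_mono weight sQ) auto
  also have "... < \<infinity>"
  proof -
   have "?H * en (\<rho> - r) < top" using Hfin by (simp add: ennreal_mult_less_top)
   hence "(\<Sum>j\<in>(UNIV::'n set). ?H * en (\<rho> - r)) < top" by (auto simp: ennreal_mult_less_top of_nat_less_top)
   thus ?thesis by (simp only: ennreal_mult_less_top infinity_ennreal_def) simp
  qed
  finally show "(NBINT x. np (outer (du h x) (g x)) q) < \<infinity>" .
 qed auto
 let ?R = "%x. ?c1 x * en (norm (\<sigma> (Z (x + h)) - \<sigma> (Z x)) * norm (du h x))"
 have sR: "slice j ?R t <= en C0 * ?M" if t: "t : T1 j \<union> T2 j" for j t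
 proof -
  let ?A = "%x. ?cR x * A x" and ?B = "%x. ?cR x * B x"
  have pt: "?R x <= en C0 * (epow (?A x) \<alpha>1 * epow (?B x) \<alpha>2 * epow (?Q x) (1 / q))" for x
  proof (cases "x : cube c \<rho>1")
   case True
   hence x: "x : cube c \<rho>" using cube_mono[of \<rho>1 \<rho> c] \<rho>1 by auto
   have "?R x = en (norm (\<sigma> (Z (x + h)) - \<sigma> (Z x))) * en (norm (du h x))" using True by (simp add: ennreal_mult)
   also have "en (norm (du h x)) = epow (?Q x) (1 / q)" using True q0 by (simp add: epow_ennreal powr_powr)
   also have "en (norm (\<sigma> (Z (x + h)) - \<sigma> (Z x))) * ... <= en C0 * (epow (A x) \<alpha>1 * epow (B x) \<alpha>2) * epow (?Q x) (1 / q)"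
    by (intro mult_right_mono C0(2)) simp
   finally show ?thesis using x by (simp add: mult.assoc)
  qed simp
  have "slice j ?R t <= slice j (%x. en C0 * (epow (?A x) \<alpha>1 * epow (?B x) \<alpha>2 * epow (?Q x) (1 / q))) t" by (intro slice_mono pt)
  also have "... = en C0 * slice j (%x. epow (?A x) \<alpha>1 * epow (?B x) \<alpha>2 * epow (?Q x) (1 / q)) t"
   unfolding slice_def by (rule nn_integral_cmult) measurable
  also have "... <= en C0 * (epow (slice j ?A t) \<alpha>1 * epow (slice j ?B t) \<alpha>2 * epow (slice j ?Q t) (1 / q))"
   using \<alpha> q0 by (intro mult_left_mono slice_Holder3) auto
  also have "... <= en C0 * ?M"
  proof (intro mult_left_mono mult_mono epow_mono sQ t)
   have "slice j ?A t = f j 0 t" by (simp add: f_def)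
   also have "... <= \<kappa> * (NBINT t. f j 0 t)" using t T1(4)[of 0 t j] T2(4)[of 0 t j] by auto
   finally show "slice j ?A t <= \<kappa> * (NBINT x. ?A x)" unfolding f0 .
   have "slice j ?B t = f j 1 t" by (simp add: f_def)
   also have "... <= \<kappa> * (NBINT t. f j 1 t)" using t T1(4)[of 1 t j] T2(4)[of 1 t j] by auto
   finally show "slice j ?B t <= \<kappa> * (NBINT x. ?B x)" unfolding f1 .
  qed (use \<alpha> q0 in auto)
  finally show ?thesis .
 qed
 have "(NBINT x. ind (cube c r) x * en (excess h x)) <= (NBINT x. en (\<eta> x * excess h x))"
  using \<eta>(4) by (intro nn_integral_mono) (auto simp: indicator_def cube_def)
 also have "... <= (NBINT x. en (norm (\<sigma> (Z (x + h)) - \<sigma> (Z x)) * norm (du h x) * norm (g x)))"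
  by (rule excess_integral_le[OF \<eta>(1-3) compact_cube cS1 z iq])
 also have "... <= (NBINT x. en (4 / (\<rho> - r)) * (\<Sum>j\<in>UNIV. ?w j (x $ j) * ?R x))"
 proof (rule nn_integral_mono)
  fix x
  show "en (norm (\<sigma> (Z (x + h)) - \<sigma> (Z x)) * norm (du h x) * norm (g x)) <= en (4 / (\<rho> - r)) * (\<Sum>j\<in>UNIV. ?w j (x $ j) * ?R x)"
  proof (cases "x : cube c \<rho>1")
   case True
   let ?v = "%j. ind (T1 j) (x $ j) + ind (T2 j) (x $ j) :: real"
   have v: "en (?v j) = ?w j (x $ j)" for j by (auto simp: indicator_def)
   have "norm (g x) <= 4 / (\<rho> - r) * (\<Sum>j\<in>UNIV. ?v j)"
    using \<eta>(7)[of x] unfolding sum_distrib_left by (simp add: add_divide_distrib distrib_left mult.commute)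
   hence "en (norm (g x)) <= en (4 / (\<rho> - r) * (\<Sum>j\<in>UNIV. ?v j))" by (rule ennreal_leI)
   also have "... = en (4 / (\<rho> - r)) * (\<Sum>j\<in>UNIV. ?w j (x $ j))"
    using r by (subst ennreal_mult) (auto simp: sum_nonneg sum_ennreal[symmetric] v[symmetric] simp del: sum_ennreal)
   finally have "en (norm (g x)) * ?R x <= en (4 / (\<rho> - r)) * (\<Sum>j\<in>UNIV. ?w j (x $ j)) * ?R x"
    by (rule mult_right_mono) simp
   moreover have "en (norm (\<sigma> (Z (x + h)) - \<sigma> (Z x)) * norm (du h x) * norm (g x)) = en (norm (g x)) * ?R x"
    using True by (simp add: ennreal_mult mult_ac)
   ultimately show ?thesis by (simp add: mult.assoc sum_distrib_right)
  qed (simp add: z)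
 qed
 also have "... = en (4 / (\<rho> - r)) * (\<Sum>j\<in>UNIV. (NBINT x. ?w j (x $ j) * ?R x))"
 proof -
  have xm [measurable]: "(%x::real^'n. x $ i) : borelfun" for i unfolding component_eq_inner by measurable
  show ?thesis by (simp add: nn_integral_cmult nn_integral_sum)
 qed
 also have "... <= en (4 / (\<rho> - r)) * (\<Sum>j\<in>(UNIV::'n set). en C0 * ?M * en (\<rho> - r))"
  by (intro mult_left_mono sum_mono weight sR) auto
 also have "... = en (4 / (\<rho> - r) * real CARD('n) * C0 * (\<rho> - r)) * ?M"
 proof -
  have "en (4 / (\<rho> - r)) * (\<Sum>j\<in>(UNIV::'n set). en C0 * m * en (\<rho> - r))
   = en (4 / (\<rho> - r)) * en (real CARD('n)) * en C0 * en (\<rho> - r) * m" for m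
   by (simp add: ennreal_of_nat_eq_real_of_nat mult_ac)
  moreover have "en (4 / (\<rho> - r)) * en (real CARD('n)) * en C0 * en (\<rho> - r)
   = en (4 / (\<rho> - r) * real CARD('n) * C0 * (\<rho> - r))"
   using r C0(1) by (simp only: ennreal_mult'[symmetric] divide_nonneg_nonneg mult_nonneg_nonneg of_nat_0_le_iff diff_ge_0_iff_ge less_imp_le zero_le_numeral)
  ultimately show ?thesis by (simp only:)
 qed
 also have "4 / (\<rho> - r) * real CARD('n) * C0 * (\<rho> - r) = 4 * real CARD('n) * C0" using r by simp
 finally show ?thesis .
qed

end

section \<open>Energy of finite differences in terms of the excess\<close>

lemma cube_shift: "x : cube c \<rho> ==> norm y <= d ==> x + y : cube c (\<rho> + d)"
proof (clarsimp simp: cube_def)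
 fix i assume x: "\<forall>i. \<bar>x $ i - c $ i\<bar> <= \<rho>" and y: "norm y <= d"
 show "\<bar>x $ i + y $ i - c $ i\<bar> <= \<rho> + d"
  using component_le_norm_cart[of y i] y x[rule_format, of i] by linarith
qed

lemma cube_shift_cball: "x : cube c \<rho> ==> norm y <= d ==> cball (x + y) e <= cube c (\<rho> + d + e)"
proof
 fix z assume x: "x : cube c \<rho>" "norm y <= d" and z: "z : cball (x + y) e"
 hence "(x + y) + (z - (x + y)) : cube c (\<rho> + d + e)"
  by (intro cube_shift) (auto simp: dist_norm norm_minus_commute)
 thus "z : cube c (\<rho> + d + e)" by simp
qed

lemma unit_interval_Jensen:
 fixes f :: "real => ennreal"
 assumes [measurable]: "f : borelfun" and p: "1 <= p"
 shows "epow (NBINT \<tau>. f \<tau> * ind {0..1} \<tau>) p <= (NBINT \<tau>. epow (f \<tau>) p * ind {0..1} \<tau>)"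
proof -
 let ?i = "%\<tau>. ind {0..1::real} \<tau> :: ennreal"
 have "(NBINT \<tau>. f \<tau> * ?i \<tau>) = (NBINT \<tau>. epow (epow (f \<tau>) p * ?i \<tau>) (1 / p) * epow (?i \<tau>) (1 - 1 / p))"
  using p by (intro nn_integral_cong) (auto simp: indicator_def epow_epow)
 also have "... <= epow (NBINT \<tau>. epow (f \<tau>) p * ?i \<tau>) (1 / p) * epow (NBINT \<tau>. ?i \<tau>) (1 - 1 / p)"
  using p by (intro nn_integral_Holder2) auto
 finally have "epow (NBINT \<tau>. f \<tau> * ?i \<tau>) p <= epow (epow (NBINT \<tau>. epow (f \<tau>) p * ?i \<tau>) (1 / p)) p"
  using p by (intro epow_mono) auto
 thus ?thesis using p by (simp add: epow_epow)
qed

lemma epow_add_le: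
 assumes r: "0 <= r" shows "epow (x + y) r <= en (2 powr r) * (epow x r + epow y r)"
proof -
 have "epow (x + y) r <= epow (2 * max x y) r"
  using r by (intro epow_mono) (auto simp: max_def mult_2 intro: add_mono)
 also have "... = en (2 powr r) * epow (max x y) r"
  using epow_ennreal[of 2 r] by (cases "r = 0") (simp_all add: r epow_mult)
 also have "... <= en (2 powr r) * (epow x r + epow y r)" by (intro mult_left_mono) (auto simp: max_def)
 finally show ?thesis .
qed

lemma epow_rpow: "0 <= x ==> epow (en x) a = en (rpow x a)"
 by (cases "a = 0") (auto simp: rpow_def epow_ennreal)

text \<open>Stated for an extended value \<open>b\<close> because it is applied to a line average of
  gradient differences that is not known to be finite.\<close>

lemma epow_square_young:
 assumes p: "2 <= p" and y: "0 <= y"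
 shows "epow b (p - 2) * en (y\<^sup>2) <= epow b p + en (y powr p)"
proof (cases "b <= en y")
 case True
 hence "epow b (p - 2) * en (y\<^sup>2) <= en (rpow y (p - 2)) * en (y\<^sup>2)"
  using p y by (intro mult_right_mono) (auto simp: epow_rpow[symmetric] intro!: epow_mono)
 also have "... = en (y powr p)"
  using rpow_mult_square[OF y p] y by (simp add: ennreal_mult[symmetric] rpow_nonneg)
 finally show ?thesis by (rule order_trans) simp
next
 case False
 have "en (y\<^sup>2) = epow (en y) 2" using y by (simp add: epow_ennreal)
 also have "... <= epow b 2" using False by (intro epow_mono) auto
 finally have "epow b (p - 2) * en (y\<^sup>2) <= epow b (p - 2) * epow b 2" by (intro mult_left_mono) simp_all
 also have "... = epow b p" using p by (subst epow_add[symmetric]) auto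
 finally show ?thesis by (rule order_trans) simp
qed

context local_min
begin

definition IE :: "real^'n => real^'n => real => ennreal" where
 "IE h c \<rho> = (NBINT x. ind (cube c \<rho>) x * en (excess h x))"

definition MZ :: ennreal where "MZ = (NBINT x. np (Z x) p)"

lemma dZ_powr_le_excess: "norm (dZ h x) powr p <= excess h x / cA"
proof -
 have "cA * norm (dZ h x) powr p <= excess h x"
  using \<sigma>_coercive(2)[of "Z (x + h)" "Z x"] rpow_mult_square[of "norm (dZ h x)" p] p2
  by (simp add: excess_def dZ_def mult.assoc)
 thus ?thesis using cA_pos by (simp add: pos_le_divide_eq mult.commute)
qed

lemma Z_dZ_le_excess: "rpow (norm (Z x)) (p - 2) * (norm (dZ h x))\<^sup>2 <= excess h x / cA"
 using \<sigma>_coercive(1)[of "Z x" "Z (x + h)"] cA_pos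
 by (simp add: excess_def dZ_def pos_le_divide_eq mult_ac)

lemma du_line:
 assumes "cube c \<rho>' <= S" "\<rho> + norm h < \<rho>'"
 shows "AE x in lborel. x : cube c \<rho> -->
  en (norm (du h x)) <= en (norm h) * (NBINT \<tau>. en (norm (Z (x + \<tau> *\<^sub>R h))) * ind {0..1} \<tau>)"
proof -
 define d where "d = \<rho>' - \<rho> - norm h"
 have d: "0 < d" using assms by (simp add: d_def)
 have sub: "cball (x + t *\<^sub>R h) d <= S" if "x : cube c \<rho>" "0 <= t" "t <= 1" for x t
 proof -
  have "norm (t *\<^sub>R h) <= norm h" using that by (simp add: mult_left_le_one_le)
  from cube_shift_cball[OF that(1) this, of d] show ?thesis using assms(1) by (simp add: d_def)
 qed
 have "(NBINT t. en (norm (Z (x + t *\<^sub>R h)) * norm h) * ind {0..1} t)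
  = en (norm h) * (NBINT \<tau>. en (norm (Z (x + \<tau> *\<^sub>R h))) * ind {0..1} \<tau>)" for x
  by (subst nn_integral_cmult[symmetric]) (simp_all add: ennreal_mult mult_ac)
 thus ?thesis using wgrad_line_bound[OF wg d sub] by (simp add: du_def)
qed

lemma du_powr_le:
 assumes "cube c \<rho>' <= S" "\<rho> + norm h < \<rho>'"
 shows "(NBINT x. ind (cube c \<rho>) x * np (du h x) p) <= np h p * MZ"
proof -
 have p1: "1 <= p" "0 < p" using p2 by auto
 have ep: "en (y powr p) = epow (en y) p" if "0 <= y" for y using that p1 by (simp add: epow_ennreal)
 have "(NBINT x. ind (cube c \<rho>) x * np (du h x) p)
  <= (NBINT x. np h p * (NBINT \<tau>. np (Z (x + \<tau> *\<^sub>R h)) p * ind {0..1} \<tau>))"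
 proof (rule nn_integral_mono_AE, rule AE_mp[OF du_line[OF assms]], intro AE_I2 impI)
  fix x
  assume x: "x : cube c \<rho> --> en (norm (du h x)) <= en (norm h) * (NBINT \<tau>. en (norm (Z (x + \<tau> *\<^sub>R h))) * ind {0..1} \<tau>)"
  show "ind (cube c \<rho>) x * np (du h x) p
   <= np h p * (NBINT \<tau>. np (Z (x + \<tau> *\<^sub>R h)) p * ind {0..1} \<tau>)"
  proof (cases "x : cube c \<rho>")
   case True
   hence "epow (en (norm (du h x))) p <= epow (en (norm h) * (NBINT \<tau>. en (norm (Z (x + \<tau> *\<^sub>R h))) * ind {0..1} \<tau>)) p"
    using x p1 by (intro epow_mono) auto
   also have "... <= epow (en (norm h)) p * (NBINT \<tau>. epow (en (norm (Z (x + \<tau> *\<^sub>R h)))) p * ind {0..1} \<tau>)"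
    using p1 by (subst epow_mult, simp, intro mult_left_mono unit_interval_Jensen) auto
   finally show ?thesis using True by (simp add: ep)
  qed simp
 qed
 also have "... = np h p * (NBINT x. (NBINT \<tau>. np (Z (x + \<tau> *\<^sub>R h)) p * ind {0..1} \<tau>))"
  by (rule nn_integral_cmult) measurable
 also have "(NBINT x. (NBINT \<tau>. np (Z (x + \<tau> *\<^sub>R h)) p * ind {0..1} \<tau>))
  = (NBINT \<tau>. (NBINT x. np (Z (x + \<tau> *\<^sub>R h)) p * ind {0..1} \<tau>))"
  by (rule lborel_pair.Fubini') measurable
 also have "... = (NBINT \<tau>. MZ * ind {0..1::real} \<tau>)"
 proof (rule nn_integral_cong)
  fix \<tau> :: real
  have "(NBINT x. np (Z (x + \<tau> *\<^sub>R h)) p) = MZ"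
   unfolding MZ_def by (rule nn_integral_lborel_shift) measurable
  thus "(NBINT x. np (Z (x + \<tau> *\<^sub>R h)) p * ind {0..1} \<tau>) = MZ * ind {0..1} \<tau>"
   by (simp add: nn_integral_multc)
 qed
 also have "... = MZ" by (simp add: nn_integral_cmult)
 finally show ?thesis .
qed

text \<open>The weight is split by bounding \<open>du h\<close> with |h| times the sum of
  \<open>norm (Z x)\<close> and the average over \<tau> of the gradient differences for
  \<open>\<tau> *\<^sub>R h\<close>. The part with \<open>Z x\<close> is handled by the coercivity
  form weighted with the gradient. The averaged part goes through Young's inequality and the form
  weighted with the increment, which brings in the excess for all shorter increments; hence the
  common bound \<open>W\<close>. The factor 3 counts two copies of the excess for \<open>h\<close>
  and one average.\<close>

lemma energy_le:
 assumes "cube c \<rho>' <= S" "\<rho> + norm h < \<rho>'" and h: "h ~= 0"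
  and W: "!!\<tau>. 0 < \<tau> ==> \<tau> <= 1 ==> IE (\<tau> *\<^sub>R h) c \<rho> <= W"
 shows "EN h c \<rho> <= np h p * MZ + np h (p - 2) * (en (3 * 2 powr (p - 2) / cA) * W)"
proof -
 let ?i = "%\<tau>. ind {0..1::real} \<tau> :: ennreal"
 let ?J = "%x. (NBINT \<tau>. en (excess (\<tau> *\<^sub>R h) x) * ?i \<tau>)"
 let ?C = "2 powr (p - 2) / cA"
 have p1: "1 <= p" "0 < p" "0 <= p - 2" using p2 by auto
 have [measurable]: "(%(x, \<tau>). excess (\<tau> *\<^sub>R h) x) : borel_measurable (borel \<Otimes>\<^sub>M borel)"
  unfolding excess_def dZ_def by measurable
 have hp: "rpow (norm h) (p - 2) = norm h powr (p - 2)" using h by (simp add: rpow_def)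
 have pt: "AE x\<in>cube c \<rho> in lborel. en (rpow (norm (du h x)) (p - 2) * (norm (dZ h x))\<^sup>2)
  <= np h (p - 2) * (en ?C * (2 * en (excess h x) + ?J x))"
 proof (rule AE_mp[OF du_line[OF assms(1,2)]], intro AE_I2 impI)
  fix x
  assume "x : cube c \<rho> --> en (norm (du h x)) <= en (norm h) * (NBINT \<tau>. en (norm (Z (x + \<tau> *\<^sub>R h))) * ?i \<tau>)"
   and "x : cube c \<rho>"
  hence "en (norm (du h x)) <= en (norm h) * (NBINT \<tau>. en (norm (Z (x + \<tau> *\<^sub>R h))) * ?i \<tau>)" by simp
  also have "(NBINT \<tau>. en (norm (Z (x + \<tau> *\<^sub>R h))) * ?i \<tau>)
   <= (NBINT \<tau>. en (norm (Z x)) * ?i \<tau> + en (norm (dZ (\<tau> *\<^sub>R h) x)) * ?i \<tau>)"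
  proof (rule nn_integral_mono)
   fix \<tau> :: real
   have "norm (Z (x + \<tau> *\<^sub>R h)) <= norm (Z x) + norm (dZ (\<tau> *\<^sub>R h) x)"
    using norm_triangle_ineq[of "Z x" "dZ (\<tau> *\<^sub>R h) x"] by (simp add: dZ_def)
   hence "en (norm (Z (x + \<tau> *\<^sub>R h))) <= en (norm (Z x)) + en (norm (dZ (\<tau> *\<^sub>R h) x))"
    by (simp add: ennreal_plus[symmetric] ennreal_leI del: ennreal_plus)
   thus "en (norm (Z (x + \<tau> *\<^sub>R h))) * ?i \<tau> <= en (norm (Z x)) * ?i \<tau> + en (norm (dZ (\<tau> *\<^sub>R h) x)) * ?i \<tau>"
    by (simp add: distrib_right[symmetric] mult_right_mono)
  qed
  also have "... = en (norm (Z x)) + (NBINT \<tau>. en (norm (dZ (\<tau> *\<^sub>R h) x)) * ?i \<tau>)" (is "_ = ?a + ?b")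
   unfolding dZ_def by (subst nn_integral_add) (simp_all add: nn_integral_cmult)
  finally have d: "en (norm (du h x)) <= en (norm h) * (?a + ?b)" by (simp add: mult_left_mono)
  let ?y = "en ((norm (dZ h x))\<^sup>2)"
  have A: "epow ?a (p - 2) * ?y <= en (1 / cA) * en (excess h x)"
   using Z_dZ_le_excess[of x h] cA_pos excess_nonneg[of h x]
   by (simp add: epow_rpow ennreal_mult[symmetric] rpow_nonneg ennreal_leI)
  have dp: "np (dZ k x) p <= en (1 / cA) * en (excess k x)" for k
   using dZ_powr_le_excess[of k x] cA_pos excess_nonneg[of k x] by (simp add: ennreal_mult[symmetric] ennreal_leI)
  have "epow ?b p <= (NBINT \<tau>. epow (en (norm (dZ (\<tau> *\<^sub>R h) x))) p * ?i \<tau>)"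
   using p1 unfolding dZ_def by (intro unit_interval_Jensen) auto
  also have "... <= (NBINT \<tau>. en (1 / cA) * (en (excess (\<tau> *\<^sub>R h) x) * ?i \<tau>))"
   using dp p1 by (intro nn_integral_mono) (auto simp: epow_ennreal indicator_def)
  also have "... = en (1 / cA) * ?J x"
   unfolding excess_def dZ_def by (rule nn_integral_cmult) measurable
  finally have b: "epow ?b p <= en (1 / cA) * ?J x" .
  have B: "epow ?b (p - 2) * ?y <= en (1 / cA) * ?J x + en (1 / cA) * en (excess h x)"
   by (rule order_trans[OF epow_square_young[OF p2]]) (auto intro!: add_mono b dp)
  have "en (rpow (norm (du h x)) (p - 2) * (norm (dZ h x))\<^sup>2) = epow (en (norm (du h x))) (p - 2) * ?y"
   by (simp add: epow_rpow ennreal_mult rpow_nonneg)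
  also have "... <= epow (en (norm h) * (?a + ?b)) (p - 2) * ?y"
   using d p1 by (intro mult_right_mono epow_mono) auto
  also have "... = np h (p - 2) * (epow (?a + ?b) (p - 2) * ?y)"
   using p1 by (simp add: epow_mult epow_rpow hp mult.assoc)
  also have "... <= np h (p - 2) * (en (2 powr (p - 2)) * (epow ?a (p - 2) + epow ?b (p - 2)) * ?y)"
   using p1 by (intro mult_left_mono mult_right_mono epow_add_le) auto
  also have "... = np h (p - 2) * (en (2 powr (p - 2)) * (epow ?a (p - 2) * ?y + epow ?b (p - 2) * ?y))"
   by (simp add: distrib_right distrib_left mult.assoc)
  also have "... <= np h (p - 2) * (en (2 powr (p - 2)) * (en (1 / cA) * en (excess h x) +
   (en (1 / cA) * ?J x + en (1 / cA) * en (excess h x))))"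
   by (intro mult_left_mono add_mono A B) auto
  also have "... = np h (p - 2) * ((en (2 powr (p - 2)) * en (1 / cA)) * (2 * en (excess h x) + ?J x))"
   by (simp add: distrib_left mult_2 mult.assoc add_ac)
  also have "en (2 powr (p - 2)) * en (1 / cA) = en ?C"
   using cA_pos by (simp add: ennreal_mult[symmetric])
  finally show "en (rpow (norm (du h x)) (p - 2) * (norm (dZ h x))\<^sup>2)
   <= np h (p - 2) * (en ?C * (2 * en (excess h x) + ?J x))" .
 qed
 have J: "(NBINT x. ind (cube c \<rho>) x * ?J x) <= W"
 proof -
  have "(NBINT x. ind (cube c \<rho>) x * ?J x)
   = (NBINT x. (NBINT \<tau>. ind (cube c \<rho>) x * (en (excess (\<tau> *\<^sub>R h) x) * ?i \<tau>)))"
   by (intro nn_integral_cong) (simp add: nn_integral_cmult[symmetric])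
  also have "... = (NBINT \<tau>. (NBINT x. ind (cube c \<rho>) x * (en (excess (\<tau> *\<^sub>R h) x) * ?i \<tau>)))"
   by (rule lborel_pair.Fubini') measurable
  also have "... = (NBINT \<tau>. IE (\<tau> *\<^sub>R h) c \<rho> * ?i \<tau>)"
   unfolding IE_def by (intro nn_integral_cong) (simp add: nn_integral_multc[symmetric] mult.assoc)
  also have "... <= (NBINT \<tau>. W * ?i \<tau>)"
  proof (rule nn_integral_mono_AE)
   \<comment> \<open>The bound \<open>W\<close> is available for positive \<tau> only, and the
     remaining value 0 forms a null set.\<close>
   have "AE \<tau> in lborel. \<tau> ~= (0::real)" by (rule AE_lborel_singleton)
   thus "AE \<tau> in lborel. IE (\<tau> *\<^sub>R h) c \<rho> * ?i \<tau> <= W * ?i \<tau>"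
    by eventually_elim (auto simp: indicator_def intro!: W)
  qed
  also have "... = W" by (simp add: nn_integral_cmult)
  finally show ?thesis .
 qed
 have I: "(NBINT x. ind (cube c \<rho>) x * (2 * en (excess h x))) <= 2 * W"
 proof -
  have "(NBINT x. ind (cube c \<rho>) x * (2 * en (excess h x))) = 2 * IE h c \<rho>"
   unfolding IE_def by (subst nn_integral_cmult[symmetric]) (simp_all add: mult_ac)
  thus ?thesis using W[of 1] by (simp add: mult_left_mono)
 qed
 have Jm [measurable]: "?J : borelfun" unfolding excess_def dZ_def by measurable
 have "EN h c \<rho> <= (NBINT x. ind (cube c \<rho>) x * np (du h x) p +
  np h (p - 2) * (en ?C * (ind (cube c \<rho>) x * (2 * en (excess h x)) + ind (cube c \<rho>) x * ?J x)))"
  unfolding EN_def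
 proof (rule nn_integral_mono_AE, rule AE_mp[OF pt], intro AE_I2 impI)
  fix x
  assume "x : cube c \<rho> --> en (rpow (norm (du h x)) (p - 2) * (norm (dZ h x))\<^sup>2)
   <= np h (p - 2) * (en ?C * (2 * en (excess h x) + ?J x))"
  thus "ind (cube c \<rho>) x * en (energy_density h x) <= ind (cube c \<rho>) x * np (du h x) p +
   np h (p - 2) * (en ?C * (ind (cube c \<rho>) x * (2 * en (excess h x)) + ind (cube c \<rho>) x * ?J x))"
   by (cases "x : cube c \<rho>") (auto simp: energy_density_def rpow_nonneg)
 qed
 also have "... = (NBINT x. ind (cube c \<rho>) x * np (du h x) p) + np h (p - 2) * (en ?C *
  ((NBINT x. ind (cube c \<rho>) x * (2 * en (excess h x))) + (NBINT x. ind (cube c \<rho>) x * ?J x)))"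
  by (simp add: nn_integral_add nn_integral_cmult)
 also have "... <= np h p * MZ + np h (p - 2) * (en ?C * (2 * W + W))"
  by (intro add_mono mult_left_mono du_powr_le[OF assms(1,2)] I J) auto
 also have "en ?C * (2 * W + W) = en (3 * 2 powr (p - 2) / cA) * W"
 proof -
  have "2 * W + W = 3 * W" by (metis distrib_right mult_1 numeral_3_eq_3 one_add_one numeral_Bit1 numeral_One numeral_Bit0)
  moreover have "en (3 * 2 powr (p - 2) / cA) = en ?C * 3"
   using cA_pos by (subst ennreal_numeral[symmetric], subst ennreal_mult[symmetric]) (auto simp: mult.commute)
  ultimately show ?thesis by (simp add: mult.assoc)
 qed
 finally show ?thesis .
qed

end

section \<open>Absorption\<close>

text \<open>With the radii \<open>2 * R - R / 2 ^ k\<close> and logarithms the inequality becomes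
  \<open>y k \<le> (k + 1) * b + \<gamma> * y (Suc k)\<close>. Subtracting the explicit solution
  \<open>b * (k * \<alpha> + \<alpha>\<^sup>2)\<close> of the recursion, where
  \<open>\<alpha> = 1 / (1 - \<gamma>)\<close>, leaves
  \<open>m k \<le> \<gamma> * m (Suc k)\<close>, so that \<open>m 0\<close> is at most
  \<open>\<gamma> ^ k * ln M\<close> for every \<open>k\<close>, hence nonpositive. The a priori
  bound \<open>M\<close> disappears from the result; only its finiteness counts.\<close>

lemma iteration_bound:
 fixes Y :: "real => real"
 assumes \<gamma>: "0 <= \<gamma>" "\<gamma> < 1" and R: "0 < R" and C: "0 <= C" and a: "0 <= a"
  and le: "!!r \<rho>. R <= r ==> r < \<rho> ==> \<rho> <= 2 * R ==> Y r <= C * (\<rho> - r) powr (- a) * Y \<rho> powr \<gamma>"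
  and Y: "!!r. R <= r ==> r <= 2 * R ==> 1 <= Y r \<and> Y r <= M"
 shows "Y R <= exp (ln (max 1 (C * R powr (- a)) * 2 powr a) / (1 - \<gamma>)\<^sup>2)"
proof -
 \<comment> \<open>One base for both the constant and the loss \<open>2 powr a\<close> at each
   halving of the gap; taking the maximum with 1 makes its powers increasing.\<close>
 define B where "B = max 1 (C * R powr (- a)) * 2 powr a"
 define b where "b = ln B"
 define \<alpha> where "\<alpha> = 1 / (1 - \<gamma>)"
 define r where "r k = 2 * R - R / 2 ^ k" for k :: nat
 define y where "y k = ln (Y (r k))" for k
 define m where "m k = y k - b * (real k * \<alpha> + \<alpha>\<^sup>2)" for k
 have p2: "1 <= (2::real) ^ k" for k by simp
 have B1: "1 <= B" unfolding B_def using a mult_mono[of 1 "max 1 (C * R powr (- a))" 1 "2 powr a"]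
  by (simp add: ge_one_powr_ge_zero)
 hence b0: "0 <= b" by (simp add: b_def)
 have rr: "R <= r k" "r k <= 2 * R" "r k < r (Suc k)" "r (Suc k) - r k = R / 2 ^ Suc k" for k
  using R p2[of k] by (simp_all add: r_def field_simps)
 have Yr: "1 <= Y (r k)" "Y (r k) <= M" for k using Y rr by auto
 have step: "y k <= (real k + 1) * b + \<gamma> * y (Suc k)" for k
 proof -
  have "Y (r k) <= C * (R / 2 ^ Suc k) powr (- a) * Y (r (Suc k)) powr \<gamma>"
   using le[OF rr(1,3,2), of k] by (simp add: rr(4))
  also have "(R / 2 ^ Suc k) powr (- a) = R powr (- a) * (2 powr a) ^ Suc k"
  proof -
   have "((2::real) ^ Suc k) powr a = (2 powr a) ^ Suc k"
    by (simp only: powr_realpow[symmetric] powr_powr zero_less_numeral powr_gt_zero mult.commute zero_neq_numeral not_False_eq_True powr_eq_0_iff)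
   moreover have "(R / 2 ^ Suc k) powr (- a) = R powr (- a) / (2 ^ Suc k) powr (- a)" by (rule powr_divide)
   ultimately show ?thesis by (simp add: powr_minus field_simps)
  qed
  also have "C * (R powr (- a) * (2 powr a) ^ Suc k) <= B ^ Suc k"
  proof -
   let ?m = "max 1 (C * R powr (- a))"
   have "?m ^ 1 <= ?m ^ Suc k" by (intro power_increasing) auto
   hence "C * R powr (- a) <= ?m ^ Suc k" by (simp add: le_max_iff_disj max_def split: if_splits)
   hence "C * R powr (- a) * (2 powr a) ^ Suc k <= ?m ^ Suc k * (2 powr a) ^ Suc k" by (intro mult_right_mono) auto
   thus ?thesis by (simp only: B_def power_mult_distrib mult.assoc)
  qed
  finally have "Y (r k) <= B ^ Suc k * Y (r (Suc k)) powr \<gamma>" by (simp add: mult_right_mono)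
  hence "ln (Y (r k)) <= ln (B ^ Suc k * Y (r (Suc k)) powr \<gamma>)"
   using Yr[of k] by (subst ln_le_cancel_iff) auto
  also have "... = (real k + 1) * b + \<gamma> * y (Suc k)"
   using B1 Yr[of "Suc k"] by (simp add: ln_mult ln_realpow ln_powr b_def y_def algebra_simps)
  finally show ?thesis by (simp add: y_def)
 qed
 have \<alpha>: "1 + \<gamma> * \<alpha> = \<alpha>" using \<gamma> by (simp add: \<alpha>_def field_simps)
 have ms: "m k <= \<gamma> * m (Suc k)" for k
 proof -
  have "(real k + 1) + \<gamma> * ((real k + 1) * \<alpha> + \<alpha>\<^sup>2) = (real k + 1) * (1 + \<gamma> * \<alpha>) + \<gamma> * \<alpha> * \<alpha>"
   by (simp add: algebra_simps power2_eq_square)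
  also have "... = real k * \<alpha> + \<alpha>\<^sup>2"
  proof -
   have g: "\<gamma> * \<alpha> = \<alpha> - 1" using \<alpha> by simp
   show ?thesis unfolding g by (simp add: algebra_simps power2_eq_square)
  qed
  finally have "b * ((real k + 1) + \<gamma> * ((real k + 1) * \<alpha> + \<alpha>\<^sup>2)) = b * (real k * \<alpha> + \<alpha>\<^sup>2)" by simp
  thus ?thesis using step[of k] by (simp add: m_def algebra_simps)
 qed
 have mk: "m 0 <= \<gamma> ^ k * m k" for k
 proof (induction k)
  case (Suc k)
  have "\<gamma> ^ k * m k <= \<gamma> ^ k * (\<gamma> * m (Suc k))" using ms \<gamma> by (intro mult_left_mono) auto
  thus ?case using Suc by (simp add: mult_ac)
 qed simp
 have M1: "1 <= M" using Yr[of 0] by simp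
 have "m 0 <= \<gamma> ^ k * ln M" for k
 proof -
  have "m k <= y k" using b0 \<gamma> by (simp add: m_def \<alpha>_def)
  also have "... <= ln M" using Yr[of k] by (simp add: y_def)
  finally have "\<gamma> ^ k * m k <= \<gamma> ^ k * ln M" using \<gamma> by (intro mult_left_mono) auto
  thus ?thesis using mk[of k] by simp
 qed
 moreover have "(%k. \<gamma> ^ k * ln M) ----> 0 * ln M"
  using \<gamma> by (intro tendsto_mult LIMSEQ_realpow_zero tendsto_const) auto
 ultimately have "m 0 <= 0 * ln M" by (intro LIMSEQ_le_const) auto
 hence "ln (Y R) <= b * \<alpha>\<^sup>2" by (simp add: m_def y_def r_def)
 moreover have "0 < Y R" using Yr(1)[of 0] by (simp add: r_def)
 ultimately have "Y R <= exp (b * \<alpha>\<^sup>2)" by (metis exp_le_cancel_iff exp_ln)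
 thus ?thesis by (simp add: b_def B_def \<alpha>_def power_divide)
qed

lemma epow_pos: "0 < x ==> epow (en x) a = en (x powr a)"
 by (cases "a = 0") (auto simp: epow_ennreal)

text \<open>The homogeneity count behind the quadratic rate: by the interpolation identity for
  \<open>q\<close>, the bracket to the power \<open>1 / q\<close> has degree 1 in \<open>T\<close>,
  and the excess factor to the power \<open>1 / 2\<close> contributes another 1. The exponents of
  \<delta> and \<open>y\<close> are those of the iteration. Everything is checked on
  logarithms.\<close>

lemma scaling_identity:
 fixes D1 :: real
 assumes pos: "0 < D1" "0 < D2" "0 < D3" "0 < D4" "0 < \<delta>" "0 < y" "0 < T"
  and q: "0 < q" "q = (1 - \<theta>) * p + \<theta> * (p * s / 2)"
 shows "(D1 / \<delta> * y * T\<^sup>2) powr (1/2) * (D2 / \<delta>) powr \<alpha> *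
   ((D4 / \<delta> * T powr p) powr (1 - \<theta>) * (D3 / \<delta> ^ 3 * T powr p * y) powr (\<theta> * s / 2)) powr (1 / q)
  = D1 powr (1/2) * D2 powr \<alpha> * (D4 powr (1 - \<theta>) * D3 powr (\<theta> * s / 2)) powr (1 / q)
   * \<delta> powr (- (1/2 + \<alpha> + ((1 - \<theta>) + 3 * \<theta> * s / 2) / q)) * y powr (1/2 + \<theta> * s / (2 * q)) * T\<^sup>2" (is "?L = ?R")
proof -
 have e: "(1 / q) * ((1 - \<theta>) * p + \<theta> * s / 2 * p) = 1"
 proof -
  have "(1 - \<theta>) * p + \<theta> * s / 2 * p = q" using q(2) by (simp add: algebra_simps)
  thus ?thesis using q(1) by simp
 qed
 let ?l = "ln T"
 have "ln ?L = (ln D1 - ln \<delta> + ln y + 2 * ?l) / 2 + \<alpha> * (ln D2 - ln \<delta>)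
  + (1 / q) * ((1 - \<theta>) * (ln D4 - ln \<delta> + p * ?l) + \<theta> * s / 2 * (ln D3 - 3 * ln \<delta> + p * ?l + ln y))"
  using pos by (simp add: ln_mult ln_div ln_powr ln_realpow algebra_simps add_divide_distrib diff_divide_distrib)
 also have "... = (ln D1 - ln \<delta> + ln y + 2 * ?l) / 2 + \<alpha> * (ln D2 - ln \<delta>)
  + (1 / q) * ((1 - \<theta>) * (ln D4 - ln \<delta>) + \<theta> * s / 2 * (ln D3 - 3 * ln \<delta> + ln y)) + (1 / q) * ((1 - \<theta>) * p + \<theta> * s / 2 * p) * ?l"
  by (simp add: algebra_simps add_divide_distrib diff_divide_distrib)
 also have "... = ln ?R" unfolding e
  using pos q(1) by (simp add: ln_mult ln_div ln_powr ln_realpow field_simps)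
 finally have "exp (ln ?L) = exp (ln ?R)" by simp
 thus ?thesis using pos by simp
qed

context local_min
begin

text \<open>A bound, independent of \<open>h\<close>, for the q-th power of the sum of
  \<open>K\<close> at \<open>x\<close> and \<open>x + h\<close>: the factor \<open>2 powr q\<close>
  splits the sum, and \<open>K_le_F\<close> with the finite energy on \<open>S\<close> is used at
  both points.\<close>

definition KB :: "real^'n => real => ennreal" where
 "KB c \<rho> = en (2 powr q) * (2 * (emeasure lborel (cube c \<rho>) + en (2 / cB) * (NBINT x. en (ind S x * F (Z x)))))"

lemma KB_finite: "KB c \<rho> < \<infinity>"
proof -
 have "(NBINT x. en (ind S x * F (Z x))) < \<infinity>"
  using FZ F_nonneg by (simp add: nn_integral_eq_integral)
 moreover have "emeasure lborel (cube c \<rho>) < \<infinity>" by (rule emeasure_compact_finite[OF compact_cube])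
 ultimately show ?thesis by (simp add: KB_def ennreal_mult_less_top)
qed

lemma measK [measurable]: "K : borelfun"
 unfolding K_def[abs_def] J_def[abs_def] by measurable

lemma K_integral_le:
 assumes "cube c \<rho> <= S" "(%x. x + h) ` cube c \<rho> <= S"
 shows "(NBINT x. ind (cube c \<rho>) x * en ((K (Z x) + K (Z (x + h))) powr q)) <= KB c \<rho>"
proof -
 let ?i = "%x. ind (cube c \<rho>) x :: ennreal"
 let ?G = "(NBINT x. en (ind S x * F (Z x)))"
 have K0: "0 <= K z" for z using K1[of z] by simp
 have q0: "0 <= q" using q2 by simp
 have *: "(NBINT x. ?i x * en (K (Z (x + k)) powr q)) <= emeasure lborel (cube c \<rho>) + en (2 / cB) * ?G"
  if "(%x. x + k) ` cube c \<rho> <= S" for k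
 proof -
  have "(NBINT x. ?i x * en (K (Z (x + k)) powr q))
   <= (NBINT x. ?i x + en (2 / cB) * en (ind S (x + k) * F (Z (x + k))))"
  proof (rule nn_integral_mono)
   fix x
   show "?i x * en (K (Z (x + k)) powr q) <= ?i x + en (2 / cB) * en (ind S (x + k) * F (Z (x + k)))"
   proof (cases "x : cube c \<rho>")
    case True
    hence "x + k : S" using that by auto
    have "en (K (Z (x + k)) powr q) <= en (1 + 2 / cB * F (Z (x + k)))" by (intro ennreal_leI K_le_F)
    also have "... = 1 + en (2 / cB) * en (F (Z (x + k)))"
     using cB_pos F_nonneg by (subst ennreal_mult[symmetric]) auto
    finally show ?thesis using True \<open>x + k : S\<close> by simp
   qed simp
  qed
  also have "... = emeasure lborel (cube c \<rho>) + en (2 / cB) * (NBINT x. en (ind S (x + k) * F (Z (x + k))))"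
   by (simp add: nn_integral_add nn_integral_cmult)
  also have "(NBINT x. en (ind S (x + k) * F (Z (x + k)))) = ?G"
   by (rule nn_integral_lborel_shift) measurable
  finally show ?thesis .
 qed
 have "(NBINT x. ?i x * en ((K (Z x) + K (Z (x + h))) powr q))
  <= (NBINT x. en (2 powr q) * (?i x * en (K (Z (x + 0)) powr q) + ?i x * en (K (Z (x + h)) powr q)))"
 proof (rule nn_integral_mono)
  fix x
  have "en ((K (Z x) + K (Z (x + h))) powr q) <= en (2 powr q * (K (Z x) powr q + K (Z (x + h)) powr q))"
   by (intro ennreal_leI powr_add_le K0 q0)
  thus "?i x * en ((K (Z x) + K (Z (x + h))) powr q)
   <= en (2 powr q) * (?i x * en (K (Z (x + 0)) powr q) + ?i x * en (K (Z (x + h)) powr q))"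
   by (cases "x : cube c \<rho>") (auto simp: ennreal_mult)
 qed
 also have "... = en (2 powr q) * ((NBINT x. ?i x * en (K (Z (x + 0)) powr q)) + (NBINT x. ?i x * en (K (Z (x + h)) powr q)))"
  by (simp add: nn_integral_add nn_integral_cmult)
 also have "... <= KB c \<rho>" unfolding KB_def mult_2
  by (intro mult_left_mono add_mono *) (use assms in auto)
 finally show ?thesis .
qed

text \<open>Crude and without any rate in \<open>h\<close>; it provides the finiteness from which
  the absorption starts.\<close>

lemma EN_bounded: "\<exists>M. \<forall>h c \<rho>. EN h c \<rho> <= en M"
proof -
 define MU where "MU = (NBINT x. np (u x) p)"
 define M where "M = 2 * (en (2 powr p) * (MU + MU)) + en (2 powr p) * (MZ + MZ)"
 have "MU < \<infinity>" "MZ < \<infinity>" unfolding MU_def MZ_def using up Zp by (simp_all add: nn_integral_eq_integral)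
 hence M: "M = en (enn2real M)" by (simp add: M_def ennreal_mult_less_top)
 have d: "(NBINT x. np (f (x + h) - f x) p) <= en (2 powr p) * (I + I)"
  if [measurable]: "f : borelfun" and I: "I = (NBINT x. np (f x) p)" for f :: "real^'n => 'b::euclidean_space" and h I
 proof -
  have "(NBINT x. np (f (x + h) - f x) p)
   <= (NBINT x. en (2 powr p) * (np (f (x + h)) p + np (f x) p))"
  proof (rule nn_integral_mono)
   fix x
   have "norm (f (x + h) - f x) powr p <= 2 powr p * (norm (f (x + h)) powr p + norm (f x) powr p)"
    using norm_add_powr_le[of p "f (x + h)" "- f x"] p2 by simp
   thus "np (f (x + h) - f x) p <= en (2 powr p) * (np (f (x + h)) p + np (f x) p)"
    by (simp add: ennreal_plus[symmetric] ennreal_mult[symmetric] ennreal_leI del: ennreal_plus)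
  qed
  also have "... = en (2 powr p) * ((NBINT x. np (f (x + h)) p) + I)"
   by (simp add: nn_integral_add nn_integral_cmult I)
  also have "(NBINT x. np (f (x + h)) p) = I"
   unfolding I by (rule nn_integral_lborel_shift) measurable
  finally show ?thesis .
 qed
 have "EN h c \<rho> <= M" for h c \<rho>
 proof -
  have "EN h c \<rho> <= (NBINT x. 2 * np (du h x) p + np (dZ h x) p)"
   unfolding EN_def
  proof (rule nn_integral_mono)
   fix x
   have "en (rpow (norm (du h x)) (p - 2) * (norm (dZ h x))\<^sup>2) <= np (du h x) p + np (dZ h x) p"
    using epow_square_young[OF p2, of "norm (dZ h x)" "en (norm (du h x))"] p2
    by (simp add: epow_rpow ennreal_mult rpow_nonneg) (simp add: rpow_def)
   thus "ind (cube c \<rho>) x * en (energy_density h x) <= 2 * np (du h x) p + np (dZ h x) p"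
    by (cases "x : cube c \<rho>") (auto simp: energy_density_def rpow_nonneg mult_2 add.assoc add_left_mono)
  qed
  also have "... = 2 * (NBINT x. np (du h x) p) + (NBINT x. np (dZ h x) p)"
   by (simp add: nn_integral_add nn_integral_cmult)
  also have "... <= M" unfolding M_def du_def dZ_def
   by (intro add_mono mult_left_mono d) (auto simp: MU_def MZ_def)
  finally show ?thesis .
 qed
 thus ?thesis using M by metis
qed

context
 fixes s \<theta> R :: real and c :: "real^'n"
 assumes s: "2 <= s" "(real CARD('n) - 3) * s <= 2 * (real CARD('n) - 1)" "2 <= CARD('n)"
  and \<theta>: "0 <= \<theta>" "\<theta> < 1" "q = (1 - \<theta>) * p + \<theta> * (p * s / 2)"
  and R: "0 < R" and cS: "cube c (4 * R) <= S"
begin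

private lemma shift: 
 assumes "norm h <= R" "\<rho> <= 3 * R" shows "cube c \<rho> <= S" "(%x. x + h) ` cube c \<rho> <= S"
proof -
 have "cube c \<rho> <= cube c (4 * R)" "cube c (\<rho> + R) <= cube c (4 * R)" using assms R by (auto intro!: cube_mono)
 thus "cube c \<rho> <= S" "(%x. x + h) ` cube c \<rho> <= S"
  using cS cube_shift[OF _ assms(1), of _ c \<rho>] by blast+
qed

text \<open>The Caccioppoli inequality with the stress difference bounded by powers of
  \<open>K\<close> at both points instead of the excess. The result is finite and uniform in
  \<open>h\<close>, which is the a priori information that \<open>iteration_bound\<close>
  requires.\<close>

private lemma excess_bounded: "\<exists>M. \<forall>h. norm h <= R --> IE h c (2 * R) <= en M"
proof -
 obtain M where M: "!!h c \<rho>. EN h c \<rho> <= en M" using EN_bounded by blast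
 let ?\<kappa> = "en (16 / (3 * R - 2 * R))" and ?CG = "en ((s + 2)\<^sup>2 * p\<^sup>2 / 8 * (2 + 32 * (real CARD('n))\<^sup>2 / (3 * R - 2 * R)\<^sup>2))"
 define W where "W = en (4 * real CARD('n) * 2) * (epow (?\<kappa> * 0) 0 * epow (?\<kappa> * KB c (3 * R)) (1 - 1 / q) *
  epow (epow (?\<kappa> * en M) (1 - \<theta>) * epow (?\<kappa> * (?CG * en M)) (\<theta> * s / 2)) (1 / q))"
 have W: "W < \<infinity>" using KB_finite[of c "3 * R"] q2 s \<theta>
  by (auto simp: W_def ennreal_mult_less_top intro!: epow_less_top)
 have "IE h c (2 * R) <= W" if h: "norm h <= R" for h
 proof -
  note S3 = shift[OF h order_refl]
  let ?B = "%x. en ((K (Z x) + K (Z (x + h))) powr q)"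
  have B: "(NBINT x. ind (cube c (3 * R)) x * ?B x) <= KB c (3 * R)" by (rule K_integral_le[OF S3])
  have P: "(NBINT x. ind (cube c (3 * R)) x * np (du h x) p) <= en M"
   by (rule order_trans[OF _ M[of h c "3 * R"]])
    (auto simp: EN_def energy_density_def rpow_nonneg intro!: nn_integral_mono mult_left_mono)
  have C: "en (norm (\<sigma> (Z (x + h)) - \<sigma> (Z x))) <= ennreal 2 * (epow 0 0 * epow (?B x) (1 - 1 / q))" for x
  proof -
   let ?K = "K (Z x) + K (Z (x + h))"
   have K: "0 < ?K" "K (Z x) <= ?K" "K (Z (x + h)) <= ?K" "0 <= K (Z x)" "0 <= K (Z (x + h))"
    using K1[of "Z x"] K1[of "Z (x + h)"] by auto
   have "norm (\<sigma> (Z (x + h)) - \<sigma> (Z x)) <= K (Z (x + h)) powr (q - 1) + K (Z x) powr (q - 1)"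
    using norm_triangle_ineq4[of "\<sigma> (Z (x + h))" "\<sigma> (Z x)"] norm_\<sigma>_K[of "Z x"] norm_\<sigma>_K[of "Z (x + h)"] by linarith
   also have "... <= ?K powr (q - 1) + ?K powr (q - 1)" using K q2 by (intro add_mono powr_mono2) auto
   also have "... = 2 * ((?K powr q) powr (1 - 1 / q))" using q2 by (simp add: powr_powr algebra_simps)
   finally have "en (norm (\<sigma> (Z (x + h)) - \<sigma> (Z x))) <= en (2 * ((?K powr q) powr (1 - 1 / q)))" by (rule ennreal_leI)
   also have "... = ennreal 2 * (epow 0 0 * epow (?B x) (1 - 1 / q))" using K(1) by (subst ennreal_mult) (auto simp: epow_pos)
   finally show ?thesis .
  qed
  have "IE h c (2 * R) <= en (4 * real CARD('n) * 2) * (epow (?\<kappa> * (NBINT x. ind (cube c (3 * R)) x * 0)) 0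
   * epow (?\<kappa> * (NBINT x. ind (cube c (3 * R)) x * ?B x)) (1 - 1 / q)
   * epow (epow (?\<kappa> * (NBINT x. ind (cube c (3 * R)) x * np (du h x) p)) (1 - \<theta>)
   * epow (?\<kappa> * (?CG * EN h c (3 * R))) (\<theta> * s / 2)) (1 / q))"
   unfolding IE_def
  \<comment> \<open>Only two Hoelder factors are wanted: \<open>A\<close> is set to 0 with exponent
    0, and \<open>epow 0 0 = 1\<close>.\<close>
  proof (rule caccioppoli[where A="%_. 0" and ?\<alpha>1.0=0, OF s \<theta> _ _ S3 _ _ _ _ _ _ C])
   show "(NBINT x. ind (cube c (3 * R)) x * ?B x) < \<infinity>" using B KB_finite by (rule order_le_less_trans)
   show "EN h c (3 * R) < \<infinity>" using M[of h c "3 * R"] by (rule order_le_less_trans) simp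
  qed (use R q2 in auto)
  also have "... <= W" unfolding W_def
   by (intro mult_left_mono mult_mono epow_mono B P M) (use q2 s \<theta> in auto)
  finally show ?thesis .
 qed
 hence "\<forall>h. norm h <= R --> IE h c (2 * R) <= en (enn2real W)" using W by simp
 thus ?thesis by blast
qed

text \<open>The absorption proper. \<open>energy_le\<close> asks for the excess at all shorter
  increments, so the quantity iterated is the supremum over \<open>t\<close> of the excess integral
  divided by \<open>(t + \<epsilon>)\<^sup>2\<close>. The crude bound and \<epsilon> make it finite,
  and the final constant \<open>Bd\<close> does not depend on \<epsilon>. Cocoercivity inserted into
  the Caccioppoli inequality returns this supremum with an exponent
  \<open>\<gamma> < 1\<close>.\<close>

lemma excess_quadratic:
 assumes e: "norm e = 1"
 shows "\<exists>C. 0 <= C \<and> (\<forall>t. 0 < t --> t <= R --> IE (t *\<^sub>R e) c R <= en (C * t\<^sup>2))"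
proof -
 obtain M where M: "!!h. norm h <= R ==> IE h c (2 * R) <= en M" using excess_bounded by blast
 have q0: "0 < q" "2 <= q" using p2 pq by auto
 define mB where "mB = enn2real (KB c (2 * R)) + 1"
 define mZ where "mZ = enn2real MZ + 1"
 define C2 where "C2 = 3 * 2 powr (p - 2) / cA"
 define c1 where "c1 = (s + 2)\<^sup>2 * p\<^sup>2 / 8"
 define D1 where "D1 = (16::real)"
 define D2 where "D2 = 16 * mB"
 define D4 where "D4 = 16 * mZ"
 define D3 where "D3 = 16 * (c1 * (2 * R\<^sup>2 + 32 * (real CARD('n))\<^sup>2)) * (mZ + C2)"
 define C0 where "C0 = sqrt (2 / cB)"
 define \<alpha> where "\<alpha> = (q - 2) / (2 * q)"
 define a where "a = 1/2 + \<alpha> + ((1 - \<theta>) + 3 * \<theta> * s / 2) / q"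
 define \<gamma> where "\<gamma> = 1/2 + \<theta> * s / (2 * q)"
 define D where "D = D1 powr (1/2) * D2 powr \<alpha> * (D4 powr (1 - \<theta>) * D3 powr (\<theta> * s / 2)) powr (1 / q)"
 \<comment> \<open>The summand \<open>R powr a\<close> pays for the constant 1 that is added in
   \<open>Y\<close>.\<close>
 define C where "C = R powr a + 4 * real CARD('n) * C0 * D"
 have MZf: "MZ < \<infinity>" unfolding MZ_def using Zp by (simp add: nn_integral_eq_integral)
 have MZ: "MZ <= en mZ" using MZf by (cases MZ) (auto simp: mZ_def ennreal_leI)
 have KB: "KB c (2 * R) <= en mB" using KB_finite[of c "2 * R"] by (cases "KB c (2 * R)") (auto simp: mB_def ennreal_leI)
 have pos: "0 < mB" "0 < mZ" "0 < C2" "0 < c1" "0 < D1" "0 < D2" "0 < D4" "0 <= C0" "0 <= \<alpha>" "0 <= D" 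
  using cA_pos cB_pos s p2 q2 by (auto simp: mB_def mZ_def C2_def c1_def D1_def D2_def D4_def C0_def \<alpha>_def D_def add_nonneg_pos)
 have D3: "0 < D3" unfolding D3_def using pos R by (intro mult_pos_pos add_pos_pos) auto
 have ths: "0 <= \<theta> * s" using \<theta> s by simp
 have a0: "0 <= a" using pos \<theta> ths q0 unfolding a_def by (intro add_nonneg_nonneg divide_nonneg_pos) auto
 have \<gamma>: "0 <= \<gamma>" "\<gamma> < 1"
 proof -
  \<comment> \<open>\<open>\<gamma> < 1\<close> means \<open>\<theta> * s < q\<close>. Because
    \<open>p\<close> is at least 2, \<open>\<theta> * s\<close> is at most the second term in the
    interpolation identity for \<open>q\<close>, and the first term is positive since
    \<open>\<theta> < 1\<close>.\<close>
  have "\<theta> * s * 1 <= \<theta> * s * (p / 2)" using p2 ths by (intro mult_left_mono) auto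
  moreover have "0 < (1 - \<theta>) * p" using \<theta> p2 by simp
  ultimately have "\<theta> * s < q" using \<theta>(3) by (simp add: mult_ac)
  hence "\<theta> * s / (2 * q) < 1 / 2" using q0 by (simp add: divide_less_eq)
  thus "\<gamma> < 1" unfolding \<gamma>_def by linarith
  show "0 <= \<gamma>" using ths q0 by (simp add: \<gamma>_def)
 qed
 have C: "0 <= C" unfolding C_def using pos by simp
 define Bd where "Bd = exp (ln (max 1 (C * R powr (- a)) * 2 powr a) / (1 - \<gamma>)\<^sup>2)"
 have main: "IE (t *\<^sub>R e) c R <= en (Bd * (t + \<epsilon>)\<^sup>2)" if t: "0 < t" "t <= R" and \<epsilon>: "0 < \<epsilon>" for t \<epsilon>
 proof -
  define X where "X \<rho> = (SUP t\<in>{0<..R}. IE (t *\<^sub>R e) c \<rho> * en (1 / (t + \<epsilon>)\<^sup>2))" for \<rho>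
  define Y where "Y \<rho> = 1 + enn2real (X \<rho>)" for \<rho>
  have XM: "X \<rho> <= en (M / \<epsilon>\<^sup>2)" if "\<rho> <= 2 * R" for \<rho>
   unfolding X_def
  proof (rule SUP_least)
   fix t assume t: "t : {0<..R}"
   have "IE (t *\<^sub>R e) c \<rho> <= IE (t *\<^sub>R e) c (2 * R)"
    unfolding IE_def using cube_mono[OF that, of c] by (intro nn_integral_mono) (auto simp: indicator_def)
   also have "... <= en M" using t e by (intro M) auto
   finally have "IE (t *\<^sub>R e) c \<rho> * en (1 / (t + \<epsilon>)\<^sup>2) <= en M * en (1 / \<epsilon>\<^sup>2)"
    using t \<epsilon> by (intro mult_mono ennreal_leI divide_left_mono power_mono) auto
   also have "... <= en (M / \<epsilon>\<^sup>2)" using \<epsilon> by (cases "0 <= M") (auto simp: ennreal_mult[symmetric] ennreal_neg)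
   finally show "IE (t *\<^sub>R e) c \<rho> * en (1 / (t + \<epsilon>)\<^sup>2) <= en (M / \<epsilon>\<^sup>2)" .
  qed
  have XY: "IE (t *\<^sub>R e) c \<rho> <= en (enn2real (X \<rho>) * (t + \<epsilon>)\<^sup>2)" if "\<rho> <= 2 * R" "0 < t" "t <= R" for \<rho> t
  proof -
   have "IE (t *\<^sub>R e) c \<rho> * en (1 / (t + \<epsilon>)\<^sup>2) <= X \<rho>" unfolding X_def using that by (intro SUP_upper) auto
   also have "... = en (enn2real (X \<rho>))" using order_le_less_trans[OF XM[OF that(1)] ennreal_less_top] by simp
   finally have "IE (t *\<^sub>R e) c \<rho> * en (1 / (t + \<epsilon>)\<^sup>2) * en ((t + \<epsilon>)\<^sup>2) <= en (enn2real (X \<rho>)) * en ((t + \<epsilon>)\<^sup>2)"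
    by (rule mult_right_mono) simp
   moreover have "IE (t *\<^sub>R e) c \<rho> * en (1 / (t + \<epsilon>)\<^sup>2) * en ((t + \<epsilon>)\<^sup>2) = IE (t *\<^sub>R e) c \<rho>"
    using that \<epsilon> by (simp add: mult.assoc ennreal_mult[symmetric])
   ultimately show ?thesis by (simp add: ennreal_mult[symmetric])
  qed
  have stp: "Y r <= C * (\<rho> - r) powr (- a) * Y \<rho> powr \<gamma>" if r: "R <= r" "r < \<rho>" "\<rho> <= 2 * R" for r \<rho>
  proof -
   define \<delta> where "\<delta> = \<rho> - r"
   have \<delta>: "0 < \<delta>" "\<delta> <= R" using r by (auto simp: \<delta>_def)
   define y where "y = Y \<rho>"
   have y: "1 <= y" by (simp add: y_def Y_def)
   have X: "IE (t *\<^sub>R e) c r * en (1 / (t + \<epsilon>)\<^sup>2) <= en (4 * real CARD('n) * C0 * D * \<delta> powr (- a) * y powr \<gamma>)"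
    if t: "t : {0<..R}" for t
   proof -
    define T where "T = t + \<epsilon>"
    have T: "0 < T" "t <= T" using t \<epsilon> by (auto simp: T_def)
    define h where "h = t *\<^sub>R e"
    have h: "norm h <= R" "norm h = t" "h ~= 0" using t e by (auto simp: h_def)
    have \<rho>3: "\<rho> <= 3 * R" "\<rho> + norm h < 4 * R" using r R h by auto
    note S3 = shift[OF h(1) \<rho>3(1)]
    \<comment> \<open>The intermediate increments are shorter multiples of the same direction
      \<open>e\<close>, hence covered by the supremum.\<close>
    have IE: "IE (\<tau> *\<^sub>R h) c \<rho> <= en (y * T\<^sup>2)" if \<tau>: "0 < \<tau>" "\<tau> <= 1" for \<tau>
    proof -
     have \<tau>t: "\<tau> * t <= t" using t \<tau> by (simp add: mult_left_le_one_le)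
     have "IE (\<tau> *\<^sub>R h) c \<rho> <= en (enn2real (X \<rho>) * (\<tau> * t + \<epsilon>)\<^sup>2)"
      using XY[OF r(3), of "\<tau> * t"] order_trans[OF \<tau>t, of R] t \<tau> by (simp add: h_def)
     also have "... <= en (y * T\<^sup>2)"
      using t \<tau> \<epsilon> \<tau>t by (intro ennreal_leI mult_mono power_mono) (auto simp: y_def Y_def T_def)
     finally show ?thesis .
    qed
    have tp: "t powr p <= T powr p" using T t p2 by (intro powr_mono2) auto
    have P: "(NBINT x. ind (cube c \<rho>) x * np (du h x) p) <= en (mZ * T powr p)"
    proof -
     have "(NBINT x. ind (cube c \<rho>) x * np (du h x) p) <= en (t powr p) * MZ"
      using du_powr_le[OF cS \<rho>3(2)] h by simp
     also have "... <= en (T powr p) * en mZ" using tp MZ by (intro mult_mono ennreal_leI) auto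
     finally show ?thesis using pos by (simp add: ennreal_mult[symmetric] mult.commute)
    qed
    have E: "EN h c \<rho> <= en ((mZ + C2) * T powr p * y)"
    proof -
     have "EN h c \<rho> <= en (t powr p) * MZ + en (t powr (p - 2)) * (en C2 * en (y * T\<^sup>2))"
      using energy_le[OF cS \<rho>3(2) h(3) IE] h by (simp add: C2_def)
     also have "... <= en (T powr p) * en mZ + en (T powr (p - 2)) * (en C2 * en (y * T\<^sup>2))"
      using tp MZ T t p2 y pos by (intro add_mono mult_mono ennreal_leI powr_mono2) auto
     also have "... = en (T powr p * mZ + T powr (p - 2) * (C2 * (y * T\<^sup>2)))"
      using pos y by (simp add: ennreal_mult[symmetric] ennreal_plus[symmetric] del: ennreal_plus)
     also have "T powr (p - 2) * (C2 * (y * T\<^sup>2)) = T powr p * C2 * y"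
     proof -
      have "T powr (p - 2) * T\<^sup>2 = T powr p" using T by (simp add: powr_diff)
      thus ?thesis by (simp add: mult_ac)
     qed
     also have "T powr p * mZ + T powr p * C2 * y <= (mZ + C2) * T powr p * y"
      using y pos mult_left_mono[of 1 y "T powr p * mZ"] by (simp add: algebra_simps)
     finally show ?thesis by (simp add: ennreal_leI)
    qed
    let ?\<kappa> = "en (16 / (\<rho> - r))" and ?CG = "en ((s + 2)\<^sup>2 * p\<^sup>2 / 8 * (2 + 32 * (real CARD('n))\<^sup>2 / (\<rho> - r)\<^sup>2))"
    let ?B = "%x. en ((K (Z x) + K (Z (x + h))) powr q)"
    have A: "(NBINT x. ind (cube c \<rho>) x * en (excess h x)) <= en (y * T\<^sup>2)"
     using IE[of 1] by (simp add: IE_def)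
    have B: "(NBINT x. ind (cube c \<rho>) x * ?B x) <= en mB"
    proof -
     have "KB c \<rho> <= KB c (2 * R)" unfolding KB_def
      using cube_mono[OF r(3), of c] by (intro mult_left_mono add_mono emeasure_mono) auto
     thus ?thesis using K_integral_le[OF S3] KB by (meson order_trans)
    qed
    \<comment> \<open>Square root of the cocoercivity inequality: exponent \<open>1 / 2\<close> on
      the excess and \<open>(q - 2) / (2 * q)\<close> on the q-th power of \<open>K\<close>;
      together with \<open>1 / q\<close> these sum to 1.\<close>
    have Cs: "en (norm (\<sigma> (Z (x + h)) - \<sigma> (Z x))) <= en C0 * (epow (en (excess h x)) (1/2) * epow (?B x) \<alpha>)" for x
    proof -
     let ?K = "K (Z x) + K (Z (x + h))" and ?n = "norm (\<sigma> (Z (x + h)) - \<sigma> (Z x))"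
     have K: "0 < ?K" using K1[of "Z x"] K1[of "Z (x + h)"] by auto
     have "?n\<^sup>2 <= (2 / cB) * (?K powr (q - 2) * excess h x)"
      using \<sigma>_cocoercive[of "Z (x + h)" "Z x"] cB_pos by (simp add: excess_def dZ_def field_simps)
     hence "sqrt (?n\<^sup>2) <= sqrt ((2 / cB) * (?K powr (q - 2) * excess h x))" by (rule real_sqrt_le_mono)
     also have "... = C0 * (excess h x powr (1/2) * (?K powr q) powr \<alpha>)"
     proof -
      have "sqrt (?K powr (q - 2)) = (?K powr q) powr \<alpha>" "sqrt (excess h x) = excess h x powr (1/2)"
       using K q0 excess_nonneg[of h x] by (simp_all add: powr_half_sqrt[symmetric] powr_powr \<alpha>_def)
      thus ?thesis by (simp only: C0_def real_sqrt_mult mult_ac)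
     qed
     finally have "?n <= C0 * (excess h x powr (1/2) * (?K powr q) powr \<alpha>)" by simp
     hence "en ?n <= en (C0 * (excess h x powr (1/2) * (?K powr q) powr \<alpha>))" by (rule ennreal_leI)
     also have "... = en C0 * (epow (en (excess h x)) (1/2) * epow (?B x) \<alpha>)"
      using K excess_nonneg[of h x] pos by (simp add: epow_pos epow_ennreal ennreal_mult)
     finally show ?thesis .
    qed
    have CG: "?\<kappa> * (?CG * EN h c \<rho>) <= en (D3 / \<delta> ^ 3 * T powr p * y)"
    proof -
     \<comment> \<open>As \<delta> is at most \<open>R\<close>, the constant 2 is dominated by
       \<open>2 * R\<^sup>2 / \<delta>\<^sup>2\<close>, which leaves a pure power of the
       gap.\<close>
     have "2 <= 2 * R\<^sup>2 / \<delta>\<^sup>2" using \<delta> power_mono[of \<delta> R 2] by (simp add: pos_le_divide_eq)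
     hence "(s + 2)\<^sup>2 * p\<^sup>2 / 8 * (2 + 32 * (real CARD('n))\<^sup>2 / (\<rho> - r)\<^sup>2) <= c1 * ((2 * R\<^sup>2 + 32 * (real CARD('n))\<^sup>2) / \<delta>\<^sup>2)"
      unfolding c1_def \<delta>_def[symmetric] by (intro mult_left_mono) (simp_all add: add_divide_distrib)
     hence "?\<kappa> * (?CG * EN h c \<rho>) <= ?\<kappa> * (en (c1 * ((2 * R\<^sup>2 + 32 * (real CARD('n))\<^sup>2) / \<delta>\<^sup>2)) * en ((mZ + C2) * T powr p * y))"
      by (rule mult_left_mono[OF mult_mono[OF ennreal_leI E]]) auto
     also have "... = en (16 / \<delta> * (c1 * ((2 * R\<^sup>2 + 32 * (real CARD('n))\<^sup>2) / \<delta>\<^sup>2) * ((mZ + C2) * T powr p * y)))"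
      using pos y \<delta> R by (simp add: ennreal_mult[symmetric] \<delta>_def[symmetric] zero_le_mult_iff)
     also have "16 / \<delta> * (c1 * ((2 * R\<^sup>2 + 32 * (real CARD('n))\<^sup>2) / \<delta>\<^sup>2) * ((mZ + C2) * T powr p * y)) = D3 / \<delta> ^ 3 * T powr p * y"
      by (simp add: D3_def power3_eq_cube power2_eq_square mult_ac)
     finally show ?thesis .
    qed
    have \<kappa>A: "?\<kappa> * (NBINT x. ind (cube c \<rho>) x * en (excess h x)) <= en (D1 / \<delta> * y * T\<^sup>2)"
     using mult_left_mono[OF A, of ?\<kappa>] \<delta> y by (simp add: ennreal_mult[symmetric] D1_def \<delta>_def mult_ac)
    have \<kappa>B: "?\<kappa> * (NBINT x. ind (cube c \<rho>) x * ?B x) <= en (D2 / \<delta>)"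
     using mult_left_mono[OF B, of ?\<kappa>] \<delta> pos by (simp add: ennreal_mult[symmetric] D2_def \<delta>_def mult_ac)
    have \<kappa>P: "?\<kappa> * (NBINT x. ind (cube c \<rho>) x * np (du h x) p) <= en (D4 / \<delta> * T powr p)"
     using mult_left_mono[OF P, of ?\<kappa>] \<delta> pos by (simp add: ennreal_mult[symmetric] D4_def \<delta>_def mult_ac)
    have "IE h c r <= en (4 * real CARD('n) * C0) * (epow (?\<kappa> * (NBINT x. ind (cube c \<rho>) x * en (excess h x))) (1/2)
     * epow (?\<kappa> * (NBINT x. ind (cube c \<rho>) x * ?B x)) \<alpha>
     * epow (epow (?\<kappa> * (NBINT x. ind (cube c \<rho>) x * np (du h x) p)) (1 - \<theta>)
     * epow (?\<kappa> * (?CG * EN h c \<rho>)) (\<theta> * s / 2)) (1 / q))"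
     unfolding IE_def
    proof (rule caccioppoli[OF s \<theta> _ r(2) S3 _ _ _ pos(9) _ pos(8) Cs])
     show "1/2 + \<alpha> + 1 / q = 1" using q0 by (simp add: \<alpha>_def field_simps)
     show "EN h c \<rho> < \<infinity>" by (rule order_le_less_trans[OF E]) simp
     show "(NBINT x. ind (cube c \<rho>) x * en (excess h x)) < \<infinity>" by (rule order_le_less_trans[OF A]) simp
     show "(NBINT x. ind (cube c \<rho>) x * ?B x) < \<infinity>" by (rule order_le_less_trans[OF B]) simp
    qed (use R r in auto)
    also have "... <= en (4 * real CARD('n) * C0) * (epow (en (D1 / \<delta> * y * T\<^sup>2)) (1/2) * epow (en (D2 / \<delta>)) \<alpha>
     * epow (epow (en (D4 / \<delta> * T powr p)) (1 - \<theta>) * epow (en (D3 / \<delta> ^ 3 * T powr p * y)) (\<theta> * s / 2)) (1 / q))"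
     by (intro mult_left_mono mult_mono epow_mono \<kappa>A \<kappa>B \<kappa>P CG) (use q0 s \<theta> pos in auto)
    also have "... = en (4 * real CARD('n) * C0 * ((D1 / \<delta> * y * T\<^sup>2) powr (1/2) * (D2 / \<delta>) powr \<alpha>
     * ((D4 / \<delta> * T powr p) powr (1 - \<theta>) * (D3 / \<delta> ^ 3 * T powr p * y) powr (\<theta> * s / 2)) powr (1 / q)))"
     using pos D3 \<delta> T y by (simp add: epow_pos ennreal_mult[symmetric])
    also have "... = en (4 * real CARD('n) * C0 * (D * \<delta> powr (- a) * y powr \<gamma> * T\<^sup>2))"
     unfolding D_def a_def \<gamma>_def
     by (subst scaling_identity[OF pos(5,6) D3 pos(7) \<delta>(1) _ T(1) q0(1) \<theta>(3)]) (use y in auto)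
    also have "... = en (4 * real CARD('n) * C0 * D * \<delta> powr (- a) * y powr \<gamma>) * en (T\<^sup>2)"
     using pos by (simp add: ennreal_mult[symmetric] mult_ac)
    finally have "IE h c r * en (1 / T\<^sup>2) <= en (4 * real CARD('n) * C0 * D * \<delta> powr (- a) * y powr \<gamma>) * en (T\<^sup>2) * en (1 / T\<^sup>2)"
     by (rule mult_right_mono) simp
    also have "... = en (4 * real CARD('n) * C0 * D * \<delta> powr (- a) * y powr \<gamma>)"
     using T by (simp add: mult.assoc ennreal_mult[symmetric])
    finally show ?thesis by (simp add: h_def T_def)
   qed
   have "X r <= en (4 * real CARD('n) * C0 * D * \<delta> powr (- a) * y powr \<gamma>)"
    unfolding X_def[of r] by (intro SUP_least X)
   hence x: "enn2real (X r) <= 4 * real CARD('n) * C0 * D * \<delta> powr (- a) * y powr \<gamma>"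
    using pos by (intro enn2real_leI) auto
   have "1 = R powr a * R powr (- a)" using R by (simp add: powr_minus)
   also have "... <= R powr a * \<delta> powr (- a)" using \<delta> a0 R by (intro mult_left_mono powr_mono2') auto
   also have "... <= R powr a * \<delta> powr (- a) * y powr \<gamma>"
    using y \<gamma> ge_one_powr_ge_zero[of y \<gamma>] mult_left_mono[of 1 "y powr \<gamma>" "R powr a * \<delta> powr (- a)"] by simp
   finally show ?thesis using x unfolding Y_def[of r] C_def \<delta>_def[symmetric] y_def[symmetric] by (simp add: algebra_simps)
  qed
  have bd: "1 <= Y r \<and> Y r <= 1 + enn2real (en (M / \<epsilon>\<^sup>2))" if "R <= r" "r <= 2 * R" for r
   unfolding Y_def using XM[OF that(2)] by (auto intro!: enn2real_mono)
  have "Y R <= Bd" unfolding Bd_def by (rule iteration_bound[OF \<gamma> R C a0 stp bd])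
  hence "enn2real (X R) <= Bd" by (simp add: Y_def)
  hence "en (enn2real (X R) * (t + \<epsilon>)\<^sup>2) <= en (Bd * (t + \<epsilon>)\<^sup>2)" by (intro ennreal_leI mult_right_mono) auto
  thus ?thesis using XY[of R t] t R by (auto intro: order_trans)
 qed
 have "IE (t *\<^sub>R e) c R <= en (Bd * t\<^sup>2)" if t: "0 < t" "t <= R" for t
 proof (rule LIMSEQ_le_const)
  \<comment> \<open>The regularisation is removed along \<open>\<epsilon> = 1 / real (Suc k)\<close>
    with \<open>Bd\<close> fixed.\<close>
  have "(%k. Bd * (t + 1 / real (Suc k))\<^sup>2) ----> Bd * (t + 0)\<^sup>2"
   using LIMSEQ_inverse_real_of_nat by (intro tendsto_intros) (simp add: inverse_eq_divide)
  thus "(%k. en (Bd * (t + 1 / real (Suc k))\<^sup>2)) ----> en (Bd * t\<^sup>2)" by simp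
  show "\<exists>N. \<forall>k\<ge>N. IE (t *\<^sub>R e) c R <= en (Bd * (t + 1 / real (Suc k))\<^sup>2)" using main[OF t] by auto
 qed
 moreover have "0 <= Bd" by (simp add: Bd_def)
 ultimately show ?thesis by blast
qed

end

end

section \<open>From bounded difference quotients to integrable gradients\<close>

lemma conv_moll_cong:
 assumes "!!y. norm (x - y) <= 1 / real (Suc k) ==> f y = g y"
 shows "mconv k f x = mconv k g x"
proof -
 have "moll k (x - y) *\<^sub>R f y = moll k (x - y) *\<^sub>R g y" for y
  using assms[of y] moll_support[of k "x - y"] by (cases "moll k (x - y) = 0") auto
 thus ?thesis by (simp only: conv_def)
qed

text \<open>Two applications of Fatou's lemma take the place of weak compactness. At a fixed
  mollification parameter Jensen's inequality carries the bound over to the mollified quotients,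
  whose limit in \<open>t\<close> is classical; afterwards the mollification is removed. The halved
  cube leaves room for the mollification radius.\<close>

lemma difference_quotient_limit:
 fixes u :: "real^'n => real^'N" and e :: "real^'n"
 assumes w: "wgrad S u G" and S: "cube c r <= S" and r: "0 < r" and m: "1 <= m" and t0: "0 < t0"
  and le: "!!t. 0 < t ==> t <= t0 ==>
   (NBINT x. ind (cube c r) x * np ((1 / t) *\<^sub>R (u (x + t *\<^sub>R e) - u x)) m) <= E"
 shows "(NBINT x. ind (cube c (r / 2)) x * np (G x *v e) m) <= E"
proof -
 note wD = wgradD[OF w]
 have u: "lintegrable u" and G: "lintegrable G" using wD by auto
 have [measurable]: "u : borelfun" "G : borelfun" using wD by auto
 have vm [measurable]: "(%M :: real^'n^'N. M *v e) : borelfun"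
  unfolding matrix_vector_mult_def by (intro borel_measurable_continuous_onI continuous_intros)
 let ?i = "%x. ind (cube c (r / 2)) x :: ennreal"
 have smooth: "(NBINT x. ?i x * np (mconv k G x *v e) m) <= E"
  if k: "1 / real (Suc k) <= r / 2" for k
 proof -
  let ?u = "mconv k u"
  define t where "t i = t0 / real (Suc i)" for i
  have t: "0 < t i" "t i <= t0" for i using t0 by (auto simp: t_def field_simps)
  define q where "q i x = (1 / t i) *\<^sub>R (?u (x + t i *\<^sub>R e) - ?u x)" for i x
  have [measurable]: "q i : borelfun" for i unfolding q_def using u by measurable
  have qE: "(NBINT x. ?i x * np (q i x) m) <= E" for i
  proof -
   let ?f = "%x. (1 / t i) *\<^sub>R (u (x + t i *\<^sub>R e) - u x)"
   \<comment> \<open>Jensen's inequality is global, so the quotient is cut off outside the cube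
     where its bound is known; on the half cube its mollification is unchanged.\<close>
   let ?g = "%x. ind (cube c r) x *\<^sub>R ?f x"
   have us: "lintegrable (%x. u (x + t i *\<^sub>R e))" using u lborel_integral_shift(2)[of u] by simp
   hence f: "lintegrable ?f" using u by auto
   hence g: "lintegrable ?g" by (rule integrable_mult_indicator[rotated]) simp
   have "q i x = mconv k ?g x" if x: "x : cube c (r / 2)" for x
   proof -
    note ci = conv_integrable[OF moll_tests[of k], where x=x]
    have "?u (x + t i *\<^sub>R e) = (LBINT y. moll k (x - y) *\<^sub>R u (y + t i *\<^sub>R e))"
     unfolding conv_def using lborel_integral_shift(1)[of "%y. moll k (x + t i *\<^sub>R e - y) *\<^sub>R u y" "t i *\<^sub>R e"]
      tests_borel[OF moll_tests[where 'a="real^'n"], of k] by simp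
    hence "?u (x + t i *\<^sub>R e) - ?u x = (LBINT y. moll k (x - y) *\<^sub>R (u (y + t i *\<^sub>R e) - u y))"
     unfolding conv_def scaleR_diff_right using ci[OF us] ci[OF u] by simp
    hence "q i x = (LBINT y. (1 / t i) *\<^sub>R (moll k (x - y) *\<^sub>R (u (y + t i *\<^sub>R e) - u y)))"
     by (simp only: q_def integral_scaleR_right)
    also have "... = mconv k ?f x" by (simp add: conv_def mult.commute)
    also have "... = mconv k ?g x"
    proof (rule conv_moll_cong)
     fix y assume "norm (x - y) <= 1 / real (Suc k)"
     hence "norm (y - x) <= r / 2" using k by (simp only: norm_minus_commute[of y x])
     from cube_shift[OF x this] show "?f y = ?g y" by simp
    qed
    finally show ?thesis .
   qed
   hence "(NBINT x. ?i x * np (q i x) m) <= (NBINT x. np (mconv k ?g x) m)"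
    by (intro nn_integral_mono) (auto simp: indicator_def)
   also have "... <= (NBINT x. np (?g x) m)" by (rule conv_Jensen[OF g m])
   also have "... = (NBINT x. ind (cube c r) x * np (?f x) m)"
    using m by (intro nn_integral_cong) (auto simp: indicator_def)
   also have "... <= E" by (rule le[OF t])
   finally show ?thesis .
  qed
  have lim: "(%i. ?i x * np (q i x) m) ----> ?i x * np (mconv k G x *v e) m" for x
  proof (cases "x : cube c (r / 2)")
   case True
   have "cball x (1 / real (Suc k)) <= S"
    using cube_shift_cball[OF True, of 0 0 "1 / real (Suc k)"] cube_mono[of "r / 2 + 1 / real (Suc k)" r c] S k by force
   hence "(?u has_derivative (%v. mconv k G x *v v)) (at (x + 0 *\<^sub>R e))" using conv_moll_wgrad[OF w] by simp
   hence "((%s. ?u (x + s *\<^sub>R e)) has_derivative (%s. mconv k G x *v (s *\<^sub>R e))) (at 0)"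
    by (rule has_derivative_compose[rotated]) (auto intro!: derivative_eq_intros)
   hence d0: "((%s. norm (?u (x + s *\<^sub>R e) - ?u x - s *\<^sub>R (mconv k G x *v e)) / norm s) \<longlongrightarrow> 0) (at 0)"
    unfolding has_derivative_at by (simp add: matrix_vector_mult_scaleR)
   have "((%s. norm ((1 / s) *\<^sub>R (?u (x + s *\<^sub>R e) - ?u x) - mconv k G x *v e)) \<longlongrightarrow> 0) (at 0)"
   proof (rule Lim_transform_eventually[OF d0])
    have "norm (?u (x + s *\<^sub>R e) - ?u x - s *\<^sub>R (mconv k G x *v e)) / norm s
     = norm ((1 / s) *\<^sub>R (?u (x + s *\<^sub>R e) - ?u x) - mconv k G x *v e)" if "s ~= 0" for s
    proof -
     have "(1 / s) *\<^sub>R (?u (x + s *\<^sub>R e) - ?u x) - mconv k G x *v e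
      = (1 / s) *\<^sub>R (?u (x + s *\<^sub>R e) - ?u x - s *\<^sub>R (mconv k G x *v e))"
      using that by (simp add: scaleR_diff_right)
     thus ?thesis by simp
    qed
    thus "\<forall>\<^sub>F s in at 0. norm (?u (x + s *\<^sub>R e) - ?u x - s *\<^sub>R (mconv k G x *v e)) / norm s
     = norm ((1 / s) *\<^sub>R (?u (x + s *\<^sub>R e) - ?u x) - mconv k G x *v e)"
     by (auto simp: eventually_at_filter)
   qed
   hence "((%s. (1 / s) *\<^sub>R (?u (x + s *\<^sub>R e) - ?u x)) \<longlongrightarrow> mconv k G x *v e) (at 0)"
    by (rule Lim_null[THEN iffD2, OF tendsto_norm_zero_cancel])
   moreover have "filterlim t (at 0) sequentially"
   proof -
    have "(%i. t0 * inverse (real (Suc i))) ----> t0 * 0" by (intro tendsto_intros LIMSEQ_inverse_real_of_nat)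
    thus ?thesis unfolding filterlim_at using t(1) by (auto simp: t_def[abs_def] divide_inverse less_imp_neq[symmetric])
   qed
   ultimately have "(%i. q i x) ----> mconv k G x *v e" unfolding q_def by (rule filterlim_compose)
   hence "(%i. norm (q i x) powr m) ----> norm (mconv k G x *v e) powr m" using m by (intro tendsto_powr2 tendsto_norm tendsto_const) auto
   thus ?thesis using True by (simp add: tendsto_ennrealI)
  qed simp
  have "(NBINT x. ?i x * np (mconv k G x *v e) m) = (NBINT x. liminf (%i. ?i x * np (q i x) m))"
   using lim by (intro nn_integral_cong lim_imp_Liminf[symmetric]) auto
  also have "... <= liminf (%i. (NBINT x. ?i x * np (q i x) m))" by (rule nn_integral_liminf) measurable
  also have "... <= liminf (%i::nat. E)" by (intro Liminf_mono always_eventually allI qE)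
  finally show ?thesis by (simp add: Liminf_const)
 qed
 obtain k0 where k0: "1 / real (Suc k0) <= r / 2" using nat_approx_posE[of "r / 2"] r by (auto intro: less_imp_le)
 have sm: "strict_mono (%k. k + k0)" by (simp add: strict_mono_def)
 obtain s where s: "strict_mono s" "AE x in lborel. (%k. mconv (s k + k0) G x) ----> G x"
  using conv_AE_subseq[OF G sm] by blast
 let ?G = "%k. mconv (s k + k0) G"
 have Gm [measurable]: "?G k : borelfun" for k using G by (rule conv_borel)
 have "1 / real (Suc (j + k0)) <= 1 / real (Suc k0)" for j by (simp add: frac_le)
 hence E: "(NBINT x. ?i x * np (?G k x *v e) m) <= E" for k
  using k0 by (intro smooth) (meson order_trans)
 have "(NBINT x. ?i x * np (G x *v e) m) <= (NBINT x. liminf (%k. ?i x * np (?G k x *v e) m))"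
 proof (rule nn_integral_mono_AE, rule AE_mp[OF s(2)], intro AE_I2 impI)
  fix x assume "(%k. ?G k x) ----> G x"
  hence "(%k. norm (?G k x *v e) powr m) ----> norm (G x *v e) powr m"
   using m unfolding matrix_vector_mult_def by (intro tendsto_powr2 tendsto_norm tendsto_const tendsto_vec_lambda tendsto_sum tendsto_mult tendsto_vec_nth) auto
  hence "(%k. ?i x * np (?G k x *v e) m) ----> ?i x * np (G x *v e) m"
   by (cases "x : cube c (r / 2)") (auto intro: tendsto_ennrealI)
  thus "?i x * np (G x *v e) m <= liminf (%k. ?i x * np (?G k x *v e) m)"
   by (simp add: lim_imp_Liminf)
 qed
 also have "... <= liminf (%k. (NBINT x. ?i x * np (?G k x *v e) m))"
  by (rule nn_integral_liminf) measurable
 also have "... <= liminf (%k::nat. E)" by (intro Liminf_mono always_eventually allI E)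
 finally show ?thesis by (simp add: Liminf_const)
qed

lemma norm_matrix_le_columns: "norm (A :: real^'n^'N) <= (\<Sum>j\<in>UNIV. norm (A *v axis j 1))"
proof -
 have A: "A = (\<Sum>j\<in>UNIV. outer (A *v axis j 1) (axis j 1))"
  by (simp add: vec_eq_iff outer_def matrix_mult_axis) (simp add: axis_def if_distrib cong: if_cong)
 have "norm A = norm (\<Sum>j\<in>UNIV. outer (A *v axis j 1) (axis j 1))" by (rule arg_cong[OF A])
 also have "... <= (\<Sum>j\<in>UNIV. norm (outer (A *v axis j 1) (axis j 1 :: real^'n)))" by (rule norm_sum)
 finally show ?thesis by (simp add: norm_outer)
qed

context local_min
begin

text \<open>The quadratic bound on the excess makes the energy of the finite difference of order
  \<open>t powr p\<close>, and the n-dimensional Sobolev inequality turns this into difference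
  quotients bounded with exponent \<open>p * s' / 2\<close>. Here \<open>s\<close> belongs to
  hyperplanes and enters through the absorption, while \<open>s'\<close> belongs to the full
  space.\<close>

lemma higher_integrability:
 assumes s: "2 <= s" "(real CARD('n) - 3) * s <= 2 * (real CARD('n) - 1)" "2 <= CARD('n)"
  and \<theta>: "0 <= \<theta>" "\<theta> < 1" "q = (1 - \<theta>) * p + \<theta> * (p * s / 2)"
  and R: "0 < R" and cS: "cube c (4 * R) <= S"
  and s': "2 <= s'" "(real CARD('n) - 2) * s' <= 2 * real CARD('n)"
 shows "(NBINT x. ind (cube c (R / 4)) x * np (Z x) (p * s' / 2)) < \<infinity>"
proof -
 let ?m = "p * s' / 2"
 have m1: "1 <= ?m" using p2 s'(1) mult_mono[of 2 p 2 s'] by simp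
 have col: "(NBINT x. ind (cube c (R / 4)) x * np (Z x *v e) ?m) < \<infinity>" if e: "norm e = 1" for e
 proof -
  obtain C where C: "0 <= C" "!!t. 0 < t ==> t <= R ==> IE (t *\<^sub>R e) c R <= en (C * t\<^sup>2)"
   using excess_quadratic[OF s \<theta> R cS e] by blast
  define mZ where "mZ = enn2real MZ"
  have "MZ < \<infinity>" unfolding MZ_def using Zp by (simp add: nn_integral_eq_integral)
  hence MZ: "MZ = en mZ" "0 <= mZ" by (auto simp: mZ_def)
  define C2 where "C2 = 3 * 2 powr (p - 2) / cA"
  define CG where "CG = (s' + 2)\<^sup>2 * p\<^sup>2 / 8 * (2 + 8 * (real CARD('n))\<^sup>2 / (R - R / 2)\<^sup>2)"
  define A where "A = CG * (mZ + C2 * C)"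
  have pos: "0 <= C2" "0 <= CG" "0 <= A" using cA_pos C MZ by (auto simp: C2_def CG_def A_def)
  have le: "(NBINT x. ind (cube c (R / 2)) x * np ((1 / t) *\<^sub>R (u (x + t *\<^sub>R e) - u x)) ?m)
   <= en (A powr (s' / 2))" if t: "0 < t" "t <= R" for t
  proof -
   define h where "h = t *\<^sub>R e"
   have h: "norm h = t" "h ~= 0" using t e by (auto simp: h_def)
   have R4: "R + norm h < 4 * R" using R t h by simp
   have "EN h c R <= en (t powr p) * MZ + en (t powr (p - 2)) * (en C2 * en (C * t\<^sup>2))"
    unfolding C2_def
   proof (subst (1 2) h(1)[symmetric], rule energy_le[OF cS R4 h(2)])
    fix \<tau> :: real assume \<tau>: "0 < \<tau>" "\<tau> <= 1"
    have \<tau>t: "0 < \<tau> * t" "\<tau> * t <= t" using \<tau> t by (auto simp: mult_left_le_one_le)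
    have "IE (\<tau> *\<^sub>R h) c R <= en (C * (\<tau> * t)\<^sup>2)" using C(2)[OF \<tau>t(1) order_trans[OF \<tau>t(2) t(2)]] by (simp add: h_def)
    also have "... <= en (C * t\<^sup>2)" using \<tau>t C by (intro ennreal_leI mult_left_mono power_mono) auto
    finally show "IE (\<tau> *\<^sub>R h) c R <= en (C * t\<^sup>2)" .
   qed
   also have "... = en (t powr p * mZ + t powr (p - 2) * (C2 * (C * t\<^sup>2)))"
    using pos C(1) MZ by (simp add: ennreal_mult[symmetric] ennreal_plus[symmetric] del: ennreal_plus)
   also have "t powr p * mZ + t powr (p - 2) * (C2 * (C * t\<^sup>2)) = t powr p * (mZ + C2 * C)"
   proof -
    have "t powr (p - 2) * t\<^sup>2 = t powr p" using t by (simp add: powr_diff)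
    thus ?thesis by (simp add: algebra_simps)
   qed
   finally have E: "EN h c R <= en (t powr p * (mZ + C2 * C))" .
   have sh: "cube c R <= S" "(%x. x + h) ` cube c R <= S"
    using cS cube_mono[of R "4 * R" c] cube_mono[of "R + t" "4 * R" c] cube_shift[of _ c R h t] h R t by auto
   have s3: "(real CARD('n) - 3) * s' <= 2 * (real CARD('n) - 1)" using s' by (simp add: algebra_simps)
   let ?I = "(NBINT x. ind (cube c (R / 2)) x * np (du h x) ?m)"
   have "epow ?I (2 / s') <= en CG * EN h c R"
    unfolding CG_def by (rule slice_energy(2)[OF s'(1) s3 s(3) _ _ sh s'(2)]) (use R in auto)
   also have "... <= en CG * en (t powr p * (mZ + C2 * C))" using E by (rule mult_left_mono) simp
   also have "... = en (A * t powr p)" using pos C MZ by (simp add: ennreal_mult[symmetric] A_def mult_ac)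
   finally have "epow (epow ?I (2 / s')) (s' / 2) <= epow (en (A * t powr p)) (s' / 2)" using s' by (intro epow_mono) auto
   hence I: "?I <= en (A powr (s' / 2) * t powr ?m)"
    using s' pos by (simp add: epow_epow epow_ennreal powr_mult powr_powr)
   have "(NBINT x. ind (cube c (R / 2)) x * np ((1 / t) *\<^sub>R (u (x + t *\<^sub>R e) - u x)) ?m)
    = (NBINT x. en (t powr (- ?m)) * (ind (cube c (R / 2)) x * np (du h x) ?m))"
    using t by (intro nn_integral_cong) (auto simp: du_def h_def powr_divide powr_minus_divide indicator_def ennreal_mult[symmetric])
   also have "... = en (t powr (- ?m)) * ?I" by (rule nn_integral_cmult) measurable
   also have "... <= en (t powr (- ?m)) * en (A powr (s' / 2) * t powr ?m)" using I by (rule mult_left_mono) simp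
   also have "... = en (A powr (s' / 2))" using t by (simp add: ennreal_mult[symmetric] powr_minus)
   finally show ?thesis .
  qed
  have "cube c (R / 2) <= S" using cS cube_mono[of "R / 2" "4 * R" c] R by auto
  hence "(NBINT x. ind (cube c (R / 2 / 2)) x * np (Z x *v e) ?m) <= en (A powr (s' / 2))"
   using R m1 by (intro difference_quotient_limit[OF wg _ _ _ R le]) auto
  thus ?thesis by (simp add: order_le_less_trans)
 qed
 have "norm (Z x) powr ?m <= real CARD('n) powr ?m * (\<Sum>j\<in>UNIV. norm (Z x *v axis j 1) powr ?m)" for x
 proof -
  \<comment> \<open>The bounds in the coordinate directions are combined through the largest
    column.\<close>
  obtain j :: 'n where j: "!!i. norm (Z x *v axis i 1) <= norm (Z x *v axis j 1)"
   using finite_has_maximal[of "range (%i. norm (Z x *v axis i 1))"] by (auto simp: not_less) (metis linorder_linear)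
  have "norm (Z x) <= (\<Sum>i\<in>(UNIV::'n set). norm (Z x *v axis j 1))"
   by (rule order_trans[OF norm_matrix_le_columns sum_mono[OF j]])
  hence "norm (Z x) powr ?m <= (real CARD('n) * norm (Z x *v axis j 1)) powr ?m" using m1 by (intro powr_mono2) auto
  also have "... = real CARD('n) powr ?m * norm (Z x *v axis j 1) powr ?m" by (simp add: powr_mult)
  also have "... <= real CARD('n) powr ?m * (\<Sum>j\<in>UNIV. norm (Z x *v axis j 1) powr ?m)"
   by (intro mult_left_mono member_le_sum[where f="%j. norm (Z x *v axis j 1) powr ?m"]) auto
  finally show ?thesis .
 qed
 hence "(NBINT x. ind (cube c (R / 4)) x * np (Z x) ?m)
  <= (NBINT x. en (real CARD('n) powr ?m) * (\<Sum>j\<in>UNIV. ind (cube c (R / 4)) x * np (Z x *v axis j 1) ?m))"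
  by (intro nn_integral_mono) (auto simp: indicator_def sum_ennreal ennreal_mult[symmetric] sum_nonneg ennreal_leI)
 also have "... = en (real CARD('n) powr ?m) * (\<Sum>j\<in>UNIV. (NBINT x. ind (cube c (R / 4)) x * np (Z x *v axis j 1) ?m))"
 proof -
  have [measurable]: "(%M :: real^'n^'N. M *v e) : borelfun" for e
   unfolding matrix_vector_mult_def by (intro borel_measurable_continuous_onI continuous_intros)
  show ?thesis by (subst nn_integral_cmult, measurable, subst nn_integral_sum) auto
 qed
 also have "... < \<infinity>" using col[of "axis _ 1"] by (auto simp: ennreal_mult_less_top)
 finally show ?thesis .
qed

end

section \<open>Borel representatives\<close>

lemma borel_lebesgue_on: "f : borelfun ==> f : borel_measurable (lebesgue_on A)"
 by (intro measurable_restrict_space1 measurable_completion) simp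

lemma borel_rep:
 fixes f :: "'a::euclidean_space => 'b::euclidean_space"
 assumes f: "f : borel_measurable (lebesgue_on A)" and A: "A : sets borel"
 obtains g where "g : borelfun" "AE x in lborel. g x = ind A x *\<^sub>R f x"
proof -
 have m: "(%x. ind A x *\<^sub>R f x) : borel_measurable (completion lborel)"
  using f A by (subst borel_measurable_restrict_space_iff[symmetric]) auto
 have "\<exists>g. g : borel_measurable lborel \<and> (AE x in lborel. (ind A x *\<^sub>R f x) \<bullet> b = g x)" for b
  using completion_ex_borel_measurable_real[OF borel_measurable_inner[OF m borel_measurable_const], of b] by blast
 then obtain g where g: "!!b. g b : borel_measurable lborel" "!!b. AE x in lborel. (ind A x *\<^sub>R f x) \<bullet> b = g b x" by metis
 show thesis
 proof (rule that[of "%x. \<Sum>b\<in>Basis. g b x *\<^sub>R b"])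
  have [measurable]: "g b : borelfun" for b using g(1)[of b] by simp
  show "(%x. \<Sum>b\<in>Basis. g b x *\<^sub>R b) : borelfun" by measurable
  have "AE x in lborel. \<forall>b\<in>Basis. (ind A x *\<^sub>R f x) \<bullet> b = g b x" using g(2) by (simp add: AE_finite_all)
  thus "AE x in lborel. (\<Sum>b\<in>Basis. g b x *\<^sub>R b) = ind A x *\<^sub>R f x"
   by eventually_elim (metis (no_types, lifting) euclidean_representation sum.cong)
 qed
qed

text \<open>Bridge from the completed measure restricted to \<open>A\<close>, in which the spaces
  are defined, to \<open>lborel\<close>, in which the estimates are made.\<close>

lemma lebesgue_on_rep:
 fixes f :: "'a::euclidean_space => 'b::euclidean_space"
 assumes f: "f : borel_measurable (lebesgue_on A)" and A: "A : sets borel"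
  and g: "g : borelfun" "AE x in lborel. g x = ind A x *\<^sub>R f x"
 shows "integrable (lebesgue_on A) f \<longleftrightarrow> lintegrable g" "integral\<^sup>L (lebesgue_on A) f = integral\<^sup>L lborel g"
proof -
 have m: "(%x. ind A x *\<^sub>R f x) : borel_measurable lebesgue"
  using f A by (subst borel_measurable_restrict_space_iff[symmetric]) auto
 have g': "g : borel_measurable lborel" "g : borel_measurable lebesgue" using g(1) by (auto intro: measurable_completion)
 have ae: "AE x in lebesgue. ind A x *\<^sub>R f x = g x" using g(2) by (auto simp: AE_completion_iff)
 have A': "A \<inter> space lebesgue : sets lebesgue" using A by auto
 show "integrable (lebesgue_on A) f \<longleftrightarrow> lintegrable g"
  unfolding integrable_restrict_space[OF A'] integrable_completion[OF g'(1), symmetric] by (rule integrable_cong_AE[OF m g'(2) ae])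
 show "integral\<^sup>L (lebesgue_on A) f = integral\<^sup>L lborel g"
  unfolding integral_restrict_space[OF A'] integral_completion[OF g'(1), symmetric] by (rule integral_cong_AE[OF m g'(2) ae])
qed

lemma lebesgue_on_zero_outside:
 fixes f :: "'a::euclidean_space => 'b::euclidean_space"
 assumes "A : sets borel" "B : sets borel" "A <= B" "!!x. x \<notin> A ==> f x = 0"
 shows "integral\<^sup>L (lebesgue_on B) f = integral\<^sup>L (lebesgue_on A) f"
 using assms by (subst (1 2) integral_restrict_space) (auto simp: indicator_def intro!: Bochner_Integration.integral_cong)

lemma nn_integral_lebesgue_on:
 "A : sets borel ==> (\<integral>\<^sup>+x. f x \<partial>lebesgue_on A) = (NBINT x. ind A x * f x)"
 by (subst nn_integral_restrict_space) (auto simp: nn_integral_completion mult.commute)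

lemma Lp_iff:
 fixes f :: "'a::euclidean_space => 'b::euclidean_space"
 assumes A: "A : sets borel"
 shows "f : Lp p A \<longleftrightarrow> f : borel_measurable (lebesgue_on A) \<and> (NBINT x. ind A x * np (f x) p) < \<infinity>"
 unfolding Lp_def integrable_iff_bounded nn_integral_lebesgue_on[OF A] by (auto simp: abs_of_nonneg)

text \<open>Lindelof's theorem reduces the cover to countably many open sets, so the exceptional
  sets have a null union.\<close>

lemma AE_local:
 fixes A :: "'a::euclidean_space set"
 assumes "!!x. x : A ==> \<exists>B. open B \<and> x : B \<and> (AE y\<in>B in lborel. P y)"
 shows "AE y\<in>A in lborel. P y"
proof -
 let ?F = "{B. open B \<and> (AE y\<in>B in lborel. P y)}"
 obtain F where F: "F <= ?F" "countable F" "\<Union>F = \<Union>?F" using Lindelof[of ?F] by blast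
 have "AE y in lborel. \<forall>B\<in>F. y : B --> P y" using F(1,2) by (subst AE_ball_countable) auto
 thus ?thesis
 proof eventually_elim
  case (elim y)
  show ?case
  proof
   assume "y : A"
   hence "y : \<Union>?F" using assms by blast
   thus "P y" using elim F(3) by blast
  qed
 qed
qed

lemma lebesgue_on_test:
 assumes f: "f : borel_measurable (lebesgue_on A)" "f0 : borelfun" "AE x\<in>A in lborel. f0 x = (f x :: real)"
  and \<psi>: "\<psi> : test_functions A" and A: "open A" "open B" "A <= B"
 shows "(LINT x|lebesgue_on B. f x * \<psi> x) = (LBINT x. f0 x * \<psi> x)"
proof -
 have \<psi>0: "\<psi> x = 0" if "x \<notin> A" for x using \<psi> that closure_subset[of "{x. \<psi> x ~= 0}"] by (auto simp: test_functions_def)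
 have \<psi>m [measurable]: "\<psi> : borelfun" by (rule tests_borel[OF test_functions_UNIV[OF \<psi>]])
 have fm: "(%x. f x * \<psi> x) : borel_measurable (lebesgue_on A)" using f(1) borel_lebesgue_on[OF \<psi>m] by (rule borel_measurable_times)
 have "(LINT x|lebesgue_on B. f x * \<psi> x) = (LINT x|lebesgue_on A. f x * \<psi> x)"
  using A \<psi>0 by (intro lebesgue_on_zero_outside) auto
 also have "... = (LBINT x. f0 x * \<psi> x)"
 proof (rule lebesgue_on_rep(2)[OF fm])
  show "AE x in lborel. f0 x * \<psi> x = ind A x *\<^sub>R (f x * \<psi> x)"
   using f(3) by eventually_elim (auto simp: indicator_def \<psi>0)
 qed (use f(2) A in auto)
 finally show ?thesis .
qed

text \<open>Compact containment makes \<open>u\<close> and \<open>G\<close> integrable on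
  \<open>A\<close>, so their extensions by zero are globally integrable; for test functions
  supported in \<open>A\<close> the integrals over \<Omega> and over the whole space agree.\<close>

lemma has_weak_grad_wgrad:
 fixes u :: "real^'n => real^'N"
 assumes h: "has_weak_grad \<Omega> u G" and \<Omega>: "open \<Omega>" and A: "open A" "A \<Subset> \<Omega>"
  and u0: "u0 : borelfun" "AE x in lborel. u0 x = ind A x *\<^sub>R u x"
  and G0: "G0 : borelfun" "AE x in lborel. G0 x = ind A x *\<^sub>R G x"
 shows "wgrad A u0 G0"
proof -
 have AO: "A <= \<Omega>" using A closure_subset[of A] by (auto simp: compactly_in_def)
 have [measurable]: "A : sets borel" "\<Omega> : sets borel" using A \<Omega> by auto
 have L: "u : Lp 1 A" "G : Lp 1 A" using h A by (auto simp: has_weak_grad_def Lp_loc_def)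
 have mu: "u : borel_measurable (lebesgue_on A)" "G : borel_measurable (lebesgue_on A)" using L by (auto simp: Lp_iff)
 have int: "lintegrable f0"
  if f: "f : Lp 1 A" "f0 : borelfun" "AE x in lborel. f0 x = ind A x *\<^sub>R f x" for f f0 :: "real^'n => 'c::euclidean_space"
 proof -
  have fm: "f : borel_measurable (lebesgue_on A)" and "integrable (lebesgue_on A) (%x. norm (f x) powr 1)"
   using f(1) by (auto simp: Lp_def)
  hence "integrable (lebesgue_on A) f" using integrable_norm_iff[OF fm] by simp
  thus ?thesis using lebesgue_on_rep(1)[OF fm _ f(2,3)] by simp
 qed
 have u0A: "AE x\<in>A in lborel. u0 x = u x" "AE x\<in>A in lborel. G0 x = G x"
  by (rule eventually_mono[OF u0(2)], simp) (rule eventually_mono[OF G0(2)], simp)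
 have um: "(%x. u x $ i) : borel_measurable (lebesgue_on A)" "(%x. u0 x $ i) : borelfun"
  "AE x\<in>A in lborel. u0 x $ i = u x $ i" for i
  using u0(1) u0A(1) mu(1) by (auto simp: component_eq_inner intro!: borel_measurable_inner elim!: eventually_mono)
 have Gm: "(%x. G x $ i $ j) : borel_measurable (lebesgue_on A)" "(%x. G0 x $ i $ j) : borelfun"
  "AE x\<in>A in lborel. G0 x $ i $ j = G x $ i $ j" for i j
  using G0(1) u0A(2) mu(2) by (auto simp: component2_eq_inner intro!: borel_measurable_inner elim!: eventually_mono)
 have "(LBINT x. u0 x $ i * pd \<phi> j x) = - (LBINT x. G0 x $ i $ j * \<phi> x)"
  if \<phi>: "\<phi> : test_functions A" for \<phi> i j
 proof -
  have "\<phi> : test_functions \<Omega>" using \<phi> test_functions_mono[OF AO] by auto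
  hence "(LINT x|lebesgue_on \<Omega>. u x $ i * pd \<phi> j x) = - (LINT x|lebesgue_on \<Omega>. G x $ i $ j * \<phi> x)"
   using h by (auto simp: has_weak_grad_def)
  thus ?thesis using lebesgue_on_test[OF um test_functions_derivative[OF \<phi>] A(1) \<Omega> AO] lebesgue_on_test[OF Gm \<phi> A(1) \<Omega> AO] by simp
 qed
 thus ?thesis using int[OF L(1) u0] int[OF L(2) G0] by (simp add: wgrad_def)
qed

lemma wgrad_has_weak_grad:
 fixes u :: "real^'n => real^'N"
 assumes w: "wgrad A u0 G0" and A: "open A"
  and u: "u : borel_measurable (lebesgue_on A)" "AE x\<in>A in lborel. u0 x = u x"
  and G: "G : borel_measurable (lebesgue_on A)" "AE x\<in>A in lborel. G0 x = G x"
 shows "has_weak_grad A u G"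
proof -
 note wD = wgradD[OF w]
 have [measurable]: "A : sets borel" using A by auto
 have L: "f : Lp_loc 1 A" if f: "f : borel_measurable (lebesgue_on A)" "lintegrable f0" "AE x\<in>A in lborel. f0 x = f x"
  for f f0 :: "real^'n => 'c::euclidean_space"
  unfolding Lp_loc_def
 proof safe
  fix B assume B: "open B" "B \<Subset> A"
  hence BA: "B <= A" using closure_subset[of B] by (auto simp: compactly_in_def)
  have "(NBINT x. ind B x * en (norm (f x))) <= (NBINT x. en (norm (f0 x)))"
   using f(3) BA by (intro nn_integral_mono_AE) (auto elim!: eventually_mono simp: indicator_def)
  also have "... < \<infinity>" using f(2) by (simp add: integrable_iff_bounded)
  finally show "f : Lp 1 B" using B BA f(1) by (auto simp: Lp_iff intro: measurable_restrict_mono)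
 qed
 have um: "(%x. u x $ i) : borel_measurable (lebesgue_on A)" "(%x. u0 x $ i) : borelfun"
  "AE x\<in>A in lborel. u0 x $ i = u x $ i" for i
  using u wD(3) by (auto simp: component_eq_inner intro!: borel_measurable_inner elim!: eventually_mono)
 have Gm: "(%x. G x $ i $ j) : borel_measurable (lebesgue_on A)" "(%x. G0 x $ i $ j) : borelfun"
  "AE x\<in>A in lborel. G0 x $ i $ j = G x $ i $ j" for i j
  using G wD(4) by (auto simp: component2_eq_inner intro!: borel_measurable_inner elim!: eventually_mono)
 show ?thesis unfolding has_weak_grad_def
  using L[OF u(1) wD(1) u(2)] L[OF G(1) wD(2) G(2)] lebesgue_on_test[OF um test_functions_derivative A A order_refl] lebesgue_on_test[OF Gm _ A A order_refl] wD(5) by simp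
qed

text \<open>\<open>weak_grad\<close> is an arbitrary choice, so its values are meaningful only
  through this uniqueness up to null sets. Locally the difference is a weak gradient of 0, and the
  fundamental lemma applies to each component.\<close>

lemma weak_grad_unique:
 fixes u :: "real^'n => real^'N"
 assumes G: "has_weak_grad A u G" and H: "has_weak_grad A u H" and A: "open A"
 shows "AE x\<in>A in lborel. G x = H x"
proof (rule AE_local)
 fix x assume "x : A"
 then obtain e where e: "0 < e" "cball x e <= A" using A open_contains_cball by blast
 define B where "B = ball x e"
 have B: "open B" "B \<Subset> A" "B : sets borel" using e by (auto simp: B_def compactly_in_def)
 have m: "u : borel_measurable (lebesgue_on B)" "G : borel_measurable (lebesgue_on B)" "H : borel_measurable (lebesgue_on B)"
  using G H B by (auto simp: has_weak_grad_def Lp_loc_def Lp_def)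
 obtain u0 where u0: "u0 : borelfun" "AE x in lborel. u0 x = ind B x *\<^sub>R u x" using borel_rep[OF m(1) B(3)] by blast
 obtain G0 where G0: "G0 : borelfun" "AE x in lborel. G0 x = ind B x *\<^sub>R G x" using borel_rep[OF m(2) B(3)] by blast
 obtain H0 where H0: "H0 : borelfun" "AE x in lborel. H0 x = ind B x *\<^sub>R H x" using borel_rep[OF m(3) B(3)] by blast
 have w: "wgrad B (%x. u0 x - u0 x) (%x. G0 x - H0 x)"
  by (intro wgrad_diff has_weak_grad_wgrad[OF G A B(1,2) u0 G0] has_weak_grad_wgrad[OF H A B(1,2) u0 H0])
 have "AE x\<in>B in lborel. (G0 x - H0 x) $ i $ j = 0" for i j
 proof (rule fundamental_lemma_variations[OF _ B(1)])
  show "lintegrable (%x. (G0 x - H0 x) $ i $ j)"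
   unfolding component2_eq_inner using wgradD(2)[OF w] by (rule integrable_inner_left)
 qed (use wgradD(5)[OF w] in simp)
 hence "AE x in lborel. \<forall>i j. x : B --> (G0 x - H0 x) $ i $ j = 0" by (intro AE_all_countable[THEN iffD2] allI) 
 with G0(2) H0(2) have "AE y\<in>B in lborel. G y = H y" by eventually_elim (auto simp: vec_eq_iff)
 thus "\<exists>B. open B \<and> x : B \<and> (AE y\<in>B in lborel. G y = H y)" using B(1) e(1) by (intro exI[of _ B]) (simp add: B_def)
qed

lemma weak_grad_AE:
 assumes "has_weak_grad A u G" "open A"
 shows "has_weak_grad A u (weak_grad A u)" "AE x\<in>A in lborel. weak_grad A u x = G x"
proof -
 show h: "has_weak_grad A u (weak_grad A u)" unfolding weak_grad_def using assms(1) by (rule someI[of "has_weak_grad A u"])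
 show "AE x\<in>A in lborel. weak_grad A u x = G x" by (rule weak_grad_unique[OF h assms])
qed

section \<open>From local minimizers to the abstract setting\<close>

lemma conv_Lp_subseq:
 fixes f :: "'a::euclidean_space => 'b::euclidean_space"
 assumes f: "lintegrable f" and p: "1 <= p" and fp: "lintegrable (%x. norm (f x) powr p)"
  and s: "AE x in lborel. (%k. mconv (s k) f x) ----> f x"
 shows "lintegrable (%x. norm (mconv k f x - f x) powr p)"
  "(%k. (LBINT x. norm (mconv (s k) f x - f x) powr p)) ----> 0"
proof -
 note [measurable] = conv_borel[OF f]
 have fm [measurable]: "f : borelfun" using f by auto
 let ?H = "%k x. 2 powr p * (norm (mconv (s k) f x) powr p + norm (f x) powr p)"
 let ?L = "%x. 2 powr p * (norm (f x) powr p + norm (f x) powr p)"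
 have J: "lintegrable (%x. norm (mconv k f x) powr p)" "(LBINT x. norm (mconv k f x) powr p) <= (LBINT x. norm (f x) powr p)" for k
  using integral_conv_Jensen[OF f p fp] by auto
 show "lintegrable (%x. norm (mconv k f x - f x) powr p)"
  using integrable_powr_add[OF J(1) fp[folded norm_minus_cancel[of "f _"]]] p by simp
 have b: "norm (mconv k f x - f x) powr p <= 2 powr p * (norm (mconv k f x) powr p + norm (f x) powr p)" for k x
  using norm_add_powr_le[of p "mconv k f x" "- f x"] p by simp
 have "(%k. (LBINT x. \<bar>norm (mconv (s k) f x - f x) powr p - 0\<bar>)) ----> 0"
 proof (rule generalized_dominated_convergence(3)[where H="?H" and ?H0.0="?L"])
  show "AE x in lborel. (%k. norm (mconv (s k) f x - f x) powr p) ----> 0"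
   using s
  proof eventually_elim
   case (elim x)
   hence "(%k. norm (mconv (s k) f x - f x)) ----> 0" by (intro tendsto_norm_zero) (simp add: LIM_zero)
   from tendsto_powr2[OF this tendsto_const, of p] show ?case using p by simp
  qed
  show "AE x in lborel. (%k. ?H k x) ----> ?L x"
   using s
  proof eventually_elim
   case (elim x)
   hence "(%k. norm (mconv (s k) f x) powr p) ----> norm (f x) powr p"
    using p by (intro tendsto_powr2 tendsto_norm tendsto_const) auto
   thus ?case by (rule tendsto_mult[OF tendsto_const tendsto_add[OF _ tendsto_const]])
  qed
  show "(LBINT x. ?H k x) <= (LBINT x. ?L x)" for k using J[of "s k"] fp by simp
 qed (use b J fp in auto)
 thus "(%k. (LBINT x. norm (mconv (s k) f x - f x) powr p)) ----> 0" by simp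
qed

lemma wgrad_conv_moll:
 fixes u :: "real^'n => real^'N"
 assumes w: "wgrad UNIV u G" and t: "mconv k u : tests"
 shows "wgrad UNIV (mconv k u) (mconv k G)"
proof -
 have "(\<chi> i j. pd (mconv k u) j x $ i) = mconv k G x" for x
 proof -
  have "frechet_derivative (mconv k u) (at x) = (%v. mconv k G x *v v)"
   using conv_moll_wgrad[OF w, of x k] frechet_derivative_at by (metis subset_UNIV)
  thus ?thesis by (simp add: vec_eq_iff matrix_mult_axis)
 qed
 thus ?thesis using wgrad_smooth[OF t] by simp
qed

text \<open>Mollifications at scales below the distance from \<open>K\<close> to the complement of
  \<open>A\<close> are test functions in \<open>A\<close>, and both they and their gradients
  converge in the p-norm. This makes the compactly supported competitors of the abstract setting
  elements of \<open>W1p_0\<close>.\<close>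

lemma wgrad_W1p_0:
 fixes \<Phi> :: "real^'n => real^'N"
 assumes w: "wgrad UNIV \<Phi> \<Psi>" and p: "1 <= p" and A: "open A" and K: "compact K" "K <= A"
  and z: "!!x. x \<notin> K ==> \<Phi> x = 0"
  and ip: "lintegrable (%x. norm (\<Phi> x) powr p)" "lintegrable (%x. norm (\<Psi> x) powr p)"
 shows "\<Phi> : W1p_0 p A"
proof -
 note wD = wgradD[OF w]
 have Ab: "A : sets borel" using A by auto
 have L: "f : Lp p A" if "f : borelfun" "lintegrable (%x. norm (f x) powr p)" for f :: "real^'n => 'c::euclidean_space"
 proof -
  have "(NBINT x. ind A x * np (f x) p) <= (NBINT x. en (norm (norm (f x) powr p)))"
   by (intro nn_integral_mono) (auto simp: indicator_def)
  also have "... < \<infinity>" using that(2) unfolding integrable_iff_bounded by blast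
  finally show ?thesis using that(1) Ab by (auto simp: Lp_iff intro: borel_lebesgue_on)
 qed
 have hw: "has_weak_grad A v H" if v: "wgrad UNIV v H" for v :: "real^'n => real^'N" and H
  using wgradD(3,4)[OF v] by (intro wgrad_has_weak_grad[OF wgrad_mono[OF v] A]) (auto intro: borel_lebesgue_on)
 have W: "\<Phi> : W1p p A" using L[OF wD(3) ip(1)] L[OF wD(4) ip(2)] hw[OF w] by (auto simp: W1p_def)
 obtain d where d: "0 < d" "!!x. x : K ==> cball x d <= A" using compact_in_open_cball[OF K(1) A K(2)] by blast
 obtain k0 where k0: "1 / real (Suc k0) <= d" using nat_approx_posE[OF d(1)] by (auto intro: less_imp_le)
 obtain r where r: "strict_mono r" "AE x in lborel. (%k. mconv (r k + k0) \<Phi> x) ----> \<Phi> x"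
  using conv_AE_subseq[OF wD(1), of "%k. k + k0"] by (auto simp: strict_mono_def)
 hence "strict_mono (%k. r k + k0)" by (simp add: strict_mono_def)
 then obtain s where s: "strict_mono s" "AE x in lborel. (%k. mconv (r (s k) + k0) \<Psi> x) ----> \<Psi> x"
  using conv_AE_subseq[OF wD(2), of "%k. r k + k0"] by blast
 \<comment> \<open>The offset \<open>k0\<close> keeps the supports of the mollifications in the
   compact set \<open>T\<close> inside \<open>A\<close>.\<close>
 define m where "m k = r (s k) + k0" for k
 have ae: "AE x in lborel. (%k. mconv (m k) \<Phi> x) ----> \<Phi> x" "AE x in lborel. (%k. mconv (m k) \<Psi> x) ----> \<Psi> x"
  using r(2) s by (auto simp: m_def o_def elim!: eventually_mono dest: LIMSEQ_subseq_LIMSEQ)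
 let ?\<psi> = "%k. mconv (m k) \<Phi>"
 define T where "T = {x + y | x y. x : K \<and> y : cball 0 d}"
 have T: "compact T" "T <= A"
 proof -
  show "compact T" unfolding T_def using K(1) compact_cball by (rule compact_sums)
  show "T <= A" using d(2) by (force simp: T_def dist_norm)
 qed
 have \<psi>T: "{x. ?\<psi> k x ~= 0} <= T" for k
 proof
  fix x assume "x : {x. ?\<psi> k x ~= 0}"
  then obtain y where y: "moll (m k) (x - y) ~= 0" "\<Phi> y ~= 0" using conv_eq_0[of "moll (m k)" x \<Phi>] by auto
  have "norm (x - y) <= 1 / real (Suc (m k))" using y(1) by (rule moll_support)
  also have "... <= 1 / real (Suc k0)" by (simp add: m_def frac_le)
  finally have "x = y + (x - y)" "x - y : cball 0 d" using k0 by (auto simp: dist_norm norm_minus_commute)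
  thus "x : T" using z y(2) unfolding T_def by blast
 qed
 have ck: "closure {x. ?\<psi> k x ~= 0} <= T" for k using \<psi>T closure_minimal compact_imp_closed[OF T(1)] by blast
 have cc: "compact (closure {x. ?\<psi> k x ~= 0})" for k
  using compact_Int_closed[OF T(1), of "closure {x. ?\<psi> k x ~= 0}"] ck[of k] by (simp add: Int_absorb1)
 have tA: "?\<psi> k : test_functions A" for k
  using C_k_conv[OF wD(1) moll_tests] cc ck[of k] T(2) by (auto simp: test_functions_def)
 have "(%k. W1p_norm p A (%x. ?\<psi> k x - \<Phi> x)) ----> 0"
 proof -
  let ?a = "%k. (LBINT x. norm (?\<psi> k x - \<Phi> x) powr p)" and ?b = "%k. (LBINT x. norm (mconv (m k) \<Psi> x - \<Psi> x) powr p)"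
  have sub: "(LINT x|lebesgue_on A. norm (f x) powr p) <= (LBINT x. norm (g x) powr p)"
   if g: "g : borelfun" "lintegrable (%x. norm (g x) powr p)" and f: "AE x\<in>A in lborel. f x = g x" for f g :: "real^'n => 'c::euclidean_space"
  proof -
   have "en (LINT x|lebesgue_on A. norm (f x) powr p) <= (\<integral>\<^sup>+x. np (f x) p \<partial>lebesgue_on A)"
   \<comment> \<open>A non-integrable integrand has Bochner integral 0, which satisfies the bound as
     well; this covers the unspecified representative \<open>weak_grad\<close>.\<close>
   proof (cases "integrable (lebesgue_on A) (%x. norm (f x) powr p)")
    case True
    thus ?thesis by (subst nn_integral_eq_integral) auto
   qed (simp add: not_integrable_integral_eq)
   also have "... <= (NBINT x. np (g x) p)"
    unfolding nn_integral_lebesgue_on[OF Ab] using f by (intro nn_integral_mono_AE) (auto elim!: eventually_mono simp: indicator_def)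
   also have "... = en (LBINT x. norm (g x) powr p)" using g(2) by (intro nn_integral_eq_integral) auto
   finally show ?thesis by simp
  qed
  have le: "0 <= W1p_norm p A (%x. ?\<psi> k x - \<Phi> x) \<and> W1p_norm p A (%x. ?\<psi> k x - \<Phi> x) <= (?a k + ?b k) powr (1 / p)" for k
  proof -
   have w': "wgrad UNIV (%x. ?\<psi> k x - \<Phi> x) (%x. mconv (m k) \<Psi> x - \<Psi> x)"
    by (intro wgrad_diff w wgrad_conv_moll test_functions_UNIV[OF tA])
   note wD' = wgradD[OF w']
   have "(LINT x|lebesgue_on A. norm (?\<psi> k x - \<Phi> x) powr p) <= ?a k"
    by (rule sub[OF wD'(3) conv_Lp_subseq(1)[OF wD(1) p ip(1) ae(1)]]) simp
   moreover have "(LINT x|lebesgue_on A. norm (weak_grad A (%x. ?\<psi> k x - \<Phi> x) x) powr p) <= ?b k"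
    by (rule sub[OF wD'(4) conv_Lp_subseq(1)[OF wD(2) p ip(2) ae(2)] weak_grad_AE(2)[OF hw[OF w'] A]])
   ultimately show ?thesis unfolding W1p_norm_def
    using p by (intro conjI powr_ge_zero powr_mono2 add_mono add_nonneg_nonneg integral_nonneg_AE) auto
  qed
  have "(%k. (?a k + ?b k) powr (1 / p)) ----> (0 + 0) powr (1 / p)"
  proof (rule tendsto_powr2[OF tendsto_add[OF conv_Lp_subseq(2)[OF wD(1) p ip(1) ae(1)] conv_Lp_subseq(2)[OF wD(2) p ip(2) ae(2)]] tendsto_const])
   show "\<forall>\<^sub>F k in sequentially. 0 <= ?a k + ?b k" by (simp add: integral_nonneg_AE)
  qed (use p in simp)
  hence lim: "(%k. (?a k + ?b k) powr (1 / p)) ----> 0" by (simp only: add_0_right powr_0)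
  show ?thesis by (rule tendsto_sandwich[OF _ _ tendsto_const lim]) (rule always_eventually, use le in blast)+
 qed
 thus ?thesis using W tA unfolding W1p_0_def by (intro CollectI conjI exI[of _ ?\<psi>]) auto
qed

text \<open>The energy uses a weak gradient chosen separately for every map and every domain.
  Uniqueness up to null sets identifies these choices with the fixed Borel representative
  \<open>Z0\<close>, and with \<open>Z0 + \<Psi>\<close> for the competitors.\<close>

lemma local_minimizer_local_min:
 fixes u :: "real^'n => real^'N" and F :: "real^'n^'N => real"
 assumes st: "structural p q L \<mu> F" and p2: "2 <= p" and pq: "p <= q"
  and m: "local_minimizer p F \<Omega> u" and \<Omega>: "open \<Omega>" and A: "open A" "A \<Subset> \<Omega>"
 obtains u0 Z0 where "local_min p q L \<mu> F A u0 Z0" "AE x\<in>A in lborel. u0 x = u x"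
  "AE x\<in>A in lborel. Z0 x = weak_grad \<Omega> u x"
proof -
 interpret pq_integrand p q L \<mu> F using st p2 pq by unfold_locales
 have AO: "A <= \<Omega>" using A closure_subset[of A] by (auto simp: compactly_in_def)
 have Ab [measurable]: "A : sets borel" using A by auto
 have [measurable]: "F : borelfun" by (rule borel_measurable_continuous_onI[OF continuous_F])
 obtain G where "u : Lp_loc p \<Omega>" "G : Lp_loc p \<Omega>" and G: "has_weak_grad \<Omega> u G"
  using m by (auto simp: local_minimizer_def W1p_loc_def)
 hence Lp: "u : Lp p A" "G : Lp p A" using A by (auto simp: Lp_loc_def)
 hence mu: "u : borel_measurable (lebesgue_on A)" "G : borel_measurable (lebesgue_on A)" by (auto simp: Lp_def)
 obtain u0 where u0: "u0 : borelfun" "AE x in lborel. u0 x = ind A x *\<^sub>R u x" using borel_rep[OF mu(1) Ab] by blast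
 obtain Z0 where Z0: "Z0 : borelfun" "AE x in lborel. Z0 x = ind A x *\<^sub>R G x" using borel_rep[OF mu(2) Ab] by blast
 note [measurable] = u0(1) Z0(1)
 have w: "wgrad A u0 Z0" by (rule has_weak_grad_wgrad[OF G \<Omega> A u0 Z0])
 have uA: "AE x\<in>A in lborel. u0 x = u x" using u0(2) by eventually_elim simp
 have ZA: "AE x\<in>A in lborel. Z0 x = G x" using Z0(2) by eventually_elim simp
 have ip: "lintegrable (%x. norm (f0 x) powr p)"
  if f: "f : Lp p A" "f0 : borelfun" "AE x in lborel. f0 x = ind A x *\<^sub>R f x" for f f0 :: "real^'n => 'c::euclidean_space"
 proof (rule integrableI_bounded)
  have "(NBINT x. en (norm (norm (f0 x) powr p))) = (NBINT x. ind A x * np (f x) p)"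
   using f(3) p2 by (intro nn_integral_cong_AE) (auto elim!: eventually_mono simp: indicator_def)
  thus "(NBINT x. en (norm (norm (f0 x) powr p))) < \<infinity>" using f(1) by (simp add: Lp_iff)
 qed (use f(2) in measurable)
 have en: "energy F v A = (NBINT x. en (ind A x * F (H x)))"
  if "has_weak_grad A v V" "AE x\<in>A in lborel. H x = V x" for v V H
  unfolding energy_def nn_integral_lebesgue_on[OF Ab]
 proof (rule nn_integral_cong_AE)
  show "AE x in lborel. ind A x * en (F (weak_grad A v x)) = en (ind A x * F (H x))"
   using weak_grad_AE(2)[OF that(1) A(1)] that(2) by eventually_elim (auto simp: indicator_def)
 qed
 have min: "energy F u A < \<infinity>" "!!\<phi>. \<phi> : W1p_0 p A ==> energy F u A <= energy F (%x. u x + \<phi> x) A"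
  using m A by (auto simp: local_minimizer_def)
 note enu = en[OF wgrad_has_weak_grad[OF w A(1) mu(1) uA mu(2) ZA] ZA]
 have "local_min p q L \<mu> F A u0 Z0"
 proof unfold_locales
  show "lintegrable (%x. ind A x * F (Z0 x))"
   using min(1) F_nonneg by (intro integrableI_nonneg) (auto simp: enu)
 next
  fix \<Phi> :: "real^'n => real^'N" and \<Psi> and K :: "(real^'n) set"
  assume h: "wgrad UNIV \<Phi> \<Psi>" "compact K" "K <= A" "!!x. x \<notin> K ==> \<Phi> x = 0" "!!x. x \<notin> K ==> \<Psi> x = 0"
   "lintegrable (%x. norm (\<Phi> x) powr p)" "lintegrable (%x. norm (\<Psi> x) powr p)"
  note hD = wgradD[OF h(1)]
  have "\<Phi> : W1p_0 p A" using p2 by (intro wgrad_W1p_0[OF h(1) _ A(1) h(2,3,4,6,7)]) auto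
  hence "energy F u A <= energy F (%x. u x + \<Phi> x) A" by (rule min(2))
  also have "energy F (%x. u x + \<Phi> x) A = (NBINT x. en (ind A x * F (Z0 x + \<Psi> x)))"
  proof -
   have "wgrad A (%x. u0 x + \<Phi> x) (%x. Z0 x + \<Psi> x)"
    using wgrad_diff[OF w wgrad_scaleR[OF wgrad_mono[OF h(1)], of A "-1"]] by simp
   hence hw: "has_weak_grad A (%x. u x + \<Phi> x) (%x. G x + \<Psi> x)"
   proof (rule wgrad_has_weak_grad[OF _ A(1)])
    show "AE x\<in>A in lborel. u0 x + \<Phi> x = u x + \<Phi> x" using uA by eventually_elim simp
    show "AE x\<in>A in lborel. Z0 x + \<Psi> x = G x + \<Psi> x" using ZA by eventually_elim simp
   qed (rule borel_measurable_add[OF mu(1) borel_lebesgue_on[OF hD(3)]], rule borel_measurable_add[OF mu(2) borel_lebesgue_on[OF hD(4)]])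
   show ?thesis by (rule en[OF hw]) (use ZA in eventually_elim, simp)
  qed
  finally show "(NBINT x. en (ind A x * F (Z0 x))) <= (NBINT x. en (ind A x * F (Z0 x + \<Psi> x)))"
   unfolding enu .
 qed (use A(1) w ip[OF Lp(1) u0] ip[OF Lp(2) Z0] in auto)
 moreover have "AE x\<in>A in lborel. Z0 x = weak_grad \<Omega> u x"
  using ZA weak_grad_AE(2)[OF G \<Omega>] by eventually_elim (use AO in auto)
 ultimately show thesis using uA that by blast
qed

text \<open>The strict bound on \<open>q\<close> leaves an admissible hyperplane exponent
  \<open>s\<close> with \<open>q < p * s / 2\<close>, hence an interpolation parameter below 1, as
  the absorption requires. For \<open>n > 3\<close> it is the critical exponent itself; for
  \<open>n \<le> 3\<close> every \<open>s\<close> from 2 on is admissible, and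
  \<open>2 * q / p + 2\<close> is large enough.\<close>

lemma interpolation_exponents:
 fixes p q n :: real
 assumes p: "2 <= p" "p <= q" and n: "2 <= n" "n <= 3 \<or> q < p * (n - 1) / (n - 3)"
 obtains s \<theta> where "2 <= s" "(n - 3) * s <= 2 * (n - 1)" "0 <= \<theta>" "\<theta> < 1" "q = (1 - \<theta>) * p + \<theta> * (p * s / 2)"
proof -
 note goal = that
 have main: thesis if s: "2 <= s" "(n - 3) * s <= 2 * (n - 1)" "q < p * s / 2" for s
 proof -
  define D where "D = p * s / 2 - p"
  define \<theta> where "\<theta> = (q - p) / D"
  have d: "0 < D" "q - p < D" using s(3) p(2) by (simp_all add: D_def)
  have "\<theta> * D = q - p" using d(1) by (simp add: \<theta>_def)
  hence "q = (1 - \<theta>) * p + \<theta> * (p * s / 2)" by (simp add: D_def algebra_simps)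
  moreover have "0 <= \<theta>" "\<theta> < 1" using d p by (auto simp: \<theta>_def)
  ultimately show thesis using s by (intro goal)
 qed
 show thesis
 proof (cases "n <= 3")
  case True
  have 1: "2 <= 2 * q / p + 2" using p by simp
  moreover have "(n - 3) * (2 * q / p + 2) <= 2 * (n - 1)"
  proof -
   have "(n - 3) * (2 * q / p + 2) <= 0" using True 1 by (intro mult_nonpos_nonneg) auto
   thus ?thesis using n by simp
  qed
  moreover have "q < p * (2 * q / p + 2) / 2" using p by (simp add: field_simps)
  ultimately show thesis by (rule main)
 next
  case False
  hence "2 <= 2 * (n - 1) / (n - 3)" "(n - 3) * (2 * (n - 1) / (n - 3)) <= 2 * (n - 1)" "q < p * (2 * (n - 1) / (n - 3)) / 2"
   using n by (auto simp: field_simps)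
  thus thesis by (rule main)
 qed
qed

lemma local_higher_integrability:
 fixes u :: "real^'n => real^'N" and F :: "real^'n^'N => real"
 assumes st: "structural p q L \<mu> F" and p2: "2 <= p" and pq: "p <= q" and n: "CARD('n) \<ge> 2"
  and q: "CARD('n) <= 3 \<or> q < p * (real CARD('n) - 1) / (real CARD('n) - 3)"
  and m: "local_minimizer p F \<Omega> u" and \<Omega>: "open \<Omega>"
  and s': "2 <= s'" "(real CARD('n) - 2) * s' <= 2 * real CARD('n)" and x0: "x0 : \<Omega>"
 obtains S r u0 Z0 where "open S" "S <= \<Omega>" "0 < r" "cube x0 r <= S" "wgrad S u0 Z0" "AE x\<in>S in lborel. u0 x = u x"
  "AE x\<in>S in lborel. Z0 x = weak_grad \<Omega> u x" "(NBINT x. ind (cube x0 r) x * np (Z0 x) (p * s' / 2)) < \<infinity>"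
proof -
 obtain e where e: "0 < e" "cball x0 e <= \<Omega>" using \<Omega> x0 open_contains_cball by blast
 define S where "S = ball x0 e"
 have S: "open S" "S \<Subset> \<Omega>" "S <= \<Omega>" using e by (auto simp: S_def compactly_in_def)
 \<comment> \<open>Places the cube of half-side \<open>4 * R\<close> inside the ball of radius
   \<open>e\<close>: its points have l1-distance at most \<open>4 * e / 5\<close> from the
   centre.\<close>
 define R where "R = e / (5 * real CARD('n))"
 have cn: "0 < real CARD('n)" by simp
 have R: "0 < R" using e by (simp add: R_def)
 have cube: "cube x0 (4 * R) <= S"
 proof
  fix x assume x: "x : cube x0 (4 * R)"
  have "norm (x - x0) <= (\<Sum>i\<in>UNIV. \<bar>(x - x0) $ i\<bar>)" by (rule norm_le_l1_cart)
  also have "... <= (\<Sum>i\<in>(UNIV::'n set). 4 * R)" using x by (intro sum_mono) (auto simp: cube_def)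
  also have "... = e * (4 / 5)" by (simp add: R_def)
  also have "... < e" using e by simp
  finally show "x : S" by (simp add: S_def dist_norm norm_minus_commute)
 qed
 obtain u0 Z0 where lm: "local_min p q L \<mu> F S u0 Z0" "AE x\<in>S in lborel. u0 x = u x" "AE x\<in>S in lborel. Z0 x = weak_grad \<Omega> u x"
  using local_minimizer_local_min[OF st p2 pq m \<Omega> S(1,2)] by blast
 obtain s \<theta> where ex: "2 <= s" "(real CARD('n) - 3) * s <= 2 * (real CARD('n) - 1)" "0 <= \<theta>" "\<theta> < 1" "q = (1 - \<theta>) * p + \<theta> * (p * s / 2)"
 proof (rule interpolation_exponents[OF p2 pq, of "real CARD('n)"])
  show "2 <= real CARD('n)" using n by simp
  show "real CARD('n) <= 3 \<or> q < p * (real CARD('n) - 1) / (real CARD('n) - 3)" using q by auto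
 qed blast
 have "(NBINT x. ind (cube x0 (R / 4)) x * np (Z0 x) (p * s' / 2)) < \<infinity>"
  by (rule local_min.higher_integrability[OF lm(1) ex(1,2) n ex(3,4,5) R cube s'])
 moreover have "cube x0 (R / 4) <= S" using cube cube_mono[of "R / 4" "4 * R" x0] R by auto
 moreover have "wgrad S u0 Z0" using lm(1) unfolding local_min_def local_min_axioms_def by blast
 ultimately show thesis using that[OF S(1,3), of "R / 4" u0 Z0] R lm by auto
qed

section \<open>Morrey embedding\<close>

lemma nn_integral_scaled:
 fixes h :: "'a::euclidean_space => ennreal"
 assumes [measurable]: "h : borelfun" and t: "0 < t"
 shows "(NBINT z. h (w + t *\<^sub>R (z - w))) = en (t powr (- real DIM('a))) * (NBINT z. h z)"
proof -
 have "(NBINT z. h z) = (\<integral>\<^sup>+z. h z \<partial>density (distr lborel borel (%z. (w - t *\<^sub>R w) + t *\<^sub>R z)) (%_. \<bar>t\<bar> ^ DIM('a)))"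
  using lborel_affine[of t "w - t *\<^sub>R w"] t by simp
 also have "... = (NBINT z. en (t ^ DIM('a)) * h (w + t *\<^sub>R (z - w)))"
  using t by (simp add: nn_integral_density nn_integral_distr ennreal_power algebra_simps)
 also have "... = en (t ^ DIM('a)) * (NBINT z. h (w + t *\<^sub>R (z - w)))"
  by (rule nn_integral_cmult) measurable
 finally show ?thesis
  using t by (simp add: mult.assoc[symmetric] ennreal_mult[symmetric] powr_minus powr_realpow)
qed

lemma emeasure_cube: "0 <= d ==> emeasure lborel (cube (x :: real^'n) d) = en ((2 * d) powr real CARD('n))"
proof -
 assume d: "0 <= d"
 have ne: "cbox (x - (\<chi> i. d)) (x + (\<chi> i. d)) ~= {}" using d by (auto simp: interval_ne_empty_cart)
 have "measure lborel (cube x d) = (2 * d) ^ CARD('n)"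
  unfolding cube_eq_cbox content_cbox_cart[OF ne] by simp
 moreover have "emeasure lborel (cube x d) ~= \<infinity>" using emeasure_compact_finite[OF compact_cube, of x d] by simp
 ultimately have "emeasure lborel (cube x d) = en ((2 * d) ^ CARD('n))" by (metis emeasure_eq_ennreal_measure infinity_ennreal_def)
 thus ?thesis using d by (cases "d = 0") (auto simp: powr_realpow zero_power)
qed

text \<open>\<open>f x\<close> and \<open>f y\<close> are both compared with the values of
  \<open>f\<close> on the cube \<open>B\<close> of half-side \<open>norm (x - y)\<close> around
  \<open>x\<close>. The differences are integrated along segments from \<open>x\<close> and from
  \<open>y\<close>; contraction by the factor \<open>t\<close> costs \<open>t powr (- n / r)\<close>
  after Hoelder's inequality, and \<open>r > n\<close> makes this integrable on the unit
  interval.\<close>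

lemma morrey:
 fixes f :: "real^'n => real^'N"
 assumes der: "!!z. z : cube c \<rho> ==> (f has_derivative (%v. D z *v v)) (at z)"
  and f: "f : borelfun" and D: "continuous_on UNIV D" and r: "real CARD('n) < r"
  and M: "0 <= M" "(NBINT z. ind (cube c \<rho>) z * np (D z) r) <= en M"
  and xy: "x : cube c a" "a + norm (x - y) <= \<rho>"
 shows "norm (f x - f y) <= 4 * real CARD('n) / (1 - real CARD('n) / r) * M powr (1 / r) * norm (x - y) powr (1 - real CARD('n) / r)"
proof (cases "x = y")
 case False
 define d where "d = norm (x - y)"
 define n where "n = real CARD('n)"
 define V where "V = (2 * d) powr n"
 define B where "B = cube x d"
 have d: "0 < d" using False by (simp add: d_def)
 have V: "0 < V" "emeasure lborel B = en V" using d by (auto simp: V_def B_def n_def emeasure_cube)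
 have n: "1 <= n" "n < r" using r by (auto simp: n_def Suc_le_eq)
 have \<beta>: "0 < 1 - n / r" using n by simp
 have Bc: "B <= cube c \<rho>"
 proof
  fix z assume z: "z : B"
  show "z : cube c \<rho>" unfolding cube_def
  proof safe
   fix i
   have "\<bar>z $ i - x $ i\<bar> <= d" "\<bar>x $ i - c $ i\<bar> <= a" using z xy(1) by (auto simp: B_def cube_def)
   thus "\<bar>z $ i - c $ i\<bar> <= \<rho>" using xy(2) unfolding d_def by linarith
  qed
 qed
 have xB: "x : B" using d by (simp add: B_def cube_def)
 have yB: "y : B" using component_le_norm_cart[of "x - y"] by (auto simp: B_def cube_def d_def abs_minus_commute)
 have Bm [measurable]: "B : sets borel" by (simp add: B_def cube_borel)
 have cvx: "w + t *\<^sub>R (z - w) : B" if "w : B" "z : B" "0 <= t" "t <= 1" for w z t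
 proof -
  have "convex B" unfolding B_def cube_eq_cbox by (rule convex_box)
  from convexD_alt[OF this that] show ?thesis by (simp add: algebra_simps)
 qed
 have Dm [measurable]: "D : borelfun" using D by (rule borel_measurable_continuous_onI)
 note [measurable] = f
 let ?m = "en (V powr (1 - 1 / r) * M powr (1 / r))"
 \<comment> \<open>Hoelder's inequality on \<open>B\<close>, followed by the contraction towards
   \<open>w\<close> as a change of variables; convexity keeps the contracted points in
   \<open>B\<close>.\<close>
 have It: "(NBINT z. ind B z * en (norm (D (w + t *\<^sub>R (z - w))))) <= ?m * en (t powr (- n / r))"
  if w: "w : B" and t: "0 < t" "t <= 1" for w t
 proof -
  let ?g = "%z. ind B z * np (D z) r"
  have "(NBINT z. ind B z * en (norm (D (w + t *\<^sub>R (z - w)))))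
   <= (NBINT z. epow (ind B z) (1 - 1 / r) * epow (?g (w + t *\<^sub>R (z - w))) (1 / r))"
   using cvx[OF w] t n by (intro nn_integral_mono) (auto simp: indicator_def epow_ennreal powr_powr)
  also have "... <= epow (NBINT z. ind B z) (1 - 1 / r) * epow (NBINT z. ?g (w + t *\<^sub>R (z - w))) (1 / r)"
   using n by (intro nn_integral_Holder2) auto
  also have "(NBINT z. ind B z) = en V" using V by simp
  also have "(NBINT z. ?g (w + t *\<^sub>R (z - w))) = en (t powr (- n)) * (NBINT z. ?g z)"
   unfolding n_def using nn_integral_scaled[of ?g t w] t by simp
  also have "epow (en V) (1 - 1 / r) * epow (en (t powr (- n)) * (NBINT z. ?g z)) (1 / r)
   <= epow (en V) (1 - 1 / r) * epow (en (t powr (- n)) * en M) (1 / r)"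
  proof (intro mult_left_mono epow_mono)
   have "(NBINT z. ?g z) <= (NBINT z. ind (cube c \<rho>) z * np (D z) r)"
    using Bc by (intro nn_integral_mono) (auto simp: indicator_def)
   thus "(NBINT z. ?g z) <= en M" using M(2) by (rule order_trans)
  qed (use n in auto)
  also have "... = ?m * en (t powr (- n / r))"
   using V n M t by (simp add: epow_ennreal epow_mult powr_powr ennreal_mult mult_ac)
  finally show ?thesis .
 qed
 have Jt: "(NBINT t. en (t powr (- n / r)) * ind {0..1} t) <= en (1 / (1 - n / r))"
 proof -
  have "((%t. t powr (- n / r)) has_integral (1 powr (- n / r + 1) / (- n / r + 1))) {0..1}"
   using \<beta> by (intro has_integral_powr_from_0) auto
  hence "((%t. if t : {0..1} then t powr (- n / r) else 0) has_integral (1 powr (- n / r + 1) / (- n / r + 1))) UNIV"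
   by (simp only: has_integral_restrict_UNIV)
  from nn_integral_has_integral_lborel[OF _ _ this]
  have "(NBINT t. en (if t : {0..1} then t powr (- n / r) else 0)) = en (1 / (1 - n / r))" by simp
  moreover have "en (if t : {0..1} then t powr (- n / r) else 0) = en (t powr (- n / r)) * ind {0..1} t" for t
   by (auto simp: indicator_def)
  ultimately show ?thesis by simp
 qed
 have bd: "(NBINT z. ind B z * en (norm (f z - f w))) <= en (2 * n * d) * (?m * en (1 / (1 - n / r)))"
  if w: "w : B" for w
 proof -
  have pt: "ind B z * en (norm (f z - f w))
   <= en (2 * n * d) * (NBINT t. ind B z * en (norm (D (w + t *\<^sub>R (z - w)))) * ind {0..1} t)" for z
  proof (cases "z : B")
   case True
   have "en (norm (f (w + 1 *\<^sub>R (z - w)) - f (w + 0 *\<^sub>R (z - w)))) <= (NBINT t. en (norm (D (w + t *\<^sub>R (z - w))) * norm (z - w)) * ind {0..1} t)"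
   proof (rule norm_diff_le_nn_integral[where D="%t. D (w + t *\<^sub>R (z - w)) *v (z - w)"])
    fix t :: real assume t: "0 <= t" "t <= 1"
    have "((%t. f (w + t *\<^sub>R (z - w))) has_derivative (%s. D (w + t *\<^sub>R (z - w)) *v (s *\<^sub>R (z - w)))) (at t)"
     using cvx[OF w True t] Bc by (intro has_derivative_compose[OF _ der]) (auto intro!: derivative_eq_intros)
    thus "((%t. f (w + t *\<^sub>R (z - w))) has_vector_derivative D (w + t *\<^sub>R (z - w)) *v (z - w)) (at t)"
     by (simp add: has_vector_derivative_def matrix_vector_mult_scaleR)
   next
    show "continuous_on UNIV (%t. norm (D (w + t *\<^sub>R (z - w))) * norm (z - w))"
     by (intro continuous_intros continuous_on_compose2[OF D]) auto
   qed (auto intro: norm_matrix_mult_le)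
   also have "... <= (NBINT t. en (2 * n * d) * (en (norm (D (w + t *\<^sub>R (z - w)))) * ind {0..1} t))"
   proof (intro nn_integral_mono)
    fix t :: real
    have "norm (z - w) <= (\<Sum>i\<in>UNIV. \<bar>(z - w) $ i\<bar>)" by (rule norm_le_l1_cart)
    also have "... <= (\<Sum>i\<in>(UNIV::'n set). 2 * d)"
    proof (rule sum_mono)
     fix i
     have "\<bar>z $ i - x $ i\<bar> <= d" "\<bar>w $ i - x $ i\<bar> <= d" using w True by (auto simp: B_def cube_def)
     thus "\<bar>(z - w) $ i\<bar> <= 2 * d" by (simp add: abs_le_iff)
    qed
    finally have "norm (z - w) <= 2 * n * d" by (simp add: n_def)
    hence "en (norm (D (w + t *\<^sub>R (z - w))) * norm (z - w)) <= en (2 * n * d) * en (norm (D (w + t *\<^sub>R (z - w))))"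
     using n d by (subst ennreal_mult[symmetric]) (auto intro!: ennreal_leI mult_right_mono simp: mult.commute)
    thus "en (norm (D (w + t *\<^sub>R (z - w))) * norm (z - w)) * ind {0..1} t
     <= en (2 * n * d) * (en (norm (D (w + t *\<^sub>R (z - w)))) * ind {0..1} t)"
     by (auto simp: indicator_def)
   qed
   also have "... = en (2 * n * d) * (NBINT t. en (norm (D (w + t *\<^sub>R (z - w)))) * ind {0..1} t)"
    by (rule nn_integral_cmult) measurable
   finally show ?thesis using True by simp
  qed simp
  have "(NBINT z. ind B z * en (norm (f z - f w)))
   <= en (2 * n * d) * (NBINT z. (NBINT t. ind B z * en (norm (D (w + t *\<^sub>R (z - w)))) * ind {0..1} t))"
   by (subst nn_integral_cmult[symmetric], measurable) (intro nn_integral_mono pt)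
  also have "(NBINT z. (NBINT t. ind B z * en (norm (D (w + t *\<^sub>R (z - w)))) * ind {0..1} t))
   = (NBINT t. (NBINT z. ind B z * en (norm (D (w + t *\<^sub>R (z - w)))) * ind {0..1} t))"
   by (rule lborel_pair.Fubini') measurable
  also have "... <= (NBINT t. ?m * (en (t powr (- n / r)) * ind {0..1} t))"
  proof (rule nn_integral_mono_AE)
   have "AE t in lborel. t ~= (0::real)" by (rule AE_lborel_singleton)
   thus "AE t in lborel. (NBINT z. ind B z * en (norm (D (w + t *\<^sub>R (z - w)))) * ind {0..1} t)
    <= ?m * (en (t powr (- n / r)) * ind {0..1} t)"
   proof eventually_elim
    case (elim t)
    thus ?case using It[OF w, of t] by (cases "t : {0..1}") auto
   qed
  qed
  also have "... = ?m * (NBINT t. en (t powr (- n / r)) * ind {0..1} t)" by (rule nn_integral_cmult) measurable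
  also have "... <= ?m * en (1 / (1 - n / r))" by (intro mult_left_mono Jt) simp
  finally show ?thesis by (simp add: mult_left_mono)
 qed
 let ?Q = "2 * n * d * (V powr (1 - 1 / r) * M powr (1 / r) * (1 / (1 - n / r)))"
 have Q: "en (2 * n * d) * (?m * en (1 / (1 - n / r))) = en ?Q" "0 <= ?Q"
  subgoal
  proof -
   have "0 <= 2 * n * d" "0 <= V powr (1 - 1 / r) * M powr (1 / r)" "0 <= 1 / (1 - n / r)" using n d \<beta> by auto
   thus ?thesis by (simp only: ennreal_mult[symmetric] mult_nonneg_nonneg)
  qed
  subgoal using n d \<beta> by simp
  done
 have "en (norm (f x - f y) * V) = (NBINT z. en (norm (f x - f y)) * ind B z)"
  using V by (simp add: nn_integral_cmult ennreal_mult)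
 also have "... <= (NBINT z. ind B z * en (norm (f z - f x)) + ind B z * en (norm (f z - f y)))"
 proof (intro nn_integral_mono)
  fix z
  have "norm (f x - f y) <= norm (f z - f x) + norm (f z - f y)" using norm_triangle_ineq4[of "f z - f y" "f z - f x"] by simp
  thus "en (norm (f x - f y)) * ind B z <= ind B z * en (norm (f z - f x)) + ind B z * en (norm (f z - f y))"
   by (auto simp: indicator_def ennreal_plus[symmetric] ennreal_leI simp del: ennreal_plus)
 qed
 also have "... = (NBINT z. ind B z * en (norm (f z - f x))) + (NBINT z. ind B z * en (norm (f z - f y)))"
  by (rule nn_integral_add) measurable
 also have "... <= en ?Q + en ?Q" using bd[OF xB] bd[OF yB] unfolding Q by (rule add_mono)
 also have "... = en (2 * ?Q)" by (subst mult_2[of ?Q], rule ennreal_plus[symmetric, OF Q(2) Q(2)])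
 finally have "norm (f x - f y) * V <= 2 * ?Q" using Q(2) by (subst (asm) ennreal_le_iff) auto
 hence "norm (f x - f y) <= 2 * ?Q / V" by (subst pos_le_divide_eq[OF V(1)])
 \<comment> \<open>\<open>V\<close> is the volume of a cube of side \<open>2 * d\<close>, so
   \<open>V powr (- 1 / r)\<close> supplies the exponent \<open>- n / r\<close> of
   \<open>d\<close>.\<close>
 also have "2 * ?Q / V = 4 * n / (1 - n / r) * M powr (1 / r) * (d * V powr (- 1 / r))"
 proof -
  have "V powr (1 - 1 / r) = V * V powr (- 1 / r)" using V by (simp add: powr_diff powr_minus_divide)
  thus ?thesis using V(1) by simp
 qed
 also have "... <= 4 * n / (1 - n / r) * M powr (1 / r) * d powr (1 - n / r)"
 proof (rule mult_left_mono)
  have "V powr (- 1 / r) = (2 * d) powr (- (n / r))" by (simp add: V_def powr_powr)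
  also have "... <= d powr (- (n / r))" using d n by (intro powr_mono2') auto
  finally have "d * V powr (- 1 / r) <= d powr 1 * d powr (- (n / r))" using d by simp
  also have "... = d powr (1 - n / r)" by (subst powr_add[symmetric]) simp
  finally show "d * V powr (- 1 / r) <= d powr (1 - n / r)" .
 qed (use n \<beta> in auto)
 finally show ?thesis by (simp add: n_def d_def)
qed simp

section \<open>Continuous representatives and patching of local information\<close>

lemma AE_open_ex:
 assumes "AE y in lborel. P (y::'a::euclidean_space)" "open U" "U ~= {}"
 obtains y where "y : U" "P y"
proof -
 obtain x e where "0 < e" "ball x e <= U" using assms(2,3) open_contains_ball by blast
 have "\<exists>y\<in>U. P y"
 proof (rule ccontr)
  assume "\<not> ?thesis"
  hence "AE y in lborel. y \<notin> ball x e" using assms(1) \<open>ball x e <= U\<close> by (auto elim!: eventually_mono)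
  hence "ball x e : null_sets lborel" by (subst AE_iff_null_sets) simp_all
  hence "emeasure lborel (ball x e) = 0" by auto
  thus False using content_ball_pos[OF \<open>0 < e\<close>, of x] by (simp add: measure_def)
 qed
 thus thesis using that by blast
qed

definition holder_on :: "'a::euclidean_space set => real => real => ('a => 'b::euclidean_space) => bool" where
 "holder_on A \<alpha> C w \<longleftrightarrow> (\<forall>x\<in>A. \<forall>y\<in>A. norm (w x - w y) <= C * norm (x - y) powr \<alpha>)"

text \<open>Morrey's estimate is uniform in the mollification parameter. Almost everywhere
  convergence supplies a point of convergence arbitrarily close to any given point, and
  equicontinuity upgrades this to convergence everywhere; the limit is the Hoelder continuous
  representative.\<close>

lemma morrey_holder:
 fixes u :: "real^'n => real^'N"
 assumes w: "wgrad S u Z" and c: "cube c (2 * \<rho>) <= S" and \<rho>: "0 < \<rho>" and r: "real CARD('n) < r"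
  and Zr: "(NBINT x. ind (cube c (2 * \<rho>)) x * np (Z x) r) < \<infinity>"
 obtains v C where "AE y\<in>ball c (\<rho> / 3) in lborel. v y = u y" "holder_on (ball c (\<rho> / 3)) (1 - real CARD('n) / r) C v"
proof -
 note wD = wgradD[OF w]
 note [measurable] = wD(3,4)
 define B where "B = ball c (\<rho> / 3)"
 define \<alpha> where "\<alpha> = 1 - real CARD('n) / r"
 have "1 <= real CARD('n)" by (simp add: Suc_le_eq)
 hence "1 <= r" using r by linarith
 hence r1: "1 <= r" "0 < \<alpha>" using r by (simp_all add: \<alpha>_def)
 obtain M where M: "0 <= M" "(NBINT x. ind (cube c (2 * \<rho>)) x * np (Z x) r) = en M"
  using Zr by (auto simp: less_top_ennreal)
 define C where "C = 4 * real CARD('n) / \<alpha> * M powr (1 / r)"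
 obtain k0 where k0: "1 / real (Suc k0) <= \<rho>" using nat_approx_posE[OF \<rho>] by (auto intro: less_imp_le)
 have hol: "norm (mconv k u x - mconv k u y) <= C * norm (x - y) powr \<alpha>" if k: "k0 <= k" and xy: "x : B" "y : B" for k x y
 proof -
  have k1: "1 / real (Suc k) <= \<rho>" using k k0 by (meson frac_le le_numeral_extra(4) of_nat_0_less_iff of_nat_le_iff order_trans zero_le_one zero_less_Suc Suc_le_mono)
  have sub: "cball z (1 / real (Suc k)) <= cube c (2 * \<rho>)" if "z : cube c \<rho>" for z
   using cube_shift_cball[OF that, of 0 0 "1 / real (Suc k)"] cube_mono[of "\<rho> + 1 / real (Suc k)" "2 * \<rho>" c] k1 by auto
  show ?thesis unfolding C_def \<alpha>_def
  proof (rule morrey[OF _ _ _ r M(1)])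
   show "(mconv k u has_derivative (%v. mconv k Z z *v v)) (at z)" if "z : cube c \<rho>" for z
    using conv_moll_wgrad[OF w] sub[OF that] c by blast
   let ?g = "%x. ind (cube c (2 * \<rho>)) x *\<^sub>R Z x"
   have g: "lintegrable ?g" by (intro integrable_mult_indicator wD(2)) simp
   have "mconv k Z z = mconv k ?g z" if "z : cube c \<rho>" for z
   proof (rule conv_moll_cong)
    fix y assume "norm (z - y) <= 1 / real (Suc k)"
    thus "Z y = ?g y" using sub[OF that] by (auto simp: dist_norm)
   qed
   hence "(NBINT z. ind (cube c \<rho>) z * np (mconv k Z z) r) <= (NBINT z. np (mconv k ?g z) r)"
    by (intro nn_integral_mono) (auto simp: indicator_def)
   also have "... <= (NBINT z. np (?g z) r)" by (rule conv_Jensen[OF g r1(1)])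
   also have "... = en M" unfolding M(2)[symmetric] using r1 by (intro nn_integral_cong) (auto simp: indicator_def)
   finally show "(NBINT z. ind (cube c \<rho>) z * np (mconv k Z z) r) <= en M" .
   show "x : cube c (\<rho> / 3)" using xy(1) cube_shift[of c c 0 "x - c" "\<rho> / 3"]
    by (simp add: B_def dist_norm norm_minus_commute cube_def)
   show "\<rho> / 3 + norm (x - y) <= \<rho>"
    using xy dist_triangle[of x y c] by (simp add: B_def dist_norm[symmetric] dist_commute)
  qed (use wD in \<open>auto intro: conv_continuous moll_tests\<close>)
 qed
 obtain s where s: "strict_mono s" "AE x in lborel. (%k. mconv (s k + k0) u x) ----> u x"
  using conv_AE_subseq[OF wD(1), of "%k. k + k0"] by (auto simp: strict_mono_def)
 define f where "f k = mconv (s k + k0) u" for k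
 have fh: "norm (f k x - f k y) <= C * norm (x - y) powr \<alpha>" if "x : B" "y : B" for k x y using hol that by (simp add: f_def)
 have C0: "0 <= C" using r1 M by (simp add: C_def)
 have "convergent (%k. f k x)" if x: "x : B" for x
 proof (rule Cauchy_convergent, rule metric_CauchyI)
  fix \<epsilon> :: real assume \<epsilon>: "0 < \<epsilon>"
  \<comment> \<open>A solution of \<open>C * \<delta> powr \<alpha> < \<epsilon> / 3\<close>;
    \<open>C + 1\<close> in the denominator covers \<open>C = 0\<close>.\<close>
  define \<delta> where "\<delta> = (\<epsilon> / (4 * (C + 1))) powr (1 / \<alpha>)"
  have \<delta>: "0 < \<delta>" "C * \<delta> powr \<alpha> < \<epsilon> / 3"
  proof -
   show "0 < \<delta>" using \<epsilon> C0 by (simp add: \<delta>_def)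
   have "\<delta> powr \<alpha> = \<epsilon> / (4 * (C + 1))" using \<epsilon> C0 r1 by (simp add: \<delta>_def powr_powr)
   hence "4 * \<delta> powr \<alpha> + 4 * (C * \<delta> powr \<alpha>) = \<epsilon>" using C0 by (simp add: field_simps)
   moreover have "0 <= C * \<delta> powr \<alpha>" using C0 by simp
   ultimately show "C * \<delta> powr \<alpha> < \<epsilon> / 3" using \<epsilon> powr_ge_zero[of \<delta> \<alpha>] by linarith
  qed
  have op: "open (ball x \<delta> \<inter> B)" "x : ball x \<delta> \<inter> B" using x \<delta>(1) by (auto simp: B_def)
  obtain y where y: "y : ball x \<delta> \<inter> B" "(%k. mconv (s k + k0) u y) ----> u y"
   using AE_open_ex[OF s(2) op(1)] op(2) by blast
  hence "Cauchy (%k. f k y)" unfolding f_def by (blast intro: LIMSEQ_imp_Cauchy)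
  then obtain K where K: "!!i j. K <= i ==> K <= j ==> dist (f i y) (f j y) < \<epsilon> / 3"
   using metric_CauchyD[of "%k. f k y" "\<epsilon> / 3"] \<epsilon> by auto
  have "norm (x - y) powr \<alpha> <= \<delta> powr \<alpha>" using y(1) r1 by (intro powr_mono2) (auto simp: dist_norm)
  hence "C * norm (x - y) powr \<alpha> <= C * \<delta> powr \<alpha>" using C0 by (rule mult_left_mono)
  hence fy: "dist (f i x) (f i y) < \<epsilon> / 3" for i
   using fh[of x y i] x y(1) \<delta>(2) by (simp add: dist_norm)
  have "dist (f i x) (f j x) < \<epsilon>" if "K <= i" "K <= j" for i j
   using K[OF that] fy[of i] fy[of j] dist_triangle[of "f i x" "f j x" "f i y"] dist_triangle[of "f i y" "f j x" "f j y"]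
   by (simp add: dist_commute)
  thus "\<exists>K. \<forall>i\<ge>K. \<forall>j\<ge>K. dist (f i x) (f j x) < \<epsilon>" by blast
 qed
 then obtain v where v: "!!x. x : B ==> (%k. f k x) ----> v x" unfolding convergent_def by metis
 have "AE y\<in>B in lborel. v y = u y"
  using s(2) by eventually_elim (use v LIMSEQ_unique in \<open>auto simp: f_def\<close>)
 moreover have "holder_on B \<alpha> C v" unfolding holder_on_def
 proof (intro ballI)
  fix x y assume "x : B" "y : B"
  thus "norm (v x - v y) <= C * norm (x - y) powr \<alpha>"
   by (intro LIMSEQ_le_const2[OF tendsto_norm[OF tendsto_diff[OF v v]]]) (auto intro: fh)
 qed
 ultimately show thesis using that by (simp add: B_def \<alpha>_def)
qed

text \<open>Local representatives are continuous and agree almost everywhere, hence everywhere on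
  overlaps, so the diagonal choice \<open>v x = w x x\<close> is consistent. On a set compactly
  contained in the domain a Lebesgue number of the cover handles nearby points; points farther
  apart, possibly in different components, are handled by boundedness of \<open>v\<close>.\<close>

lemma holder_locI:
 fixes u :: "'a::euclidean_space => 'b::euclidean_space"
 assumes \<Omega>: "open \<Omega>" and \<alpha>: "0 < \<alpha>"
  and loc: "!!x. x : \<Omega> ==> \<exists>e w C. 0 < e \<and> (AE y in lborel. y : ball x e --> w y = u y) \<and> holder_on (ball x e) \<alpha> C w"
 shows "u : holder_loc \<alpha> \<Omega>"
proof -
 define P where "P x t \<longleftrightarrow> 0 < fst t \<and> (AE y\<in>ball x (fst t) in lborel. fst (snd t) y = u y) \<and>
  holder_on (ball x (fst t)) \<alpha> (snd (snd t)) (fst (snd t))" for x and t :: "real \<times> ('a => 'b) \<times> real"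
 have "\<forall>x\<in>\<Omega>. \<exists>t. P x t"
 proof
  fix x assume "x : \<Omega>"
  then obtain e w C where "0 < e" "AE y in lborel. y : ball x e --> w y = u y" "holder_on (ball x e) \<alpha> C w" using loc by blast
  hence "P x (e, w, C)" by (simp add: P_def)
  thus "\<exists>t. P x t" ..
 qed
 then obtain t where t: "!!x. x : \<Omega> ==> P x (t x)" using bchoice by metis
 define e where "e x = fst (t x)" for x
 define w where "w x = fst (snd (t x))" for x
 define C where "C x = snd (snd (t x))" for x
 have e: "!!x. x : \<Omega> ==> 0 < e x" and ae: "!!x. x : \<Omega> ==> AE y\<in>ball x (e x) in lborel. w x y = u y"
  and hol: "!!x. x : \<Omega> ==> holder_on (ball x (e x)) \<alpha> (C x) (w x)"
  using t unfolding P_def e_def w_def C_def by blast+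
 have h: "norm (w x y - w x z) <= \<bar>C x\<bar> * norm (y - z) powr \<alpha>" if "x : \<Omega>" "y : ball x (e x)" "z : ball x (e x)" for x y z
 proof -
  have "norm (w x y - w x z) <= C x * norm (y - z) powr \<alpha>" using hol[OF that(1)] that unfolding holder_on_def by blast
  also have "... <= \<bar>C x\<bar> * norm (y - z) powr \<alpha>" by (intro mult_right_mono) auto
  finally show ?thesis .
 qed
 define v where "v x = w x x" for x
 have vw: "v y = w x y" if x: "x : \<Omega>" and y: "y : \<Omega>" "y : ball x (e x)" for x y
 proof (rule ccontr)
  assume "v y ~= w x y"
  hence d: "0 < norm (w x y - w y y)" (is "0 < ?d") by (simp add: v_def)
  define c where "c = \<bar>C x\<bar> + \<bar>C y\<bar> + 1"
  \<comment> \<open>Within this distance of \<open>y\<close> the Hoelder bounds of the two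
    representatives together stay below the presumed gap \<open>?d\<close>.\<close>
  define \<delta> where "\<delta> = (?d / c) powr (1 / \<alpha>)"
  have c: "0 < c" by (simp add: c_def)
  have \<delta>: "0 < \<delta>" "c * \<delta> powr \<alpha> = ?d" using d c \<alpha> by (simp_all add: \<delta>_def powr_powr)
  obtain z where z: "z : ball x (e x) \<inter> ball y (e y) \<inter> ball y \<delta>"
   "(z : ball x (e x) --> w x z = u z) \<and> (z : ball y (e y) --> w y z = u z)"
  proof (rule AE_open_ex)
   show "AE z in lborel. (z : ball x (e x) --> w x z = u z) \<and> (z : ball y (e y) --> w y z = u z)"
    using ae[OF x] ae[OF y(1)] by eventually_elim blast
   show "ball x (e x) \<inter> ball y (e y) \<inter> ball y \<delta> ~= {}" using y e[OF y(1)] \<delta>(1) by (auto intro!: exI[of _ y])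
  qed auto
  have yy: "y : ball y (e y)" using e[OF y(1)] by simp
  have "?d <= norm (w x y - w x z) + norm (w y z - w y y)" using z norm_triangle_ineq[of "w x y - w x z" "w y z - w y y"] by auto
  also have "... <= \<bar>C x\<bar> * norm (y - z) powr \<alpha> + \<bar>C y\<bar> * norm (z - y) powr \<alpha>"
   using z y yy x by (intro add_mono h) auto
  also have "... <= c * norm (y - z) powr \<alpha>" by (simp add: c_def norm_minus_commute algebra_simps)
  also have "... < c * \<delta> powr \<alpha>" using z(1) c \<alpha> by (intro mult_strict_left_mono powr_less_mono2) (auto simp: dist_norm)
  finally show False unfolding \<delta>(2) by simp
 qed
 have vh: "norm (v y - v z) <= \<bar>C x\<bar> * norm (y - z) powr \<alpha>" if "x : \<Omega>" "y : \<Omega> \<inter> ball x (e x)" "z : \<Omega> \<inter> ball x (e x)" for x y z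
  using h[of x y z] vw[of x y] vw[of x z] that by auto
 have "AE y\<in>\<Omega> in lborel. v y = u y"
 proof (rule AE_local)
  fix x assume x: "x : \<Omega>"
  have "AE y in lborel. y : ball x (e x) \<inter> \<Omega> --> v y = u y" using ae[OF x] by eventually_elim (use vw[OF x] in auto)
  thus "\<exists>B. open B \<and> x : B \<and> (AE y\<in>B in lborel. v y = u y)"
   using x e[OF x] \<Omega> by (intro exI[of _ "ball x (e x) \<inter> \<Omega>"]) auto
 qed
 hence AE: "AE x in lebesgue_on \<Omega>. v x = u x" using \<Omega> by (subst AE_restrict_space_iff) (auto simp: AE_completion_iff)
 have "\<exists>C. \<forall>y\<in>A. \<forall>z\<in>A. norm (v y - v z) <= C * norm (y - z) powr \<alpha>" if A: "open A" "A \<Subset> \<Omega>" for A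
 proof -
  let ?K = "closure A"
  have K: "compact ?K" "?K <= \<Omega>" using A by (auto simp: compactly_in_def)
  have "?K <= (\<Union>x\<in>?K. ball x (e x))" using e K(2) by force
  then obtain I where I: "I <= ?K" "finite I" "?K <= (\<Union>x\<in>I. ball x (e x))" using compactE_image[OF K(1), of ?K "%x. ball x (e x)"] by auto
  obtain \<delta> where \<delta>: "0 < \<delta>" "!!x. x : ?K ==> \<exists>G\<in>(%x. ball x (e x)) ` I. ball x \<delta> <= G"
   using Heine_Borel_lemma[OF K(1) I(3)] by blast
  define Cm where "Cm = (\<Sum>x\<in>I. \<bar>C x\<bar>)"
  define Bd where "Bd = (\<Sum>x\<in>I. norm (v x) + \<bar>C x\<bar> * e x powr \<alpha>)"
  have Cm: "\<bar>C x\<bar> <= Cm" if "x : I" for x unfolding Cm_def using that I(2) by (intro member_le_sum) auto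
  have IO: "x : \<Omega>" if "x : I" for x using I(1) K(2) that by auto
  have Bd: "norm (v y) <= Bd" if y: "y : ?K" for y
  proof -
   obtain x where x: "x : I" "y : ball x (e x)" using I(3) y by auto
   have xx: "x : \<Omega> \<inter> ball x (e x)" using IO[OF x(1)] e by simp
   have "norm (v y) <= norm (v x) + norm (v y - v x)" using norm_triangle_ineq[of "v x" "v y - v x"] by simp
   also have "norm (v y - v x) <= \<bar>C x\<bar> * norm (y - x) powr \<alpha>" using x y K(2) IO xx by (intro vh) auto
   also have "... <= \<bar>C x\<bar> * e x powr \<alpha>" using x(2) \<alpha> by (intro mult_left_mono powr_mono2) (auto simp: dist_norm norm_minus_commute)
   also have "norm (v x) + ... <= Bd" unfolding Bd_def using x(1) I(2)
    by (intro member_le_sum[where f="%x. norm (v x) + \<bar>C x\<bar> * e x powr \<alpha>"]) auto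
   finally show ?thesis by simp
  qed
  show ?thesis
  proof (intro exI ballI)
   fix y z assume yz: "y : A" "z : A"
   hence yK: "y : ?K" "z : ?K" using closure_subset by blast+
   have B0: "0 <= Bd" using Bd[OF yK(1)] norm_ge_zero order_trans by blast
   have C0: "0 <= Cm" by (simp add: Cm_def sum_nonneg)
   show "norm (v y - v z) <= (Cm + 2 * Bd / \<delta> powr \<alpha>) * norm (y - z) powr \<alpha>"
   proof (cases "norm (y - z) < \<delta>")
    case True
    obtain x where x: "x : I" "ball y \<delta> <= ball x (e x)" using \<delta>(2)[OF yK(1)] by auto
    have "y : ball y \<delta>" "z : ball y \<delta>" using True \<delta>(1) by (auto simp: dist_norm)
    hence "y : ball x (e x)" "z : ball x (e x)" using x(2) by blast+
    hence "norm (v y - v z) <= \<bar>C x\<bar> * norm (y - z) powr \<alpha>" using yK K(2) IO[OF x(1)] by (intro vh) auto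
    also have "... <= (Cm + 2 * Bd / \<delta> powr \<alpha>) * norm (y - z) powr \<alpha>" using Cm[OF x(1)] B0 by (intro mult_right_mono) (auto intro: order_trans)
    finally show ?thesis .
   next
    case False
    have "norm (v y - v z) <= 2 * Bd" using norm_triangle_ineq4[of "v y" "v z"] Bd[OF yK(1)] Bd[OF yK(2)] by simp
    also have "... <= 2 * Bd / \<delta> powr \<alpha> * norm (y - z) powr \<alpha>"
    proof -
     have "\<delta> powr \<alpha> <= norm (y - z) powr \<alpha>" using False \<delta>(1) \<alpha> by (intro powr_mono2) auto
     hence "2 * Bd / \<delta> powr \<alpha> * \<delta> powr \<alpha> <= 2 * Bd / \<delta> powr \<alpha> * norm (y - z) powr \<alpha>" using B0 by (intro mult_left_mono) auto
     thus ?thesis using \<delta>(1) by simp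
    qed
    also have "... <= (Cm + 2 * Bd / \<delta> powr \<alpha>) * norm (y - z) powr \<alpha>" using C0 by (intro mult_right_mono) auto
    finally show ?thesis .
   qed
  qed
 qed
 thus ?thesis unfolding holder_loc_def using AE by blast
qed

lemma emeasure_compactly_in: "A \<Subset> \<Omega> ==> emeasure lborel A < \<infinity>"
 using emeasure_mono[OF closure_subset[of A], of lborel] emeasure_compact_finite[of "closure A"]
 by (auto simp: compactly_in_def intro: order_le_less_trans)

text \<open>A Hoelder estimate on a bounded set bounds the representative there, and sets compactly
  contained in the domain have finite measure.\<close>

lemma holder_loc_Lp_loc:
 assumes u: "u : holder_loc \<alpha> \<Omega>" and m: "u : Lp_loc 1 \<Omega>" and \<alpha>: "0 < \<alpha>" and \<Omega>: "open \<Omega>" and q: "0 <= q"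
 shows "u : Lp_loc q \<Omega>"
 unfolding Lp_loc_def
proof safe
 fix A assume A: "open A" "A \<Subset> \<Omega>"
 have Ab: "A : sets borel" and sub: "A <= \<Omega>" using A closure_subset[of A] by (auto simp: compactly_in_def)
 have mu: "u : borel_measurable (lebesgue_on A)" using m A by (auto simp: Lp_loc_def Lp_def)
 obtain v where v: "AE x in lebesgue_on \<Omega>. v x = u x" "\<exists>C. \<forall>x\<in>A. \<forall>y\<in>A. norm (v x - v y) <= C * norm (x - y) powr \<alpha>"
  using u A unfolding holder_loc_def by blast
 then obtain C where C: "!!x y. x : A ==> y : A ==> norm (v x - v y) <= C * norm (x - y) powr \<alpha>" by blast
 have vu: "AE x\<in>\<Omega> in lborel. v x = u x" using v(1) \<Omega> by (subst (asm) AE_restrict_space_iff) (auto simp: AE_completion_iff)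
 have "bounded A" using A bounded_subset[OF compact_imp_bounded closure_subset] by (auto simp: compactly_in_def)
 then obtain d where d: "!!x. x : A ==> norm x <= d" unfolding bounded_iff by blast
 obtain B where B: "!!x. x : A ==> norm (v x) <= B"
 proof (cases "A = {}")
  case False
  then obtain a where a: "a : A" by blast
  have "norm (v x) <= norm (v a) + \<bar>C\<bar> * (2 * d) powr \<alpha>" if x: "x : A" for x
  proof -
   have "norm (x - a) <= 2 * d" using d[OF x] d[OF a] norm_triangle_ineq4[of x a] by simp
   hence "C * norm (x - a) powr \<alpha> <= \<bar>C\<bar> * (2 * d) powr \<alpha>" using \<alpha> by (intro mult_mono powr_mono2) auto
   thus ?thesis using C[OF x a] norm_triangle_ineq[of "v a" "v x - v a"] by simp
  qed
  thus thesis by (rule that)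
 qed (use that in blast)
 have "(NBINT x. ind A x * np (u x) q) <= (NBINT x. en (B powr q) * ind A x)"
 proof (rule nn_integral_mono_AE)
  show "AE x in lborel. ind A x * np (u x) q <= en (B powr q) * ind A x"
   using vu
  proof eventually_elim
   case (elim x)
   thus ?case using B[of x] sub q by (cases "x : A") (auto intro!: ennreal_leI powr_mono2)
  qed
 qed
 also have "... < \<infinity>" using emeasure_compactly_in[OF A(2)] Ab by (simp add: nn_integral_cmult ennreal_mult_less_top)
 finally show "u : Lp q A" using mu by (simp add: Lp_iff[OF Ab])
qed

lemma Lp_locI:
 fixes f :: "'a::euclidean_space => 'b::euclidean_space"
 assumes m: "f : Lp_loc 1 \<Omega>" and q: "0 <= q"
  and loc: "!!x. x : \<Omega> ==> \<exists>B. open B \<and> x : B \<and> (NBINT y. ind B y * np (f y) q) < \<infinity>"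
 shows "f : Lp_loc q \<Omega>"
 unfolding Lp_loc_def
proof safe
 fix A assume A: "open A" "A \<Subset> \<Omega>"
 have Ab: "A : sets borel" using A by auto
 have mf: "f : borel_measurable (lebesgue_on A)" using m A by (auto simp: Lp_loc_def Lp_def)
 \<comment> \<open>The covering sets may reach beyond \<open>A\<close>, where measurability of
   \<open>f\<close> is not at hand; the Borel function \<open>g\<close> makes the sum of integrals
   legitimate.\<close>
 obtain g where g [measurable]: "g : borelfun" and gf: "AE x in lborel. g x = ind A x *\<^sub>R f x" using borel_rep[OF mf Ab] by blast
 obtain B where B: "!!x. x : \<Omega> ==> open (B x) \<and> x : B x \<and> (NBINT y. ind (B x) y * np (f y) q) < \<infinity>" using loc by metis
 have K: "compact (closure A)" "closure A <= \<Omega>" using A by (auto simp: compactly_in_def)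
 obtain I where I: "I <= closure A" "finite I" "closure A <= (\<Union>x\<in>I. B x)"
  using compactE_image[OF K(1), of "closure A" B] B K(2) by blast
 have Bm: "B x : sets borel" if "x : I" for x using B that I(1) K(2) by (intro borel_open) blast
 have "(NBINT y. ind A y * np (f y) q) <= (NBINT y. (\<Sum>x\<in>I. ind (B x) y * np (g y) q))"
 proof (rule nn_integral_mono_AE)
  show "AE y in lborel. ind A y * np (f y) q <= (\<Sum>x\<in>I. ind (B x) y * np (g y) q)"
   using gf
  proof eventually_elim
   case (elim y)
   show ?case
   proof (cases "y : A")
    case True
    then obtain x where x: "x : I" "y : B x" using I(3) closure_subset[of A] by blast
    have "np (f y) q = ind (B x) y * np (g y) q" using True x elim by simp
    also have "... <= (\<Sum>x\<in>I. ind (B x) y * np (g y) q)" using I(2) x(1) by (intro member_le_sum) auto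
    finally show ?thesis using True by simp
   qed simp
  qed
 qed
 also have "... = (\<Sum>x\<in>I. (NBINT y. ind (B x) y * np (g y) q))"
 proof (rule nn_integral_sum)
  fix x assume "x : I"
  note [measurable] = Bm[OF this]
  show "(%y. ind (B x) y * np (g y) q) : borel_measurable lborel" by measurable
 qed
 also have "... <= (\<Sum>x\<in>I. (NBINT y. ind (B x) y * np (f y) q))"
  using gf by (intro sum_mono nn_integral_mono_AE) (auto elim!: eventually_mono simp: indicator_def)
 also have "... < \<infinity>" using B I(1,2) K(2) by (simp add: subset_eq)
 finally show "f : Lp q A" using mf by (simp add: Lp_iff[OF Ab])
qed

lemma Lp_loc_dominated:
 fixes f :: "'a::euclidean_space => 'b::euclidean_space" and g :: "'a => 'c::euclidean_space"
 assumes g: "g : Lp_loc m \<Omega>" and f: "!!A. open A ==> A \<Subset> \<Omega> ==> f : borel_measurable (lebesgue_on A)"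
  and le: "!!x. norm (f x) powr q <= c * (1 + norm (g x) powr m)"
 shows "f : Lp_loc q \<Omega>"
 unfolding Lp_loc_def
proof safe
 fix A assume A: "open A" "A \<Subset> \<Omega>"
 have Ab: "A : sets borel" using A by auto
 have gi: "integrable (lebesgue_on A) (%x. norm (g x) powr m)" using g A by (auto simp: Lp_loc_def Lp_def)
 have "emeasure (lebesgue_on A) (space (lebesgue_on A)) < \<infinity>"
  using emeasure_compactly_in[OF A(2)] Ab by (simp add: emeasure_restrict_space)
 hence "integrable (lebesgue_on A) (%x. 1 :: real)" by (simp add: integrable_iff_bounded)
 hence "integrable (lebesgue_on A) (%x. c * (1 + norm (g x) powr m))"
  using gi by (intro integrable_mult_right Bochner_Integration.integrable_add)
 hence "integrable (lebesgue_on A) (%x. norm (f x) powr q)"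
 proof (rule integrable_bound')
  show "AE x in lebesgue_on A. norm (norm (f x) powr q) <= norm (c * (1 + norm (g x) powr m))"
   using le by (intro AE_I2) (simp add: order_trans[OF _ abs_ge_self])
 qed (use f[OF A] in measurable)
 thus "f : Lp q A" using f[OF A] by (simp add: Lp_def)
qed

lemma powr_le_add_one: "0 <= x ==> 0 <= a ==> a <= b ==> x powr a <= 1 + x powr (b::real)"
proof (cases "x <= 1")
 case True
 assume "0 <= x" "0 <= a"
 hence "x powr a <= 1" using True by (intro powr_le1) auto
 thus ?thesis by (rule order_trans) simp
qed (use powr_mono[of a b x] in linarith)

text \<open>All three claims come from one fact: the weak gradient is locally integrable to every
  exponent \<open>m\<close> with \<open>0 \<le> m \<le> p * s / 2\<close> for some \<open>s\<close>
  admissible in the n-dimensional Sobolev inequality. For \<open>n \<ge> 3\<close> the largest such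
  exponent is \<open>n * p / (n - 2)\<close>; for \<open>n = 2\<close> there is no limit.\<close>

theorem corollary1p3:
  fixes \<Omega> :: "(real^'n) set"
    and F :: "real^'n^'N \<Rightarrow> real"
    and u :: "real^'n \<Rightarrow> real^'N"
    and p q L \<mu> :: real
  assumes "open \<Omega>"
    and "CARD('n) \<ge> 2"
    and "2 \<le> p" and "p \<le> q"
    and "CARD('n) \<ge> 4 \<Longrightarrow> q < p * (real CARD('n) - 1) / (real CARD('n) - 3)"
    and "structural p q L \<mu> F"
    and "local_minimizer p F \<Omega> u"
  shows "(p > real CARD('n) - 2 \<and> CARD('n) \<ge> 3 \<longrightarrow>
            u \<in> holder_loc (1 - (real CARD('n) - 2) / p) \<Omega>) \<and>
         ((CARD('n) \<ge> 3 \<longrightarrow> q \<le> real CARD('n) * p / (real CARD('n) - 2)) \<longrightarrow>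
            weak_grad \<Omega> u \<in> Lp_loc q \<Omega>) \<and>
         (CARD('n) = 2 \<longrightarrow>
            (\<forall>\<beta>\<^sub>0 m. 0 < \<beta>\<^sub>0 \<and> \<beta>\<^sub>0 < 1 \<and> 1 \<le> m \<longrightarrow>
               u \<in> holder_loc \<beta>\<^sub>0 \<Omega> \<inter> W1p_loc m \<Omega> \<and>
               (\<lambda>x. grad F (weak_grad \<Omega> u x)) \<in> Lp_loc m \<Omega>))"
proof -
 note \<Omega> = assms(1)
 interpret pq_integrand p q L \<mu> F using assms by unfold_locales
 have L1': "1 < L" by (rule L1)
 let ?n = "real CARD('n)" and ?Z = "weak_grad \<Omega> u"
 have n2: "2 <= ?n" using assms(2) by simp
 obtain G where "has_weak_grad \<Omega> u G" using assms(7) by (auto simp: local_minimizer_def W1p_loc_def)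
 hence hw: "has_weak_grad \<Omega> u ?Z" by (rule weak_grad_AE(1)[OF _ \<Omega>])
 hence Lu: "u : Lp_loc 1 \<Omega>" "?Z : Lp_loc 1 \<Omega>" by (auto simp: has_weak_grad_def)
 have "CARD('n) <= 3 \<or> q < p * (?n - 1) / (?n - 3)" using assms(5) by linarith
 note local = local_higher_integrability[OF assms(6,3,4,2) this assms(7) \<Omega>]
 define ok where "ok m \<longleftrightarrow> 0 <= m \<and> (\<exists>s\<ge>2. (?n - 2) * s <= 2 * ?n \<and> m <= p * s / 2)" for m
 \<comment> \<open>In dimension 2 every \<open>s\<close> from 2 on is admissible; the witness gives
   \<open>p * s / 2 = m + p\<close>.\<close>
 have ok2: "ok m" if "CARD('n) = 2" "0 <= m" for m
 proof -
  have "m <= p * (2 * m / p + 2) / 2" using assms(3) by (simp add: field_simps)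
  thus ?thesis using that assms(3) unfolding ok_def by (intro conjI exI[of _ "2 * m / p + 2"]) auto
 qed
 have ok3: "ok m" if "3 <= CARD('n)" "0 <= m" "m <= ?n * p / (?n - 2)" for m
  using that unfolding ok_def by (intro conjI exI[of _ "2 * ?n / (?n - 2)"]) (auto simp: field_simps)
 have sub: "(NBINT y. ind (cube x r) y * np (Z0 y) m) < \<infinity>"
  if "0 <= m" "m <= m'" "(NBINT y. ind (cube x r) y * np (Z0 y) m') < \<infinity>" and [measurable]: "Z0 : borelfun"
  for x r m m' and Z0 :: "real^'n => real^'n^'N"
 proof -
  have "(NBINT y. ind (cube x r) y * np (Z0 y) m)
   <= (NBINT y. ind (cube x r) y + ind (cube x r) y * np (Z0 y) m')"
  proof (rule nn_integral_mono)
   fix y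
   have "np (Z0 y) m <= en (1 + norm (Z0 y) powr m')" by (intro ennreal_leI powr_le_add_one that(1,2)) simp
   thus "ind (cube x r) y * np (Z0 y) m <= ind (cube x r) y + ind (cube x r) y * np (Z0 y) m'"
    by (cases "y : cube x r") auto
  qed
  also have "... = emeasure lborel (cube x r) + (NBINT y. ind (cube x r) y * np (Z0 y) m')"
   by (simp add: nn_integral_add)
  also have "... < \<infinity>" using that(3) emeasure_compact_finite[OF compact_cube, of x r] by simp
  finally show ?thesis .
 qed
 have Z: "?Z : Lp_loc m \<Omega>" if m: "ok m" for m
 proof (rule Lp_locI[OF Lu(2)])
  obtain s where s: "2 <= s" "(?n - 2) * s <= 2 * ?n" "m <= p * s / 2" and m0: "0 <= m" using m by (auto simp: ok_def)
  show "0 <= m" by (rule m0)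
  fix x assume x: "x : \<Omega>"
  obtain S r u0 Z0 where "open S" "S <= \<Omega>" and S: "0 < r" "cube x r <= S" "wgrad S u0 Z0" and "AE y\<in>S in lborel. u0 y = u y"
   and S': "AE y\<in>S in lborel. Z0 y = ?Z y" "(NBINT y. ind (cube x r) y * np (Z0 y) (p * s / 2)) < \<infinity>"
   by (rule local[OF s(1,2) x]) (rule that)
  have bc: "ball x r <= cube x r"
  proof
   fix y assume "y : ball x r"
   thus "y : cube x r" using cube_shift[of x x 0 "y - x" r] by (simp add: dist_norm norm_minus_commute cube_def)
  qed
  have "(NBINT y. ind (ball x r) y * np (?Z y) m) <= (NBINT y. ind (cube x r) y * np (Z0 y) m)"
  proof (rule nn_integral_mono_AE)
   show "AE y in lborel. ind (ball x r) y * np (?Z y) m <= ind (cube x r) y * np (Z0 y) m"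
    using S'(1)
   proof eventually_elim
    case (elim y)
    thus ?case using bc S(2) by (cases "y : ball x r") auto
   qed
  qed
  also have "... < \<infinity>" by (rule sub[OF m0 s(3) S'(2) wgradD(4)[OF S(3)]])
  finally show "\<exists>B. open B \<and> x : B \<and> (NBINT y. ind B y * np (?Z y) m) < \<infinity>"
   using S(1) by (intro exI[of _ "ball x r"]) auto
 qed
 have H: "u : holder_loc (1 - ?n / r) \<Omega>" if r: "ok r" "?n < r" for r
 proof (rule holder_locI[OF \<Omega>])
  obtain s where s: "2 <= s" "(?n - 2) * s <= 2 * ?n" "r <= p * s / 2" using r by (auto simp: ok_def)
  show "0 < 1 - ?n / r" using r n2 by simp
  fix x assume x: "x : \<Omega>"
  obtain S \<rho> u0 Z0 where "open S" "S <= \<Omega>" and S: "0 < \<rho>" "cube x \<rho> <= S" "wgrad S u0 Z0" "AE y\<in>S in lborel. u0 y = u y"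
   and "AE y\<in>S in lborel. Z0 y = ?Z y" and S': "(NBINT y. ind (cube x \<rho>) y * np (Z0 y) (p * s / 2)) < \<infinity>"
   by (rule local[OF s(1,2) x]) (rule that)
  have c: "cube x (2 * (\<rho> / 2)) <= S" using S by simp
  have "(NBINT y. ind (cube x (2 * (\<rho> / 2))) y * np (Z0 y) r) < \<infinity>"
   using sub[OF _ s(3) S' wgradD(4)[OF S(3)]] r n2 by simp
  from morrey_holder[OF S(3) c _ r(2) this] S(1) obtain v C where
   v: "AE y\<in>ball x (\<rho> / 2 / 3) in lborel. v y = u0 y" "holder_on (ball x (\<rho> / 2 / 3)) (1 - ?n / r) C v" by auto
  have bS: "ball x (\<rho> / 2 / 3) <= S"
  proof
   fix y assume "y : ball x (\<rho> / 2 / 3)"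
   hence "y : cube x \<rho>" using cube_shift[of x x 0 "y - x" \<rho>] S(1) by (simp add: dist_norm norm_minus_commute cube_def)
   thus "y : S" using S(2) by blast
  qed
  have "AE y\<in>ball x (\<rho> / 2 / 3) in lborel. v y = u y" using v(1) S(4) by eventually_elim (use bS in auto)
  thus "\<exists>e w C. 0 < e \<and> (AE y in lborel. y : ball x e --> w y = u y) \<and> holder_on (ball x e) (1 - ?n / r) C w"
   using v(2) S(1) by (intro exI[of _ "\<rho> / 2 / 3"] exI[of _ v] exI[of _ C] conjI) auto
 qed
 have i: "u : holder_loc (1 - (?n - 2) / p) \<Omega>" if "?n - 2 < p" "3 <= CARD('n)"
 proof -
  \<comment> \<open>For \<open>r = n * p / (n - 2)\<close> the Morrey exponent
    \<open>1 - n / r\<close> equals \<open>1 - (n - 2) / p\<close>, and \<open>r > n\<close> is the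
    condition \<open>p > n - 2\<close>.\<close>
  have "?n * (?n - 2) < ?n * p" using that n2 by (intro mult_strict_left_mono) auto
  hence "?n < ?n * p / (?n - 2)" using that by (simp add: pos_less_divide_eq)
  moreover have "ok (?n * p / (?n - 2))" using that assms(3) by (intro ok3) auto
  ultimately show ?thesis using H[of "?n * p / (?n - 2)"] that by simp
 qed
 have ii: "?Z : Lp_loc q \<Omega>" if "3 <= CARD('n) --> q <= ?n * p / (?n - 2)"
 proof (cases "CARD('n) = 2")
  case True
  thus ?thesis using assms by (intro Z ok2) auto
 next
  case False
  thus ?thesis using assms that by (intro Z ok3) auto
 qed
 have iii: "u : holder_loc \<beta> \<Omega> \<inter> W1p_loc m \<Omega> \<and> (%x. grad F (?Z x)) : Lp_loc m \<Omega>"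
  if n: "CARD('n) = 2" and \<beta>: "0 < \<beta>" "\<beta> < 1" and m: "1 <= m" for \<beta> m
 proof -
  \<comment> \<open>\<open>r = 2 / (1 - \<beta>)\<close> is the solution of
    \<open>1 - 2 / r = \<beta>\<close>.\<close>
  have "?n < 2 / (1 - \<beta>)" using n \<beta> by (simp add: pos_less_divide_eq)
  hence "u : holder_loc (1 - ?n / (2 / (1 - \<beta>))) \<Omega>" using \<beta> by (intro H ok2[OF n]) auto
  moreover have "1 - ?n / (2 / (1 - \<beta>)) = \<beta>" using n by (simp add: field_simps)
  ultimately have h: "u : holder_loc \<beta> \<Omega>" by metis
  have "u : Lp_loc m \<Omega>" using m by (intro holder_loc_Lp_loc[OF h Lu(1) \<beta>(1) \<Omega>]) auto
  moreover have "?Z : Lp_loc m \<Omega>" using m by (intro Z ok2[OF n]) auto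
  ultimately have W: "u : W1p_loc m \<Omega>" using hw by (auto simp: W1p_loc_def)
  \<comment> \<open>The stress is at most \<open>K powr (q - 1)\<close> and \<open>K\<close> grows
    at most linearly, so the m-th power of the stress is controlled by this power of the gradient,
    and in dimension 2 all exponents are available.\<close>
  define t where "t = (q - 1) * m"
  have t: "0 <= t" using q2 m by (simp add: t_def)
  have "norm (grad F z) powr m <= (2 powr t * (K 0 powr t + (2 * L) powr t)) * (1 + norm z powr t)" for z
  proof -
   have K: "0 <= K 0" "0 <= K z" using K1[of 0] K1[of z] by auto
   have "norm (grad F z) powr m <= (K z powr (q - 1)) powr m" using norm_\<sigma>_K[of z] m by (intro powr_mono2) auto
   also have "... = K z powr t" by (simp add: powr_powr t_def)
   also have "... <= (K 0 + 2 * L * norm z) powr t" using K_lipschitz[of z 0] K t by (intro powr_mono2) auto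
   also have "... <= 2 powr t * (K 0 powr t + (2 * L * norm z) powr t)" using K L1' t by (intro powr_add_le) auto
   also have "... <= (2 powr t * (K 0 powr t + (2 * L) powr t)) * (1 + norm z powr t)"
    using L1' by (simp add: powr_mult algebra_simps)
   finally show ?thesis .
  qed
  moreover have "(%x. grad F (?Z x)) : borel_measurable (lebesgue_on A)" if "open A" "A \<Subset> \<Omega>" for A
   using measurable_compose[OF _ borel_measurable_continuous_onI[OF continuous_\<sigma>]] Lu(2) that by (auto simp: Lp_loc_def Lp_def)
  ultimately have "(%x. grad F (?Z x)) : Lp_loc m \<Omega>" by (intro Lp_loc_dominated[OF Z[OF ok2[OF n t]]])
  thus ?thesis using h W by blast
 qed
 show ?thesis using i ii iii by blast
qed

end
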